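(* For every $k\ge 4$ there exist positive constants $c,C$ such that $$\lim_{n\to\infty}\Pr[H^k(n,p)\rightarrow(K_3^{+k}\cup C_{t_k})]=\begin{cases}0 & \text{if } p\le cn^{-1/\theta},\\ 1&\text{if } p\ge Cn^{-1/\theta},\end{cases}$$ where $\theta:=m_k(K_3^{+k},C_{t_k})$, $t_4=8$, $t_5=14$, and $t_k=k^2$ for $k\ge 6$.
   Context: $H^k(n,p)$: random $k$-uniform hypergraph on $n$ vertices, each $k$-set an edge independently with probability $p$. $G\rightarrow(F)$: every 2-colouring of the edges of $G$ contains a monochromatic copy of $F$. For a graph $G=(V,E)$ and a set $W$ of $k-2$ new vertices, $G^{+k}$ is the $k$-uniform hypergraph with vertex set $V\cup W$ and edges $\{e\cup W: e\in E\}$; $K_3^{+k}$ is this construction applied to the triangle $K_3$. The tight $k$-cycle $C_t$ has vertices $v_0,\ldots,v_{t-1}$ and edges $\{v_i,v_{i+1},\ldots,v_{i+k-1}\}$ for $0\le i\le t-1$ (indices mod $t$). $K_3^{+k}\cup C_{t_k}$ is the vertex-disjoint union. $d_k(G)=0$ if $e(G)=0$, $=1/k$ if $e(G)=1,v(G)=k$, else $\frac{e(G)-1}{v(G)-k}$; $m_k(G)=\max_{H\subseteq G}d_k(H)$. For $m_k(F_1)\ge m_k(F_2)$: $m_k(F_1,F_2)=\max\{\frac{e(F_1')}{v(F_1')-k+1/m_k(F_2)}:F_1'\subseteq F_1,e(F_1')\ge1\}$. *)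

theory Defs
  imports "HOL-Probability.Probability" "HOL-Library.Ramsey"
begin

type_synonym 'a hypergraph = "'a set \<times> 'a set set"

abbreviation verts :: "'a hypergraph \<Rightarrow> 'a set" where
  "verts G \<equiv> fst G"

abbreviation edges :: "'a hypergraph \<Rightarrow> 'a set set" where
  "edges G \<equiv> snd G"

definition subhypergraph :: "'a hypergraph \<Rightarrow> 'a hypergraph \<Rightarrow> bool" where
  "subhypergraph H G \<longleftrightarrow>
     verts H \<subseteq> verts G \<and> edges H \<subseteq> edges G \<and> edges H \<subseteq> Pow (verts H)"


definition Kn_graph :: "nat \<Rightarrow> nat hypergraph" where
  "Kn_graph n = ({..<n}, [{..<n}]\<^bsup>2\<^esup>)"

(* The new vertices W are Inr 0, ..., Inr (k - 3), so they are disjoint from V by typing;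
   e <+> {..<k - 2} is the copy of e together with W. *)
definition graph_plus :: "nat \<Rightarrow> 'a hypergraph \<Rightarrow> ('a + nat) hypergraph" where
  "graph_plus k G = (verts G <+> {..<k - 2}, (\<lambda>e. e <+> {..<k - 2}) ` edges G)"

definition tight_cycle :: "nat \<Rightarrow> nat \<Rightarrow> nat hypergraph" where
  "tight_cycle k t = ({..<t}, (\<lambda>i. (\<lambda>j. (i + j) mod t) ` {..<k}) ` {..<t})"

definition disjoint_union :: "'a hypergraph \<Rightarrow> 'b hypergraph \<Rightarrow> ('a + 'b) hypergraph" where
  "disjoint_union G H =
     (verts G <+> verts H, (\<lambda>e. Inl ` e) ` edges G \<union> (\<lambda>e. Inr ` e) ` edges H)"

definition cycle_length :: "nat \<Rightarrow> nat" where
  "cycle_length k = (if k = 4 then 8 else if k = 5 then 14 else k\<^sup>2)"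


definition edge_density :: "nat \<Rightarrow> 'a hypergraph \<Rightarrow> real" where
  "edge_density k G =
     (if card (edges G) = 0 then 0
      else if card (edges G) = 1 \<and> card (verts G) = k then 1 / real k
      else (real (card (edges G)) - 1) / (real (card (verts G)) - real k))"

definition max_density :: "nat \<Rightarrow> 'a hypergraph \<Rightarrow> real" where
  "max_density k G = Max {edge_density k H |H. subhypergraph H G}"

(* The asymmetric density m_k(F1, F2). It is only meant for
   max_density k F1 \<ge> max_density k F2; the order of the arguments matters. *)
definition asym_density :: "nat \<Rightarrow> 'a hypergraph \<Rightarrow> 'b hypergraph \<Rightarrow> real" where
  "asym_density k F1 F2 =
     Max {real (card (edges H)) / (real (card (verts H)) - real k + 1 / max_density k F2) |H.
            subhypergraph H F1 \<and> card (edges H) \<ge> 1}"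


(* f maps F onto a (not necessarily induced) copy of F in G. *)
definition embedding :: "('a \<Rightarrow> 'b) \<Rightarrow> 'a hypergraph \<Rightarrow> 'b hypergraph \<Rightarrow> bool" where
  "embedding f F G \<longleftrightarrow>
     inj_on f (verts F) \<and> f ` verts F \<subseteq> verts G \<and> (\<forall>e\<in>edges F. f ` e \<in> edges G)"

definition ramsey_arrow :: "'b hypergraph \<Rightarrow> 'a hypergraph \<Rightarrow> bool" where
  "ramsey_arrow G F \<longleftrightarrow>
     (\<forall>col :: 'b set \<Rightarrow> bool. \<exists>f. embedding f F G \<and>
        (\<exists>c. \<forall>e\<in>edges F. col (f ` e) = c))"


definition random_hypergraph :: "nat \<Rightarrow> nat \<Rightarrow> real \<Rightarrow> nat hypergraph pmf" where
  "random_hypergraph k n p =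
     map_pmf (\<lambda>b. ({..<n}, {e \<in> [{..<n}]\<^bsup>k\<^esup>. b e}))
       (Pi_pmf ([{..<n}]\<^bsup>k\<^esup>) False (\<lambda>_. bernoulli_pmf p))"

end

theory Submission
  imports Defs "HOL-Real_Asymp.Real_Asymp"
begin

text \<open>
  Write \<open>x = (t - k) / (t - 1)\<close>; then \<open>1 / \<theta> = (1 + x) / 3\<close> and \<open>1 / 2 < x < 1\<close>.

  0-statement. It suffices to split the edges into a class without tight cycle \<open>C\<^sub>t\<close> and a class without
  triangle \<open>K\<^sub>3\<^sup>+\<^sup>k\<close>. A minimal hypergraph without such a split can be explored edge set by edge set: at a
  vertex of small degree the edges can be recoloured locally, so a failure forces either a new triangle or a
  new tight cycle each of whose edges carries its own triangle. Each step has expected weight below \<open>1 / e\<close>,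
  so for \<open>p \<le> c n\<^sup>-\<^sup>1\<^sup>/\<^sup>\<theta>\<close> no exploration survives logarithmically many steps, unless it meets a set of
  logarithmic size in which all degrees are large; such sets are excluded by the first moment.

  1-statement. Split the vertices into three parts. The first part contains \<open>k + 1\<close> vertices spanning five
  edges, hence a monochromatic triangle. In the second part no cycle-free set of edges meets all triangles:
  a minimal such set has a container fingerprint whose edges carry nearly disjoint triangles, and by Ramsey's
  theorem the complement of the container has so many triangles that Janson's inequality beats the number of
  choices. In the third part the edges are not a union of two cycle-free sets, by containers again.
  A monochromatic cycle of the second or third part matches the colour of some triangle in another part.
\<close>

section \<open>Random subsets of a finite set\<close>

text \<open>The number x is the reciprocal of the density of the tight cycle. At p = n^(-1/\<theta>)
  a cycle edge with its own triangle has weight n p^3 = n^(-x), and t - k free vertices balance t -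
  1 such edges exactly. So a step of the exploration has constant weight at the threshold, and a
  small c is enough to win. The cycle lengths come from the other obstacle: a set in which all
  degrees exceed the local bound D has at least (D + 1) v / k edges on v vertices, and the first
  moment removes it when k < (D + 1) / \<theta>. Longer cycles push 1 / \<theta> towards 2/3, and
  t_k is long enough for this inequality. In the 1-statement the number of triangles, about n^(k+1)
  p^3 = n^(k-x), has the same order as the container fingerprints. A plain count of fingerprints
  costs a logarithm in the exponent and would fail; hence every fingerprint edge is charged with the
  probability p^3 of its own triangle. For unions of two cycle-free sets the available exponent n^k
  p is larger by a power of n, and a plain count is enough.\<close>

definition rEx :: "real \<Rightarrow> 'a set \<Rightarrow> ('a set \<Rightarrow> real) \<Rightarrow> real" where
  "rEx p \<Omega> f = (\<Sum>X\<in>Pow \<Omega>. p ^ card X * (1 - p) ^ card (\<Omega> - X) * f X)"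

definition rPr :: "real \<Rightarrow> 'a set \<Rightarrow> ('a set \<Rightarrow> bool) \<Rightarrow> real" where
  "rPr p \<Omega> A = rEx p \<Omega> (\<lambda>X. of_bool (A X))"

lemma rEx_empty [simp]: "rEx p {} f = f {}"
  by (simp add: rEx_def)

text \<open>Conditioning on whether a belongs to the random set. Writing expectations as explicit
  finite sums makes this the recursion behind the inductions on the ground set below.\<close>

lemma rEx_insert:
  assumes "finite \<Omega>" "a \<notin> \<Omega>"
  shows "rEx p (insert a \<Omega>) f = p * rEx p \<Omega> (\<lambda>X. f (insert a X)) + (1 - p) * rEx p \<Omega> f"
proof -
  have fin: "finite X" if "X \<in> Pow \<Omega>" for X using that assms finite_subset by blast
  have inj: "inj_on (insert a) (Pow \<Omega>)" using assms by (auto simp: inj_on_def)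
  have disj: "Pow \<Omega> \<inter> insert a ` Pow \<Omega> = {}" using assms by auto
  have "rEx p (insert a \<Omega>) f =
     (\<Sum>X\<in>Pow \<Omega>. p ^ card X * (1 - p) ^ card (insert a \<Omega> - X) * f X)
   + (\<Sum>X\<in>insert a ` Pow \<Omega>. p ^ card X * (1 - p) ^ card (insert a \<Omega> - X) * f X)"
    unfolding rEx_def Pow_insert using assms disj by (subst sum.union_disjoint) auto
  also have "(\<Sum>X\<in>Pow \<Omega>. p ^ card X * (1 - p) ^ card (insert a \<Omega> - X) * f X)
     = (1 - p) * rEx p \<Omega> f"
    unfolding rEx_def sum_distrib_left
  proof (rule sum.cong)
    fix X assume X: "X \<in> Pow \<Omega>"
    then have "insert a \<Omega> - X = insert a (\<Omega> - X)" using assms by auto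
    then have "card (insert a \<Omega> - X) = Suc (card (\<Omega> - X))" using assms by simp
    then show "p ^ card X * (1 - p) ^ card (insert a \<Omega> - X) * f X
      = (1 - p) * (p ^ card X * (1 - p) ^ card (\<Omega> - X) * f X)" by simp
  qed simp
  also have "(\<Sum>X\<in>insert a ` Pow \<Omega>. p ^ card X * (1 - p) ^ card (insert a \<Omega> - X) * f X)
     = p * rEx p \<Omega> (\<lambda>X. f (insert a X))"
    unfolding rEx_def sum_distrib_left sum.reindex[OF inj] o_def
  proof (rule sum.cong)
    fix X assume X: "X \<in> Pow \<Omega>"
    then have "insert a \<Omega> - insert a X = \<Omega> - X" using assms by auto
    moreover have "card (insert a X) = Suc (card X)"
      using X assms fin[OF X] by (intro card_insert_disjoint) auto
    ultimately show "p ^ card (insert a X) * (1 - p) ^ card (insert a \<Omega> - insert a X) * f (insert a X)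
      = p * (p ^ card X * (1 - p) ^ card (\<Omega> - X) * f (insert a X))" by simp
  qed simp
  finally show ?thesis by simp
qed

lemma rEx_cong: "(\<And>X. X \<subseteq> \<Omega> \<Longrightarrow> f X = g X) \<Longrightarrow> rEx p \<Omega> f = rEx p \<Omega> g"
  unfolding rEx_def by (rule sum.cong) auto

lemma rPr_cong: "(\<And>X. X \<subseteq> \<Omega> \<Longrightarrow> A X = B X) \<Longrightarrow> rPr p \<Omega> A = rPr p \<Omega> B"
  unfolding rPr_def by (rule rEx_cong) auto

lemma rEx_mono:
  assumes "0 \<le> p" "p \<le> 1" "\<And>X. X \<subseteq> \<Omega> \<Longrightarrow> f X \<le> g X"
  shows "rEx p \<Omega> f \<le> rEx p \<Omega> g"
  unfolding rEx_def using assms by (intro sum_mono mult_left_mono) auto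

lemma rEx_cmult: "rEx p \<Omega> (\<lambda>X. c * f X) = c * rEx p \<Omega> f"
  by (simp add: rEx_def sum_distrib_left algebra_simps)

lemma rEx_add: "rEx p \<Omega> (\<lambda>X. f X + g X) = rEx p \<Omega> f + rEx p \<Omega> g"
  by (simp add: rEx_def sum.distrib algebra_simps)

lemma rEx_diff: "rEx p \<Omega> (\<lambda>X. f X - g X) = rEx p \<Omega> f - rEx p \<Omega> g"
  by (simp add: rEx_def sum_subtractf algebra_simps)

lemma rEx_sum: "rEx p \<Omega> (\<lambda>X. \<Sum>i\<in>I. f i X) = (\<Sum>i\<in>I. rEx p \<Omega> (f i))"
  unfolding rEx_def sum_distrib_left by (rule sum.swap)

lemma rEx_const:
  assumes "finite \<Omega>" shows "rEx p \<Omega> (\<lambda>X. c) = c"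
  using assms by (induction \<Omega>) (auto simp: rEx_insert algebra_simps)

lemma rPr_mono:
  assumes "0 \<le> p" "p \<le> 1" "\<And>X. X \<subseteq> \<Omega> \<Longrightarrow> A X \<Longrightarrow> B X"
  shows "rPr p \<Omega> A \<le> rPr p \<Omega> B"
  unfolding rPr_def using assms by (intro rEx_mono) auto

lemma rPr_nonneg: "0 \<le> p \<Longrightarrow> p \<le> 1 \<Longrightarrow> 0 \<le> rPr p \<Omega> A"
  unfolding rPr_def rEx_def by (intro sum_nonneg) auto

lemma rPr_le_1:
  assumes "finite \<Omega>" "0 \<le> p" "p \<le> 1" shows "rPr p \<Omega> A \<le> 1"
  using rEx_mono[OF assms(2,3), of \<Omega> "\<lambda>X. of_bool (A X)" "\<lambda>_. 1"] rEx_const[OF assms(1), of p 1]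
  by (simp add: rPr_def)

lemma rPr_not:
  assumes "finite \<Omega>" shows "rPr p \<Omega> (\<lambda>X. \<not> A X) = 1 - rPr p \<Omega> A"
proof -
  have "rPr p \<Omega> (\<lambda>X. \<not> A X) = rEx p \<Omega> (\<lambda>X. 1 - of_bool (A X))"
    unfolding rPr_def by (rule rEx_cong) auto
  also have "\<dots> = 1 - rPr p \<Omega> A" by (simp add: rEx_diff rEx_const[OF assms] rPr_def)
  finally show ?thesis .
qed

lemma rPr_Un:
  assumes "0 \<le> p" "p \<le> 1"
  shows "rPr p \<Omega> (\<lambda>X. A X \<or> B X) \<le> rPr p \<Omega> A + rPr p \<Omega> B"
  unfolding rPr_def rEx_add[symmetric] using assms by (intro rEx_mono) auto

lemma rPr_Union:
  assumes "0 \<le> p" "p \<le> 1" "finite I"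
  shows "rPr p \<Omega> (\<lambda>X. \<exists>i\<in>I. A i X) \<le> (\<Sum>i\<in>I. rPr p \<Omega> (A i))"
  unfolding rPr_def rEx_sum[symmetric]
proof (rule rEx_mono[OF assms(1,2)])
  fix X assume "X \<subseteq> \<Omega>"
  show "of_bool (\<exists>i\<in>I. A i X) \<le> (\<Sum>i\<in>I. of_bool (A i X) :: real)"
  proof (cases "\<exists>i\<in>I. A i X")
    case True
    then obtain j where j: "j \<in> I" "A j X" by blast
    have "(of_bool (A j X) :: real) \<le> (\<Sum>i\<in>I. of_bool (A i X))"
      using j assms by (intro member_le_sum) auto
    then show ?thesis using j True by simp
  qed (auto intro: sum_nonneg)
qed

lemma rEx_markov:
  assumes "0 \<le> p" "p \<le> 1" "c > 0" "\<And>X. X \<subseteq> \<Omega> \<Longrightarrow> f X \<ge> 0"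
  shows "rPr p \<Omega> (\<lambda>X. f X \<ge> c) \<le> rEx p \<Omega> f / c"
proof -
  have "rPr p \<Omega> (\<lambda>X. f X \<ge> c) \<le> rEx p \<Omega> (\<lambda>X. (1 / c) * f X)"
    unfolding rPr_def using assms by (intro rEx_mono) (auto simp: divide_simps)
  then show ?thesis by (simp only: rEx_cmult) simp
qed

text \<open>Fubini for the product measure; independence of events that look at disjoint coordinates
  is read off from it.\<close>

lemma rEx_Un_disjoint:
  assumes "finite A" "finite B" "A \<inter> B = {}"
  shows "rEx p (A \<union> B) f = rEx p A (\<lambda>X. rEx p B (\<lambda>Y. f (X \<union> Y)))"
  using assms
proof (induction A arbitrary: f)
  case (insert a A)
  have "rEx p (insert a A \<union> B) f = rEx p (insert a (A \<union> B)) f" by simp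
  also have "\<dots> = p * rEx p (A \<union> B) (\<lambda>X. f (insert a X)) + (1 - p) * rEx p (A \<union> B) f"
    using insert by (subst rEx_insert) auto
  also have "\<dots> = rEx p (insert a A) (\<lambda>X. rEx p B (\<lambda>Y. f (X \<union> Y)))"
    using insert by (subst rEx_insert) (auto simp: insert.IH)
  finally show ?case .
qed simp

lemma rEx_restrict:
  assumes "finite \<Omega>" "A \<subseteq> \<Omega>"
  shows "rEx p \<Omega> (\<lambda>X. f (X \<inter> A)) = rEx p A f"
proof -
  have fin: "finite A" "finite (\<Omega> - A)" using assms finite_subset by auto
  have "rEx p \<Omega> (\<lambda>X. f (X \<inter> A)) = rEx p (A \<union> (\<Omega> - A)) (\<lambda>X. f (X \<inter> A))"
    using assms by (simp add: Un_absorb1)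
  also have "\<dots> = rEx p A (\<lambda>X. rEx p (\<Omega> - A) (\<lambda>Y. f ((X \<union> Y) \<inter> A)))"
    using fin by (rule rEx_Un_disjoint) auto
  also have "\<dots> = rEx p A (\<lambda>X. rEx p (\<Omega> - A) (\<lambda>Y. f X))"
    by (intro rEx_cong arg_cong[where f = f]) auto
  also have "\<dots> = rEx p A f" using fin by (simp add: rEx_const)
  finally show ?thesis .
qed

lemma rPr_restrict:
  assumes "finite \<Omega>" "A \<subseteq> \<Omega>"
  shows "rPr p \<Omega> (\<lambda>X. P (X \<inter> A)) = rPr p A P"
  unfolding rPr_def by (rule rEx_restrict[OF assms])

lemma rPr_indep:
  assumes "finite \<Omega>" "A \<subseteq> \<Omega>" "B \<subseteq> \<Omega>" "A \<inter> B = {}"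
  shows "rPr p \<Omega> (\<lambda>X. P (X \<inter> A) \<and> Q (X \<inter> B)) = rPr p A P * rPr p B Q"
proof -
  have fin: "finite A" "finite B" using assms(1-3) by (auto intro: finite_subset)
  have "rPr p \<Omega> (\<lambda>X. P (X \<inter> A) \<and> Q (X \<inter> B))
      = rPr p \<Omega> (\<lambda>X. P (X \<inter> (A \<union> B) \<inter> A) \<and> Q (X \<inter> (A \<union> B) \<inter> B))"
    by (intro rPr_cong arg_cong2[where f = "(\<and>)"] arg_cong[where f = P] arg_cong[where f = Q]) auto
  also have "\<dots> = rPr p (A \<union> B) (\<lambda>X. P (X \<inter> A) \<and> Q (X \<inter> B))"
    using assms by (intro rPr_restrict[where P = "\<lambda>X. P (X \<inter> A) \<and> Q (X \<inter> B)"]) auto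
  also have "\<dots> = rEx p A (\<lambda>X. rEx p B (\<lambda>Y. of_bool (P ((X \<union> Y) \<inter> A) \<and> Q ((X \<union> Y) \<inter> B))))"
    unfolding rPr_def using fin assms(4) by (rule rEx_Un_disjoint)
  also have "\<dots> = rEx p A (\<lambda>X. rEx p B (\<lambda>Y. of_bool (P X) * of_bool (Q Y)))"
  proof (intro rEx_cong)
    fix X Y assume "X \<subseteq> A" "Y \<subseteq> B"
    then have "(X \<union> Y) \<inter> A = X" "(X \<union> Y) \<inter> B = Y" using assms(4) by auto
    then show "of_bool (P ((X \<union> Y) \<inter> A) \<and> Q ((X \<union> Y) \<inter> B)) = (of_bool (P X) * of_bool (Q Y) :: real)"
      by simp
  qed
  also have "\<dots> = rEx p A (\<lambda>X. rEx p B (\<lambda>Y. of_bool (Q Y)) * of_bool (P X))"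
    by (simp only: rEx_cmult mult.commute)
  also have "\<dots> = rPr p A P * rPr p B Q" unfolding rPr_def rEx_cmult by (rule mult.commute)
  finally show ?thesis .
qed

lemma rPr_superset:
  assumes "finite \<Omega>" "S \<subseteq> \<Omega>"
  shows "rPr p \<Omega> (\<lambda>X. S \<subseteq> X) = p ^ card S"
proof -
  have fin: "finite S" using assms finite_subset by auto
  have "rPr p \<Omega> (\<lambda>X. S \<subseteq> X) = rPr p \<Omega> (\<lambda>X. S \<subseteq> X \<inter> S)" by (rule rPr_cong) auto
  also have "\<dots> = rPr p S (\<lambda>X. S \<subseteq> X)" using assms by (rule rPr_restrict)
  also have "\<dots> = p ^ card S" using fin
  proof (induction S)
    case (insert a S)
    have "rPr p (insert a S) (\<lambda>X. insert a S \<subseteq> X)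
      = p * rEx p S (\<lambda>X. of_bool (S \<subseteq> X)) + (1 - p) * rEx p S (\<lambda>X. 0)"
      unfolding rPr_def using insert
      by (subst rEx_insert) (auto intro!: arg_cong2[where f = "(+)"] arg_cong2[where f = "(*)"] rEx_cong)
    then show ?case using insert by (simp add: rEx_const rPr_def)
  qed (simp add: rPr_def)
  finally show ?thesis .
qed

lemma rPr_disjoint:
  assumes "finite \<Omega>" "S \<subseteq> \<Omega>"
  shows "rPr p \<Omega> (\<lambda>X. X \<inter> S = {}) = (1 - p) ^ card S"
proof -
  have fin: "finite S" using assms finite_subset by auto
  have "rPr p \<Omega> (\<lambda>X. X \<inter> S = {}) = rPr p S (\<lambda>X. X = {})" using assms by (rule rPr_restrict)
  also have "\<dots> = (1 - p) ^ card S" using fin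
  proof (induction S)
    case (insert a S)
    then show ?case by (simp add: rPr_def rEx_insert rEx_const)
  qed (simp add: rPr_def)
  finally show ?thesis .
qed

lemma rPr_first_moment:
  assumes "finite \<Omega>" "0 \<le> p" "p \<le> 1" "finite \<F>" "\<And>S. S \<in> \<F> \<Longrightarrow> S \<subseteq> \<Omega>"
  shows "rPr p \<Omega> (\<lambda>X. \<exists>S\<in>\<F>. S \<subseteq> X) \<le> (\<Sum>S\<in>\<F>. p ^ card S)"
  using rPr_Union[OF assms(2-4), of \<Omega> "\<lambda>S X. S \<subseteq> X"] assms(1,5) by (simp add: rPr_superset)

text \<open>Induction on the ground set: after conditioning on one element both conditional means
  are monotone in that bit, in opposite directions, so the covariance term p (1 - p) (f1 - f0) (g1 -
  g0) is not positive. Monotonicity is asked for all pairs of sets, so that it passes to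
  \<open>\<lambda>X. f (insert a X)\<close>.\<close>

lemma rEx_harris:
  fixes f g :: "'a set \<Rightarrow> real"
  assumes "finite \<Omega>" "0 \<le> p" "p \<le> 1"
    and "\<And>X Y. X \<subseteq> Y \<Longrightarrow> f X \<le> f Y" "\<And>X Y. X \<subseteq> Y \<Longrightarrow> g Y \<le> g X"
  shows "rEx p \<Omega> (\<lambda>X. f X * g X) \<le> rEx p \<Omega> f * rEx p \<Omega> g"
  using assms(1,4,5)
proof (induction \<Omega> arbitrary: f g)
  case (insert a \<Omega>)
  let ?f1 = "rEx p \<Omega> (\<lambda>X. f (insert a X))" and ?f0 = "rEx p \<Omega> f"
  let ?g1 = "rEx p \<Omega> (\<lambda>X. g (insert a X))" and ?g0 = "rEx p \<Omega> g"
  have 1: "rEx p \<Omega> (\<lambda>X. f (insert a X) * g (insert a X)) \<le> ?f1 * ?g1"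
    by (rule insert.IH) (auto intro: insert.prems)
  have 0: "rEx p \<Omega> (\<lambda>X. f X * g X) \<le> ?f0 * ?g0"
    by (rule insert.IH) (auto intro: insert.prems)
  have f: "?f0 \<le> ?f1" and g: "?g1 \<le> ?g0"
    using assms(2,3) by (auto intro!: rEx_mono insert.prems)
  have "p * (1 - p) * ((?f1 - ?f0) * (?g1 - ?g0)) \<le> 0"
    using f g assms(2,3) by (intro mult_nonneg_nonpos) (auto intro: mult_nonneg_nonpos)
  then have key: "p * (?f1 * ?g1) + (1 - p) * (?f0 * ?g0)
      \<le> (p * ?f1 + (1 - p) * ?f0) * (p * ?g1 + (1 - p) * ?g0)"
    by (simp add: algebra_simps power2_eq_square)
  have "rEx p (insert a \<Omega>) (\<lambda>X. f X * g X)
     \<le> p * (?f1 * ?g1) + (1 - p) * (?f0 * ?g0)"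
    unfolding rEx_insert[OF insert.hyps] using 0 1 assms(2,3)
    by (intro add_mono mult_left_mono) auto
  also note key
  also have "(p * ?f1 + (1 - p) * ?f0) * (p * ?g1 + (1 - p) * ?g0)
     = rEx p (insert a \<Omega>) f * rEx p (insert a \<Omega>) g"
    by (simp add: rEx_insert[OF insert.hyps])
  finally show ?case .
qed simp

lemma rPr_harris:
  assumes "finite \<Omega>" "0 \<le> p" "p \<le> 1"
    and "\<And>X Y. X \<subseteq> Y \<Longrightarrow> A X \<Longrightarrow> A Y" "\<And>X Y. X \<subseteq> Y \<Longrightarrow> B Y \<Longrightarrow> B X"
  shows "rPr p \<Omega> (\<lambda>X. A X \<and> B X) \<le> rPr p \<Omega> A * rPr p \<Omega> B"
proof -
  have "rPr p \<Omega> (\<lambda>X. A X \<and> B X) = rEx p \<Omega> (\<lambda>X. of_bool (A X) * of_bool (B X))"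
    unfolding rPr_def by (rule rEx_cong) auto
  also have "\<dots> \<le> rPr p \<Omega> A * rPr p \<Omega> B"
    unfolding rPr_def by (rule rEx_harris[OF assms(1-3)]) (use assms(4,5) in auto)
  finally show ?thesis .
qed

text \<open>An inductive form of the coupling of two densities: the bit a is more often present
  under q, and its presence can only help an increasing event. It transfers estimates made at one
  fixed density to every larger one.\<close>

lemma rPr_mono_p:
  assumes "finite \<Omega>" "0 \<le> p" "p \<le> q" "q \<le> 1" and "\<And>X Y. X \<subseteq> Y \<Longrightarrow> A X \<Longrightarrow> A Y"
  shows "rPr p \<Omega> A \<le> rPr q \<Omega> A"
  unfolding rPr_def using assms(1,5)
proof (induction \<Omega> arbitrary: A)
  case (insert a \<Omega>)
  let ?E = "\<lambda>p. rEx p \<Omega> (\<lambda>X. of_bool (A (insert a X)))" and ?F = "\<lambda>p. rEx p \<Omega> (\<lambda>X. of_bool (A X))"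
  have 1: "?E p \<le> ?E q" by (rule insert.IH) (erule insert.prems[OF Set.insert_mono])
  have 0: "?F p \<le> ?F q" by (rule insert.IH) (auto intro: insert.prems)
  have le: "?F p \<le> ?E p" using assms by (intro rEx_mono) (auto dest: insert.prems[OF subset_insertI])
  have "p * ?E p + (1 - p) * ?F p \<le> q * ?E p + (1 - q) * ?F p"
    using mult_nonneg_nonneg[of "q - p" "?E p - ?F p"] assms le by (simp add: algebra_simps)
  also have "\<dots> \<le> q * ?E q + (1 - q) * ?F q"
    using 0 1 assms by (intro add_mono mult_left_mono) auto
  finally show ?case by (simp add: rEx_insert[OF insert.hyps])
qed simp

text \<open>Janson's inequality, with the proof of Boppana and Spencer.\<close>

lemma rPr_janson:
  fixes B :: "'i \<Rightarrow> 'a set"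
  assumes fin: "finite \<Omega>" and p: "0 \<le> p" "p \<le> 1"
    and d: "distinct xs" and B: "\<And>i. i \<in> set xs \<Longrightarrow> B i \<subseteq> \<Omega>"
  shows "rPr p \<Omega> (\<lambda>X. \<forall>i\<in>set xs. \<not> B i \<subseteq> X)
    \<le> exp (- (\<Sum>i\<in>set xs. p ^ card (B i))
        + (\<Sum>i\<in>set xs. \<Sum>j\<in>{j\<in>set xs. j \<noteq> i \<and> B j \<inter> B i \<noteq> {}}. p ^ card (B i \<union> B j)))"
  using d B
proof (induction xs)
  case Nil
  then show ?case using rPr_le_1[OF fin p] by simp
next
  case (Cons i xs)
  let ?N = "\<lambda>X. \<forall>j\<in>set xs. \<not> B j \<subseteq> X"
  let ?J = "{j\<in>set xs. B j \<inter> B i \<noteq> {}}"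
  \<comment> \<open>Only the sets disjoint from \<open>B i\<close> remain in \<open>?N2\<close>, so
    this event does not depend on the coordinates in \<open>B i\<close>; the other sets are paid for
    in D.\<close>
  let ?N2 = "\<lambda>X. \<forall>j\<in>set xs - ?J. \<not> B j \<subseteq> X"
  define D where "D = (\<Sum>j\<in>?J. p ^ card (B i \<union> B j))"
  have Bi: "B i \<subseteq> \<Omega>" using Cons.prems by simp
  have split: "rPr p \<Omega> ?N = rPr p \<Omega> (\<lambda>X. \<forall>j\<in>set (i # xs). \<not> B j \<subseteq> X) + rPr p \<Omega> (\<lambda>X. ?N X \<and> B i \<subseteq> X)"
    unfolding rPr_def rEx_add[symmetric] by (rule rEx_cong) auto
  have N2: "?N2 (X \<inter> (\<Omega> - B i)) = ?N2 X" if "X \<subseteq> \<Omega>" for X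
  proof -
    have "B j \<subseteq> X \<inter> (\<Omega> - B i) \<longleftrightarrow> B j \<subseteq> X" if "j \<in> set xs - ?J" for j
      using that \<open>X \<subseteq> \<Omega>\<close> by blast
    then show ?thesis by (intro ball_cong) auto
  qed
  have indep: "rPr p \<Omega> (\<lambda>X. ?N2 X \<and> B i \<subseteq> X) = rPr p \<Omega> ?N2 * p ^ card (B i)"
  proof -
    have "rPr p \<Omega> (\<lambda>X. ?N2 X \<and> B i \<subseteq> X) = rPr p \<Omega> (\<lambda>X. ?N2 (X \<inter> (\<Omega> - B i)) \<and> B i \<subseteq> X \<inter> B i)"
      by (rule rPr_cong) (subst N2, auto)
    also have "\<dots> = rPr p (\<Omega> - B i) ?N2 * rPr p (B i) (\<lambda>X. B i \<subseteq> X)"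
      using fin Bi by (intro rPr_indep) auto
    also have "rPr p (\<Omega> - B i) ?N2 = rPr p \<Omega> (\<lambda>X. ?N2 (X \<inter> (\<Omega> - B i)))"
      using fin by (subst rPr_restrict) auto
    also have "\<dots> = rPr p \<Omega> ?N2" by (rule rPr_cong) (rule N2)
    also have "rPr p (B i) (\<lambda>X. B i \<subseteq> X) = p ^ card (B i)"
      using finite_subset[OF Bi fin] by (intro rPr_superset) auto
    finally show ?thesis .
  qed
  have each: "rPr p \<Omega> (\<lambda>X. B i \<union> B j \<subseteq> X \<and> ?N2 X) \<le> p ^ card (B i \<union> B j) * rPr p \<Omega> ?N2" if "j \<in> ?J" for j
  proof -
    have "rPr p \<Omega> (\<lambda>X. B i \<union> B j \<subseteq> X \<and> ?N2 X) \<le> rPr p \<Omega> (\<lambda>X. B i \<union> B j \<subseteq> X) * rPr p \<Omega> ?N2"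
      by (rule rPr_harris[OF fin p]) blast+
    also have "rPr p \<Omega> (\<lambda>X. B i \<union> B j \<subseteq> X) = p ^ card (B i \<union> B j)"
      using that Cons.prems by (intro rPr_superset fin) auto
    finally show ?thesis .
  qed
  have "rPr p \<Omega> (\<lambda>X. ?N2 X \<and> B i \<subseteq> X)
     \<le> rPr p \<Omega> (\<lambda>X. (?N X \<and> B i \<subseteq> X) \<or> (\<exists>j\<in>?J. B i \<union> B j \<subseteq> X \<and> ?N2 X))"
    using p by (rule rPr_mono) auto
  also have "\<dots> \<le> rPr p \<Omega> (\<lambda>X. ?N X \<and> B i \<subseteq> X) + rPr p \<Omega> (\<lambda>X. \<exists>j\<in>?J. B i \<union> B j \<subseteq> X \<and> ?N2 X)"
    using p by (rule rPr_Un)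
  also have "rPr p \<Omega> (\<lambda>X. \<exists>j\<in>?J. B i \<union> B j \<subseteq> X \<and> ?N2 X)
     \<le> (\<Sum>j\<in>?J. rPr p \<Omega> (\<lambda>X. B i \<union> B j \<subseteq> X \<and> ?N2 X))"
    using p by (intro rPr_Union) auto
  also have "\<dots> \<le> (\<Sum>j\<in>?J. p ^ card (B i \<union> B j) * rPr p \<Omega> ?N2)"
    by (intro sum_mono each)
  also have "\<dots> = D * rPr p \<Omega> ?N2" by (simp add: D_def sum_distrib_right)
  finally have lower: "rPr p \<Omega> (\<lambda>X. ?N X \<and> B i \<subseteq> X) \<ge> rPr p \<Omega> ?N2 * (p ^ card (B i) - D)"
    unfolding indep by (simp add: algebra_simps)
  have N_le: "rPr p \<Omega> ?N \<le> rPr p \<Omega> ?N2" using p by (rule rPr_mono) auto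
  \<comment> \<open>If the bracket is nonnegative, \<open>?N2\<close> may be replaced by the smaller
    \<open>?N\<close>; otherwise the bound is trivial.\<close>
  have lower': "rPr p \<Omega> (\<lambda>X. ?N X \<and> B i \<subseteq> X) \<ge> rPr p \<Omega> ?N * (p ^ card (B i) - D)"
  proof (cases "p ^ card (B i) - D \<ge> 0")
    case True
    then show ?thesis using lower mult_right_mono[OF N_le True] by linarith
  next
    case False
    then have "rPr p \<Omega> ?N * (p ^ card (B i) - D) \<le> 0" using rPr_nonneg[OF p, of \<Omega> ?N]
      by (intro mult_nonneg_nonpos) auto
    then show ?thesis using rPr_nonneg[OF p, of \<Omega> "\<lambda>X. ?N X \<and> B i \<subseteq> X"] by linarith
  qed
  define S where "S = (\<lambda>ys. \<Sum>i\<in>set ys. \<Sum>j\<in>{j\<in>set ys. j \<noteq> i \<and> B j \<inter> B i \<noteq> {}}. p ^ card (B i \<union> B j))"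
  \<comment> \<open>The double sum runs over ordered pairs, so the row of i already pays for D, and
    the new entries in the other rows are dropped.\<close>
  have Srec: "S xs + D \<le> S (i # xs)"
  proof -
    have "D \<le> (\<Sum>j\<in>{j\<in>set (i # xs). j \<noteq> i \<and> B j \<inter> B i \<noteq> {}}. p ^ card (B i \<union> B j))"
      unfolding D_def using Cons.prems p by (intro sum_mono2) auto
    moreover have "S xs \<le> (\<Sum>i'\<in>set xs. \<Sum>j\<in>{j\<in>set (i # xs). j \<noteq> i' \<and> B j \<inter> B i' \<noteq> {}}. p ^ card (B i' \<union> B j))"
      unfolding S_def using p by (intro sum_mono sum_mono2) auto
    ultimately show ?thesis using Cons.prems by (simp add: S_def)
  qed
  have "rPr p \<Omega> (\<lambda>X. \<forall>j\<in>set (i # xs). \<not> B j \<subseteq> X) \<le> rPr p \<Omega> ?N * (1 + (D - p ^ card (B i)))"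
    using split lower' by (simp add: algebra_simps)
  also have "\<dots> \<le> rPr p \<Omega> ?N * exp (D - p ^ card (B i))"
    using rPr_nonneg[OF p] by (intro mult_left_mono exp_ge_add_one_self) auto
  also have "\<dots> \<le> exp (- (\<Sum>i\<in>set xs. p ^ card (B i)) + S xs) * exp (D - p ^ card (B i))"
    unfolding S_def using Cons by (intro mult_right_mono Cons.IH) auto
  also have "\<dots> = exp (- (\<Sum>i\<in>set (i # xs). p ^ card (B i)) + (S xs + D))"
    using Cons.prems by (simp add: exp_add[symmetric])
  also have "\<dots> \<le> exp (- (\<Sum>i\<in>set (i # xs). p ^ card (B i)) + S (i # xs))" using Srec by simp
  finally show ?case by (simp only: S_def)
qed

section \<open>Transfer from the random hypergraph to finite sums\<close>

lemma prob_random_hypergraph: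
  assumes "0 \<le> p" "p \<le> 1"
  shows "measure_pmf.prob (random_hypergraph k n p) {G. A G}
       = rPr p ([{..<n}]\<^bsup>k\<^esup>) (\<lambda>X. A ({..<n}, X))"
proof -
  define \<Omega> where "\<Omega> = [{..<n}]\<^bsup>k\<^esup>"
  define M where "M = Pi_pmf \<Omega> False (\<lambda>_. bernoulli_pmf p)"
  define S where "S = {b. A ({..<n}, {e \<in> \<Omega>. b e})}"
  \<comment> \<open>Outside \<Omega> the product takes its default value False, so the support
    consists of indicator functions of subsets of \<Omega>, and these correspond to the subsets
    themselves.\<close>
  define T where "T = (\<lambda>X e. e \<in> X) ` Pow \<Omega>"
  have fin: "finite \<Omega>" by (simp add: \<Omega>_def finite_imp_finite_nsets)
  have inj: "inj_on (\<lambda>X e. e \<in> X) (Pow \<Omega>)" by (auto simp: inj_on_def fun_eq_iff)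
  have sub: "set_pmf M \<subseteq> T"
  proof
    fix b assume "b \<in> set_pmf M"
    then have "b \<in> PiE_dflt \<Omega> False (\<lambda>_. set_pmf (bernoulli_pmf p))"
      using fin by (simp add: M_def set_Pi_pmf)
    then have "\<forall>e. e \<notin> \<Omega> \<longrightarrow> \<not> b e" by (auto simp: PiE_dflt_def)
    then have b: "b = (\<lambda>e. e \<in> {e\<in>\<Omega>. b e})" by (auto simp: fun_eq_iff)
    have "(\<lambda>e. e \<in> {e\<in>\<Omega>. b e}) \<in> T" unfolding T_def by (rule imageI) auto
    then show "b \<in> T" by (subst b)
  qed
  have "measure_pmf.prob (random_hypergraph k n p) {G. A G} = measure_pmf.prob M S"
    by (simp add: random_hypergraph_def M_def \<Omega>_def S_def vimage_def)
  also have "\<dots> = measure_pmf.prob M (S \<inter> T)"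
    using sub by (intro measure_prob_cong_0) (auto simp: set_pmf_iff)
  also have "\<dots> = (\<Sum>b\<in>S \<inter> T. pmf M b)"
    using fin by (intro measure_measure_pmf_finite) (auto simp: T_def)
  also have "\<dots> = (\<Sum>b\<in>T. if b \<in> S then pmf M b else 0)"
    using fin by (subst Int_commute, intro sum.inter_restrict) (simp add: T_def)
  also have "\<dots> = (\<Sum>b\<in>T. pmf M b * of_bool (b \<in> S))" by (rule sum.cong) auto
  also have "\<dots> = (\<Sum>X\<in>Pow \<Omega>. pmf M (\<lambda>e. e \<in> X) * of_bool ((\<lambda>e. e \<in> X) \<in> S))"
    unfolding T_def sum.reindex[OF inj] by simp
  also have "\<dots> = rPr p \<Omega> (\<lambda>X. A ({..<n}, X))"
    unfolding rPr_def rEx_def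
  proof (rule sum.cong)
    fix X assume X: "X \<in> Pow \<Omega>"
    have "pmf M (\<lambda>e. e \<in> X) = (\<Prod>e\<in>\<Omega>. pmf (bernoulli_pmf p) (e \<in> X))"
      unfolding M_def using fin X by (subst pmf_Pi') auto
    also have "\<dots> = (\<Prod>e\<in>\<Omega>. if e \<in> X then p else 1 - p)"
      using assms by (intro prod.cong) auto
    also have "\<dots> = (\<Prod>e\<in>\<Omega> \<inter> X. p) * (\<Prod>e\<in>\<Omega> - X. 1 - p)"
      using fin by (subst prod.If_cases) (auto simp: Diff_eq)
    also have "\<dots> = p ^ card X * (1 - p) ^ card (\<Omega> - X)"
      using X by (simp add: Int_absorb1)
    finally have 1: "pmf M (\<lambda>e. e \<in> X) = p ^ card X * (1 - p) ^ card (\<Omega> - X)" .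
    have "{e \<in> \<Omega>. e \<in> X} = X" using X by auto
    then show "pmf M (\<lambda>e. e \<in> X) * of_bool ((\<lambda>e. e \<in> X) \<in> S)
        = p ^ card X * (1 - p) ^ card (\<Omega> - X) * of_bool (A ({..<n}, X))"
      by (simp add: 1 S_def)
  qed simp
  finally show ?thesis by (simp add: \<Omega>_def)
qed

section \<open>Hypergraph containers\<close>

text \<open>\<open>cert Ok m Goal\<close> says that there is a decision tree which queries membership in the
  unknown set \<open>I\<close>, gets at most \<open>m\<close> positive answers \<open>\<sigma> I\<close>, and outputs a set \<open>\<xi> I\<close>
  disjoint from \<open>I\<close>. The last clause says that the positive answers alone determine the run.\<close>

definition certifies ::
  "('a set \<Rightarrow> 'a set) \<Rightarrow> ('a set \<Rightarrow> 'a set) \<Rightarrow> real \<Rightarrow> ('a set \<Rightarrow> bool) \<Rightarrow> 'a set \<Rightarrow> bool" where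
  "certifies \<sigma> \<xi> m Goal I \<longleftrightarrow> \<sigma> I \<subseteq> I \<and> finite (\<sigma> I) \<and> real (card (\<sigma> I)) \<le> m
      \<and> Goal (\<xi> I) \<and> \<xi> I \<inter> I = {} \<and> (\<forall>S. \<sigma> I \<subseteq> S \<and> S \<subseteq> I \<longrightarrow> \<xi> S = \<xi> I)"

definition cert :: "('a set \<Rightarrow> bool) \<Rightarrow> real \<Rightarrow> ('a set \<Rightarrow> bool) \<Rightarrow> bool" where
  "cert Ok m Goal \<longleftrightarrow> (\<exists>\<sigma> \<xi>. \<forall>I. Ok I \<longrightarrow> certifies \<sigma> \<xi> m Goal I)"

lemma certifiesD:
  assumes "certifies \<sigma> \<xi> m G I"
  shows "\<sigma> I \<subseteq> I" "finite (\<sigma> I)" "real (card (\<sigma> I)) \<le> m" "G (\<xi> I)" "\<xi> I \<inter> I = {}"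
    "\<And>S. \<sigma> I \<subseteq> S \<Longrightarrow> S \<subseteq> I \<Longrightarrow> \<xi> S = \<xi> I"
  using assms unfolding certifies_def by (elim conjE; (assumption | iprover))+

lemma certE:
  assumes "cert Ok m G"
  obtains \<sigma> \<xi> where "\<And>I. Ok I \<Longrightarrow> certifies \<sigma> \<xi> m G I"
  using assms unfolding cert_def by blast

lemma cert_weaken:
  assumes "cert Ok m G" "\<And>I. Ok' I \<Longrightarrow> Ok I" "m \<le> m'" "\<And>X. G X \<Longrightarrow> G' X"
  shows "cert Ok' m' G'"
proof -
  obtain \<sigma> \<xi> where 1: "\<And>I. Ok I \<Longrightarrow> certifies \<sigma> \<xi> m G I" using assms(1) by (rule certE) blast
  have "certifies \<sigma> \<xi> m' G' I" if "Ok' I" for I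
  proof -
    note c = certifiesD[OF 1[OF assms(2)[OF that]]]
    show ?thesis unfolding certifies_def
    proof (intro conjI allI impI)
      show "real (card (\<sigma> I)) \<le> m'" using c(3) assms(3) by linarith
      show "G' (\<xi> I)" by (rule assms(4)[OF c(4)])
      show "\<xi> S = \<xi> I" if "\<sigma> I \<subseteq> S \<and> S \<subseteq> I" for S by (rule c(6)) (use that in auto)
    qed (rule c(1,2,5))+
  qed
  then show ?thesis unfolding cert_def by (intro exI allI impI)
qed

text \<open>A leaf of the decision tree: no query is made and the output is fixed.\<close>

lemma cert_const:
  assumes "\<And>I. Ok I \<Longrightarrow> X \<inter> I = {}" "G X" "0 \<le> m"
  shows "cert Ok m G"
  unfolding cert_def certifies_def using assms by (intro exI[of _ "\<lambda>_. {}"] exI[of _ "\<lambda>_. X"]) auto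

text \<open>An inner node of the decision tree that queries v; only a positive answer is charged. A
  set between \<open>\<sigma> I\<close> and I gives the same answer as I, since v belongs to
  \<open>\<sigma> I\<close> in the first case and lies outside I in the second, so the fingerprint
  still determines the run.\<close>

lemma cert_branch:
  assumes "cert (\<lambda>I. Ok I \<and> v \<in> I) (m - 1) G" "cert (\<lambda>I. Ok I \<and> v \<notin> I) m G"
  shows "cert Ok m G"
proof -
  obtain \<sigma>1 \<xi>1 where 1: "\<And>I. Ok I \<and> v \<in> I \<Longrightarrow> certifies \<sigma>1 \<xi>1 (m - 1) G I"
    using assms(1) by (rule certE) blast
  obtain \<sigma>0 \<xi>0 where 0: "\<And>I. Ok I \<and> v \<notin> I \<Longrightarrow> certifies \<sigma>0 \<xi>0 m G I"
    using assms(2) by (rule certE) blast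
  define \<sigma> where "\<sigma> = (\<lambda>I. if v \<in> I then insert v (\<sigma>1 I) else \<sigma>0 I)"
  define \<xi> where "\<xi> = (\<lambda>I. if v \<in> I then \<xi>1 I else \<xi>0 I)"
  have "certifies \<sigma> \<xi> m G I" if Ok: "Ok I" for I
  proof (cases "v \<in> I")
    case True
    note c = 1[OF conjI[OF Ok True], unfolded certifies_def]
    have "finite (\<sigma>1 I)" using c by blast
    then have "real (card (insert v (\<sigma>1 I))) \<le> real (card (\<sigma>1 I)) + 1"
      by (simp add: card_insert_if)
    moreover have "\<xi> S = \<xi> I" if S: "\<sigma> I \<subseteq> S" "S \<subseteq> I" for S
    proof -
      have "v \<in> S" "\<sigma>1 I \<subseteq> S" using S True by (auto simp: \<sigma>_def)
      then have "\<xi>1 S = \<xi>1 I" using c S by blast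
      then show ?thesis using True \<open>v \<in> S\<close> by (simp add: \<xi>_def)
    qed
    moreover have "\<sigma> I = insert v (\<sigma>1 I)" "\<xi> I = \<xi>1 I" using True by (simp_all add: \<sigma>_def \<xi>_def)
    moreover have "\<sigma>1 I \<subseteq> I" "finite (\<sigma>1 I)" "real (card (\<sigma>1 I)) \<le> m - 1" "G (\<xi>1 I)" "\<xi>1 I \<inter> I = {}"
      using c by blast+
    ultimately show ?thesis using True unfolding certifies_def by auto
  next
    case False
    note c = 0[OF conjI[OF Ok False], unfolded certifies_def]
    have "\<xi> S = \<xi> I" if S: "\<sigma> I \<subseteq> S" "S \<subseteq> I" for S
    proof -
      have "v \<notin> S" "\<sigma>0 I \<subseteq> S" using S False by (auto simp: \<sigma>_def)
      then have "\<xi>0 S = \<xi>0 I" using c S by blast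
      then show ?thesis using False \<open>v \<notin> S\<close> by (simp add: \<xi>_def)
    qed
    moreover have "\<sigma> I = \<sigma>0 I" "\<xi> I = \<xi>0 I" using False by (simp_all add: \<sigma>_def \<xi>_def)
    moreover have "\<sigma>0 I \<subseteq> I" "finite (\<sigma>0 I)" "real (card (\<sigma>0 I)) \<le> m" "G (\<xi>0 I)" "\<xi>0 I \<inter> I = {}"
      using c by blast+
    ultimately show ?thesis unfolding certifies_def by auto
  qed
  then show ?thesis unfolding cert_def by blast
qed

text \<open>Two runs one after the other, where the second may depend on the output X of the first.
  The fingerprints are united, and X can be recomputed from the union before the second run is
  replayed.\<close>

lemma cert_bind:
  assumes "cert Ok m1 G1" "\<And>X. G1 X \<Longrightarrow> cert (\<lambda>I. Ok I \<and> X \<inter> I = {}) m2 (\<lambda>Y. G2 (X \<union> Y))"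
  shows "cert Ok (m1 + m2) G2"
proof -
  obtain \<sigma> \<xi> where 1: "\<And>I. Ok I \<Longrightarrow> certifies \<sigma> \<xi> m1 G1 I" using assms(1) by (rule certE) blast
  have "\<forall>X. \<exists>s x. G1 X \<longrightarrow> (\<forall>I. Ok I \<and> X \<inter> I = {} \<longrightarrow> certifies s x m2 (\<lambda>Y. G2 (X \<union> Y)) I)"
    using assms(2) unfolding cert_def by blast
  then obtain s x where 2: "\<And>X. G1 X \<longrightarrow> (\<forall>I. Ok I \<and> X \<inter> I = {} \<longrightarrow> certifies (s X) (x X) m2 (\<lambda>Y. G2 (X \<union> Y)) I)"
    by metis
  have "certifies (\<lambda>I. \<sigma> I \<union> s (\<xi> I) I) (\<lambda>I. \<xi> I \<union> x (\<xi> I) I) (m1 + m2) G2 I" if Ok: "Ok I" for I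
  proof -
    note a = certifiesD[OF 1[OF Ok]]
    have "certifies (s (\<xi> I)) (x (\<xi> I)) m2 (\<lambda>Y. G2 (\<xi> I \<union> Y)) I" using a(4,5) Ok 2 by blast
    note b = certifiesD[OF this]
    have "card (\<sigma> I \<union> s (\<xi> I) I) \<le> card (\<sigma> I) + card (s (\<xi> I) I)" by (rule card_Un_le)
    then have c: "real (card (\<sigma> I \<union> s (\<xi> I) I)) \<le> m1 + m2" using a(3) b(3) by linarith
    show ?thesis unfolding certifies_def
    proof (intro conjI allI impI)
      show "\<sigma> I \<union> s (\<xi> I) I \<subseteq> I" using a(1) b(1) by (rule Un_least)
      show "finite (\<sigma> I \<union> s (\<xi> I) I)" using a(2) b(2) by (rule finite_UnI)
      show "G2 (\<xi> I \<union> x (\<xi> I) I)" by (rule b(4))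
      show "(\<xi> I \<union> x (\<xi> I) I) \<inter> I = {}" using a(5) b(5) by blast
      fix S assume S: "\<sigma> I \<union> s (\<xi> I) I \<subseteq> S \<and> S \<subseteq> I"
      have "\<xi> S = \<xi> I" by (rule a(6)) (use S in auto)
      moreover have "x (\<xi> I) S = x (\<xi> I) I" by (rule b(6)) (use S in auto)
      ultimately show "\<xi> S \<union> x (\<xi> S) S = \<xi> I \<union> x (\<xi> I) I" by simp
    qed (rule c)
  qed
  then show ?thesis unfolding cert_def by (intro exI allI impI)
qed

section \<open>The container algorithm\<close>

definition codegree :: "'a set set \<Rightarrow> 'a set \<Rightarrow> nat" where
  "codegree \<H> \<sigma> = card {e\<in>\<H>. \<sigma> \<subseteq> e}"

definition avoids :: "'a set set \<Rightarrow> 'a set \<Rightarrow> bool" where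
  "avoids \<H> I \<longleftrightarrow> (\<forall>e\<in>\<H>. \<not> e \<subseteq> I)"

text \<open>The codegree condition of the container method: D is the scale of the vertex degrees,
  and every further prescribed element costs a factor q.\<close>

definition capped :: "real \<Rightarrow> real \<Rightarrow> real \<Rightarrow> nat \<Rightarrow> 'a set set \<Rightarrow> bool" where
  "capped K D q r \<H> \<longleftrightarrow>
     (\<forall>\<sigma>. \<sigma> \<noteq> {} \<longrightarrow> finite \<sigma> \<longrightarrow> card \<sigma> \<le> r \<longrightarrow> real (codegree \<H> \<sigma>) \<le> K * D * q ^ (card \<sigma> - 1))"

lemma sum_degree_subsets:
  assumes "finite \<Omega>" "\<G> \<subseteq> [\<Omega>]\<^bsup>r\<^esup>"
  shows "(\<Sum>\<sigma>\<in>Pow \<Omega>. codegree \<G> \<sigma>) = 2 ^ r * card \<G>"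
proof -
  have finG: "finite \<G>" using assms finite_imp_finite_nsets finite_subset by blast
  have "(\<Sum>\<sigma>\<in>Pow \<Omega>. codegree \<G> \<sigma>) = (\<Sum>\<sigma>\<in>Pow \<Omega>. \<Sum>e\<in>\<G>. if \<sigma> \<subseteq> e then 1 else 0)"
    unfolding codegree_def using finG by (intro sum.cong) (auto simp: sum.If_cases Int_def)
  also have "\<dots> = (\<Sum>e\<in>\<G>. \<Sum>\<sigma>\<in>Pow \<Omega>. if \<sigma> \<subseteq> e then 1 else 0)" by (rule sum.swap)
  also have "\<dots> = (\<Sum>e\<in>\<G>. 2 ^ r)"
  proof (rule sum.cong)
    fix e assume "e \<in> \<G>"
    then have e: "e \<subseteq> \<Omega>" "card e = r" "finite e" using assms by (auto simp: nsets_def)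
    have "Pow \<Omega> \<inter> {\<sigma>. \<sigma> \<subseteq> e} = Pow e" using e by auto
    then show "(\<Sum>\<sigma>\<in>Pow \<Omega>. if \<sigma> \<subseteq> e then 1 else 0) = (2::nat) ^ r"
      using assms(1) e by (simp add: sum.If_cases card_Pow)
  qed simp
  also have "\<dots> = 2 ^ r * card \<G>" by simp
  finally show ?thesis .
qed

lemma sum_degree_points:
  assumes "finite \<Omega>" "\<G> \<subseteq> [\<Omega>]\<^bsup>r\<^esup>"
  shows "(\<Sum>v\<in>\<Omega>. card {e\<in>\<G>. v \<in> e}) = r * card \<G>"
proof -
  have finG: "finite \<G>" using assms finite_imp_finite_nsets finite_subset by blast
  have "(\<Sum>v\<in>\<Omega>. card {e\<in>\<G>. v \<in> e}) = (\<Sum>v\<in>\<Omega>. \<Sum>e\<in>\<G>. if v \<in> e then 1 else 0)"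
    using finG by (intro sum.cong) (auto simp: sum.If_cases Int_def)
  also have "\<dots> = (\<Sum>e\<in>\<G>. \<Sum>v\<in>\<Omega>. if v \<in> e then 1 else 0)" by (rule sum.swap)
  also have "\<dots> = (\<Sum>e\<in>\<G>. r)"
  proof (rule sum.cong)
    fix e assume "e \<in> \<G>"
    then have e: "e \<subseteq> \<Omega>" "card e = r" using assms by (auto simp: nsets_def)
    have "\<Omega> \<inter> e = e" using e by auto
    then show "(\<Sum>v\<in>\<Omega>. if v \<in> e then 1 else 0) = r"
      using assms(1) e by (simp add: sum.If_cases)
  qed simp
  also have "\<dots> = r * card \<G>" by simp
  finally show ?thesis .
qed

text \<open>A single shrinking step, packaged as a predicate so that it can serve as induction
  hypothesis on the uniformity r. The normalisation \<open>D * q ^ (r - 1) = 1\<close> says that a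
  full r-set has codegree of constant order. The output has to lie in \<open>\<Union>\<H>\<close>,
  so that repeated steps on the edges that are left produce new elements each time.\<close>

definition has_containers :: "nat \<Rightarrow> real \<Rightarrow> real \<Rightarrow> real \<Rightarrow> real \<Rightarrow> 'a itself \<Rightarrow> bool" where
  "has_containers r K \<beta> L \<delta> TYPE('a) \<longleftrightarrow>
    (\<forall>(\<Omega> :: 'a set) \<H> q D N. finite \<Omega> \<longrightarrow> \<H> \<subseteq> [\<Omega>]\<^bsup>r\<^esup> \<longrightarrow> real (card \<Omega>) \<le> N \<longrightarrow> 0 < q \<longrightarrow> q \<le> 1 \<longrightarrow> 0 < D
      \<longrightarrow> D * q ^ (r - 1) = 1 \<longrightarrow> 1 \<le> q * N \<longrightarrow> capped K D q r \<H> \<longrightarrow> \<beta> * D * N \<le> real (card \<H>) \<longrightarrow>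
      cert (\<lambda>I. I \<subseteq> \<Omega> \<and> avoids \<H> I) (L * (q * N)) (\<lambda>X. X \<subseteq> \<Union>\<H> \<and> \<delta> * N \<le> real (card X)))"

text \<open>One level: query a vertex of large degree in the part of \<open>\<H>\<close> without saturated subsets;
  a positive answer contributes its link to \<open>\<G>\<close>, which is one uniformity lower.\<close>

lemma container_level:
  fixes \<Omega> :: "'a set"
  assumes IH: "has_containers r (K + 1) \<beta>' L' \<delta>' TYPE('a)"
    and r: "r \<ge> 1" and K: "K > 0" and \<beta>: "\<beta> > 0" and \<beta>': "\<beta>' > 0" "\<beta>' \<le> \<beta> / (K * 2 ^ Suc r)" "\<beta>' \<le> \<beta>\<^sup>2 / (32 * K)"
    and L': "L' > 0"
    and fin: "finite \<Omega>" and H: "\<H> \<subseteq> [\<Omega>]\<^bsup>Suc r\<^esup>" and N: "real (card \<Omega>) \<le> N"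
    and q: "0 < q" "q \<le> 1" and D: "0 < D" "D * q ^ r = 1" and qN: "1 \<le> q * N"
    and cap: "capped K D q (Suc r) \<H>" and large: "\<beta> * D * N \<le> real (card \<H>)"
    and m: "m = 4 * \<beta>' / \<beta> * (q * N) + 1 + L' * (q * N)" and \<delta>: "\<delta> = min \<delta>' (\<beta> / (8 * K))"
  shows "F \<subseteq> \<Omega> \<Longrightarrow> X \<subseteq> \<Union>\<H> \<Longrightarrow> \<G> \<subseteq> [\<Omega>]\<^bsup>r\<^esup> \<Longrightarrow> \<forall>g\<in>\<G>. \<exists>v\<in>F. insert v g \<in> \<H> \<Longrightarrow>
    capped (K + 1) (D * q) q r \<G> \<Longrightarrow> real (card F) * (\<beta> / 4 * D) \<le> real (card \<G>) \<Longrightarrow>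
    (real (card F) - 1) * (\<beta> / 4 * D) \<le> \<beta>' * (D * q) * N \<Longrightarrow>
    cert (\<lambda>I. I \<subseteq> \<Omega> \<and> avoids \<H> I \<and> F \<subseteq> I \<and> X \<inter> I = {}) (m - real (card F))
      (\<lambda>X. X \<subseteq> \<Union>\<H> \<and> \<delta> * N \<le> real (card X))"
proof (induction "card (\<Omega> - (F \<union> X))" arbitrary: F X \<G> rule: less_induct)
  \<comment> \<open>F collects the positive answers and X the negative ones; \<G> consists of the
    link edges gained so far. Each member of F has brought at least \<open>\<beta> / 4 * D\<close>
    new link edges, which bounds F by the size of \<G>.\<close>
  case less
  note F = less.prems(1) and X = less.prems(2) and G = less.prems(3) and link = less.prems(4)
    and capG = less.prems(5) and cF = less.prems(6) and cF' = less.prems(7)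
  have Npos: "N > 0" using qN q zero_less_mult_pos[of q N] by simp
  have finH: "finite \<H>" using H fin finite_imp_finite_nsets finite_subset by blast
  have finG: "finite \<G>" using G fin finite_imp_finite_nsets finite_subset by blast
  have UH: "\<Union>\<H> \<subseteq> \<Omega>" using H by (auto simp: nsets_def)
  have finF: "finite F" using F fin by (rule finite_subset)
  have finX: "finite X" using order_trans[OF X UH] fin by (rule finite_subset)
  show ?case
  proof (cases "\<beta>' * (D * q) * N \<le> real (card \<G>)")
    \<comment> \<open>\<G> is large enough for the induction hypothesis: I contains F and avoids
      \<H>, so it can contain no edge of \<G>.\<close>
    case True
    have "D * q * q ^ (r - 1) = 1" using D r by (simp add: mult.assoc flip: power_Suc)
    then have "cert (\<lambda>I. I \<subseteq> \<Omega> \<and> avoids \<G> I) (L' * (q * N)) (\<lambda>X. X \<subseteq> \<Union>\<G> \<and> \<delta>' * N \<le> real (card X))"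
      using IH[unfolded has_containers_def, rule_format, OF fin G N q mult_pos_pos[OF D(1) q(1)] _ qN capG True] by simp
    then show ?thesis
    proof (rule cert_weaken)
      fix I assume I: "I \<subseteq> \<Omega> \<and> avoids \<H> I \<and> F \<subseteq> I \<and> X \<inter> I = {}"
      then show "I \<subseteq> \<Omega> \<and> avoids \<G> I" using link unfolding avoids_def by (meson insert_subsetI subsetD)
    next
      have "real (card F) - 1 \<le> \<beta>' * (D * q) * N / (\<beta> / 4 * D)"
        using cF' \<beta> D by (subst pos_le_divide_eq) auto
      also have "\<dots> = 4 * \<beta>' / \<beta> * (q * N)" using \<beta> D by (simp add: field_simps)
      finally show "L' * (q * N) \<le> m - real (card F)" unfolding m by simp
    next
      fix Y assume Y: "Y \<subseteq> \<Union>\<G> \<and> \<delta>' * N \<le> real (card Y)"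
      have "\<Union>\<G> \<subseteq> \<Union>\<H>" using link by blast
      moreover have "\<delta> * N \<le> \<delta>' * N" unfolding \<delta> using Npos by (intro mult_right_mono) auto
      ultimately show "Y \<subseteq> \<Union>\<H> \<and> \<delta> * N \<le> real (card Y)" using Y by auto
    qed
  next
    case False
    \<comment> \<open>A set is saturated once its codegree in \<G> has reached the level aimed at.
      Edges of \<H> over saturated sets are no longer used, which is what keeps \<G> capped with
      constant \<open>K + 1\<close>: at most \<open>D * q ^ card \<sigma>\<close> before a query and
      \<open>K * D * q ^ card \<sigma>\<close> from the query itself.\<close>
    define sat where "sat = {\<sigma>\<in>Pow \<Omega>. \<sigma> \<noteq> {} \<and> card \<sigma> \<le> r \<and> D * q ^ card \<sigma> \<le> real (codegree \<G> \<sigma>)}"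
    define U where "U = {e\<in>\<H>. \<forall>\<sigma>\<in>sat. \<not> \<sigma> \<subseteq> e}"
    have UH': "U \<subseteq> \<H>" and finU: "finite U" using finH by (auto simp: U_def)
    have finsat: "finite sat" unfolding sat_def using fin by auto
    \<comment> \<open>Saturated sets spoil at most half of the edges that \<H> is known to have: the
      codegree of a saturated set in \<H> is at most K / q times its codegree in \<G>, and the
      codegrees in \<G> add up to \<open>2 ^ r * card \<G>\<close>, which is small as long as \<G>
      is.\<close>
    have "card (\<H> - U) \<le> card (\<Union>\<sigma>\<in>sat. {e\<in>\<H>. \<sigma> \<subseteq> e})"
      using finH finsat by (intro card_mono) (auto simp: U_def)
    also have "\<dots> \<le> (\<Sum>\<sigma>\<in>sat. codegree \<H> \<sigma>)" unfolding codegree_def using finsat by (rule card_UN_le)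
    finally have "real (card (\<H> - U)) \<le> (\<Sum>\<sigma>\<in>sat. real (codegree \<H> \<sigma>))"
      by (metis of_nat_le_iff of_nat_sum)
    also have "\<dots> \<le> (\<Sum>\<sigma>\<in>sat. K / q * real (codegree \<G> \<sigma>))"
    proof (rule sum_mono)
      fix \<sigma> assume s: "\<sigma> \<in> sat"
      then have fs: "finite \<sigma>" "\<sigma> \<noteq> {}" "card \<sigma> \<le> r" using fin finite_subset by (auto simp: sat_def)
      then have c: "card \<sigma> = Suc (card \<sigma> - 1)" by (metis Suc_pred' card_gt_0_iff)
      have "real (codegree \<H> \<sigma>) \<le> K * D * q ^ (card \<sigma> - 1)" using cap fs unfolding capped_def by auto
      also have "\<dots> = K / q * (D * q ^ card \<sigma>)" by (subst (2) c) (use q in simp)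
      also have "\<dots> \<le> K / q * real (codegree \<G> \<sigma>)" using s K q by (intro mult_left_mono) (auto simp: sat_def)
      finally show "real (codegree \<H> \<sigma>) \<le> K / q * real (codegree \<G> \<sigma>)" .
    qed
    also have "\<dots> \<le> (\<Sum>\<sigma>\<in>Pow \<Omega>. K / q * real (codegree \<G> \<sigma>))"
      using fin K q by (intro sum_mono2) (auto simp: sat_def)
    also have "\<dots> = K / q * (2 ^ r * real (card \<G>))"
      unfolding sum_distrib_left[symmetric] by (simp only: of_nat_sum[symmetric] sum_degree_subsets[OF fin G]) simp
    also have "\<dots> \<le> K / q * (2 ^ r * (\<beta>' * (D * q) * N))"
      using False K q by (intro mult_left_mono) auto
    also have "\<dots> = (K * 2 ^ r * \<beta>') * (D * N)" using q by simp
    also have "\<dots> \<le> (\<beta> / 2) * (D * N)"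
    proof (rule mult_right_mono)
      show "K * 2 ^ r * \<beta>' \<le> \<beta> / 2" using \<beta>'(2) K by (simp add: field_simps)
    qed (use D Npos in auto)
    finally have "real (card (\<H> - U)) \<le> \<beta> / 2 * (D * N)" .
    moreover have "real (card \<H>) = real (card (\<H> - U)) + real (card U)"
      using card_Diff_subset[OF finU UH'] card_mono[OF finH UH'] by simp
    ultimately have cU: "real (card U) \<ge> \<beta> / 2 * (D * N)" using large by (simp add: algebra_simps)
    show ?thesis
    proof (cases "\<exists>v\<in>\<Omega> - (F \<union> X). \<beta> / 4 * D \<le> real (card {e\<in>U. v \<in> e})")
      case True
      then obtain v where v: "v \<in> \<Omega>" "v \<notin> F" "v \<notin> X" and dv: "\<beta> / 4 * D \<le> real (card {e\<in>U. v \<in> e})" by auto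
      have "{e\<in>U. v \<in> e} \<noteq> {}"
      proof
        assume "{e\<in>U. v \<in> e} = {}"
        then have "\<beta> / 4 * D \<le> 0" using dv by (simp only: card.empty of_nat_0)
        then show False using \<beta> D by (simp add: mult_le_0_iff)
      qed
      then have vH: "v \<in> \<Union>\<H>" using UH' by blast
      define A where "A = (\<lambda>e. e - {v}) ` {e\<in>U. v \<in> e}"
      have inj: "inj_on (\<lambda>e. e - {v}) {e\<in>U. v \<in> e}" by (auto simp: inj_on_def)
      have cA: "card A = card {e\<in>U. v \<in> e}" unfolding A_def by (rule card_image[OF inj])
      have A: "A \<subseteq> [\<Omega>]\<^bsup>r\<^esup>" using H UH' by (fastforce simp: A_def nsets_def)
      \<comment> \<open>A link edge already present in \<G> would itself be saturated, because
        \<open>D * q ^ r = 1\<close>; hence the link edges of v are really new.\<close>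
      have disj: "A \<inter> \<G> = {}"
      proof (rule ccontr)
        assume "A \<inter> \<G> \<noteq> {}"
        then obtain e where e: "e \<in> U" "v \<in> e" "e - {v} \<in> \<G>" by (auto simp: A_def)
        let ?s = "e - {v}"
        have s: "?s \<subseteq> \<Omega>" "card ?s = r" "finite ?s" using e G by (auto simp: nsets_def)
        have "card {?s} \<le> codegree \<G> ?s" unfolding codegree_def using finG e by (intro card_mono) auto
        moreover have "?s \<noteq> {}" using s(2) r by (metis card.empty not_one_le_zero)
        ultimately have "?s \<in> sat" using s D unfolding sat_def by simp
        then show False using e by (auto simp: U_def)
      qed
      have cG: "card (\<G> \<union> A) = card \<G> + card A"
        using disj finG finU by (intro card_Un_disjoint) (auto simp: A_def)
      have step: "card (\<Omega> - (insert v F \<union> X)) < card (\<Omega> - (F \<union> X))"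
        "card (\<Omega> - (F \<union> insert v X)) < card (\<Omega> - (F \<union> X))"
        using v fin by (intro psubset_card_mono; auto)+
      have cins: "card (insert v F) = Suc (card F)" using v finF by simp
      have "cert (\<lambda>I. I \<subseteq> \<Omega> \<and> avoids \<H> I \<and> insert v F \<subseteq> I \<and> X \<inter> I = {}) (m - real (card (insert v F)))
          (\<lambda>X. X \<subseteq> \<Union>\<H> \<and> \<delta> * N \<le> real (card X))"
      proof (rule less.hyps[OF step(1), where \<G>="\<G> \<union> A"])
        show "insert v F \<subseteq> \<Omega>" using v F by auto
        show "X \<subseteq> \<Union>\<H>" by (rule X)
        show "\<G> \<union> A \<subseteq> [\<Omega>]\<^bsup>r\<^esup>" using G A by auto
        have "insert v (e - {v}) \<in> \<H>" if "e \<in> U" "v \<in> e" for e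
          using that UH' by (auto simp: insert_absorb)
        then show "\<forall>g\<in>\<G> \<union> A. \<exists>v\<in>insert v F. insert v g \<in> \<H>" using link by (auto simp: A_def)
        show "capped (K + 1) (D * q) q r (\<G> \<union> A)" unfolding capped_def
        proof (intro allI impI)
          fix \<sigma> :: "'a set" assume s: "\<sigma> \<noteq> {}" "finite \<sigma>" "card \<sigma> \<le> r"
          have c: "card \<sigma> = Suc (card \<sigma> - 1)" using s by (metis Suc_pred' card_gt_0_iff)
          have qq: "D * q ^ card \<sigma> = D * q * q ^ (card \<sigma> - 1)" by (subst c) simp
          have un: "{e\<in>\<G> \<union> A. \<sigma> \<subseteq> e} = {e\<in>\<G>. \<sigma> \<subseteq> e} \<union> {e\<in>A. \<sigma> \<subseteq> e}" by auto
          have le: "codegree (\<G> \<union> A) \<sigma> \<le> codegree \<G> \<sigma> + codegree A \<sigma>"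
            unfolding codegree_def un by (rule card_Un_le)
          show "real (codegree (\<G> \<union> A) \<sigma>) \<le> (K + 1) * (D * q) * q ^ (card \<sigma> - 1)"
          proof (cases "{e\<in>A. \<sigma> \<subseteq> e} = {}")
            case True
            then have "codegree (\<G> \<union> A) \<sigma> \<le> codegree \<G> \<sigma>" using le unfolding codegree_def by (simp only: card.empty add_0_right)
            moreover have "real (codegree \<G> \<sigma>) \<le> (K + 1) * (D * q) * q ^ (card \<sigma> - 1)"
              using capG s unfolding capped_def by blast
            ultimately show ?thesis by simp
          next
            case False
            then obtain e where e: "e \<in> U" "v \<in> e" "\<sigma> \<subseteq> e - {v}" by (auto simp: A_def)
            then have "\<sigma> \<notin> sat" by (auto simp: U_def)
            moreover have "\<sigma> \<subseteq> \<Omega>" using e UH' H by (auto simp: nsets_def)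
            ultimately have 1: "real (codegree \<G> \<sigma>) \<le> D * q ^ card \<sigma>" using s by (auto simp: sat_def)
            have "codegree A \<sigma> \<le> codegree \<H> (insert v \<sigma>)"
            proof -
              have sub: "{e\<in>A. \<sigma> \<subseteq> e} \<subseteq> (\<lambda>e. e - {v}) ` {e\<in>\<H>. insert v \<sigma> \<subseteq> e}"
                using UH' by (auto simp: A_def)
              have "card {e\<in>A. \<sigma> \<subseteq> e} \<le> card ((\<lambda>e. e - {v}) ` {e\<in>\<H>. insert v \<sigma> \<subseteq> e})"
                using finH sub by (intro card_mono) auto
              also have "\<dots> \<le> card {e\<in>\<H>. insert v \<sigma> \<subseteq> e}" using finH by (intro card_image_le) auto
              finally show ?thesis by (simp add: codegree_def)
            qed
            moreover have "card (insert v \<sigma>) = Suc (card \<sigma>)" using e s by (intro card_insert_disjoint) auto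
            moreover have "real (codegree \<H> (insert v \<sigma>)) \<le> K * D * q ^ (card (insert v \<sigma>) - 1)"
              using cap s \<open>card (insert v \<sigma>) = Suc (card \<sigma>)\<close> unfolding capped_def
              by (metis Suc_le_mono finite_insert insert_not_empty)
            ultimately have "real (codegree A \<sigma>) \<le> K * D * q ^ card \<sigma>" by simp
            then have "real (codegree (\<G> \<union> A) \<sigma>) \<le> (K + 1) * (D * q ^ card \<sigma>)"
              using 1 le by (simp add: algebra_simps)
            then show ?thesis unfolding qq by (simp add: mult.assoc)
          qed
        qed
        show "real (card (insert v F)) * (\<beta> / 4 * D) \<le> real (card (\<G> \<union> A))"
          unfolding cins cG using cF dv cA by (simp add: algebra_simps)
        show "(real (card (insert v F)) - 1) * (\<beta> / 4 * D) \<le> \<beta>' * (D * q) * N"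
          unfolding cins using cF False by simp
      qed
      then have c1: "cert (\<lambda>I. (I \<subseteq> \<Omega> \<and> avoids \<H> I \<and> F \<subseteq> I \<and> X \<inter> I = {}) \<and> v \<in> I) (m - real (card F) - 1)
          (\<lambda>X. X \<subseteq> \<Union>\<H> \<and> \<delta> * N \<le> real (card X))"
        by (rule cert_weaken) (auto simp: cins)
      have "cert (\<lambda>I. I \<subseteq> \<Omega> \<and> avoids \<H> I \<and> F \<subseteq> I \<and> insert v X \<inter> I = {}) (m - real (card F))
          (\<lambda>X. X \<subseteq> \<Union>\<H> \<and> \<delta> * N \<le> real (card X))"
        using X vH by (intro less.hyps[OF step(2) F _ G link capG cF cF']) auto
      then have c0: "cert (\<lambda>I. (I \<subseteq> \<Omega> \<and> avoids \<H> I \<and> F \<subseteq> I \<and> X \<inter> I = {}) \<and> v \<notin> I) (m - real (card F))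
          (\<lambda>X. X \<subseteq> \<Union>\<H> \<and> \<delta> * N \<le> real (card X))"
        by (rule cert_weaken) auto
      show ?thesis by (rule cert_branch[OF c1 c0])
    next
      \<comment> \<open>All elements of large degree have been queried. The edges of U then force F
        and X together to have at least \<open>\<beta> / (4 * K) * N\<close> elements, F has at most
        half of that, and so X is a valid output.\<close>
      case none: False
      have "\<beta> / 2 * (D * N) \<le> real (card U)" by (rule cU)
      also have "\<dots> \<le> real (Suc r * card U)" by simp
      also have "\<dots> = (\<Sum>v\<in>\<Omega>. real (card {e\<in>U. v \<in> e}))"
        using sum_degree_points[OF fin order_trans[OF UH' H]] by (metis of_nat_sum)
      also have "\<dots> \<le> (\<Sum>v\<in>\<Omega>. \<beta> / 4 * D + (if v \<in> F \<union> X then K * D else 0))"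
      proof (rule sum_mono)
        fix v assume v: "v \<in> \<Omega>"
        show "real (card {e\<in>U. v \<in> e}) \<le> \<beta> / 4 * D + (if v \<in> F \<union> X then K * D else 0)"
        proof (cases "v \<in> F \<union> X")
          case True
          have "card {e\<in>U. v \<in> e} \<le> codegree \<H> {v}" unfolding codegree_def using finH UH' by (intro card_mono) auto
          also have "real (codegree \<H> {v}) \<le> K * D"
            using cap[unfolded capped_def, rule_format, of "{v}"] by simp
          finally have "real (card {e\<in>U. v \<in> e}) \<le> K * D" by simp
          then show ?thesis using True \<beta> D by (simp add: add_increasing)
        next
          case False
          then have "\<not> \<beta> / 4 * D \<le> real (card {e\<in>U. v \<in> e})" using none v by blast
          then show ?thesis using False by simp
        qed
      qed
      also have "\<dots> = real (card \<Omega>) * (\<beta> / 4 * D) + real (card (F \<union> X)) * (K * D)"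
      proof -
        have "\<Omega> \<inter> (F \<union> X) = F \<union> X" using F X UH by auto
        then have "(\<Sum>v\<in>\<Omega>. if v \<in> F \<union> X then K * D else 0) = real (card (F \<union> X)) * (K * D)"
          using fin by (subst sum.inter_restrict[symmetric]) simp_all
        then show ?thesis by (simp add: sum.distrib)
      qed
      also have "\<dots> \<le> N * (\<beta> / 4 * D) + real (card (F \<union> X)) * (K * D)"
        using N \<beta> D by (intro add_right_mono mult_right_mono) auto
      finally have "D * (\<beta> / 4 * N) \<le> D * (real (card (F \<union> X)) * K)" by (simp add: algebra_simps)
      then have FX: "\<beta> / 4 * N \<le> real (card (F \<union> X)) * K" using D(1) by (rule mult_left_le_imp_le)
      have "real (card F) * (\<beta> / 4 * D) < \<beta>' * (D * q) * N" using cF False by linarith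
      then have "D * (real (card F) * (\<beta> / 4)) < D * (\<beta>' * q * N)" by (simp add: algebra_simps)
      then have "real (card F) * (\<beta> / 4) < \<beta>' * q * N" by (rule mult_left_less_imp_less) (use D in simp)
      also have "\<dots> \<le> \<beta>' * 1 * N" using q \<beta>' Npos by (intro mult_right_mono mult_left_mono) auto
      also have "\<dots> \<le> \<beta>\<^sup>2 / (32 * K) * N" using \<beta>' Npos by (intro mult_right_mono) auto
      finally have "(\<beta> / 4) * real (card F) < (\<beta> / 4) * (\<beta> / (8 * K) * N)" by (simp add: power2_eq_square algebra_simps)
      then have Fc: "real (card F) < \<beta> / (8 * K) * N" by (rule mult_left_less_imp_less) (use \<beta> in simp)
      have "real (card (F \<union> X)) \<le> real (card F) + real (card X)" using card_Un_le[of F X] by linarith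
      moreover have "\<beta> / (4 * K) * N \<le> real (card (F \<union> X))" using FX K by (simp add: field_simps)
      ultimately have "\<beta> / (8 * K) * N \<le> real (card X)" using Fc by (simp add: field_simps)
      moreover have "\<delta> * N \<le> \<beta> / (8 * K) * N" unfolding \<delta> using Npos by (intro mult_right_mono) auto
      moreover have "0 \<le> m - real (card F)"
      proof -
        have "real (card F) - 1 \<le> \<beta>' * (D * q) * N / (\<beta> / 4 * D)"
          using cF' \<beta> D by (subst pos_le_divide_eq) auto
        also have "\<dots> = 4 * \<beta>' / \<beta> * (q * N)" using \<beta> D by (simp add: field_simps)
        finally show ?thesis unfolding m using L' qN by (simp add: add_increasing2)
      qed
      ultimately show ?thesis using X by (intro cert_const[where X = X]) auto
    qed
  qed
qed

text \<open>Induction on the uniformity: a level either outputs its negative answers or hands a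
  hypergraph of uniformity one lower, with cap K + 1, to the induction hypothesis. For uniformity 1
  the edges are singletons, and their union is disjoint from I without any query.\<close>

lemma container_exists:
  assumes "r \<ge> 1" "K > 0" "\<beta> > 0"
  shows "\<exists>L>0. \<exists>\<delta>>0. has_containers r K \<beta> L \<delta> TYPE('a)"
  using assms
proof (induction r arbitrary: K \<beta> rule: nat_induct_at_least)
  case base
  have "has_containers 1 K \<beta> 1 \<beta> TYPE('a)"
    unfolding has_containers_def
  proof (intro allI impI)
    fix \<Omega> :: "'a set" and \<H> and q D N :: real
    assume fin: "finite \<Omega>" and H: "\<H> \<subseteq> [\<Omega>]\<^bsup>1\<^esup>" and D: "D * q ^ (1 - 1) = 1"
      and qN: "1 \<le> q * N" and c: "\<beta> * D * N \<le> real (card \<H>)"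
    have finH: "finite \<H>" using H fin finite_imp_finite_nsets finite_subset by blast
    have sing: "\<exists>v. e = {v}" if "e \<in> \<H>" for e using H that by (auto simp: nsets_def card_1_singleton_iff)
    have "\<H> \<subseteq> (\<lambda>v. {v}) ` \<Union>\<H>" using sing by blast
    moreover have fU: "finite (\<Union>\<H>)" using finH sing by (metis finite.simps finite_Union)
    ultimately have "card \<H> \<le> card (\<Union>\<H>)" by (meson card_image_le card_mono finite_imageI order_trans)
    then have "\<beta> * N \<le> real (card (\<Union>\<H>))" using c D by simp
    moreover have "\<Union>\<H> \<inter> I = {}" if "I \<subseteq> \<Omega> \<and> avoids \<H> I" for I
      using that sing unfolding avoids_def by fastforce
    ultimately show "cert (\<lambda>I. I \<subseteq> \<Omega> \<and> avoids \<H> I) (1 * (q * N)) (\<lambda>X. X \<subseteq> \<Union>\<H> \<and> \<beta> * N \<le> real (card X))"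
      using qN by (intro cert_const[where X = "\<Union>\<H>"]) auto
  qed
  then show ?case using base by (intro exI[of _ 1] conjI exI[of _ \<beta>]) auto
next
  case (Suc r)
  \<comment> \<open>The first bound keeps the edges lost to saturation below half; the second keeps
    the positive answers below half of the queried elements when the level stops.\<close>
  define \<beta>' where "\<beta>' = min (\<beta> / (K * 2 ^ Suc r)) (\<beta>\<^sup>2 / (32 * K))"
  have \<beta>': "\<beta>' > 0" "\<beta>' \<le> \<beta> / (K * 2 ^ Suc r)" "\<beta>' \<le> \<beta>\<^sup>2 / (32 * K)"
    using Suc.prems by (auto simp: \<beta>'_def)
  obtain L' \<delta>' where L': "L' > 0" "\<delta>' > 0" "has_containers r (K + 1) \<beta>' L' \<delta>' TYPE('a)"
    using Suc.IH[of "K + 1" \<beta>'] Suc.prems \<beta>' by auto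
  define L where "L = 4 * \<beta>' / \<beta> + 1 + L'"
  define \<delta> where "\<delta> = min \<delta>' (\<beta> / (8 * K))"
  have "has_containers (Suc r) K \<beta> L \<delta> TYPE('a)"
    unfolding has_containers_def
  proof (intro allI impI)
    fix \<Omega> :: "'a set" and \<H> and q D N :: real
    assume fin: "finite \<Omega>" and H: "\<H> \<subseteq> [\<Omega>]\<^bsup>Suc r\<^esup>" and N: "real (card \<Omega>) \<le> N"
      and q: "0 < q" "q \<le> 1" and D: "0 < D" "D * q ^ (Suc r - 1) = 1"
      and qN: "1 \<le> q * N" and cap: "capped K D q (Suc r) \<H>" and c: "\<beta> * D * N \<le> real (card \<H>)"
    have qN0: "0 \<le> q * N" using qN by linarith
    have N0: "0 \<le> N" using N by (meson of_nat_0_le_iff order_trans)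
    have "0 \<le> \<beta>' * (D * q) * N" "0 \<le> \<beta> * D" using \<beta>' D q N0 Suc.prems by auto
    then have neg: "- (\<beta> * D / 4) \<le> \<beta>' * (D * q) * N" by linarith
    have capped_empty: "capped (K + 1) (D * q) q r {}"
      unfolding capped_def codegree_def using Suc.prems D q by simp
    have "cert (\<lambda>I. I \<subseteq> \<Omega> \<and> avoids \<H> I \<and> {} \<subseteq> I \<and> {} \<inter> I = {})
        (4 * \<beta>' / \<beta> * (q * N) + 1 + L' * (q * N) - real (card ({} :: 'a set))) (\<lambda>X. X \<subseteq> \<Union>\<H> \<and> \<delta> * N \<le> real (card X))"
      using D(2) neg
      by (intro container_level[OF L'(3) Suc.hyps Suc.prems(1,2) \<beta>' L'(1) fin H N q D(1) _ qN cap c refl \<delta>_def, where \<G> = "{}"])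
         (auto intro: capped_empty)
    then show "cert (\<lambda>I. I \<subseteq> \<Omega> \<and> avoids \<H> I) (L * (q * N)) (\<lambda>X. X \<subseteq> \<Union>\<H> \<and> \<delta> * N \<le> real (card X))"
      by (rule cert_weaken) (use qN in \<open>auto simp: L_def algebra_simps\<close>)
  qed
  moreover have "L > 0" using L'(1) \<beta>'(1) Suc.prems by (simp add: L_def add_pos_pos)
  moreover have "\<delta> > 0" using L'(2) Suc.prems by (simp add: \<delta>_def)
  ultimately show ?case by (intro exI[of _ L] exI[of _ \<delta>] conjI)
qed

text \<open>The shrinking step is repeated on the edges that avoid the elements already excluded,
  until fewer than \<open>\<beta> * D * N\<close> of them are left. Every round excludes
  \<open>\<delta> * N\<close> further elements, so about \<open>1 / \<delta>\<close> rounds are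
  enough.\<close>

theorem containers:
  assumes "r \<ge> 1" "K > 0" "\<beta> > 0"
  shows "\<exists>L>0. \<forall>(\<Omega> :: 'a set) \<H> q D N. finite \<Omega> \<longrightarrow> \<H> \<subseteq> [\<Omega>]\<^bsup>r\<^esup> \<longrightarrow> real (card \<Omega>) \<le> N \<longrightarrow> 0 < q
      \<longrightarrow> q \<le> 1 \<longrightarrow> 0 < D \<longrightarrow> D * q ^ (r - 1) = 1 \<longrightarrow> 1 \<le> q * N \<longrightarrow> capped K D q r \<H> \<longrightarrow>
      cert (\<lambda>I. I \<subseteq> \<Omega> \<and> avoids \<H> I) (L * (q * N))
        (\<lambda>X. X \<subseteq> \<Omega> \<and> real (card {e\<in>\<H>. e \<inter> X = {}}) < \<beta> * D * N)"
proof -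
  obtain L \<delta> where L: "L > 0" "\<delta> > 0" "has_containers r K \<beta> L \<delta> TYPE('a)"
    using container_exists[OF assms, where 'a = 'a] by (elim exE conjE)
  define n0 where "n0 = nat \<lceil>1 / \<delta>\<rceil>"
  have "1 / \<delta> \<le> real n0" unfolding n0_def by (rule real_nat_ceiling_ge)
  then have n0: "1 \<le> real n0 * \<delta>" using L(2) by (simp add: divide_le_eq)
  show ?thesis
  proof (intro exI[of _ "real (Suc n0) * L"] conjI allI impI)
    show "0 < real (Suc n0) * L" using L by simp
    fix \<Omega> :: "'a set" and \<H> and q D N :: real
    assume fin: "finite \<Omega>" and H: "\<H> \<subseteq> [\<Omega>]\<^bsup>r\<^esup>" and N: "real (card \<Omega>) \<le> N"
      and q: "0 < q" "q \<le> 1" and D: "0 < D" "D * q ^ (r - 1) = 1"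
      and qN: "1 \<le> q * N" and cap: "capped K D q r \<H>"
    let ?G = "\<lambda>X. X \<subseteq> \<Omega> \<and> real (card {e\<in>\<H>. e \<inter> X = {}}) < \<beta> * D * N"
    have finH: "finite \<H>" using H fin finite_imp_finite_nsets finite_subset by blast
    have Npos: "N > 0" using qN q zero_less_mult_pos[of q N] by simp
    \<comment> \<open>Here n counts the rounds that the elements outside X0 can still pay
      for.\<close>
    have main: "cert (\<lambda>I. (I \<subseteq> \<Omega> \<and> avoids \<H> I) \<and> X0 \<inter> I = {}) (real n * (L * (q * N))) (\<lambda>X. ?G (X0 \<union> X))"
      if "X0 \<subseteq> \<Omega>" "real (card (\<Omega> - X0)) \<le> real n * \<delta> * N" for n X0
      using that
    proof (induction n arbitrary: X0)
      case 0
      then have "\<Omega> - X0 = {}" using fin by auto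
      have "e \<inter> X0 \<noteq> {}" if "e \<in> \<H>" for e
      proof -
        have e: "e \<subseteq> \<Omega>" "card e = r" using that H by (auto simp: nsets_def)
        then have "e \<subseteq> X0" using \<open>\<Omega> - X0 = {}\<close> by auto
        moreover have "e \<noteq> {}" using e assms(1) by auto
        ultimately show ?thesis by auto
      qed
      then have "{e\<in>\<H>. e \<inter> X0 = {}} = {}" by auto
      then have "?G (X0 \<union> {})" using 0 assms D Npos by (simp only: Un_empty_right) simp
      then show ?case by (intro cert_const[where X = "{}"]) auto
    next
      case (Suc n)
      show ?case
      proof (cases "?G X0")
        case True
        then show ?thesis using L qN by (intro cert_const[where X = "{}"]) auto
      next
        case False
        define \<H>0 where "\<H>0 = {e\<in>\<H>. e \<inter> X0 = {}}"
        have H0: "\<H>0 \<subseteq> [\<Omega>]\<^bsup>r\<^esup>" using H by (auto simp: \<H>0_def)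
        have deg: "codegree \<H>0 \<sigma> \<le> codegree \<H> \<sigma>" for \<sigma>
          unfolding codegree_def \<H>0_def using finH by (intro card_mono) auto
        have cap0: "capped K D q r \<H>0" unfolding capped_def
        proof (intro allI impI)
          fix \<sigma> :: "'a set" assume "\<sigma> \<noteq> {}" "finite \<sigma>" "card \<sigma> \<le> r"
          then have "real (codegree \<H> \<sigma>) \<le> K * D * q ^ (card \<sigma> - 1)" using cap unfolding capped_def by blast
          then show "real (codegree \<H>0 \<sigma>) \<le> K * D * q ^ (card \<sigma> - 1)" using deg[of \<sigma>] by simp
        qed
        have c0: "\<beta> * D * N \<le> real (card \<H>0)" using False Suc.prems by (simp add: \<H>0_def not_less)
        have "cert (\<lambda>I. I \<subseteq> \<Omega> \<and> avoids \<H>0 I) (L * (q * N)) (\<lambda>X. X \<subseteq> \<Union>\<H>0 \<and> \<delta> * N \<le> real (card X))"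
          by (rule L(3)[unfolded has_containers_def, rule_format, OF fin H0 N q D qN cap0 c0])
        then have 1: "cert (\<lambda>I. (I \<subseteq> \<Omega> \<and> avoids \<H> I) \<and> X0 \<inter> I = {}) (L * (q * N)) (\<lambda>X. X \<subseteq> \<Union>\<H>0 \<and> \<delta> * N \<le> real (card X))"
          by (rule cert_weaken) (auto simp: avoids_def \<H>0_def)
        have "cert (\<lambda>I. (I \<subseteq> \<Omega> \<and> avoids \<H> I) \<and> X0 \<inter> I = {}) (L * (q * N) + real n * (L * (q * N))) (\<lambda>X. ?G (X0 \<union> X))"
        proof (rule cert_bind[OF 1])
          fix X assume X: "X \<subseteq> \<Union>\<H>0 \<and> \<delta> * N \<le> real (card X)"
          have sub: "X \<subseteq> \<Omega> - X0" using X H0 by (fastforce simp: \<H>0_def nsets_def)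
          have "\<Omega> - (X0 \<union> X) = (\<Omega> - X0) - X" by auto
          then have "real (card (\<Omega> - (X0 \<union> X))) = real (card (\<Omega> - X0)) - real (card X)"
            using sub fin by (simp add: card_Diff_subset finite_subset card_mono of_nat_diff)
          also have "\<dots> \<le> real n * \<delta> * N" using X Suc.prems by (simp add: algebra_simps)
          finally have "cert (\<lambda>I. (I \<subseteq> \<Omega> \<and> avoids \<H> I) \<and> (X0 \<union> X) \<inter> I = {}) (real n * (L * (q * N))) (\<lambda>Y. ?G ((X0 \<union> X) \<union> Y))"
            using sub Suc.prems by (intro Suc.IH) auto
          then show "cert (\<lambda>I. ((I \<subseteq> \<Omega> \<and> avoids \<H> I) \<and> X0 \<inter> I = {}) \<and> X \<inter> I = {}) (real n * (L * (q * N))) (\<lambda>Y. ?G (X0 \<union> (X \<union> Y)))"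
            by (rule cert_weaken) (auto simp: Un_assoc)
        qed
        then show ?thesis by (rule cert_weaken) (auto simp: algebra_simps)
      qed
    qed
    have "real (card \<Omega>) \<le> real n0 * \<delta> * N" using N mult_right_mono[OF n0, of N] Npos by linarith
    then have "cert (\<lambda>I. (I \<subseteq> \<Omega> \<and> avoids \<H> I) \<and> {} \<inter> I = {}) (real n0 * (L * (q * N))) (\<lambda>X. ?G ({} \<union> X))"
      using main[of "{}" n0] by simp
    then show "cert (\<lambda>I. I \<subseteq> \<Omega> \<and> avoids \<H> I) (real (Suc n0) * L * (q * N)) ?G"
      by (rule cert_weaken) (use L qN in \<open>auto simp: algebra_simps\<close>)
  qed
qed

section \<open>Triangles and tight cycles\<close>

text \<open>In the expansion of a triangle each edge omits exactly one of the three graph vertices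
  from the k + 1 vertices, so the copies are the triples of facets of (k+1)-sets.\<close>

definition is_tri :: "nat \<Rightarrow> 'a set set \<Rightarrow> bool" where
  "is_tri k T \<longleftrightarrow> (\<exists>Q a b c. finite Q \<and> card Q = Suc k \<and> a \<in> Q \<and> b \<in> Q \<and> c \<in> Q
     \<and> a \<noteq> b \<and> a \<noteq> c \<and> b \<noteq> c \<and> T = {Q - {a}, Q - {b}, Q - {c}})"

definition window :: "nat \<Rightarrow> nat \<Rightarrow> nat \<Rightarrow> nat set" where
  "window k t i = (\<lambda>j. (i + j) mod t) ` {..<k}"

definition cyc :: "nat \<Rightarrow> nat \<Rightarrow> (nat \<Rightarrow> 'a) \<Rightarrow> 'a set set" where
  "cyc k t v = (\<lambda>i. v ` window k t i) ` {..<t}"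

definition is_cyc :: "nat \<Rightarrow> nat \<Rightarrow> 'a set set \<Rightarrow> bool" where
  "is_cyc k t C \<longleftrightarrow> (\<exists>v. inj_on v {..<t} \<and> C = cyc k t v)"

text \<open>A triangle seen from one of its edges g: the other two edges replace a vertex of g by a
  common apex z. The counting of triangles at a given edge uses this form.\<close>

lemma is_triE:
  assumes "is_tri k T" "g \<in> T"
  obtains z a b where "finite g" "card g = k" "z \<notin> g" "a \<in> g" "b \<in> g" "a \<noteq> b"
    "T = {g, insert z g - {a}, insert z g - {b}}"
proof -
  have main: "\<exists>z a b. z \<notin> g \<and> a \<in> g \<and> b \<in> g \<and> a \<noteq> b \<and> T = {g, insert z g - {a}, insert z g - {b}} \<and> finite g \<and> card g = k"
    if Q: "finite Q" "card Q = Suc k" "z \<in> Q" "a \<in> Q" "b \<in> Q" "z \<noteq> a" "z \<noteq> b" "a \<noteq> b"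
      "g = Q - {z}" "T = {Q - {z}, Q - {a}, Q - {b}}" for Q z a b
  proof -
    have "insert z g = Q" using Q by auto
    moreover have "card g = k" "finite g" "z \<notin> g" "a \<in> g" "b \<in> g" using Q by auto
    ultimately show ?thesis using Q by (intro exI[of _ z] exI[of _ a] exI[of _ b]) simp
  qed
  obtain Q a b c where Q: "finite Q" "card Q = Suc k" "a \<in> Q" "b \<in> Q" "c \<in> Q"
     "a \<noteq> b" "a \<noteq> c" "b \<noteq> c" "T = {Q - {a}, Q - {b}, Q - {c}}"
    using assms(1) unfolding is_tri_def by blast
  have "g = Q - {a} \<or> g = Q - {b} \<or> g = Q - {c}" using assms(2) Q(9) by blast
  then have "\<exists>z a b. z \<notin> g \<and> a \<in> g \<and> b \<in> g \<and> a \<noteq> b \<and> T = {g, insert z g - {a}, insert z g - {b}} \<and> finite g \<and> card g = k"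
  proof (elim disjE)
    assume "g = Q - {a}" then show ?thesis using Q by (intro main[of Q a b c]) auto
  next
    assume "g = Q - {b}" then show ?thesis using Q by (intro main[of Q b a c]) auto
  next
    assume "g = Q - {c}" then show ?thesis using Q by (intro main[of Q c a b]) auto
  qed
  then show thesis using that by blast
qed

lemma is_tri_card:
  assumes "is_tri k T" shows "finite T" "card T = 3"
proof -
  obtain Q a b c where Q: "a \<in> Q" "b \<in> Q" "c \<in> Q" "a \<noteq> b" "a \<noteq> c" "b \<noteq> c"
    "T = {Q - {a}, Q - {b}, Q - {c}}" using assms unfolding is_tri_def by blast
  have "Q - {a} \<noteq> Q - {b}" "Q - {a} \<noteq> Q - {c}" "Q - {b} \<noteq> Q - {c}" using Q by auto
  then show "finite T" "card T = 3" using Q(7) by auto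
qed

text \<open>The other two edges of the triangle omit different vertices of g, so at least one of
  them still contains y. Choosing colours for the edges at y is therefore enough to deal with such
  triangles.\<close>

lemma is_tri_two_at_vertex:
  assumes "is_tri k T" "y \<in> g" "g \<in> T"
  shows "\<exists>g1\<in>T. \<exists>g2\<in>T. g1 \<noteq> g2 \<and> y \<in> g1 \<and> y \<in> g2 \<and> card (g1 \<inter> g2) = k - 1"
proof -
  obtain z a b where g: "finite g" "card g = k" "z \<notin> g" "a \<in> g" "b \<in> g" "a \<noteq> b"
    "T = {g, insert z g - {a}, insert z g - {b}}" by (rule is_triE[OF assms(1,3)])
  have *: "card (g \<inter> (insert z g - {x})) = k - 1" if "x \<in> g" for x
  proof -
    have "g \<inter> (insert z g - {x}) = g - {x}" using g(3) by auto
    then show ?thesis using that g by simp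
  qed
  have "\<exists>x\<in>{a, b}. x \<noteq> y" using g(6) by auto
  then obtain x where x: "x \<in> {a, b}" "x \<noteq> y" by blast
  then have "insert z g - {x} \<in> T" "x \<in> g" using g by auto
  moreover have "g \<noteq> insert z g - {x}" using \<open>x \<in> g\<close> by auto
  moreover have "y \<in> insert z g - {x}" using assms(2) x by auto
  ultimately show ?thesis using assms * by metis
qed

section \<open>Windows of a tight cycle\<close>

lemma mod_add_inj:
  assumes "x < y" "y < x + t" shows "(i + x) mod t \<noteq> (i + y) mod (t::nat)"
proof
  assume "(i + x) mod t = (i + y) mod t"
  then have "t dvd (i + y) - (i + x)" using assms by (metis add_le_cancel_left less_imp_le mod_eq_dvd_iff_nat)
  then have "t dvd y - x" by simp
  then show False using assms by (auto dest: dvd_imp_le)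
qed

lemma inj_on_shift: "inj_on (\<lambda>j. (i + j) mod t) {m..<m + t}" for t :: nat
proof (rule inj_onI)
  fix x y assume "x \<in> {m..<m + t}" "y \<in> {m..<m + t}" "(i + x) mod t = (i + y) mod t"
  then show "x = y" using mod_add_inj[of x y t i] mod_add_inj[of y x t i] by (cases x y rule: linorder_cases) auto
qed

lemma card_window: assumes "k \<le> t" shows "card (window k t i) = k"
proof -
  have "inj_on (\<lambda>j. (i + j) mod t) {..<k}"
    using inj_on_shift[of i t 0] assms by (auto intro: inj_on_subset)
  then show ?thesis by (simp add: window_def card_image)
qed

lemma window_subset: "0 < t \<Longrightarrow> window k t i \<subseteq> {..<t}"
  by (auto simp: window_def)

lemma finite_window [simp]: "finite (window k t i)"
  by (simp add: window_def)

lemma window_Suc: "window (Suc k) t i = insert ((i + k) mod t) (window k t i)"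
  by (auto simp: window_def lessThan_Suc)

text \<open>Induction on k: passing from windows of length k to length k + 1 adds the successors,
  and a nonempty set of residues closed under successor is everything. So part of a tight cycle
  spans at least as many vertices as a tight path with equally many edges, or all t of them.\<close>

lemma card_Union_window:
  assumes "I \<subseteq> {..<t}" "I \<noteq> {}" "k \<ge> 1"
  shows "min t (card I + k - 1) \<le> card (\<Union>i\<in>I. window k t i)"
  using assms(3)
proof (induction k rule: nat_induct_at_least)
  case base
  have "window 1 t i = {i}" if "i \<in> I" for i using that assms(1) by (auto simp: window_def)
  then have "(\<Union>i\<in>I. window 1 t i) = I" by auto
  then show ?case by simp
next
  case (Suc k)
  define U where "U = (\<Union>i\<in>I. window k t i)"
  define U' where "U' = (\<Union>i\<in>I. window (Suc k) t i)"
  have t: "t > 0" using assms by auto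
  have "finite I" using assms(1) by (rule finite_subset) simp
  then have fin: "finite U" "finite U'" by (auto simp: U_def U'_def)
  have sub: "U \<subseteq> U'" by (auto simp: U_def U'_def window_Suc)
  have Ut: "U \<subseteq> {..<t}" "U' \<subseteq> {..<t}" using window_subset[OF t] by (auto simp: U_def U'_def)
  have succ: "(u + 1) mod t \<in> U'" if u: "u \<in> U" for u
  proof -
    obtain i j where ij: "i \<in> I" "j < k" "u = (i + j) mod t" using u by (auto simp: U_def window_def)
    then have "(u + 1) mod t = (i + Suc j) mod t" by (simp add: mod_simps)
    then show ?thesis using ij unfolding U'_def window_def by blast
  qed
  show ?case
  proof (cases "U' = {..<t}")
    case True
    then show ?thesis by (simp add: U'_def[symmetric])
  next
    case False
    have "U \<noteq> U'"
    proof
      assume eq: "U = U'"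
      obtain i where i: "i \<in> I" using assms by blast
      then have i0: "i \<in> U" using Suc.hyps assms(1) unfolding U_def window_def
        by (intro UN_I[of i] image_eqI[of _ _ 0]) auto
      have "(i + m) mod t \<in> U" for m
      proof (induction m)
        case 0
        then show ?case using i0 assms(1) i by auto
      next
        case (Suc m)
        have "((i + m) mod t + 1) mod t = (i + Suc m) mod t" by (simp add: mod_simps)
        then show ?case using succ[OF Suc.IH] eq by simp
      qed
      then have "(i + (u + t - i)) mod t \<in> U" for u .
      moreover have "(i + (u + t - i)) mod t = u" if "u < t" for u
      proof -
        have "i + (u + t - i) = u + t" using i assms(1) by auto
        then show ?thesis using that by simp
      qed
      ultimately have "{..<t} \<subseteq> U" by (metis lessThan_iff subsetI)
      then show False using False eq Ut by auto
    qed
    then have "card U < card U'" using sub fin by (intro psubset_card_mono) auto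
    then show ?thesis using Suc.IH by (simp add: U_def U'_def)
  qed
qed

text \<open>Two cyclic intervals may overlap at either end; since \<open>2 * k \<le> t\<close> only
  one of the two overlaps can be nonempty, and it is shortened by the cyclic distance.\<close>

lemma card_window_Int:
  assumes "2 * k \<le> t" "d < t" "r \<le> d" "d + r \<le> t" "r \<le> k"
  shows "card (window k t i \<inter> window k t ((i + d) mod t)) \<le> k - r"
proof -
  let ?\<phi> = "\<lambda>j. (i + j) mod t"
  have t: "t > 0" using assms by linarith
  have "window k t i \<inter> window k t ((i + d) mod t) \<subseteq> ?\<phi> ` ({d..<k} \<union> {t..<d + k})"
  proof
    fix x assume x: "x \<in> window k t i \<inter> window k t ((i + d) mod t)"
    then obtain m m' where m: "m < k" "x = ?\<phi> m" "m' < k" "x = (i + d + m') mod t"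
      by (auto simp: window_def mod_simps)
    then have eq: "?\<phi> m = ?\<phi> (d + m')" by (simp add: add.assoc)
    have "d + m' = m \<or> d + m' \<ge> t"
    proof (rule ccontr)
      assume "\<not> (d + m' = m \<or> d + m' \<ge> t)"
      then have "d + m' < t" "d + m' \<noteq> m" by auto
      moreover have "m < t" using m assms by linarith
      ultimately show False using mod_add_inj[of m "d + m'" t i] mod_add_inj[of "d + m'" m t i] eq
        by (cases m "d + m'" rule: linorder_cases) auto
    qed
    then have "d + m' \<in> {d..<k} \<union> {t..<d + k}" using m by auto
    then show "x \<in> ?\<phi> ` ({d..<k} \<union> {t..<d + k})" using eq m by auto
  qed
  then have "card (window k t i \<inter> window k t ((i + d) mod t)) \<le> card ({d..<k} \<union> {t..<d + k})"
    by (meson card_image_le card_mono finite_Un finite_atLeastLessThan finite_imageI order_trans)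
  also have "\<dots> \<le> card {d..<k} + card {t..<d + k}" by (rule card_Un_le)
  also have "\<dots> \<le> k - r" using assms by simp
  finally show ?thesis .
qed

lemma inj_on_window:
  assumes "2 * k \<le> t" "1 \<le> k" shows "inj_on (window k t) {..<t}"
proof -
  have "window k t i \<noteq> window k t j" if "i < j" "j < t" for i j
  proof
    assume eq: "window k t i = window k t j"
    have "card (window k t i \<inter> window k t ((i + (j - i)) mod t)) \<le> k - 1"
      using that assms by (intro card_window_Int) auto
    moreover have "(i + (j - i)) mod t = j" using that by simp
    ultimately have "card (window k t i) \<le> k - 1" using eq by simp
    then show False using card_window[of k t i] assms by simp
  qed
  then show ?thesis by (intro inj_onI) (metis lessThan_iff linorder_cases)
qed

definition pair_close :: "nat \<Rightarrow> nat \<Rightarrow> nat \<Rightarrow> nat set \<Rightarrow> bool" where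
  "pair_close k t r S \<longleftrightarrow> S \<subseteq> {..<t} \<and> (\<forall>i\<in>S. \<forall>j\<in>S. k - r < card (window k t i \<inter> window k t j))"

lemma pair_close_shift:
  assumes "pair_close k t r S" "2 * k \<le> t" "r \<le> k" "i \<in> S" "j \<in> S" "i < j"
  shows "j - i < r \<or> t - r < j - i"
proof (rule ccontr)
  assume "\<not> (j - i < r \<or> t - r < j - i)"
  then have "card (window k t i \<inter> window k t ((i + (j - i)) mod t)) \<le> k - r"
    using assms by (intro card_window_Int) (auto simp: pair_close_def)
  moreover have "(i + (j - i)) mod t = j" using assms by (auto simp: pair_close_def)
  ultimately show False using assms unfolding pair_close_def by (metis not_le)
qed

text \<open>The indices are pairwise at cyclic distance below r. As \<open>3 * r \<le> t + 1\<close>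
  they cannot go all the way round, so they lie in an arc of r indices.\<close>

lemma card_pair_close:
  assumes "pair_close k t r S" "2 * k \<le> t" "r \<le> k" "3 * r \<le> t + 1" "1 \<le> r"
  shows "card S \<le> r"
proof (cases "S = {}")
  case False
  have fin: "finite S" using assms(1) finite_subset unfolding pair_close_def by blast
  define a where "a = Min S"
  have a: "a \<in> S" "\<And>j. j \<in> S \<Longrightarrow> a \<le> j" using fin False by (auto simp: a_def)
  have St: "\<And>j. j \<in> S \<Longrightarrow> j < t" using assms(1) by (auto simp: pair_close_def)
  note sh = pair_close_shift[OF assms(1-3)]
  \<comment> \<open>The circle is cut at the smallest index a: A is the part of the arc that starts
    at a, and B is the part that precedes a across the cut.\<close>
  define A where "A = {j\<in>S. j - a < r}"
  define B where "B = {j\<in>S. t - r < j - a}"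
  have S: "S = A \<union> B"
  proof -
    have "j \<in> A \<union> B" if "j \<in> S" for j
      using sh[OF a(1) that] a(2)[OF that] that assms(5) by (cases "a = j") (auto simp: A_def B_def)
    then show ?thesis by (auto simp: A_def B_def)
  qed
  show ?thesis
  proof (cases "B = {}")
    case True
    then have "S = A" using S by simp
    then have "j - a < r" if "j \<in> S" for j using that unfolding A_def by blast
    then have "S \<subseteq> {a..<a + r}" using a(2) by fastforce
    then have "card S \<le> card {a..<a + r}" by (intro card_mono) auto
    then show ?thesis by simp
  next
    case False
    define b where "b = Min B"
    have finB: "finite B" using fin by (auto simp: B_def)
    have b: "b \<in> B" "\<And>j. j \<in> B \<Longrightarrow> b \<le> j" using finB False by (auto simp: b_def)
    have bS: "b \<in> S" and bt: "b < t" using b St by (auto simp: B_def)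
    have A: "A \<subseteq> {a..<r + b - t}"
    proof
      fix j assume j: "j \<in> A"
      then have jS: "j \<in> S" by (auto simp: A_def)
      have "j < b" using j b(1) assms(4) by (auto simp: A_def B_def)
      then have "b - j < r \<or> t - r < b - j" using sh[OF jS bS] by simp
      moreover have "\<not> b - j < r"
        using j b(1) assms(4) by (auto simp: A_def B_def)
      ultimately show "j \<in> {a..<r + b - t}" using a(2)[OF jS] by auto
    qed
    have B: "B \<subseteq> {b..<t}" using b(2) St by (auto simp: B_def)
    have "card S \<le> card A + card B" unfolding S by (rule card_Un_le)
    also have "\<dots> \<le> card {a..<r + b - t} + card {b..<t}" using A B by (intro add_mono card_mono) auto
    also have "\<dots> \<le> r"
    proof -
      have "a \<in> A" using a(1) assms(5) by (simp add: A_def)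
      then have "a < r + b - t" using A by auto
      then show ?thesis using bt by simp
    qed
    finally show ?thesis .
  qed
qed simp

lemma card_cyc:
  assumes "inj_on v {..<t}" "2 * k \<le> t" "1 \<le> k" shows "card (cyc k t v) = t"
proof -
  have "inj_on (\<lambda>i. v ` window k t i) {..<t}"
  proof (rule inj_onI)
    fix i j assume ij: "i \<in> {..<t}" "j \<in> {..<t}" "v ` window k t i = v ` window k t j"
    then have "window k t i = window k t j"
      using inj_on_image_eq_iff[OF assms(1)] window_subset[of t k] by (metis lessThan_iff not_less_zero gr0I)
    then show "i = j" using inj_on_window[OF assms(2,3)] ij by (auto dest: inj_onD)
  qed
  then show ?thesis unfolding cyc_def by (simp add: card_image)
qed

lemma card_image_window_Int:
  assumes "inj_on v {..<t}" "t > 0"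
  shows "card (v ` window k t i \<inter> v ` window k t j) = card (window k t i \<inter> window k t j)"
proof -
  have "v ` window k t i \<inter> v ` window k t j = v ` (window k t i \<inter> window k t j)"
    using inj_on_image_Int[OF assms(1)] window_subset[OF assms(2)] by metis
  moreover have "inj_on v (window k t i \<inter> window k t j)" using assms window_subset[OF assms(2)] by (meson inf.coboundedI1 inj_on_subset)
  ultimately show ?thesis by (simp add: card_image)
qed

lemma card_image_window:
  assumes "inj_on v {..<t}" "k \<le> t" "t > 0" shows "card (v ` window k t i) = k"
  using card_image_window_Int[OF assms(1,3), of k i i] card_window[OF assms(2)] by simp

text \<open>Inclusion and exclusion inside g; the second form gains one because A and B do not cover
  g.\<close>

lemma card_Int_ge:
  assumes "finite g" "k - 1 \<le> card (g \<inter> A)" "k - 1 \<le> card (g \<inter> B)" "card g = k" "finite A" "k \<ge> 1"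
  shows "k - 2 \<le> card (A \<inter> B)" and "\<not> g \<subseteq> A \<union> B \<Longrightarrow> k - 1 \<le> card (A \<inter> B)"
proof -
  have fin: "finite (g \<inter> A)" "finite (g \<inter> B)" using assms by auto
  have un: "card (g \<inter> A) + card (g \<inter> B) = card (g \<inter> A \<union> g \<inter> B) + card (g \<inter> A \<inter> (g \<inter> B))"
    by (rule card_Un_Int[OF fin])
  have sub: "g \<inter> A \<union> g \<inter> B \<subseteq> g" by auto
  have 1: "card (g \<inter> A \<union> g \<inter> B) \<le> k" using card_mono[OF assms(1) sub] assms(4) by simp
  have 2: "card (g \<inter> A \<inter> (g \<inter> B)) \<le> card (A \<inter> B)" using assms by (intro card_mono) auto
  show "k - 2 \<le> card (A \<inter> B)" using un 1 2 assms by linarith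
  assume "\<not> g \<subseteq> A \<union> B"
  then have "g \<inter> A \<union> g \<inter> B \<subset> g" by auto
  then have "card (g \<inter> A \<union> g \<inter> B) < k" using psubset_card_mono[OF assms(1)] assms(4) by metis
  then show "k - 1 \<le> card (A \<inter> B)" using un 2 assms by linarith
qed

text \<open>Two cycle edges that both share k - 1 vertices with g share at least k - 2 with each
  other, and k - 1 if g leaves the cycle. Hence their indices lie in an arc of length 3 or 2. This
  limits how many triangles on a cycle can use the same additional edge.\<close>

lemma card_served:
  assumes v: "inj_on v {..<t}" and kt: "2 * k \<le> t" "8 \<le> t" "3 \<le> k" and g: "finite g" "card g = k"
    and S: "S = {i. i < t \<and> k - 1 \<le> card (g \<inter> v ` window k t i)}"
  shows "card S \<le> 3" and "\<not> g \<subseteq> v ` {..<t} \<Longrightarrow> card S \<le> 2"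
proof -
  have t: "t > 0" using kt by auto
  have "k - 3 < card (window k t i \<inter> window k t j)" if "i \<in> S" "j \<in> S" for i j
    using card_Int_ge(1)[OF g(1) _ _ g(2), of "v ` window k t i" "v ` window k t j"] that kt
    unfolding S card_image_window_Int[OF v t] by simp
  then have "pair_close k t 3 S" by (auto simp: pair_close_def S)
  then show "card S \<le> 3" using kt by (intro card_pair_close[of k t 3]) auto
  assume out: "\<not> g \<subseteq> v ` {..<t}"
  have "k - 2 < card (window k t i \<inter> window k t j)" if "i \<in> S" "j \<in> S" for i j
  proof -
    have "v ` window k t i \<union> v ` window k t j \<subseteq> v ` {..<t}" using window_subset[OF t] by blast
    then have "\<not> g \<subseteq> v ` window k t i \<union> v ` window k t j" using out by blast
    then show ?thesis
      using card_Int_ge(2)[OF g(1) _ _ g(2), of "v ` window k t i" "v ` window k t j"] that kt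
      unfolding S card_image_window_Int[OF v t] by simp
  qed
  then have "pair_close k t 2 S" by (auto simp: pair_close_def S)
  then show "card S \<le> 2" using kt by (intro card_pair_close[of k t 2]) auto
qed

text \<open>The k edges of the cycle at a vertex are consecutive windows that do not reach round the
  cycle, because \<open>2 * k \<le> t\<close>. In the metric \<open>k - card (e \<inter> e')\<close>
  they form an isometric path, which is all that the local colouring has to destroy.\<close>

lemma cyc_edges_at_vertex:
  assumes v: "inj_on v {..<t}" and kt: "2 * k \<le> t" "1 \<le> k" and e: "e \<in> cyc k t v" "y \<in> e"
  obtains F where "\<And>m. m < k \<Longrightarrow> F m \<in> cyc k t v" "\<And>m. m < k \<Longrightarrow> y \<in> F m"
    "\<And>m m'. m \<le> m' \<Longrightarrow> m' < k \<Longrightarrow> card (F m \<inter> F m') = k - (m' - m)"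
proof -
  have t: "t > 0" using kt by auto
  obtain s where s: "s < t" "y = v s" using e window_subset[OF t] unfolding cyc_def by blast
  \<comment> \<open>The shift puts s at position k - 1, the one position common to all intervals
    \<open>{m..<m + k}\<close> with m < k.\<close>
  define \<phi> where "\<phi> = (\<lambda>m. (s + (t + 1 - k) + m) mod t)"
  define F where "F = (\<lambda>m. v ` \<phi> ` {m..<m + k})"
  have inj: "inj_on \<phi> {..<t}" unfolding \<phi>_def using inj_on_shift[of "s + (t + 1 - k)" t 0] by (simp add: atLeast0LessThan)
  have \<phi>t: "\<phi> m < t" for m using t by (simp add: \<phi>_def)
  have inj2: "inj_on (v \<circ> \<phi>) {..<t}" by (rule comp_inj_on[OF inj]) (use v \<phi>t in \<open>auto intro: inj_on_subset\<close>)
  have winF: "\<phi> ` {m..<m + k} = window k t (\<phi> m)" for m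
  proof -
    have "x \<in> (\<lambda>j. m + j) ` {..<k}" if "x \<in> {m..<m + k}" for x
      using that by (intro image_eqI[of _ _ "x - m"]) auto
    then have "{m..<m + k} = (\<lambda>j. m + j) ` {..<k}" by auto
    then show ?thesis unfolding window_def \<phi>_def by (simp add: image_image mod_simps add.assoc)
  qed
  show thesis
  proof (rule that[of F])
    fix m assume m: "m < k"
    show "F m \<in> cyc k t v" unfolding F_def winF cyc_def using \<phi>t by auto
    have "\<phi> (k - 1) = s" using kt s by (simp add: \<phi>_def)
    then show "y \<in> F m" unfolding F_def s(2) using m by (intro imageI image_eqI[of s \<phi> "k - 1"]) auto
  next
    fix m m' assume m: "m \<le> m'" "m' < k"
    have sub: "{m..<m + k} \<subseteq> {..<t}" "{m'..<m' + k} \<subseteq> {..<t}" using m kt by auto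
    have "F m \<inter> F m' = (v \<circ> \<phi>) ` {m..<m + k} \<inter> (v \<circ> \<phi>) ` {m'..<m' + k}" by (simp add: F_def image_comp)
    also have "\<dots> = (v \<circ> \<phi>) ` ({m..<m + k} \<inter> {m'..<m' + k})" by (rule inj_on_image_Int[OF inj2 sub, symmetric])
    also have "{m..<m + k} \<inter> {m'..<m' + k} = {m'..<m + k}" using m by auto
    finally have "F m \<inter> F m' = (v \<circ> \<phi>) ` {m'..<m + k}" .
    moreover have "inj_on (v \<circ> \<phi>) {m'..<m + k}" by (rule inj_on_subset[OF inj2]) (use m kt in auto)
    ultimately have "card (F m \<inter> F m') = card {m'..<m + k}" by (metis card_image)
    then show "card (F m \<inter> F m') = k - (m' - m)" using m by simp
  qed
qed

section \<open>Copies of the two target hypergraphs\<close>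

lemma edges_K3: "edges (Kn_graph 3) = (\<lambda>i. {..<3} - {i}) ` {..<3}"
proof -
  have "[{..<3::nat}]\<^bsup>2\<^esup> = {{0,1},{0,2},{1,2}}"
    unfolding nsets_def
  proof (intro set_eqI iffI)
    fix N assume N: "N \<in> {N. N \<subseteq> {..<3::nat} \<and> finite N \<and> card N = 2}"
    then obtain x y where xy: "N = {x, y}" "x \<noteq> y" by (auto simp: card_2_iff)
    then have "x \<in> {0,1,2}" "y \<in> {0,1,2}" using N by auto
    then show "N \<in> {{0,1},{0,2},{1,2}}" using xy by (auto simp: insert_commute)
  qed auto
  moreover have "(\<lambda>i. {..<3} - {i}) ` {..<3} = {{0,1},{0,2},{1,2::nat}}"
  proof -
    have "{..<3} = {0,1,2::nat}" by auto
    then show ?thesis by (auto simp: insert_Diff_if)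
  qed
  ultimately show ?thesis by (simp add: Kn_graph_def)
qed

lemma verts_K3_plus: "verts (graph_plus k (Kn_graph 3)) = {..<3} <+> {..<k - 2}"
  by (simp add: graph_plus_def Kn_graph_def)

lemma edges_K3_plus:
  "edges (graph_plus k (Kn_graph 3)) = (\<lambda>i. ({..<3} <+> {..<k - 2}) - {Inl i}) ` {..<3}"
proof -
  have "({..<3} - {i}) <+> {..<k - 2} = ({..<3} <+> {..<k - 2}) - {Inl i}" for i :: nat by auto
  then show ?thesis by (simp add: graph_plus_def edges_K3 image_image)
qed

lemma K3_plus_edges_image:
  assumes "inj_on f ({..<3} <+> {..<k - 2})"
  shows "(\<lambda>e. f ` e) ` edges (graph_plus k (Kn_graph 3))
       = (\<lambda>i. f ` ({..<3} <+> {..<k - 2}) - {f (Inl i)}) ` {..<3}"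
proof -
  have "f ` (({..<3} <+> {..<k - 2}) - {Inl i}) = f ` ({..<3} <+> {..<k - 2}) - {f (Inl i)}" if "i < 3" for i
    using inj_on_image_set_diff[OF assms, of "{..<3} <+> {..<k - 2}" "{Inl i}"] that by auto
  then show ?thesis unfolding edges_K3_plus image_image by (intro image_cong) auto
qed

lemma is_tri_of_embedding:
  assumes "inj_on f (verts (graph_plus k (Kn_graph 3)))" "k \<ge> 2"
  shows "is_tri k ((\<lambda>e. f ` e) ` edges (graph_plus k (Kn_graph 3)))"
proof -
  let ?W = "{..<3::nat} <+> {..<k - 2}"
  have inj: "inj_on f ?W" using assms(1) by (simp add: verts_K3_plus)
  have c: "card (f ` ?W) = Suc k" using assms(2) inj by (simp add: card_image card_Plus)
  have d: "f (Inl i) \<noteq> f (Inl j)" if "i \<noteq> j" "i < 3" "j < 3" for i j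
    using inj that by (auto dest: inj_onD)
  have 3: "{..<3::nat} = {0,1,2}" by auto
  show ?thesis unfolding K3_plus_edges_image[OF inj] is_tri_def
    using c d[of 0 1] d[of 0 2] d[of 1 2]
    by (intro exI[of _ "f ` ?W"] exI[of _ "f (Inl 0)"] exI[of _ "f (Inl 1)"] exI[of _ "f (Inl 2)"])
       (auto simp: 3)
qed

lemma embedding_of_is_tri:
  assumes "is_tri k T" "T \<subseteq> E" "\<Union>T \<subseteq> V" "k \<ge> 2"
  obtains f where "embedding f (graph_plus k (Kn_graph 3)) (V, E)"
    "(\<lambda>e. f ` e) ` edges (graph_plus k (Kn_graph 3)) = T" "f ` verts (graph_plus k (Kn_graph 3)) \<subseteq> \<Union>T"
proof -
  obtain Q a b c where Q: "finite Q" "card Q = Suc k" "a \<in> Q" "b \<in> Q" "c \<in> Q"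
     "a \<noteq> b" "a \<noteq> c" "b \<noteq> c" "T = {Q - {a}, Q - {b}, Q - {c}}"
    using assms(1) unfolding is_tri_def by blast
  have "card (Q - {a, b, c}) = k - 2" using Q by (simp add: card_Diff_subset)
  then obtain h where h: "bij_betw h {..<k - 2} (Q - {a, b, c})"
    using Q(1) ex_bij_betw_nat_finite[of "Q - {a,b,c}"] by (auto simp: atLeast0LessThan)
  define f where "f = case_sum (\<lambda>i::nat. if i = 0 then a else if i = 1 then b else c) h"
  let ?W = "{..<3::nat} <+> {..<k - 2}"
  have 3: "{..<3::nat} = {0,1,2}" by auto
  have hi: "h j \<in> Q" "h j \<noteq> a" "h j \<noteq> b" "h j \<noteq> c" if "j < k - 2" for j
    using bij_betwE[OF h] that by auto
  have inj: "inj_on f ?W"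
    unfolding inj_on_def
  proof (intro ballI impI)
    fix x y assume x: "x \<in> ?W" and y: "y \<in> ?W" and eq: "f x = f y"
    have hh: "i = j" if "i < k - 2" "j < k - 2" "h i = h j" for i j
      using h that by (auto simp: bij_betw_def dest: inj_onD)
    show "x = y" using x y eq hi Q(6-8) hh unfolding 3 f_def
      by (auto split: if_splits) (metis hi lessThan_iff)+
  qed
  have "f ` ?W = f ` Inl ` {..<3} \<union> f ` Inr ` {..<k - 2}" by (auto simp: Plus_def)
  also have "f ` Inl ` {..<3} = {a, b, c}" unfolding 3 f_def by auto
  also have "f ` Inr ` {..<k - 2} = Q - {a, b, c}" using h by (auto simp: f_def bij_betw_def image_image)
  finally have im: "f ` ?W = Q" using Q by auto
  have T: "(\<lambda>e. f ` e) ` edges (graph_plus k (Kn_graph 3)) = T"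
    unfolding K3_plus_edges_image[OF inj] im Q(9) by (auto simp: 3 f_def)
  have UT: "\<Union>T = Q" using Q by auto
  show thesis
  proof (rule that[of f])
    show "embedding f (graph_plus k (Kn_graph 3)) (V, E)"
      unfolding embedding_def verts_K3_plus using inj im UT assms(2,3) T by auto
    show "f ` verts (graph_plus k (Kn_graph 3)) \<subseteq> \<Union>T" unfolding verts_K3_plus im UT by simp
  qed (rule T)
qed

lemma edges_tight_cycle_image: "(\<lambda>e. f ` e) ` edges (tight_cycle k t) = cyc k t f"
  by (simp add: tight_cycle_def cyc_def window_def image_image)

lemma embedding_cyc:
  assumes "inj_on v {..<t}" "cyc k t v \<subseteq> E" "v ` {..<t} \<subseteq> V"
  shows "embedding v (tight_cycle k t) (V, E)"
  using assms edges_tight_cycle_image[of v k t] unfolding embedding_def by (auto simp: tight_cycle_def)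

lemma Union_cyc:
  assumes "1 \<le> k" shows "\<Union>(cyc k t v) = v ` {..<t}"
proof -
  have "(\<Union>i<t. window k t i) = {..<t}"
  proof
    show "(\<Union>i<t. window k t i) \<subseteq> {..<t}" by (auto simp: window_def)
    show "{..<t} \<subseteq> (\<Union>i<t. window k t i)"
    proof
      fix i assume "i \<in> {..<t}"
      then have "i < t" by simp
      then have "i \<in> window k t i" using assms unfolding window_def by (intro image_eqI[of _ _ 0]) auto
      then show "i \<in> (\<Union>i<t. window k t i)" using \<open>i < t\<close> by blast
    qed
  qed
  then show ?thesis unfolding cyc_def by (metis image_UN image_image)
qed

text \<open>B is the class without cycle and G - B the class without triangle. Asking for this split
  is stronger than avoiding a monochromatic disjoint union, but it passes to subsets and can be
  repaired locally at a vertex.\<close>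

definition colourable :: "nat \<Rightarrow> nat \<Rightarrow> 'a set set \<Rightarrow> bool" where
  "colourable k t G \<longleftrightarrow> (\<exists>B\<subseteq>G. (\<forall>T. is_tri k T \<and> T \<subseteq> G \<longrightarrow> T \<inter> B \<noteq> {}) \<and> (\<forall>C. is_cyc k t C \<longrightarrow> \<not> C \<subseteq> B))"

text \<open>In a monochromatic copy the triangle meets B, so the common colour is that of B, and
  then the tight cycle lies in B.\<close>

lemma colourable_imp_not_arrow:
  assumes "colourable k t E" "k \<ge> 2"
  shows "\<not> ramsey_arrow (V, E) (disjoint_union (graph_plus k (Kn_graph 3)) (tight_cycle k t))"
proof
  let ?F = "disjoint_union (graph_plus k (Kn_graph 3)) (tight_cycle k t)"
  assume arrow: "ramsey_arrow (V, E) ?F"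
  obtain B where B: "B \<subseteq> E" "\<And>T. is_tri k T \<Longrightarrow> T \<subseteq> E \<Longrightarrow> T \<inter> B \<noteq> {}" "\<And>C. is_cyc k t C \<Longrightarrow> \<not> C \<subseteq> B"
    using assms(1) unfolding colourable_def by blast
  obtain f c where f: "embedding f ?F (V, E)" and c: "\<And>e. e \<in> edges ?F \<Longrightarrow> (f ` e \<in> B) = c"
    using arrow[unfolded ramsey_arrow_def, rule_format, of "\<lambda>e. e \<in> B"] by blast
  have inj: "inj_on f (verts (graph_plus k (Kn_graph 3)) <+> verts (tight_cycle k t))"
    using f by (simp add: embedding_def disjoint_union_def)
  have inj1: "inj_on (f \<circ> Inl) (verts (graph_plus k (Kn_graph 3)))"
    using inj by (auto simp: inj_on_def)
  have inj2: "inj_on (f \<circ> Inr) {..<t}" using inj by (auto simp: inj_on_def tight_cycle_def)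
  define T where "T = (\<lambda>e. (f \<circ> Inl) ` e) ` edges (graph_plus k (Kn_graph 3))"
  have T: "is_tri k T" unfolding T_def using inj1 assms(2) by (rule is_tri_of_embedding)
  have TE: "T \<subseteq> E" and Tc: "\<And>g. g \<in> T \<Longrightarrow> (g \<in> B) = c"
  proof -
    have in_F: "Inl ` e \<in> edges ?F" if "e \<in> edges (graph_plus k (Kn_graph 3))" for e
      using that by (simp add: disjoint_union_def)
    have "f ` Inl ` e \<in> E" if "e \<in> edges (graph_plus k (Kn_graph 3))" for e
      using f in_F[OF that] by (simp add: embedding_def)
    then show "T \<subseteq> E" unfolding T_def by (auto simp: image_comp)
    show "(g \<in> B) = c" if "g \<in> T" for g
      using that c[OF in_F] unfolding T_def by (auto simp: image_comp)
  qed
  have Cc: "\<And>g. g \<in> cyc k t (f \<circ> Inr) \<Longrightarrow> (g \<in> B) = c"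
  proof -
    fix g assume "g \<in> cyc k t (f \<circ> Inr)"
    then obtain e where e: "e \<in> edges (tight_cycle k t)" "g = f ` Inr ` e"
      unfolding edges_tight_cycle_image[symmetric] by (auto simp: image_comp)
    have "Inr ` e \<in> edges ?F" using e by (simp add: disjoint_union_def)
    then show "(g \<in> B) = c" using c e by simp
  qed
  have "c" using B(2)[OF T TE] Tc by blast
  then have "cyc k t (f \<circ> Inr) \<subseteq> B" using Cc by blast
  then show False using B(3) inj2 unfolding is_cyc_def by blast
qed

lemma embedding_disjoint_union:
  assumes f: "embedding f F (V, E)" and g: "embedding g G (V, E)"
    and disj: "f ` verts F \<inter> g ` verts G = {}"
  shows "embedding (case_sum f g) (disjoint_union F G) (V, E)"
proof -
  have "inj_on (case_sum f g) (verts F <+> verts G)"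
    using f g disj unfolding inj_on_def embedding_def
    by (auto split: sum.splits)
  then show ?thesis using f g unfolding embedding_def disjoint_union_def
    by (auto simp: image_image)
qed

section \<open>Colouring the edges at a vertex of small degree\<close>

definition iso_path :: "('b \<Rightarrow> 'b \<Rightarrow> nat) \<Rightarrow> nat \<Rightarrow> 'b set \<Rightarrow> (nat \<Rightarrow> 'b) \<Rightarrow> bool" where
  "iso_path d k Z P \<longleftrightarrow> (\<forall>i<k. P i \<in> Z) \<and> (\<forall>i j. i \<le> j \<longrightarrow> j < k \<longrightarrow> d (P i) (P j) = j - i)"

text \<open>R is the part that is kept out of the class without cycles. Having no two points at
  distance 1, it does not contain both of two triangle edges at the vertex; and L - R contains no
  image of the k cycle edges at that vertex.\<close>

definition hits_paths :: "('b \<Rightarrow> 'b \<Rightarrow> nat) \<Rightarrow> nat \<Rightarrow> 'b set \<Rightarrow> 'b set \<Rightarrow> bool" where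
  "hits_paths d k L R \<longleftrightarrow> R \<subseteq> L \<and> (\<forall>a\<in>R. \<forall>b\<in>R. d a b \<noteq> 1) \<and> (\<forall>P. \<not> iso_path d k (L - R) P)"

text \<open>The 60 orderings of four out of five points up to reversal, written out so that a
  statement about geodesics becomes purely propositional.\<close>

lemma four_of_five:
  assumes "u0 \<in> {c0,c1,c2,c3,c4}" "u1 \<in> {c0,c1,c2,c3,c4}" "u2 \<in> {c0,c1,c2,c3,c4}" "u3 \<in> {c0,c1,c2,c3,c4}"
    and I: "I u0 u1 u2 u3" and rev: "I u3 u2 u1 u0" and ne: "distinct [u0, u1, u2, u3]"
  shows "I c0 c1 c2 c3 \<or> I c0 c1 c2 c4 \<or> I c0 c1 c3 c2 \<or> I c0 c1 c3 c4 \<or> I c0 c1 c4 c2 \<or> I c0 c1 c4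
      c3 \<or> I c0 c2 c1 c3 \<or> I c0 c2 c1 c4 \<or> I c0 c2 c3 c1 \<or> I c0 c2 c3 c4 \<or> I c0 c2 c4 c1 \<or> I
      c0 c2 c4 c3 \<or> I c0 c3 c1 c2 \<or> I c0 c3 c1 c4 \<or> I c0 c3 c2 c1 \<or> I c0 c3 c2 c4 \<or> I c0 c3 c4
      c1 \<or> I c0 c3 c4 c2 \<or> I c0 c4 c1 c2 \<or> I c0 c4 c1 c3 \<or> I c0 c4 c2 c1 \<or> I c0 c4 c2 c3 \<or> I
      c0 c4 c3 c1 \<or> I c0 c4 c3 c2 \<or> I c1 c0 c2 c3 \<or> I c1 c0 c2 c4 \<or> I c1 c0 c3 c2 \<or> I c1 c0 c3
      c4 \<or> I c1 c0 c4 c2 \<or> I c1 c0 c4 c3 \<or> I c1 c2 c0 c3 \<or> I c1 c2 c0 c4 \<or> I c1 c2 c3 c4 \<or> I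
      c1 c2 c4 c3 \<or> I c1 c3 c0 c2 \<or> I c1 c3 c0 c4 \<or> I c1 c3 c2 c4 \<or> I c1 c3 c4 c2 \<or> I c1 c4 c0
      c2 \<or> I c1 c4 c0 c3 \<or> I c1 c4 c2 c3 \<or> I c1 c4 c3 c2 \<or> I c2 c0 c1 c3 \<or> I c2 c0 c1 c4 \<or> I
      c2 c0 c3 c4 \<or> I c2 c0 c4 c3 \<or> I c2 c1 c0 c3 \<or> I c2 c1 c0 c4 \<or> I c2 c1 c3 c4 \<or> I c2 c1 c4
      c3 \<or> I c2 c3 c0 c4 \<or> I c2 c3 c1 c4 \<or> I c2 c4 c0 c3 \<or> I c2 c4 c1 c3 \<or> I c3 c0 c1 c4 \<or> I
      c3 c0 c2 c4 \<or> I c3 c1 c0 c4 \<or> I c3 c1 c2 c4 \<or> I c3 c2 c0 c4 \<or> I c3 c2 c1 c4"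
proof -
  have ne: "u0 \<noteq> u1" "u0 \<noteq> u2" "u0 \<noteq> u3" "u1 \<noteq> u2" "u1 \<noteq> u3" "u2 \<noteq> u3" using ne by auto
  show ?thesis
    using assms(1-4) I rev ne by (elim insertE emptyE; hypsubst; simp)
qed

text \<open>For \<open>k = 4\<close> the edges at the vertex form a graph on at most seven vertices, and one of nine
  candidate sets \<open>R\<close> always works.\<close>

lemma seven_vertices:
  fixes A :: "'b \<Rightarrow> 'b \<Rightarrow> bool"
  assumes sym: "\<And>u v. A u v = A v u" and irr: "\<And>u. \<not> A u u"
    and I: "\<And>u0 u1 u2 u3. I u0 u1 u2 u3 \<longleftrightarrow> A u0 u1 \<and> A u1 u2 \<and> A u2 u3 \<and> \<not> A u0 u2 \<and> \<not> A u1 u3 \<and> \<not> A u0 u3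
      \<and> (\<forall>w\<in>{p0,p1,p2,p3,x,y,z}. \<not> (A u0 w \<and> A w u3))"
    and P: "I p0 p1 p2 p3"
    and no: "\<And>r s. r \<in> {p0,p1,p2,p3,x,y,z} \<Longrightarrow> s \<in> {p0,p1,p2,p3,x,y,z} \<Longrightarrow> \<not> A r s \<Longrightarrow>
      \<exists>u0 u1 u2 u3. {u0,u1,u2,u3} \<subseteq> {p0,p1,p2,p3,x,y,z} - {r, s} \<and> distinct [u0,u1,u2,u3] \<and> I u0 u1 u2 u3"
  shows False
proof -
  have rev: "I u3 u2 u1 u0" if "I u0 u1 u2 u3" for u0 u1 u2 u3
    using that sym unfolding I by blast
  \<comment> \<open>If r and s are not adjacent, {r, s} is a candidate for R; its failure leaves a
    geodesic on the five remaining points.\<close>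
  have five: "A r s \<or> I c0 c1 c2 c3 \<or> I c0 c1 c2 c4 \<or> I c0 c1 c3 c2 \<or> I c0 c1 c3 c4 \<or> I c0 c1 c4 c2 \<or> I c0 c1 c4
      c3 \<or> I c0 c2 c1 c3 \<or> I c0 c2 c1 c4 \<or> I c0 c2 c3 c1 \<or> I c0 c2 c3 c4 \<or> I c0 c2 c4 c1 \<or> I
      c0 c2 c4 c3 \<or> I c0 c3 c1 c2 \<or> I c0 c3 c1 c4 \<or> I c0 c3 c2 c1 \<or> I c0 c3 c2 c4 \<or> I c0 c3 c4
      c1 \<or> I c0 c3 c4 c2 \<or> I c0 c4 c1 c2 \<or> I c0 c4 c1 c3 \<or> I c0 c4 c2 c1 \<or> I c0 c4 c2 c3 \<or> I
      c0 c4 c3 c1 \<or> I c0 c4 c3 c2 \<or> I c1 c0 c2 c3 \<or> I c1 c0 c2 c4 \<or> I c1 c0 c3 c2 \<or> I c1 c0 c3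
      c4 \<or> I c1 c0 c4 c2 \<or> I c1 c0 c4 c3 \<or> I c1 c2 c0 c3 \<or> I c1 c2 c0 c4 \<or> I c1 c2 c3 c4 \<or> I
      c1 c2 c4 c3 \<or> I c1 c3 c0 c2 \<or> I c1 c3 c0 c4 \<or> I c1 c3 c2 c4 \<or> I c1 c3 c4 c2 \<or> I c1 c4 c0
      c2 \<or> I c1 c4 c0 c3 \<or> I c1 c4 c2 c3 \<or> I c1 c4 c3 c2 \<or> I c2 c0 c1 c3 \<or> I c2 c0 c1 c4 \<or> I
      c2 c0 c3 c4 \<or> I c2 c0 c4 c3 \<or> I c2 c1 c0 c3 \<or> I c2 c1 c0 c4 \<or> I c2 c1 c3 c4 \<or> I c2 c1 c4
      c3 \<or> I c2 c3 c0 c4 \<or> I c2 c3 c1 c4 \<or> I c2 c4 c0 c3 \<or> I c2 c4 c1 c3 \<or> I c3 c0 c1 c4 \<or> I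
      c3 c0 c2 c4 \<or> I c3 c1 c0 c4 \<or> I c3 c1 c2 c4 \<or> I c3 c2 c0 c4 \<or> I c3 c2 c1 c4"
    if rs: "r \<in> {p0,p1,p2,p3,x,y,z}" "s \<in> {p0,p1,p2,p3,x,y,z}"
    and sub: "{p0,p1,p2,p3,x,y,z} \<subseteq> {r, s, c0, c1, c2, c3, c4}" for r s c0 c1 c2 c3 c4
  proof (cases "A r s")
    case False
    obtain u0 u1 u2 u3 where u: "{u0,u1,u2,u3} \<subseteq> {p0,p1,p2,p3,x,y,z} - {r, s}" "distinct [u0,u1,u2,u3]" "I u0 u1 u2 u3"
      using no[OF rs False] by blast
    then have "u0 \<in> {c0,c1,c2,c3,c4}" "u1 \<in> {c0,c1,c2,c3,c4}" "u2 \<in> {c0,c1,c2,c3,c4}" "u3 \<in> {c0,c1,c2,c3,c4}"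
      using sub by blast+
    then have "I c0 c1 c2 c3 \<or> I c0 c1 c2 c4 \<or> I c0 c1 c3 c2 \<or> I c0 c1 c3 c4 \<or> I c0 c1 c4 c2 \<or> I c0 c1 c4
      c3 \<or> I c0 c2 c1 c3 \<or> I c0 c2 c1 c4 \<or> I c0 c2 c3 c1 \<or> I c0 c2 c3 c4 \<or> I c0 c2 c4 c1 \<or> I
      c0 c2 c4 c3 \<or> I c0 c3 c1 c2 \<or> I c0 c3 c1 c4 \<or> I c0 c3 c2 c1 \<or> I c0 c3 c2 c4 \<or> I c0 c3 c4
      c1 \<or> I c0 c3 c4 c2 \<or> I c0 c4 c1 c2 \<or> I c0 c4 c1 c3 \<or> I c0 c4 c2 c1 \<or> I c0 c4 c2 c3 \<or> I
      c0 c4 c3 c1 \<or> I c0 c4 c3 c2 \<or> I c1 c0 c2 c3 \<or> I c1 c0 c2 c4 \<or> I c1 c0 c3 c2 \<or> I c1 c0 c3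
      c4 \<or> I c1 c0 c4 c2 \<or> I c1 c0 c4 c3 \<or> I c1 c2 c0 c3 \<or> I c1 c2 c0 c4 \<or> I c1 c2 c3 c4 \<or> I
      c1 c2 c4 c3 \<or> I c1 c3 c0 c2 \<or> I c1 c3 c0 c4 \<or> I c1 c3 c2 c4 \<or> I c1 c3 c4 c2 \<or> I c1 c4 c0
      c2 \<or> I c1 c4 c0 c3 \<or> I c1 c4 c2 c3 \<or> I c1 c4 c3 c2 \<or> I c2 c0 c1 c3 \<or> I c2 c0 c1 c4 \<or> I
      c2 c0 c3 c4 \<or> I c2 c0 c4 c3 \<or> I c2 c1 c0 c3 \<or> I c2 c1 c0 c4 \<or> I c2 c1 c3 c4 \<or> I c2 c1 c4
      c3 \<or> I c2 c3 c0 c4 \<or> I c2 c3 c1 c4 \<or> I c2 c4 c0 c3 \<or> I c2 c4 c1 c3 \<or> I c3 c0 c1 c4 \<or> I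
      c3 c0 c2 c4 \<or> I c3 c1 c0 c4 \<or> I c3 c1 c2 c4 \<or> I c3 c2 c0 c4 \<or> I c3 c2 c1 c4"
      using u(3) rev[OF u(3)] u(2) by (rule four_of_five)
    then show ?thesis by (rule disjI2)
  qed simp
  have P': "A p0 p1" "A p1 p2" "A p2 p3" "\<not> A p0 p2" "\<not> A p1 p3" "\<not> A p0 p3"
    "\<not> (A p0 x \<and> A x p3)" "\<not> (A p0 y \<and> A y p3)" "\<not> (A p0 z \<and> A z p3)"
    using P unfolding I by auto
  note flip = irr sym[of p1 p0] sym[of p2 p0] sym[of p3 p0] sym[of x p0] sym[of y p0] sym[of z p0] sym[of p2 p1]
    sym[of p3 p1] sym[of x p1] sym[of y p1] sym[of z p1] sym[of p3 p2] sym[of x p2] sym[of y p2] sym[of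
    z p2] sym[of x p3] sym[of y p3] sym[of z p3] sym[of y x] sym[of z x] sym[of z y] P'(1-6) if_True
  \<comment> \<open>The nine candidates are the three non-adjacent pairs on the given path, and each
    end of the path together with x, y or z. What is left is a propositional problem about the
    adjacencies.\<close>
  note r0 = five[of p0 p2 p1 p3 x y z, unfolded I, simplified, simplified flip, simplified]
  note r1 = five[of p1 p3 p0 p2 x y z, unfolded I, simplified, simplified flip, simplified]
  note r2 = five[of p0 p3 p1 p2 x y z, unfolded I, simplified, simplified flip, simplified]
  note r3 = five[of p0 x p1 p2 p3 y z, unfolded I, simplified, simplified flip, simplified]
  note r4 = five[of p0 y p1 p2 p3 x z, unfolded I, simplified, simplified flip, simplified]
  note r5 = five[of p0 z p1 p2 p3 x y, unfolded I, simplified, simplified flip, simplified]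
  note r6 = five[of p3 x p0 p1 p2 y z, unfolded I, simplified, simplified flip, simplified]
  note r7 = five[of p3 y p0 p1 p2 x z, unfolded I, simplified, simplified flip, simplified]
  note r8 = five[of p3 z p0 p1 p2 x y, unfolded I, simplified, simplified flip, simplified]
  have P2: "\<not> (A p0 x \<and> A p3 x)" "\<not> (A p0 y \<and> A p3 y)" "\<not> (A p0 z \<and> A p3 z)"
    using P'(7-9) sym by blast+
  show False using P2 r0 r1 r2 r3 r4 r5 r6 r7 r8 by (smt (verit))
qed

lemma parity_of_equal_distance:
  fixes i j m m' :: nat
  assumes "i mod 2 = j mod 2" "(if i \<le> j then j - i else i - j) = (if m \<le> m' then m' - m else m - m')"
  shows "m mod 2 = m' mod 2"
proof -
  have even_dist: "(x - y) mod 2 = 0" if "y \<le> x" "y mod 2 = x mod 2" for x y :: nat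
    using that by presburger
  have 1: "(if i \<le> j then j - i else i - j) mod 2 = 0"
  proof (cases "i \<le> j")
    case True
    then show ?thesis using even_dist[OF True assms(1)] by simp
  next
    case False
    then show ?thesis using even_dist[OF _ assms(1)[symmetric]] by simp
  qed
  show ?thesis
  proof (cases "m \<le> m'")
    case True
    then have "(m' - m) mod 2 = 0" using 1 assms(2) by simp
    then show ?thesis using True by presburger
  next
    case False
    then have "(m - m') mod 2 = 0" using 1 assms(2) by simp
    then show ?thesis using False by presburger
  qed
qed

text \<open>The edges at the vertex enter only through the number
  \<open>k - card (e \<inter> e')\<close>, and the arguments below use it only as a metric with
  integral values.\<close>

locale metric_on =
  fixes d :: "'b \<Rightarrow> 'b \<Rightarrow> nat" and L :: "'b set"
  assumes fin: "finite L" and sym: "d a b = d b a"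
    and tri: "a \<in> L \<Longrightarrow> b \<in> L \<Longrightarrow> c \<in> L \<Longrightarrow> d a c \<le> d a b + d b c"
    and zero: "a \<in> L \<Longrightarrow> b \<in> L \<Longrightarrow> d a b = 0 \<longleftrightarrow> a = b"
begin

lemma iso_pathD:
  assumes "iso_path d k Z P" "i < k" "j < k"
  shows "d (P i) (P j) = (if i \<le> j then j - i else i - j)"
  using assms sym[of "P i" "P j"] unfolding iso_path_def by auto

lemma iso_path_inj:
  assumes "iso_path d k Z P" "Z \<subseteq> L" shows "inj_on P {..<k}"
proof (rule inj_onI)
  fix i j assume ij: "i \<in> {..<k}" "j \<in> {..<k}" "P i = P j"
  then have "P i \<in> L" using assms by (auto simp: iso_path_def)
  then have "d (P i) (P j) = 0" using ij zero by auto
  then show "i = j" using iso_pathD[OF assms(1), of i j] ij by (auto split: if_splits)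
qed

text \<open>A geodesic on four points is described well enough by adjacency alone: it is an induced
  path whose ends have no common neighbour. With at most three points off it, this is the situation
  of \<open>seven_vertices\<close>.\<close>

lemma hits_paths_four:
  assumes "card L \<le> 7" shows "\<exists>R. hits_paths d 4 L R"
proof (rule ccontr)
  assume none: "\<nexists>R. hits_paths d 4 L R"
  have avoid: "\<exists>Q. iso_path d 4 (L - R) Q" if "R \<subseteq> L" "\<And>a b. a \<in> R \<Longrightarrow> b \<in> R \<Longrightarrow> d a b \<noteq> 1" for R
    using none that unfolding hits_paths_def by blast
  obtain P where P: "iso_path d 4 L P" using avoid[of "{}"] by auto
  have PL: "P i \<in> L" if "i < 4" for i using P that by (auto simp: iso_path_def)
  define X where "X = L - P ` {..<4}"
  have "card (P ` {..<4}) = 4" using iso_path_inj[OF P] by (simp add: card_image)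
  moreover have "P ` {..<4} \<subseteq> L" using PL by auto
  ultimately have cX: "card X \<le> 3" using fin assms unfolding X_def by (simp add: card_Diff_subset finite_subset)
  have "\<exists>x\<in>L. \<exists>y\<in>L. \<exists>z\<in>L. X \<subseteq> {x, y, z}"
  proof -
    have finX: "finite X" "X \<subseteq> L" using fin by (auto simp: X_def)
    obtain xs where xs: "set xs = X" "distinct xs" using finite_distinct_list[OF finX(1)] by blast
    then have len: "length xs \<le> 3" using cX distinct_card by metis
    \<comment> \<open>P 0 pads the list when fewer than three points lie off the path.\<close>
    define g where "g = (\<lambda>i. if i < length xs then xs ! i else P 0)"
    have "g i \<in> L" for i using finX xs PL[of 0] nth_mem[of i xs] by (auto simp: g_def)
    moreover have "X \<subseteq> {g 0, g 1, g 2}"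
    proof
      fix x assume "x \<in> X"
      then obtain i where "i < length xs" "x = xs ! i" using xs by (metis in_set_conv_nth)
      then have "x = g i" "i \<in> {0, 1, 2}" using len by (auto simp: g_def)
      then show "x \<in> {g 0, g 1, g 2}" by auto
    qed
    ultimately show ?thesis by blast
  qed
  then obtain x y z where xyz: "x \<in> L" "y \<in> L" "z \<in> L" "X \<subseteq> {x, y, z}" by blast
  have 4: "{..<4::nat} = {0,1,2,3}" by auto
  have P4: "P ` {..<4} = {P 0, P 1, P 2, P 3}" unfolding 4 by (simp only: image_insert image_empty)
  have "P ` {..<4} \<subseteq> L" using PL by auto
  then have L: "L = {P 0, P 1, P 2, P 3, x, y, z}"
    using xyz unfolding X_def P4 by blast
  define A where "A = (\<lambda>u v. u \<in> L \<and> v \<in> L \<and> d u v = 1)"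
  define I where "I = (\<lambda>u0 u1 u2 u3. A u0 u1 \<and> A u1 u2 \<and> A u2 u3 \<and> \<not> A u0 u2 \<and> \<not> A u1 u3 \<and> \<not> A u0 u3
      \<and> (\<forall>w\<in>{P 0, P 1, P 2, P 3, x, y, z}. \<not> (A u0 w \<and> A w u3)))"
  have I: "I (Q 0) (Q 1) (Q 2) (Q 3)" if Q: "iso_path d 4 Z Q" "Z \<subseteq> L" for Q Z
  proof -
    have QL: "Q i \<in> L" if "i < 4" for i using Q that by (auto simp: iso_path_def)
    have no: "\<not> (A (Q 0) w \<and> A w (Q 3))" for w
    proof
      assume "A (Q 0) w \<and> A w (Q 3)"
      then have "d (Q 0) (Q 3) \<le> 2" using tri[of "Q 0" w "Q 3"] unfolding A_def by linarith
      then show False using iso_pathD[OF Q(1), of 0 3] by simp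
    qed
    have "A (Q 0) (Q 1)" "A (Q 1) (Q 2)" "A (Q 2) (Q 3)" "\<not> A (Q 0) (Q 2)" "\<not> A (Q 1) (Q 3)" "\<not> A (Q 0) (Q 3)"
      using QL iso_pathD[OF Q(1), of 0 1] iso_pathD[OF Q(1), of 1 2] iso_pathD[OF Q(1), of 2 3]
        iso_pathD[OF Q(1), of 0 2] iso_pathD[OF Q(1), of 1 3] iso_pathD[OF Q(1), of 0 3] unfolding A_def by simp_all
    then show ?thesis unfolding I_def using no by blast
  qed
  show False
  proof (rule seven_vertices[where A = A and I = I and ?p0.0 = "P 0" and ?p1.0 = "P 1" and ?p2.0 = "P 2" and ?p3.0 = "P 3" and x = x and y = y and z = z])
    show "A u v = A v u" for u v unfolding A_def using sym[of u v] by auto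
    show "\<not> A u u" for u using zero[of u u] by (auto simp: A_def)
    show "I u0 u1 u2 u3 \<longleftrightarrow> A u0 u1 \<and> A u1 u2 \<and> A u2 u3 \<and> \<not> A u0 u2 \<and> \<not> A u1 u3 \<and> \<not> A u0 u3
      \<and> (\<forall>w\<in>{P 0, P 1, P 2, P 3, x, y, z}. \<not> (A u0 w \<and> A w u3))" for u0 u1 u2 u3 by (simp add: I_def)
    show "I (P 0) (P 1) (P 2) (P 3)" using I[OF P] by simp
    fix r s assume rs: "r \<in> {P 0, P 1, P 2, P 3, x, y, z}" "s \<in> {P 0, P 1, P 2, P 3, x, y, z}" "\<not> A r s"
    then have rsL: "r \<in> L" "s \<in> L" unfolding L by auto
    then have "d r s \<noteq> 1" "d s r \<noteq> 1" "d r r \<noteq> 1" "d s s \<noteq> 1"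
      using rs(3) sym[of s r] zero[of r r] zero[of s s] unfolding A_def by simp_all
    then obtain Q where Q: "iso_path d 4 (L - {r, s}) Q" using avoid[of "{r, s}"] rsL by auto
    have "{Q 0, Q 1, Q 2, Q 3} \<subseteq> L - {r, s}" using Q by (auto simp: iso_path_def)
    moreover have "distinct [Q 0, Q 1, Q 2, Q 3]"
      using inj_on_eq_iff[OF iso_path_inj[OF Q]] by simp
    moreover have "I (Q 0) (Q 1) (Q 2) (Q 3)" using I[OF Q] by auto
    ultimately show "\<exists>u0 u1 u2 u3. {u0,u1,u2,u3} \<subseteq> {P 0, P 1, P 2, P 3, x, y, z} - {r, s}
        \<and> distinct [u0,u1,u2,u3] \<and> I u0 u1 u2 u3" unfolding L[symmetric] by blast
  qed
qed

lemma card_parity: "card {i. i < k \<and> i mod 2 = (e::nat)} = (if e = 0 then (k + 1) div 2 else if e = 1 then k div 2 else 0)"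
proof (induction k)
  case (Suc k)
  have "{i. i < Suc k \<and> i mod 2 = e} = (if k mod 2 = e then insert k {i. i < k \<and> i mod 2 = e} else {i. i < k \<and> i mod 2 = e})"
    by (auto simp: less_Suc_eq)
  then have "card {i. i < Suc k \<and> i mod 2 = e} = card {i. i < k \<and> i mod 2 = e} + (if k mod 2 = e then 1 else 0)" by simp
  then show ?case using Suc.IH by (auto split: if_splits) presburger+
qed auto

text \<open>The candidates for R are the empty set, the two parity classes of a geodesic P, and one
  class enlarged by a point. If a candidate of (k + 1) div 2 points fails, at most k points remain
  and a second geodesic runs through all of them, nearly alternating between a class of P and the
  points off P. Two such geodesics give a point with two neighbours in both parity classes, which is
  impossible: its neighbours on P lie within three consecutive positions.\<close>

lemma hits_paths_ge_five:
  assumes k: "k \<ge> 5" and cL: "card L \<le> k + (k + 1) div 2" shows "\<exists>R. hits_paths d k L R"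
proof (rule ccontr)
  assume none: "\<nexists>R. hits_paths d k L R"
  have avoid: "\<exists>Q. iso_path d k (L - R) Q" if "R \<subseteq> L" "\<And>a b. a \<in> R \<Longrightarrow> b \<in> R \<Longrightarrow> d a b \<noteq> 1" for R
    using none that unfolding hits_paths_def by blast
  obtain P where P: "iso_path d k L P" using avoid[of "{}"] by auto
  have PL: "P i \<in> L" if "i < k" for i using P that by (auto simp: iso_path_def)
  have injP: "inj_on P {..<k}" using iso_path_inj[OF P] by simp
  note dP = iso_pathD[OF P]
  define cl where "cl = (\<lambda>e::nat. {i. i < k \<and> i mod 2 = e})"
  define S where "S = (\<lambda>e. P ` cl e)"
  define X where "X = L - P ` {..<k}"
  have c01: "cl 0 \<union> cl 1 = {..<k}" "cl 0 \<inter> cl 1 = {}" "cl e \<subseteq> {..<k}" "finite (cl e)" for e by (auto simp: cl_def)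
  have ccl: "card (cl 0) = (k + 1) div 2" "card (cl 1) = k div 2" unfolding cl_def by (simp_all only: card_parity) simp_all
  have SL: "S e \<subseteq> L" for e using PL by (auto simp: S_def cl_def)
  have cS: "card (S e) = card (cl e)" for e unfolding S_def by (rule card_image) (meson c01(3) injP inj_on_subset)
  have S01: "S 0 \<union> S 1 = P ` {..<k}" unfolding S_def c01(1)[symmetric] by (rule image_Un[symmetric])
  have Sdisj: "S 0 \<inter> S 1 = {}"
    unfolding S_def using inj_on_image_Int[OF injP c01(3) c01(3), of 0 1] c01(2) by simp
  have LX: "L = S 0 \<union> S 1 \<union> X" using SL unfolding S01 X_def by (auto simp: PL)
  have Xdisj: "X \<inter> S e = {}" for e using c01(3)[of e] by (auto simp: X_def S_def)
  have XL: "X \<subseteq> L" by (auto simp: X_def)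
  have S_E: "\<exists>i<k. u = P i \<and> i mod 2 = e" if "u \<in> S e" for u e using that by (auto simp: S_def cl_def)
  define idx where "idx = inv_into {..<k} P"
  have idx: "idx u < k" "P (idx u) = u" "idx u mod 2 = e" if u: "u \<in> S e" for u e
  proof -
    have "u \<in> P ` cl e" using u by (simp add: S_def)
    then show "idx u < k" "P (idx u) = u" "idx u mod 2 = e"
      unfolding idx_def by (auto simp: cl_def inv_into_f_f[OF injP])
  qed
  have indep: "d a b \<noteq> 1" if ab: "a \<in> S e" "b \<in> S e" for a b e
  proof -
    obtain i where i: "i < k" "a = P i" "i mod 2 = e" using S_E[OF ab(1)] by blast
    obtain j where j: "j < k" "b = P j" "j mod 2 = e" using S_E[OF ab(2)] by blast
    have "i mod 2 = j mod 2" using i j by simp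
    then show ?thesis using dP[OF i(1) j(1)] i(2) j(2) by (auto split: if_splits) presburger+
  qed
  have far: "d x (P m') \<le> c + (if m \<le> m' then m' - m else m - m')" if "x \<in> L" "m < k" "m' < k" "d x (P m) = c" for x m m' c
    using tri[OF that(1) PL[OF that(2)] PL[OF that(3)]] dP[OF that(2,3)] that(4) by linarith
  have near: "m \<le> m' + 2" if x: "x \<in> L" and m: "m < k" "m' < k" "d x (P m) = 1" "d x (P m') = 1" for x m m'
  proof -
    have "d (P m) (P m') \<le> 2" using tri[OF PL[OF m(1)] x PL[OF m(2)]] sym[of "P m" x] m by linarith
    then show ?thesis using dP[OF m(1,2)] by (simp split: if_splits)
  qed
  \<comment> \<open>A vertex has no two neighbours in each of the two parity classes of a geodesic.\<close>
  have K: False if x: "x \<in> L" and a: "a \<in> S 0" "a' \<in> S 0" "a \<noteq> a'" and b: "b \<in> S 1" "b' \<in> S 1" "b \<noteq> b'"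
    and adj: "d x a = 1" "d x a' = 1" "d x b = 1" "d x b' = 1" for x a a' b b'
  proof -
    define i i' j j' where "i = idx a" and "i' = idx a'" and "j = idx b" and "j' = idx b'"
    note i = idx[OF a(1), folded i_def] and i' = idx[OF a(2), folded i'_def]
      and j = idx[OF b(1), folded j_def] and j' = idx[OF b(2), folded j'_def]
    have ad: "d x (P i) = 1" "d x (P i') = 1" "d x (P j) = 1" "d x (P j') = 1"
      unfolding i(2) i'(2) j(2) j'(2) by (rule adj)+
    have "i \<noteq> i'" using a(3) i(2) i'(2) by metis
    moreover have "j \<noteq> j'" using b(3) j(2) j'(2) by metis
    moreover have "i \<le> i' + 2" "i' \<le> i + 2" "j \<le> j' + 2" "j' \<le> j + 2" "i \<le> j + 2" "j \<le> i + 2"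
      "i \<le> j' + 2" "j' \<le> i + 2" "i' \<le> j + 2" "j \<le> i' + 2" "i' \<le> j' + 2" "j' \<le> i' + 2"
      using near[OF x i(1) i'(1) ad(1,2)] near[OF x i'(1) i(1) ad(2,1)] near[OF x j(1) j'(1) ad(3,4)]
        near[OF x j'(1) j(1) ad(4,3)] near[OF x i(1) j(1) ad(1,3)] near[OF x j(1) i(1) ad(3,1)]
        near[OF x i(1) j'(1) ad(1,4)] near[OF x j'(1) i(1) ad(4,1)] near[OF x i'(1) j(1) ad(2,3)]
        near[OF x j(1) i'(1) ad(3,2)] near[OF x i'(1) j'(1) ad(2,4)] near[OF x j'(1) i'(1) ad(4,2)] by simp_all
    ultimately show False using i(3) i'(3) j(3) j'(3) by presburger
  qed
  \<comment> \<open>Points of one parity class of P have even distance, so they occupy positions of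
    one parity on any other geodesic.\<close>
  have par: "m mod 2 = m' mod 2" if Qm: "iso_path d k Z Q" "m < k" "m' < k" "Q m \<in> S e" "Q m' \<in> S e" for Z Q m m' e
  proof -
    obtain i where i: "i < k" "Q m = P i" "i mod 2 = e" using S_E[OF Qm(4)] by blast
    obtain j where j: "j < k" "Q m' = P j" "j mod 2 = e" using S_E[OF Qm(5)] by blast
    have "i mod 2 = j mod 2" using i j by simp
    moreover have "(if i \<le> j then j - i else i - j) = (if m \<le> m' then m' - m else m - m')"
      using dP[OF i(1) j(1)] iso_pathD[OF Qm(1-3)] i(2) j(2) by simp
    ultimately show ?thesis by (rule parity_of_equal_distance)
  qed
  have cLe: "card (L - R) \<le> k" if "R \<subseteq> L" "(k + 1) div 2 \<le> card R" for R
    using that fin cL by (simp add: card_Diff_subset finite_subset)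
  have cover: "Q ` {..<k} = L - R" if "iso_path d k (L - R) Q" "R \<subseteq> L" "(k + 1) div 2 \<le> card R" for Q R
  proof (rule card_seteq)
    show "finite (L - R)" using fin by simp
    show "Q ` {..<k} \<subseteq> L - R" using that(1) by (auto simp: iso_path_def)
    have "inj_on Q {..<k}" using iso_path_inj[OF that(1)] by auto
    then show "card (L - R) \<le> card (Q ` {..<k})" using cLe[OF that(2,3)] by (simp add: card_image)
  qed
  have parity_class: "\<exists>\<pi>. {m. m < k \<and> Q m \<in> S e} \<subseteq> cl \<pi> \<and> (\<pi> = 0 \<or> \<pi> = 1) \<and> card {m. m < k \<and> Q m \<in> S e} = card (cl e)"
    if Q: "iso_path d k (L - R) Q" "R \<subseteq> L" "(k + 1) div 2 \<le> card R" "S e \<inter> R = {}" for Q R e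
  proof -
    let ?M = "{m. m < k \<and> Q m \<in> S e}"
    have inj: "inj_on Q {..<k}" using iso_path_inj[OF Q(1)] by auto
    have "Q ` ?M = S e"
    proof
      show "S e \<subseteq> Q ` ?M"
      proof
        fix a assume a: "a \<in> S e"
        then have "a \<in> Q ` {..<k}" using cover[OF Q(1-3)] SL Q(4) by auto
        then show "a \<in> Q ` ?M" using a by auto
      qed
    qed auto
    moreover have "inj_on Q ?M" using inj by (rule inj_on_subset) auto
    ultimately have c: "card ?M = card (cl e)" using cS by (metis card_image)
    have "\<exists>\<pi>. ?M \<subseteq> cl \<pi> \<and> (\<pi> = 0 \<or> \<pi> = 1)"
    proof (cases "?M = {}")
      case False
      then obtain m where m: "m < k" "Q m \<in> S e" by auto
      have "?M \<subseteq> cl (m mod 2)"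
      proof
        fix m' assume "m' \<in> ?M"
        then have "m' < k" "m' mod 2 = m mod 2" using par[OF Q(1) _ m(1) _ m(2)] by blast+
        then show "m' \<in> cl (m mod 2)" by (simp add: cl_def)
      qed
      moreover have "m mod 2 = 0 \<or> m mod 2 = 1" by presburger
      ultimately show ?thesis by (intro exI[of _ "m mod 2"] conjI)
    qed auto
    then show ?thesis using c by (elim exE conjE) (intro exI conjI)
  qed
  show False
  proof (cases "even k")
    case ev: True
    then have half: "(k + 1) div 2 = k div 2" by presburger
    then have cc: "card (cl e) = k div 2" if "e = 0 \<or> e = 1" for e using that ccl by auto
    \<comment> \<open>All but at most one vertex of \<open>X\<close> have two neighbours in each parity class.\<close>
    have two: "\<exists>x0. \<forall>x\<in>X - {x0}. \<exists>a\<in>S e. \<exists>a'\<in>S e. a \<noteq> a' \<and> d x a = 1 \<and> d x a' = 1"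
      and cX: "card X = k div 2"
      if e: "e = 0 \<and> e' = 1 \<or> e = 1 \<and> e' = 0" for e e' :: nat
    proof -
      have R: "S e' \<subseteq> L" "(k + 1) div 2 \<le> card (S e')" using SL cS cc half e by auto
      have disj: "S e \<inter> S e' = {}" using Sdisj e by auto
      obtain Q where Q: "iso_path d k (L - S e') Q" using avoid[OF R(1)] indep by blast
      have cov: "Q ` {..<k} = L - S e'" by (rule cover[OF Q R])
      have LS: "L - S e' = S e \<union> X" using LX disj Xdisj[of e'] e by auto
      have inj: "inj_on Q {..<k}" using iso_path_inj[OF Q] by auto
      obtain \<pi> where \<pi>: "{m. m < k \<and> Q m \<in> S e} \<subseteq> cl \<pi>" "\<pi> = 0 \<or> \<pi> = 1" "card {m. m < k \<and> Q m \<in> S e} = card (cl e)"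
        using parity_class[OF Q R disj] by metis
      have M: "{m. m < k \<and> Q m \<in> S e} = cl \<pi>"
        using \<pi> cc[OF \<pi>(2)] cc[of e] e c01(4) by (intro card_seteq) auto
      have inS: "Q m \<in> S e" if "m < k" "m mod 2 = \<pi>" for m using M that by (auto simp: cl_def)
      have inX: "m mod 2 \<noteq> \<pi>" if "m < k" "Q m \<in> X" for m
        using inS[OF that(1)] that Xdisj by blast
      have "card (S e \<union> X) = card (S e) + card X" using Xdisj[of e] fin SL XL
        by (intro card_Un_disjoint) (auto intro: finite_subset)
      moreover have "card (S e \<union> X) = k" using cov LS inj by (metis card_image card_lessThan)
      moreover have "card (S e) = k div 2" using cS[of e] cc[of e] e by auto
      ultimately show "card X = k div 2" using ev by presburger
      \<comment> \<open>For even k exactly one end of Q has the parity that belongs to X; it is the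
        only point of X that can lack two neighbours in \<open>S e\<close>.\<close>
      define x0 where "x0 = (if \<pi> = 0 then Q (k - 1) else Q 0)"
      show "\<exists>x0. \<forall>x\<in>X - {x0}. \<exists>a\<in>S e. \<exists>a'\<in>S e. a \<noteq> a' \<and> d x a = 1 \<and> d x a' = 1"
      proof (intro exI[of _ x0] ballI)
        fix x assume x: "x \<in> X - {x0}"
        then have "x \<in> Q ` {..<k}" using cov LS by auto
        then obtain m where m: "m < k" "x = Q m" by auto
        have mp: "m mod 2 \<noteq> \<pi>" using inX m x by auto
        have "m \<noteq> 0 \<and> m \<noteq> k - 1"
        proof (cases "\<pi> = 0")
          case True
          then have "m mod 2 \<noteq> 0" "Q m \<noteq> Q (k - 1)" using mp x m by (auto simp: x0_def)
          then show ?thesis by (metis mod_0)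
        next
          case False
          then have "\<pi> = 1" using \<pi>(2) by simp
          then have "m mod 2 \<noteq> 1" "Q m \<noteq> Q 0" using mp x m by (auto simp: x0_def)
          moreover have "(k - 1) mod 2 = 1" using ev k by presburger
          ultimately show ?thesis by metis
        qed
        then have mm: "m - 1 < k" "m + 1 < k" "m \<ge> 1" using m by auto
        have "(m - 1) mod 2 = \<pi>" "(m + 1) mod 2 = \<pi>" using mp \<pi>(2) mm(3) by presburger+
        then have "Q (m - 1) \<in> S e" "Q (m + 1) \<in> S e" using inS mm by auto
        moreover have "Q (m - 1) \<noteq> Q (m + 1)" using inj mm by (auto dest: inj_onD)
        moreover have "d x (Q (m - 1)) = 1" "d x (Q (m + 1)) = 1"
          using iso_pathD[OF Q m(1) mm(1)] iso_pathD[OF Q m(1) mm(2)] mm m by auto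
        ultimately show "\<exists>a\<in>S e. \<exists>a'\<in>S e. a \<noteq> a' \<and> d x a = 1 \<and> d x a' = 1" by blast
      qed
    qed
    obtain x0 where x0: "\<forall>x\<in>X - {x0}. \<exists>a\<in>S 0. \<exists>a'\<in>S 0. a \<noteq> a' \<and> d x a = 1 \<and> d x a' = 1" using two[of 0 1] by auto
    obtain x1 where x1: "\<forall>x\<in>X - {x1}. \<exists>a\<in>S 1. \<exists>a'\<in>S 1. a \<noteq> a' \<and> d x a = 1 \<and> d x a' = 1" using two[of 1 0] by auto
    \<comment> \<open>X has k / 2 points, at least three, while at most two are exceptional.\<close>
    have "k \<ge> 6" using k ev by presburger
    then have "card X \<ge> 3" using cX[of 0 1] by simp
    moreover have "card {x0, x1} \<le> 2" by (simp add: card_insert_if)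
    ultimately have "card X > card {x0, x1}" by linarith
    then have "X - {x0, x1} \<noteq> {}" by (metis Diff_eq_empty_iff card_mono finite.emptyI finite_insert leD)
    then obtain x where x: "x \<in> X" "x \<noteq> x0" "x \<noteq> x1" by blast
    obtain a a' where a: "a \<in> S 0" "a' \<in> S 0" "a \<noteq> a'" "d x a = 1" "d x a' = 1" using x0 x by blast
    obtain b b' where b: "b \<in> S 1" "b' \<in> S 1" "b \<noteq> b'" "d x b = 1" "d x b' = 1" using x1 x by blast
    have "x \<in> L" using x XL by blast
    then show False by (rule K[OF _ a(1-3) b(1-3) a(4,5) b(4,5)])
  next
    case od: False
    \<comment> \<open>For odd k the class \<open>S 1\<close> has one point less than
      \<open>S 0\<close>, so it fills either all odd positions of the second geodesic, or all even
      positions but one.\<close>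
    then have halfs: "(k + 1) div 2 = k div 2 + 1" by presburger
    have R0: "S 0 \<subseteq> L" "(k + 1) div 2 \<le> card (S 0)" using SL cS ccl by auto
    obtain P' where P': "iso_path d k (L - S 0) P'" using avoid[OF R0(1)] indep by blast
    have cov': "P' ` {..<k} = L - S 0" by (rule cover[OF P' R0])
    have LS0: "L - S 0 = S 1 \<union> X" using LX Sdisj Xdisj[of 0] by auto
    have inj': "inj_on P' {..<k}" using iso_path_inj[OF P'] by auto
    note dP' = iso_pathD[OF P']
    have P'L: "P' m \<in> L" if "m < k" for m using P' that by (auto simp: iso_path_def)
    obtain \<pi> where \<pi>: "{m. m < k \<and> P' m \<in> S 1} \<subseteq> cl \<pi>" "\<pi> = 0 \<or> \<pi> = 1" "card {m. m < k \<and> P' m \<in> S 1} = card (cl 1)"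
      using parity_class[OF P' R0 Sdisj[unfolded Int_commute[of "S 0"]]] by metis
    show False
    proof (cases "\<pi> = 1")
      case True
      have M: "{m. m < k \<and> P' m \<in> S 1} = cl 1" using \<pi> True c01(4) by (intro card_seteq) auto
      have inS: "P' m \<in> S 1 \<longleftrightarrow> m mod 2 = 1" if "m < k" for m using M that by (auto simp: cl_def)
      have inX: "\<exists>m. m < k \<and> x = P' m \<and> m mod 2 = 0" if "x \<in> X" for x
      proof -
        have "x \<in> P' ` {..<k}" using cov' LS0 that by auto
        then obtain m where m: "m < k" "x = P' m" by auto
        then show ?thesis using inS[OF m(1)] that Xdisj[of 1] by (metis Int_iff empty_iff mod2_eq_if parity_cases)
      qed
      have one: False if x: "x \<in> X" and a: "a \<in> S 0" "a' \<in> S 0" "a \<noteq> a'" "d x a = 1" "d x a' = 1" for x a a'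
      proof -
        obtain m where m: "m < k" "x = P' m" "m mod 2 = 0" using inX[OF x] by metis
        have xL: "x \<in> L" using x XL by auto
        \<comment> \<open>Here P j is the neighbour of x in \<open>S 1\<close> and P j3 the
          following point of that class on the second geodesic. The neighbours P l and P l' of x lie
          on both sides of P j, so one of them is next to P j3, and x is within distance 2 of a
          point at distance 3.\<close>
        have ends: False if n: "n1 < k" "n3 < k" "n1 mod 2 = 1" "n3 mod 2 = 1" "d x (P' n1) = 1" "d x (P' n3) = 3" "d (P' n1) (P' n3) = 2" for n1 n3
        proof -
          obtain j j3 where j: "j < k" "j mod 2 = 1" "P' n1 = P j" "j3 < k" "j3 mod 2 = 1" "P' n3 = P j3"
            using inS n S_E by metis
          obtain l l' where l: "l < k" "l mod 2 = 0" "a = P l" "l' < k" "l' mod 2 = 0" "a' = P l'"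
            using S_E[OF a(1)] S_E[OF a(2)] by metis
          have ad: "d x (P l) = 1" "d x (P l') = 1" "d x (P j) = 1" using a l j n by auto
          have "l \<noteq> l'" using a l by auto
          moreover have "l \<le> l' + 2" "l' \<le> l + 2" "l \<le> j + 2" "j \<le> l + 2" "l' \<le> j + 2" "j \<le> l' + 2"
            using near[OF xL l(1,4) ad(1,2)] near[OF xL l(4,1) ad(2,1)] near[OF xL l(1) j(1) ad(1,3)]
              near[OF xL j(1) l(1) ad(3,1)] near[OF xL l(4) j(1) ad(2,3)] near[OF xL j(1) l(4) ad(3,2)] by simp_all
          moreover have "j = j3 + 2 \<or> j3 = j + 2" using dP[OF j(1,4)] n(7) j(3,6) by (cases "j \<le> j3") auto
          moreover have "l + 2 \<le> j3 \<or> j3 + 2 \<le> l"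
            using far[OF xL l(1) j(4) ad(1)] n(6) j(6) by (simp split: if_splits)
          moreover have "l' + 2 \<le> j3 \<or> j3 + 2 \<le> l'"
            using far[OF xL l(4) j(4) ad(2)] n(6) j(6) by (simp split: if_splits)
          ultimately show False using j(2,5) l(2,5) by presburger
        qed
        consider "m = 0" | "m = k - 1" | "1 \<le> m" "m + 1 < k" using m by linarith
        then show False
        proof cases
          case 1
          show False by (rule ends[of 1 3]) (use 1 m k dP'[of 0 1] dP'[of 0 3] dP'[of 1 3] in auto)
        next
          case 2
          have "(k - 2) mod 2 = 1" "(k - 4) mod 2 = 1" using od k by presburger+
          moreover have "d x (P' (k - 2)) = 1" "d x (P' (k - 4)) = 3" "d (P' (k - 2)) (P' (k - 4)) = 2"
          proof -
            have "x = P' (k - 1)" using 2 m(2) by simp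
            moreover have "d (P' (k - 1)) (P' (k - 2)) = 1" using dP'[of "k - 1" "k - 2"] k by auto
            moreover have "d (P' (k - 1)) (P' (k - 4)) = 3" using dP'[of "k - 1" "k - 4"] k by auto
            moreover have "d (P' (k - 2)) (P' (k - 4)) = 2" using dP'[of "k - 2" "k - 4"] k by auto
            ultimately show "d x (P' (k - 2)) = 1" "d x (P' (k - 4)) = 3" "d (P' (k - 2)) (P' (k - 4)) = 2" by simp_all
          qed
          ultimately show False using ends[of "k - 2" "k - 4"] k by simp
        next
          case 3
          have "(m - 1) mod 2 = 1" "(m + 1) mod 2 = 1" using m(3) 3 by presburger+
          then have "P' (m - 1) \<in> S 1" "P' (m + 1) \<in> S 1" using inS 3 by auto
          moreover have "P' (m - 1) \<noteq> P' (m + 1)" using inj' 3 by (auto dest: inj_onD)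
          moreover have "d x (P' (m - 1)) = 1" "d x (P' (m + 1)) = 1"
            using dP'[of m "m - 1"] dP'[of m "m + 1"] 3 m by auto
          ultimately show False using K[OF xL a(1-3) _ _ _ a(4,5)] by blast
        qed
      qed
      obtain Q where Q: "iso_path d k (L - S 1) Q" using avoid[OF SL] indep by blast
      have QA: "Q m \<in> S 0 \<or> Q m \<in> X" if "m < k" for m using Q that LX by (auto simp: iso_path_def)
      have notX: "\<not> (Q m \<in> X \<and> Q (Suc m) \<in> X)" if "Suc m < k" for m
      proof
        assume "Q m \<in> X \<and> Q (Suc m) \<in> X"
        then obtain i j where "i < k" "j < k" "Q m = P' i" "Q (Suc m) = P' j" "i mod 2 = 0" "j mod 2 = 0"
          using inX by metis
        then have "(if i \<le> j then j - i else i - j) = 1" "i mod 2 = 0" "j mod 2 = 0"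
          using dP'[of i j] iso_pathD[OF Q, of m "Suc m"] that by simp_all
        then show False by (cases "i \<le> j"; simp; presburger)
      qed
      have notS: "\<not> (Q m \<in> S 0 \<and> Q (Suc m) \<in> S 0)" if "Suc m < k" for m
        using indep[of "Q m" 0 "Q (Suc m)"] iso_pathD[OF Q, of m "Suc m"] that by auto
      have "\<exists>m. 1 \<le> m \<and> m + 1 < k \<and> Q m \<in> X"
      proof (cases "Q 1 \<in> X")
        case True
        then show ?thesis using k by (intro exI[of _ 1]) auto
      next
        case False
        then have "Q 2 \<in> X" using QA[of 1] QA[of 2] notS[of 1] k by (auto simp: numeral_2_eq_2)
        then show ?thesis using k by (intro exI[of _ 2]) auto
      qed
      then obtain m where m: "1 \<le> m" "m + 1 < k" "Q m \<in> X" by blast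
      have "Q (m - 1) \<in> S 0" using notX[of "m - 1"] QA[of "m - 1"] m by auto
      moreover have "Q (m + 1) \<in> S 0" using notX[of m] QA[of "m + 1"] m by auto
      moreover have "Q (m - 1) \<noteq> Q (m + 1)" using iso_path_inj[OF Q] m by (auto dest: inj_onD)
      moreover have "d (Q m) (Q (m - 1)) = 1" "d (Q m) (Q (m + 1)) = 1"
        using iso_pathD[OF Q, of m "m - 1"] iso_pathD[OF Q, of m "m + 1"] m by auto
      ultimately show False using one[OF m(3)] by blast
    next
      case False
      then have \<pi>0: "\<pi> = 0" using \<pi>(2) by simp
      let ?M = "{m. m < k \<and> P' m \<in> S 1}"
      have "card (cl 0 - ?M) = 1" using \<pi> \<pi>0 ccl halfs c01(4) by (subst card_Diff_subset) (auto intro: finite_subset)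
      then obtain ms where ms: "cl 0 - ?M = {ms}" by (auto simp: card_1_singleton_iff)
      have msk: "ms < k" "ms mod 2 = 0" "P' ms \<notin> S 1" using ms by (auto simp: cl_def)
      have inS: "P' m \<in> S 1" if "m < k" "m mod 2 = 0" "m \<noteq> ms" for m
      proof (rule ccontr)
        assume "P' m \<notin> S 1"
        then have "m \<in> cl 0 - ?M" using that by (simp add: cl_def)
        then show False using ms that(3) by blast
      qed
      have inX: "P' m \<in> X" if "m < k" "m mod 2 = 1" for m
      proof -
        have "P' m \<notin> S 1" using \<pi>(1) \<pi>0 that by (auto simp: cl_def)
        then show ?thesis using cov' LS0 that by auto
      qed
      have xs: "P' ms \<in> X" using cov' LS0 msk by auto
      \<comment> \<open>\<open>S 1\<close> alone is one point too small for the counting argument;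
        the missing even position of the second geodesic can be added without creating a distance
        1.\<close>
      define R where "R = insert (P' ms) (S 1)"
      have RL: "R \<subseteq> L" using SL P'L msk by (auto simp: R_def)
      have "finite (S 1)" by (simp add: S_def c01)
      then have cR: "(k + 1) div 2 \<le> card R" using msk cS ccl halfs by (simp add: R_def)
      have evS: "\<exists>m. m < k \<and> b = P' m \<and> m mod 2 = 0" if "b \<in> R" for b
      proof (cases "b = P' ms")
        case False
        then have b: "b \<in> S 1" using that by (simp add: R_def)
        then have "b \<in> P' ` {..<k}" using cov' LS0 by auto
        then obtain m where "m < k" "b = P' m" by auto
        then show ?thesis using b \<pi>(1) \<pi>0 by (auto simp: cl_def)
      qed (use msk in auto)
      have "d a b \<noteq> 1" if ab: "a \<in> R" "b \<in> R" for a b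
      proof -
        obtain m m' where "m < k" "a = P' m" "m mod 2 = 0" "m' < k" "b = P' m'" "m' mod 2 = 0"
          using evS[OF ab(1)] evS[OF ab(2)] by metis
        then show ?thesis using dP'[of m m'] by (auto split: if_splits) presburger+
      qed
      then obtain Q where Q: "iso_path d k (L - R) Q" using avoid[OF RL] by blast
      have R0': "S 0 \<inter> R = {}" using Sdisj xs Xdisj[of 0] by (auto simp: R_def)
      obtain \<pi>' where \<pi>': "{m. m < k \<and> Q m \<in> S 0} \<subseteq> cl \<pi>'" "\<pi>' = 0 \<or> \<pi>' = 1" "card {m. m < k \<and> Q m \<in> S 0} = card (cl 0)"
        using parity_class[OF Q RL cR R0'] by metis
      have "\<pi>' = 0"
      proof (rule ccontr)
        assume "\<pi>' \<noteq> 0"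
        then have "card (cl 0) \<le> card (cl 1)" using \<pi>' c01(4) card_mono by metis
        then show False using ccl halfs by simp
      qed
      then have MQ: "{m. m < k \<and> Q m \<in> S 0} = cl 0" using \<pi>' c01(4) by (intro card_seteq) auto
      have QS: "Q m \<in> S 0 \<longleftrightarrow> m mod 2 = 0" if "m < k" for m
      proof -
        have "m \<in> {m. m < k \<and> Q m \<in> S 0} \<longleftrightarrow> m \<in> cl 0" by (simp only: MQ)
        then show ?thesis using that by (simp add: cl_def)
      qed
      have twoA: "\<exists>a\<in>S 0. \<exists>a'\<in>S 0. a \<noteq> a' \<and> d x a = 1 \<and> d x a' = 1" if x: "x \<in> X" "x \<noteq> P' ms" for x
      proof -
        have "x \<in> L - R" using x XL Xdisj[of 1] by (auto simp: R_def)
        then obtain m where m: "m < k" "x = Q m" using cover[OF Q RL cR] by auto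
        then have mo: "m mod 2 = 1" using QS[OF m(1)] x Xdisj[of 0] by (metis Int_iff empty_iff mod2_eq_if parity_cases)
        then have mm: "1 \<le> m" "m + 1 < k" using m od by presburger+
        have "(m - 1) mod 2 = 0" "(m + 1) mod 2 = 0" using mo mm by presburger+
        then have "Q (m - 1) \<in> S 0" "Q (m + 1) \<in> S 0" using QS mm by auto
        moreover have "Q (m - 1) \<noteq> Q (m + 1)" using iso_path_inj[OF Q] mm by (auto dest: inj_onD)
        moreover have "d x (Q (m - 1)) = 1" "d x (Q (m + 1)) = 1"
          using iso_pathD[OF Q, of m "m - 1"] iso_pathD[OF Q, of m "m + 1"] mm m by auto
        ultimately show ?thesis by blast
      qed
      have "\<exists>m. m mod 2 = 1 \<and> m + 1 < k \<and> m - 1 \<noteq> ms \<and> m + 1 \<noteq> ms"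
      proof -
        \<comment> \<open>In the one bad case, k = 5 with ms = 2, the two points of
          \<open>S 1\<close> would sit at the two ends of the second geodesic, at distance 4,
          although they have distance 2 on P.\<close>
        have "ms \<noteq> 2 \<or> k \<ge> 7"
        proof (rule ccontr)
          assume "\<not> ?thesis"
          then have k5: "k = 5" "ms = 2" using k od by presburger+
          then have "P' 0 \<in> S 1" "P' 4 \<in> S 1" using inS by auto
          then obtain i j where "i < 5" "i mod 2 = 1" "P' 0 = P i" "j < 5" "j mod 2 = 1" "P' 4 = P j"
            using k5 by (auto simp: S_def cl_def)
          then have "(if i \<le> j then j - i else i - j) = 4" "i < 5" "j < 5" "i mod 2 = 1" "j mod 2 = 1"
            using dP[of i j] dP'[of 0 4] k5(1) by simp_all
          then show False by (cases "i \<le> j"; simp; presburger)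
        qed
        then have "ms = 0 \<or> ms = 2 \<and> k \<ge> 7 \<or> ms \<ge> 4" using msk(2) by presburger
        then consider "ms = 0" | "ms = 2" "k \<ge> 7" | "ms \<ge> 4" by linarith
        then show ?thesis
        proof cases
          case 1 then show ?thesis using k by (intro exI[of _ 3]) auto
        next
          case 2 then show ?thesis by (intro exI[of _ 5]) auto
        next
          case 3 then show ?thesis using k by (intro exI[of _ 1]) auto
        qed
      qed
      then obtain m where m: "m mod 2 = 1" "m + 1 < k" "m - 1 \<noteq> ms" "m + 1 \<noteq> ms" by blast
      then have m1: "1 \<le> m" by presburger
      have x: "P' m \<in> X" using inX m by auto
      have "(m - 1) mod 2 = 0" "(m + 1) mod 2 = 0" using m m1 by presburger+
      then have b: "P' (m - 1) \<in> S 1" "P' (m + 1) \<in> S 1" using inS m by auto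
      have bne: "P' (m - 1) \<noteq> P' (m + 1)" using inj' m m1 by (auto dest: inj_onD)
      have bd: "d (P' m) (P' (m - 1)) = 1" "d (P' m) (P' (m + 1)) = 1"
        using dP'[of m "m - 1"] dP'[of m "m + 1"] m m1 by auto
      have "P' m \<noteq> P' ms" using inj' m msk by (auto dest: inj_onD)
      then obtain a a' where "a \<in> S 0" "a' \<in> S 0" "a \<noteq> a'" "d (P' m) a = 1" "d (P' m) a' = 1"
        using twoA[OF x] by blast
      then show False using K[OF _ _ _ _ b bne _ _ bd] x XL by blast
    qed
  qed
qed

end

text \<open>The number of edges at a vertex that can always be recoloured locally. For k = 4 the
  general formula would give 6, and then the density condition of \<open>cycle_length_props\<close>
  would fail for t = 8; this is why four-point geodesics are treated separately, up to seven
  points.\<close>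

definition degree_bound :: "nat \<Rightarrow> nat" where
  "degree_bound k = (if k = 4 then 7 else k + (k + 1) div 2)"

text \<open>The distance of two k-sets is k minus the size of their intersection; its triangle
  inequality is inclusion and exclusion inside the middle set.\<close>

lemma local_colouring:
  fixes L :: "'a set set"
  assumes k: "k \<ge> 4" and L: "finite L" "card L \<le> degree_bound k" "\<And>e. e \<in> L \<Longrightarrow> finite e \<and> card e = k"
  obtains R where "R \<subseteq> L" "\<And>e e'. e \<in> R \<Longrightarrow> e' \<in> R \<Longrightarrow> e \<noteq> e' \<Longrightarrow> card (e \<inter> e') \<noteq> k - 1"
    "\<And>F. (\<And>m. m < k \<Longrightarrow> F m \<in> L - R) \<Longrightarrow>
       (\<And>m m'. m \<le> m' \<Longrightarrow> m' < k \<Longrightarrow> card (F m \<inter> F m') = k - (m' - m)) \<Longrightarrow> False"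
proof -
  define d where "d = (\<lambda>e e' :: 'a set. k - card (e \<inter> e'))"
  have le: "card (e \<inter> e') \<le> k" if "e \<in> L" for e e'
    using L(3)[OF that] card_mono[of e "e \<inter> e'"] by auto
  interpret metric_on d L
  proof
    show "finite L" by (rule L(1))
    show "d a b = d b a" for a b by (simp add: d_def Int_commute)
    fix a b assume a: "a \<in> L" and b: "b \<in> L"
    show "d a c \<le> d a b + d b c" if c: "c \<in> L" for c
    proof -
      have fb: "finite b" "card b = k" using L(3)[OF b] by auto
      have "card (a \<inter> b) + card (b \<inter> c) = card (a \<inter> b \<union> b \<inter> c) + card (a \<inter> b \<inter> (b \<inter> c))"
        using fb by (intro card_Un_Int) auto
      moreover have "card (a \<inter> b \<union> b \<inter> c) \<le> k" using fb card_mono[of b "a \<inter> b \<union> b \<inter> c"] by auto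
      moreover have "card (a \<inter> b \<inter> (b \<inter> c)) \<le> card (a \<inter> c)" using L(3)[OF a] by (intro card_mono) auto
      ultimately show ?thesis unfolding d_def using le[OF a] le[OF b] by linarith
    qed
    show "d a b = 0 \<longleftrightarrow> a = b"
    proof
      assume "d a b = 0"
      then have c: "card (a \<inter> b) = k" using le[OF a, of b] by (simp add: d_def)
      have "a \<inter> b = a" using c L(3)[OF a] by (intro card_subset_eq) auto
      moreover have "a \<inter> b = b" using c L(3)[OF b] by (intro card_subset_eq) auto
      ultimately show "a = b" by auto
    qed (use L(3)[OF b] in \<open>simp add: d_def\<close>)
  qed
  have "\<exists>R. hits_paths d k L R"
  proof (cases "k = 4")
    case True
    then show ?thesis using hits_paths_four L(2) by (simp add: degree_bound_def)
  next
    case False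
    then show ?thesis using hits_paths_ge_five[of k] L(2) k by (simp add: degree_bound_def)
  qed
  then obtain R where R: "R \<subseteq> L" "\<forall>a\<in>R. \<forall>b\<in>R. d a b \<noteq> 1" "\<forall>P. \<not> iso_path d k (L - R) P"
    unfolding hits_paths_def by blast
  show thesis
  proof (rule that[of R])
    show "R \<subseteq> L" by (rule R(1))
    show "card (e \<inter> e') \<noteq> k - 1" if "e \<in> R" "e' \<in> R" "e \<noteq> e'" for e e'
    proof -
      have "d e e' \<noteq> 1" using R(2) that by blast
      then show ?thesis using k by (auto simp: d_def)
    qed
    fix F assume F: "\<And>m. m < k \<Longrightarrow> F m \<in> L - R"
      "\<And>m m'. m \<le> m' \<Longrightarrow> m' < k \<Longrightarrow> card (F m \<inter> F m') = k - (m' - m)"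
    have "iso_path d k (L - R) F" unfolding iso_path_def d_def using F by auto
    then show False using R(3) by blast
  qed
qed

section \<open>The weight of one exploration step\<close>

lemma double_count:
  assumes "finite I" "\<And>i. i \<in> I \<Longrightarrow> finite (G i) \<and> card (G i) = 2"
    and "\<And>g. g \<in> (\<Union>i\<in>I. G i) \<Longrightarrow> card {i\<in>I. g \<in> G i} \<le> c"
  shows "2 * card I \<le> c * card (\<Union>i\<in>I. G i)"
proof -
  let ?U = "\<Union>i\<in>I. G i"
  have finU: "finite ?U" using assms(1,2) by auto
  have "2 * card I = (\<Sum>i\<in>I. card {g\<in>?U. g \<in> G i})"
  proof -
    have "card {g\<in>?U. g \<in> G i} = 2" if "i \<in> I" for i
    proof -
      have "{g\<in>?U. g \<in> G i} = G i" using that by auto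
      then show ?thesis using assms(2)[OF that] by simp
    qed
    then show ?thesis by simp
  qed
  also have "\<dots> = (\<Sum>g\<in>?U. card {i\<in>I. g \<in> G i})"
    using assms(1) finU by (intro sum_multicount_gen) auto
  also have "\<dots> \<le> (\<Sum>g\<in>?U. c)" by (intro sum_mono assms(3))
  finally show ?thesis by (simp add: mult.commute)
qed

text \<open>The condition \<open>2 * k \<le> t\<close> lets two windows overlap in a single interval
  only, so a tight cycle looks locally like a tight path.\<close>

locale kt =
  fixes k t :: nat
  assumes k4: "4 \<le> k" and tk: "2 * k \<le> t"
begin

lemma t_pos: "0 < t" "8 \<le> t" "k \<le> t" "1 \<le> k" "3 \<le> k"
  using k4 tk by auto

definition edge :: "(nat \<Rightarrow> 'a) \<Rightarrow> nat \<Rightarrow> 'a set" where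
  "edge v i = v ` window k t i"

text \<open>The two further edges of a triangle on the i-th cycle edge with apex z. The omitted
  vertices are given by their offsets in the window, so that they contribute a constant number of
  choices.\<close>

definition apexes :: "(nat \<Rightarrow> 'a) \<Rightarrow> nat \<Rightarrow> 'a \<Rightarrow> nat \<Rightarrow> nat \<Rightarrow> 'a set set" where
  "apexes v i z \<alpha> \<beta> = {insert z (edge v i) - {v ((i + \<alpha>) mod t)}, insert z (edge v i) - {v ((i + \<beta>) mod t)}}"

lemma edge_props:
  assumes "inj_on v {..<t}"
  shows "finite (edge v i)" "card (edge v i) = k" "edge v i \<subseteq> v ` {..<t}"
proof -
  show "finite (edge v i)" by (simp add: edge_def)
  show "card (edge v i) = k" by (simp add: edge_def card_image_window[OF assms t_pos(3,1)])
  show "edge v i \<subseteq> v ` {..<t}" unfolding edge_def by (rule image_mono[OF window_subset[OF t_pos(1)]])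
qed

lemma edge_mem: "\<alpha> < k \<Longrightarrow> v ((i + \<alpha>) mod t) \<in> edge v i"
  by (auto simp: edge_def window_def)

lemma edge_vertex_inj:
  assumes "inj_on v {..<t}" "\<alpha> < k" "\<beta> < k" "\<alpha> \<noteq> \<beta>"
  shows "v ((i + \<alpha>) mod t) \<noteq> v ((i + \<beta>) mod t)"
proof -
  have "(i + \<alpha>) mod t \<noteq> (i + \<beta>) mod t"
    using inj_on_shift[of i t 0] assms t_pos by (auto dest: inj_onD)
  then show ?thesis using assms(1) t_pos by (auto dest: inj_onD)
qed

lemma edge_inj: "inj_on v {..<t} \<Longrightarrow> i < t \<Longrightarrow> j < t \<Longrightarrow> edge v i = edge v j \<Longrightarrow> i = j"
  using inj_on_window[OF tk t_pos(4)] inj_on_image_eq_iff[of v "{..<t}"] window_subset[OF t_pos(1)]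
  by (metis edge_def inj_onD lessThan_iff)

text \<open>The edges that the triangles at the edges \<open>i \<in> F\<close> of a tight cycle add outweigh the choices of their
  apexes, because an added edge lies in at most three of these triangles, and in at most two of them
  if its apex is not on the cycle.\<close>

lemma apex_weight:
  fixes n p :: real
  assumes v: "inj_on v {..<t}" and F: "F \<subseteq> {..<t}"
    and z: "\<And>i. i \<in> F \<Longrightarrow> z i \<notin> edge v i"
    and ab: "\<And>i. i \<in> F \<Longrightarrow> \<alpha> i < k" "\<And>i. i \<in> F \<Longrightarrow> \<beta> i < k" "\<And>i. i \<in> F \<Longrightarrow> \<alpha> i \<noteq> \<beta> i"
    and p: "0 < p" "p \<le> 1" and np: "1 \<le> n * p" "1 \<le> n^2 * p^3" "1 \<le> n^3 * p^4" and n: "1 \<le> n"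
  defines "\<G> \<equiv> (\<Union>i\<in>F. apexes v i (z i) (\<alpha> i) (\<beta> i))"
  shows "n ^ card (z ` F - v ` {..<t}) * p ^ card \<G> \<le> (n * p^2) ^ card F"
proof -
  define W where "W = v ` {..<t}"
  define G where "G = (\<lambda>i. apexes v i (z i) (\<alpha> i) (\<beta> i))"
  define a where "a = (\<lambda>i. v ((i + \<alpha> i) mod t))"
  define b where "b = (\<lambda>i. v ((i + \<beta> i) mod t))"
  have finF: "finite F" using F finite_subset by blast
  have a: "a i \<in> edge v i" "b i \<in> edge v i" "a i \<noteq> b i" if "i \<in> F" for i
    using ab[OF that] edge_mem edge_vertex_inj[OF v] by (auto simp: a_def b_def)
  have G: "G i = {insert (z i) (edge v i) - {a i}, insert (z i) (edge v i) - {b i}}" for i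
    by (simp add: G_def apexes_def a_def b_def)
  have G2: "finite (G i) \<and> card (G i) = 2" if "i \<in> F" for i
  proof -
    have "insert (z i) (edge v i) - {a i} \<noteq> insert (z i) (edge v i) - {b i}" using a[OF that] by auto
    then show ?thesis by (simp add: G)
  qed
  have g: "finite g" "card g = k" "k - 1 \<le> card (g \<inter> edge v i)" "z i \<in> g" "g \<subseteq> insert (z i) (edge v i)"
    if ig: "i \<in> F" "g \<in> G i" for i g
  proof -
    note e = edge_props[OF v, of i]
    have c: "card (insert (z i) (edge v i)) = Suc k" using e z[OF ig(1)] by simp
    have "\<exists>x\<in>edge v i. g = insert (z i) (edge v i) - {x}" using ig(2) a[OF ig(1)] unfolding G by blast
    then obtain x where x: "x \<in> edge v i" "g = insert (z i) (edge v i) - {x}" by blast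
    show "finite g" "g \<subseteq> insert (z i) (edge v i)" using x e by auto
    show "card g = k" using x c e by simp
    show "z i \<in> g" using x z[OF ig(1)] by auto
    have "g \<inter> edge v i = edge v i - {x}" using x z[OF ig(1)] by auto
    then show "k - 1 \<le> card (g \<inter> edge v i)" using e x by simp
  qed
  have UG: "\<Union>(G i) = insert (z i) (edge v i)" if "i \<in> F" for i using a[OF that] by (auto simp: G)
  have served: "card {i\<in>I. g \<in> G i} \<le> 3" "\<not> g \<subseteq> W \<Longrightarrow> card {i\<in>I. g \<in> G i} \<le> 2"
    if Ig: "I \<subseteq> F" "g \<in> (\<Union>i\<in>I. G i)" for I g
  proof -
    let ?S = "{i. i < t \<and> k - 1 \<le> card (g \<inter> v ` window k t i)}"
    obtain i where i: "i \<in> F" "g \<in> G i" using Ig by auto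
    have sub: "{i\<in>I. g \<in> G i} \<subseteq> ?S" using Ig F g(3) by (fastforce simp: edge_def)
    have fin: "finite ?S" by simp
    have "card {i\<in>I. g \<in> G i} \<le> card ?S" by (rule card_mono[OF fin sub])
    moreover have "card ?S \<le> 3" by (rule card_served(1)[OF v tk t_pos(2,5) g(1,2)[OF i] refl])
    moreover have "card ?S \<le> 2" if "\<not> g \<subseteq> W"
      using that unfolding W_def by (rule card_served(2)[OF v tk t_pos(2,5) g(1,2)[OF i] refl])
    ultimately show "card {i\<in>I. g \<in> G i} \<le> 3" "\<not> g \<subseteq> W \<Longrightarrow> card {i\<in>I. g \<in> G i} \<le> 2" by linarith+
  qed
  \<comment> \<open>The cycle edges are grouped by apex: Fin has the apexes on the cycle, and each
    apex x in Z, off the cycle, has its own group. Added edges of different groups are different, so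
    the weights multiply.\<close>
  define Fin where "Fin = {i\<in>F. z i \<in> W}"
  define Z where "Z = z ` F - W"
  define Fz where "Fz = (\<lambda>x. {i\<in>F. z i = x})"
  define U where "U = (\<lambda>I. \<Union>i\<in>I. G i)"
  have finU: "finite (U I)" if "I \<subseteq> F" for I unfolding U_def using that finF G2 by (meson finite_UN finite_subset subsetD)
  have finZ: "finite Z" using finF by (simp add: Z_def)
  have FzF: "Fz x \<subseteq> F" "Fin \<subseteq> F" for x by (auto simp: Fz_def Fin_def)
  have UinW: "g \<subseteq> W" if "g \<in> U Fin" for g
    using that g(5) edge_props(3)[OF v] unfolding U_def Fin_def W_def by blast
  have Uz: "x \<in> g \<and> g \<subseteq> insert x W" if "g \<in> U (Fz x)" for g x
    using that g(4,5) edge_props(3)[OF v] unfolding U_def Fz_def W_def by blast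
  have F_split: "F = Fin \<union> (\<Union>x\<in>Z. Fz x)" by (auto simp: Fin_def Z_def Fz_def)
  have cardF: "card F = card Fin + (\<Sum>x\<in>Z. card (Fz x))"
  proof -
    have "card F = card Fin + card (\<Union>x\<in>Z. Fz x)"
      using finF by (subst F_split, intro card_Un_disjoint) (auto simp: Fin_def Z_def Fz_def)
    also have "card (\<Union>x\<in>Z. Fz x) = (\<Sum>x\<in>Z. card (Fz x))"
      using finZ finF by (intro card_UN_disjoint) (auto simp: Fz_def)
    finally show ?thesis .
  qed
  have G_split: "\<G> = U Fin \<union> (\<Union>x\<in>Z. U (Fz x))"
  proof -
    have "\<G> = U F" by (simp add: \<G>_def U_def G_def)
    also have "\<dots> = U (Fin \<union> (\<Union>x\<in>Z. Fz x))" by (simp only: F_split[symmetric])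
    also have "\<dots> = U Fin \<union> (\<Union>x\<in>Z. U (Fz x))" by (auto simp: U_def)
    finally show ?thesis .
  qed
  have cardG: "card \<G> = card (U Fin) + (\<Sum>x\<in>Z. card (U (Fz x)))"
  proof -
    have "U Fin \<inter> (\<Union>x\<in>Z. U (Fz x)) = {}"
    proof (rule ccontr)
      assume "U Fin \<inter> (\<Union>x\<in>Z. U (Fz x)) \<noteq> {}"
      then obtain g x where "g \<in> U Fin" "x \<in> Z" "g \<in> U (Fz x)" by blast
      then show False using UinW Uz by (auto simp: Z_def)
    qed
    then have "card \<G> = card (U Fin) + card (\<Union>x\<in>Z. U (Fz x))"
      unfolding G_split using finU FzF finZ by (intro card_Un_disjoint) auto
    also have "card (\<Union>x\<in>Z. U (Fz x)) = (\<Sum>x\<in>Z. card (U (Fz x)))"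
    proof (rule card_UN_disjoint[OF finZ])
      show "\<forall>x\<in>Z. finite (U (Fz x))" using finU FzF by auto
      show "\<forall>x\<in>Z. \<forall>y\<in>Z. x \<noteq> y \<longrightarrow> U (Fz x) \<inter> U (Fz y) = {}"
      proof (intro ballI impI, rule ccontr)
        fix x y assume xy: "x \<in> Z" "y \<in> Z" "x \<noteq> y" "U (Fz x) \<inter> U (Fz y) \<noteq> {}"
        then obtain g where g: "g \<in> U (Fz x)" "g \<in> U (Fz y)" by blast
        then have "x \<in> insert y W" using Uz by blast
        then show False using xy by (auto simp: Z_def)
      qed
    qed
    finally show ?thesis .
  qed
  have np2: "0 < n * p^2" using p n by simp
  have inside: "p ^ card (U Fin) \<le> (n * p^2) ^ card Fin"
  proof -
    \<comment> \<open>Each added edge serves at most three indices. The deficit against two edges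
      per index is covered by \<open>1 \<le> n^3 * p^4\<close>, since an apex on the cycle brings no
      factor n.\<close>
    have "2 * card Fin \<le> 3 * card (U Fin)"
      unfolding U_def using finF FzF(2) G2 served(1)[OF FzF(2)]
      by (intro double_count) (auto intro: finite_subset)
    then have "p ^ (3 * card (U Fin)) \<le> p ^ (2 * card Fin)" using p by (intro power_decreasing) auto
    also have "\<dots> \<le> p ^ (2 * card Fin) * (n^3 * p^4) ^ card Fin"
      using p np by (simp add: mult_le_cancel_left1)
    also have "\<dots> = (p^2 * (n^3 * p^4)) ^ card Fin" by (simp add: power_mult power_mult_distrib)
    also have "p^2 * (n^3 * p^4) = (n * p^2)^3" by (simp add: power_mult_distrib flip: power_add power_mult)
    finally have "(p ^ card (U Fin)) ^ 3 \<le> ((n * p^2) ^ card Fin) ^ 3"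
      by (simp only: power_mult[symmetric] mult.commute)
    then have "(p ^ card (U Fin)) ^ Suc 2 \<le> ((n * p^2) ^ card Fin) ^ Suc 2" by (simp only: eval_nat_numeral)
    then show ?thesis by (rule power_le_imp_le_base) (use np2 in simp)
  qed
  have outside: "n * p ^ card (U (Fz x)) \<le> (n * p^2) ^ card (Fz x)" if x: "x \<in> Z" for x
  proof -
    define m where "m = card (Fz x)"
    have fz: "finite (Fz x)" using finF by (simp add: Fz_def)
    have "Fz x \<noteq> {}" using x by (auto simp: Z_def Fz_def)
    then have m1: "m \<ge> 1" using fz by (simp add: m_def card_gt_0_iff Suc_le_eq)
    have notW: "\<not> g \<subseteq> W" if "g \<in> U (Fz x)" for g using Uz[OF that] x by (auto simp: Z_def)
    have "2 * card (Fz x) \<le> 2 * card (U (Fz x))"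
      unfolding U_def
    proof (rule double_count[OF fz])
      fix g assume "g \<in> (\<Union>i\<in>Fz x. G i)"
      then show "card {i \<in> Fz x. g \<in> G i} \<le> 2" using served(2)[OF FzF(1)] notW by (auto simp: U_def)
    qed (use FzF G2 in blast)
    then have mU: "m \<le> card (U (Fz x))" by (simp add: m_def)
    have pw: "p ^ card (U (Fz x)) \<le> p ^ j" if "j \<le> card (U (Fz x))" for j
      using p that by (intro power_decreasing) auto
    \<comment> \<open>One apex costs a single factor n. One triangle brings two edges, two triangles
      at least three, and m triangles at least m; the assumptions on n and p turn this into
      \<open>(n * p^2) ^ m\<close>.\<close>
    consider "m = 1" | "m = 2" | "m \<ge> 3" using m1 by linarith
    then show ?thesis
    proof cases
      case 1
      then obtain i where i: "Fz x = {i}" by (auto simp: m_def card_1_singleton_iff)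
      then have "card (U (Fz x)) = 2" using G2[of i] FzF(1)[of x] by (simp add: U_def)
      then show ?thesis using 1 by (simp add: m_def)
    next
      case 2
      then obtain i j where ij: "Fz x = {i, j}" "i \<noteq> j" by (auto simp: m_def card_2_iff)
      then have ijF: "i \<in> F" "j \<in> F" "z i = x" "z j = x" by (auto simp: Fz_def)
      have "G i \<noteq> G j"
      proof
        assume "G i = G j"
        then have "insert x (edge v i) = insert x (edge v j)" using UG ijF by metis
        then have "edge v i = edge v j" using z ijF by (metis Diff_insert_absorb)
        then show False using edge_inj[OF v] ijF F ij by auto
      qed
      then have "G i \<subset> G i \<union> G j"
        using G2[OF ijF(1)] G2[OF ijF(2)] by (metis card_subset_eq psubsetI sup.cobounded1 sup.cobounded2)
      then have "card (G i) < card (G i \<union> G j)" using G2[OF ijF(1)] G2[OF ijF(2)] by (intro psubset_card_mono) auto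
      then have "3 \<le> card (U (Fz x))" using G2[OF ijF(1)] ij by (simp add: U_def)
      then have "n * p ^ card (U (Fz x)) \<le> n * p^3" using pw n by (intro mult_left_mono) auto
      also have "n * p^3 * 1 \<le> n * p^3 * (n * p)" using np n p by (intro mult_left_mono) auto
      then have "n * p^3 \<le> n * p^3 * (n * p)" by simp
      also have "\<dots> = (n * p^2)^2" by (simp add: power2_eq_square power3_eq_cube)
      finally show ?thesis using 2 by (simp add: m_def)
    next
      case 3
      have "n * p ^ card (U (Fz x)) \<le> n * p ^ m" using pw[OF mU] n by (intro mult_left_mono) auto
      also have "\<dots> \<le> (n * p) ^ m * p ^ m"
      proof (rule mult_right_mono)
        have "n = n * 1" by simp
        also have "\<dots> \<le> n * (n^2 * p^3)" using np(2) n by (intro mult_left_mono) auto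
        also have "\<dots> = (n * p) ^ 3" by (simp add: power_mult_distrib power2_eq_square power3_eq_cube)
        also have "\<dots> \<le> (n * p) ^ m" using np 3 by (intro power_increasing) auto
        finally show "n \<le> (n * p) ^ m" .
      qed (use p in auto)
      also have "\<dots> = (n * p^2) ^ m" by (simp add: power_mult_distrib power2_eq_square)
      finally show ?thesis by (simp add: m_def)
    qed
  qed
  have "n ^ card (z ` F - v ` {..<t}) * p ^ card \<G>
      = p ^ card (U Fin) * (\<Prod>x\<in>Z. n * p ^ card (U (Fz x)))"
    unfolding cardG by (simp add: prod.distrib power_add power_sum Z_def W_def)
  also have "\<dots> \<le> (n * p^2) ^ card Fin * (\<Prod>x\<in>Z. (n * p^2) ^ card (Fz x))"
    using inside outside p n by (intro mult_mono prod_mono) (auto intro!: prod_nonneg)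
  also have "\<dots> = (n * p^2) ^ card F" unfolding cardF by (simp add: power_add power_sum)
  finally show ?thesis .
qed

text \<open>There are at most n ^ s sets of s new apexes, and a map into these and W has at most 2 *
  t values at each place. So the factor n per new apex cancels and a constant remains.\<close>

lemma sum_apex_choices:
  fixes W F :: "nat set"
  assumes F: "finite F" "card F \<le> t" and W: "finite W" "card W \<le> t" and n: "1 \<le> n"
  shows "(\<Sum>z\<in>PiE F (\<lambda>_. {..<n}). 1 / real n ^ card (z ` F - W)) \<le> real (t + 1) * real (2 * t) ^ t"
proof -
  let ?P = "PiE F (\<lambda>_. {..<n})"
  have finP: "finite ?P" using F by (intro finite_PiE) auto
  have le: "card (z ` F - W) \<le> t" for z :: "nat \<Rightarrow> nat"
    by (meson F card_Diff_subset_Int card_image_le card_mono Diff_subset finite_imageI order_trans)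
  have each: "real (card {z\<in>?P. card (z ` F - W) = s}) \<le> real n ^ s * real (2 * t) ^ t" if s: "s \<le> t" for s
  proof -
    have "{z\<in>?P. card (z ` F - W) = s} \<subseteq> (\<Union>Z\<in>{Z. Z \<subseteq> {..<n} \<and> card Z = s}. PiE F (\<lambda>_. W \<union> Z))"
    proof
      fix z assume z: "z \<in> {z\<in>?P. card (z ` F - W) = s}"
      then have "z \<in> PiE F (\<lambda>_. W \<union> (z ` F - W))" by (auto simp: PiE_iff)
      moreover have "z ` F - W \<subseteq> {..<n}" using z by (auto simp: PiE_iff)
      ultimately show "z \<in> (\<Union>Z\<in>{Z. Z \<subseteq> {..<n} \<and> card Z = s}. PiE F (\<lambda>_. W \<union> Z))" using z by blast
    qed
    moreover have fin: "finite {Z. Z \<subseteq> {..<n} \<and> card Z = s}" by simp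
    moreover have finZ: "finite (PiE F (\<lambda>_. W \<union> Z))" if "Z \<subseteq> {..<n}" for Z
      using F W that by (intro finite_PiE) (auto intro: finite_subset)
    ultimately have "card {z\<in>?P. card (z ` F - W) = s} \<le> card (\<Union>Z\<in>{Z. Z \<subseteq> {..<n} \<and> card Z = s}. PiE F (\<lambda>_. W \<union> Z))"
      by (intro card_mono) auto
    also have "\<dots> \<le> (\<Sum>Z\<in>{Z. Z \<subseteq> {..<n} \<and> card Z = s}. card (PiE F (\<lambda>_. W \<union> Z)))" by (rule card_UN_le[OF fin])
    also have "\<dots> \<le> (\<Sum>Z\<in>{Z. Z \<subseteq> {..<n} \<and> card Z = s}. (2 * t) ^ t)"
    proof (rule sum_mono)
      fix Z assume "Z \<in> {Z. Z \<subseteq> {..<n} \<and> card Z = s}"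
      then have "card (W \<union> Z) \<le> 2 * t" using card_Un_le[of W Z] W s by auto
      then have "card (W \<union> Z) ^ card F \<le> (2 * t) ^ card F" by (rule power_mono) simp
      moreover have "card (PiE F (\<lambda>_. W \<union> Z)) = card (W \<union> Z) ^ card F" using F(1) by (simp add: card_PiE)
      ultimately have "card (PiE F (\<lambda>_. W \<union> Z)) \<le> (2 * t) ^ card F" by simp
      also have "\<dots> \<le> (2 * t) ^ t" using F t_pos by (intro power_increasing) auto
      finally show "card (PiE F (\<lambda>_. W \<union> Z)) \<le> (2 * t) ^ t" .
    qed
    also have "\<dots> = (n choose s) * (2 * t) ^ t" by (simp add: n_subsets)
    also have "\<dots> \<le> n ^ s * (2 * t) ^ t"
    proof (rule mult_right_mono)
      show "n choose s \<le> n ^ s" by (cases "s \<le> n") (simp_all add: binomial_le_pow binomial_eq_0)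
    qed simp
    finally have "real (card {z\<in>?P. card (z ` F - W) = s}) \<le> real (n ^ s * (2 * t) ^ t)" by (rule of_nat_mono)
    then show ?thesis by simp
  qed
  have "(\<Sum>z\<in>?P. 1 / real n ^ card (z ` F - W)) = (\<Sum>s\<in>{..t}. \<Sum>z\<in>{z\<in>?P. card (z ` F - W) = s}. 1 / real n ^ card (z ` F - W))"
    using le finP by (intro sum.group[symmetric]) auto
  also have "\<dots> = (\<Sum>s\<in>{..t}. real (card {z\<in>?P. card (z ` F - W) = s}) / real n ^ s)"
    by (intro sum.cong) simp_all
  also have "\<dots> \<le> (\<Sum>s\<in>{..t}. real (2 * t) ^ t)"
  proof (rule sum_mono)
    fix s assume "s \<in> {..t}"
    then have "real (card {z\<in>?P. card (z ` F - W) = s}) / real n ^ s \<le> real n ^ s * real (2 * t) ^ t / real n ^ s"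
      using n each by (intro divide_right_mono) auto
    then show "real (card {z\<in>?P. card (z ` F - W) = s}) / real n ^ s \<le> real (2 * t) ^ t" using n by simp
  qed
  also have "\<dots> = real (t + 1) * real (2 * t) ^ t" by simp
  finally show ?thesis .
qed

section \<open>One step of the exploration\<close>

definition new_idx :: "nat set set \<Rightarrow> (nat \<Rightarrow> nat) \<Rightarrow> nat set" where
  "new_idx E v = {i. i < t \<and> edge v i \<notin> E}"

definition ext :: "nat set set \<Rightarrow> (nat \<Rightarrow> nat) \<Rightarrow> (nat \<Rightarrow> nat) \<Rightarrow> (nat \<Rightarrow> nat) \<Rightarrow> (nat \<Rightarrow> nat) \<Rightarrow> nat set set" where
  "ext E v z \<alpha> \<beta> = E \<union> cyc k t v \<union> (\<Union>i\<in>new_idx E v. apexes v i (z i) (\<alpha> i) (\<beta> i))"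

text \<open>The added triangle edges avoid the cycle and E, so the new edges of both kinds can be
  counted separately.\<close>

definition ok_ext :: "nat set set \<Rightarrow> (nat \<Rightarrow> nat) \<Rightarrow> (nat \<Rightarrow> nat) \<Rightarrow> (nat \<Rightarrow> nat) \<Rightarrow> (nat \<Rightarrow> nat) \<Rightarrow> bool" where
  "ok_ext E v z \<alpha> \<beta> \<longleftrightarrow> (\<forall>i\<in>new_idx E v. z i \<notin> edge v i \<and> \<alpha> i \<noteq> \<beta> i \<and>
     apexes v i (z i) (\<alpha> i) (\<beta> i) \<inter> (cyc k t v \<union> E) = {})"

text \<open>The cycle is anchored with its first edge at e and must contribute something new.
  Membership in \<open>PiE\<close> determines v by its values on the t positions, so the family is
  finite.\<close>

definition cycles_at :: "nat \<Rightarrow> nat set set \<Rightarrow> nat set \<Rightarrow> (nat \<Rightarrow> nat) set" where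
  "cycles_at n E e = {v\<in>PiE {..<t} (\<lambda>_. {..<n}). inj_on v {..<t} \<and> edge v 0 = e \<and> new_idx E v \<noteq> {}}"

definition choices :: "nat \<Rightarrow> nat set \<Rightarrow> ((nat \<Rightarrow> nat) \<times> (nat \<Rightarrow> nat) \<times> (nat \<Rightarrow> nat)) set" where
  "choices n F = PiE F (\<lambda>_. {..<n}) \<times> PiE F (\<lambda>_. {..<k}) \<times> PiE F (\<lambda>_. {..<k})"

definition cyc_succ :: "nat \<Rightarrow> nat set set \<Rightarrow> nat set \<Rightarrow> nat set set set" where
  "cyc_succ n E e = (\<lambda>(v, z, \<alpha>, \<beta>). ext E v z \<alpha> \<beta>) `
     {(v, z, \<alpha>, \<beta>). v \<in> cycles_at n E e \<and> (z, \<alpha>, \<beta>) \<in> choices n (new_idx E v) \<and> ok_ext E v z \<alpha> \<beta>}"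

definition tri_succ :: "nat \<Rightarrow> nat set set \<Rightarrow> nat set set set" where
  "tri_succ n E = (\<lambda>(g, z, a, b). E \<union> {g, insert z g - {a}, insert z g - {b}}) `
     {(g, z, a, b). g \<in> E \<and> z \<in> {..<n} \<and> a \<in> g \<and> b \<in> g \<and> z \<notin> g \<and> a \<noteq> b \<and> \<not> {insert z g - {a}, insert z g - {b}} \<subseteq> E}"

lemma cyc_eq: "cyc k t v = edge v ` {..<t}"
  by (simp add: cyc_def edge_def)

lemma finite_choices: "finite F \<Longrightarrow> finite (choices n F)"
  by (auto simp: choices_def intro!: finite_PiE finite_cartesian_product)

lemma finite_cycles_at: "finite (cycles_at n E e)"
  unfolding cycles_at_def by (rule finite_subset[of _ "PiE {..<t} (\<lambda>_. {..<n})"]) (auto intro!: finite_PiE)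

lemma card_ext:
  assumes fin: "finite E" and v: "inj_on v {..<t}" and ok: "ok_ext E v z \<alpha> \<beta>"
  shows "card (ext E v z \<alpha> \<beta>) = card E + card (new_idx E v) + card (\<Union>i\<in>new_idx E v. apexes v i (z i) (\<alpha> i) (\<beta> i))"
proof -
  let ?F = "new_idx E v" and ?G = "\<Union>i\<in>new_idx E v. apexes v i (z i) (\<alpha> i) (\<beta> i)"
  have finF: "finite ?F" by (simp add: new_idx_def)
  have finG: "finite ?G" using finF by (auto simp: apexes_def)
  have "E \<union> cyc k t v = E \<union> edge v ` ?F" by (auto simp: cyc_eq new_idx_def)
  moreover have "card (E \<union> edge v ` ?F) = card E + card ?F"
  proof -
    have "card (E \<union> edge v ` ?F) = card E + card (edge v ` ?F)"
      using fin finF by (intro card_Un_disjoint) (auto simp: new_idx_def)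
    moreover have "inj_on (edge v) ?F" using edge_inj[OF v] by (auto simp: inj_on_def new_idx_def)
    ultimately show ?thesis by (simp add: card_image)
  qed
  moreover have "(E \<union> cyc k t v) \<inter> ?G = {}" using ok unfolding ok_ext_def by blast
  moreover have "finite (E \<union> cyc k t v)" using fin by (simp add: cyc_eq)
  ultimately show ?thesis unfolding ext_def using finG by (simp add: card_Un_disjoint)
qed

text \<open>Every new cycle edge has weight p, and by \<open>apex_weight\<close> its triangle
  contributes n * p^2 once the apexes are summed out; what remains is a sum over cycles in the
  single parameter n * p^3.\<close>

lemma sum_cyc_succ:
  fixes p :: real
  assumes fin: "finite E" and n: "1 \<le> n" and p: "0 < p" "p \<le> 1"
    and np: "1 \<le> real n * p" "1 \<le> real n^2 * p^3" "1 \<le> real n^3 * p^4"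
  shows "(\<Sum>X\<in>cyc_succ n E e. p ^ card X) \<le> p ^ card E * (real (t + 1) * real (2 * t) ^ t * real k ^ (2 * t))
      * (\<Sum>v\<in>cycles_at n E e. (real n * p^3) ^ card (new_idx E v))"
proof -
  define K0 where "K0 = real (t + 1) * real (2 * t) ^ t"
  let ?J = "SIGMA v:cycles_at n E e. {c\<in>choices n (new_idx E v). case c of (z, \<alpha>, \<beta>) \<Rightarrow> ok_ext E v z \<alpha> \<beta>}"
  have finF: "finite (new_idx E v)" "card (new_idx E v) \<le> t" for v
  proof -
    show "finite (new_idx E v)" by (simp add: new_idx_def)
    have "new_idx E v \<subseteq> {..<t}" by (auto simp: new_idx_def)
    then show "card (new_idx E v) \<le> t" using card_mono[of "{..<t}"] by fastforce
  qed
  have finJ: "finite ?J" using finite_cycles_at finite_choices[OF finF(1)] by auto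
  have eq: "{(v, z, \<alpha>, \<beta>). v \<in> cycles_at n E e \<and> (z, \<alpha>, \<beta>) \<in> choices n (new_idx E v) \<and> ok_ext E v z \<alpha> \<beta>} = ?J" by auto
  have "(\<Sum>X\<in>cyc_succ n E e. p ^ card X) \<le> (\<Sum>(v, c)\<in>?J. p ^ card (case c of (z, \<alpha>, \<beta>) \<Rightarrow> ext E v z \<alpha> \<beta>))"
    unfolding cyc_succ_def eq using sum_image_le[OF finJ, of "\<lambda>X. p ^ card X" "\<lambda>(v, z, \<alpha>, \<beta>). ext E v z \<alpha> \<beta>"] p
    by (simp add: case_prod_unfold)
  also have "\<dots> = (\<Sum>v\<in>cycles_at n E e. \<Sum>c\<in>{c\<in>choices n (new_idx E v). case c of (z, \<alpha>, \<beta>) \<Rightarrow> ok_ext E v z \<alpha> \<beta>}.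
      p ^ card (case c of (z, \<alpha>, \<beta>) \<Rightarrow> ext E v z \<alpha> \<beta>))"
    using finite_cycles_at finite_choices[OF finF(1)] by (subst sum.Sigma) auto
  also have "\<dots> \<le> (\<Sum>v\<in>cycles_at n E e. p ^ card E * (K0 * real k ^ (2 * t)) * (real n * p^3) ^ card (new_idx E v))"
  proof (rule sum_mono)
    fix v assume v: "v \<in> cycles_at n E e"
    then have inj: "inj_on v {..<t}" by (simp add: cycles_at_def)
    let ?F = "new_idx E v"
    let ?w = "\<lambda>z. 1 / real n ^ card (z ` ?F - v ` {..<t})"
    have "(\<Sum>c\<in>{c\<in>choices n ?F. case c of (z, \<alpha>, \<beta>) \<Rightarrow> ok_ext E v z \<alpha> \<beta>}. p ^ card (case c of (z, \<alpha>, \<beta>) \<Rightarrow> ext E v z \<alpha> \<beta>))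
       \<le> (\<Sum>c\<in>{c\<in>choices n ?F. case c of (z, \<alpha>, \<beta>) \<Rightarrow> ok_ext E v z \<alpha> \<beta>}. p ^ card E * (real n * p^3) ^ card ?F * ?w (fst c))"
    proof (rule sum_mono)
      fix c assume c: "c \<in> {c\<in>choices n ?F. case c of (z, \<alpha>, \<beta>) \<Rightarrow> ok_ext E v z \<alpha> \<beta>}"
      obtain z \<alpha> \<beta> where zab: "c = (z, \<alpha>, \<beta>)" by (metis prod_cases3)
      have ok: "ok_ext E v z \<alpha> \<beta>" and ch: "z \<in> PiE ?F (\<lambda>_. {..<n})" "\<alpha> \<in> PiE ?F (\<lambda>_. {..<k})" "\<beta> \<in> PiE ?F (\<lambda>_. {..<k})"
        using c zab by (auto simp: choices_def)
      let ?G = "\<Union>i\<in>?F. apexes v i (z i) (\<alpha> i) (\<beta> i)"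
      let ?s = "card (z ` ?F - v ` {..<t})"
      have "real n ^ ?s * p ^ card ?G \<le> (real n * p^2) ^ card ?F"
      proof (rule apex_weight[OF inj])
        show "?F \<subseteq> {..<t}" by (auto simp: new_idx_def)
      qed (use ok ch p np n in \<open>auto simp: ok_ext_def PiE_iff\<close>)
      then have G: "p ^ card ?G \<le> (real n * p^2) ^ card ?F / real n ^ ?s" using n by (simp add: pos_le_divide_eq mult.commute)
      have "p ^ card (ext E v z \<alpha> \<beta>) = p ^ card E * (p ^ card ?F * p ^ card ?G)"
        unfolding card_ext[OF fin inj ok] by (simp add: power_add)
      also have "\<dots> \<le> p ^ card E * (p ^ card ?F * ((real n * p^2) ^ card ?F / real n ^ ?s))"
        using G p by (intro mult_left_mono) auto
      also have "\<dots> = p ^ card E * ((p * (real n * p^2)) ^ card ?F * ?w z)" by (simp add: power_mult_distrib)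
      also have "p * (real n * p^2) = real n * p^3" by (simp add: power2_eq_square power3_eq_cube)
      finally show "p ^ card (case c of (z, \<alpha>, \<beta>) \<Rightarrow> ext E v z \<alpha> \<beta>) \<le> p ^ card E * (real n * p^3) ^ card ?F * ?w (fst c)"
        by (simp add: zab mult.assoc)
    qed
    also have "\<dots> \<le> (\<Sum>c\<in>choices n ?F. p ^ card E * (real n * p^3) ^ card ?F * ?w (fst c))"
      using p finite_choices[OF finF(1)] by (intro sum_mono2) auto
    also have "\<dots> = p ^ card E * (real n * p^3) ^ card ?F * (\<Sum>c\<in>choices n ?F. ?w (fst c))"
      by (simp add: sum_distrib_left)
    also have "(\<Sum>c\<in>choices n ?F. ?w (fst c)) = (\<Sum>z\<in>PiE ?F (\<lambda>_. {..<n}). ?w z) * (real k ^ card ?F * real k ^ card ?F)"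
    proof -
      let ?Y = "PiE ?F (\<lambda>_. {..<k}) \<times> PiE ?F (\<lambda>_. {..<k})"
      have "(\<Sum>c\<in>choices n ?F. ?w (fst c)) = (\<Sum>(z, y)\<in>PiE ?F (\<lambda>_. {..<n}) \<times> ?Y. ?w z)"
        unfolding choices_def by (simp only: case_prod_unfold)
      also have "\<dots> = (\<Sum>z\<in>PiE ?F (\<lambda>_. {..<n}). \<Sum>y\<in>?Y. ?w z)" by (rule sum.cartesian_product[symmetric])
      also have "\<dots> = (\<Sum>z\<in>PiE ?F (\<lambda>_. {..<n}). ?w z * real (card ?Y))" by (simp only: sum_constant mult.commute)
      also have "\<dots> = (\<Sum>z\<in>PiE ?F (\<lambda>_. {..<n}). ?w z) * real (card ?Y)" by (rule sum_distrib_right[symmetric])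
      also have "real (card ?Y) = real k ^ card ?F * real k ^ card ?F"
        using finF by (simp add: card_cartesian_product card_PiE)
      finally show ?thesis .
    qed
    also have "p ^ card E * (real n * p^3) ^ card ?F * ((\<Sum>z\<in>PiE ?F (\<lambda>_. {..<n}). ?w z) * (real k ^ card ?F * real k ^ card ?F))
        \<le> p ^ card E * (real n * p^3) ^ card ?F * (K0 * (real k ^ t * real k ^ t))"
    proof (intro mult_left_mono mult_mono)
      have "card (v ` {..<t}) \<le> t" using card_image_le[of "{..<t}" v] by simp
      then show "(\<Sum>z\<in>PiE ?F (\<lambda>_. {..<n}). ?w z) \<le> K0"
        unfolding K0_def using finF n by (intro sum_apex_choices) auto
      show "real k ^ card ?F \<le> real k ^ t" using finF t_pos by (intro power_increasing) auto
      then show "real k ^ card ?F \<le> real k ^ t" .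
    qed (use p in \<open>auto intro!: sum_nonneg simp: K0_def\<close>)
    also have "\<dots> = p ^ card E * (K0 * real k ^ (2 * t)) * (real n * p^3) ^ card ?F"
    proof -
      have "real k ^ (2 * t) = real k ^ t * real k ^ t" by (simp add: mult_2 power_add)
      then show ?thesis by (simp only: mult_ac)
    qed
    finally show "(\<Sum>c\<in>{c\<in>choices n ?F. case c of (z, \<alpha>, \<beta>) \<Rightarrow> ok_ext E v z \<alpha> \<beta>}. p ^ card (case c of (z, \<alpha>, \<beta>) \<Rightarrow> ext E v z \<alpha> \<beta>))
       \<le> p ^ card E * (K0 * real k ^ (2 * t)) * (real n * p^3) ^ card ?F" .
  qed
  finally show ?thesis by (simp add: K0_def sum_distrib_left)
qed

text \<open>The cycles are sorted by the set U of positions whose vertices are already in E. With u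
  < t old positions there are about \<open>n ^ (t - u)\<close> choices, and by
  \<open>card_Union_window\<close> at least t - 1 - (u - k) new edges. The case u = k is the
  balanced main term A; every further old vertex costs one factor M, and these cases are absorbed by
  B.\<close>

lemma sum_cycles_at:
  fixes q :: real
  assumes fin: "finite E" and E: "\<And>f. f \<in> E \<Longrightarrow> finite f" and e: "e \<in> E" "card e = k" and q: "0 \<le> q" "q \<le> 1"
    and M: "real (card (\<Union>E)) \<le> M" "1 \<le> M" and n: "1 \<le> n"
    and A: "real n ^ (t - k) * q ^ (t - 1) \<le> A"
    and B: "\<And>u. k < u \<Longrightarrow> u < t \<Longrightarrow> real n ^ (t - u) * q ^ (t - 1 - (u - k)) \<le> B" "q \<le> B" and AB: "0 \<le> A" "0 \<le> B"
  shows "(\<Sum>v\<in>cycles_at n E e. q ^ card (new_idx E v)) \<le> 2 ^ t * real k ^ k * (A + M ^ t * B)"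
proof -
  define Vs where "Vs = \<Union>E"
  define Uv where "Uv = (\<lambda>v. {i. i < t \<and> v i \<in> Vs})"
  have finV: "finite Vs" using fin E by (auto simp: Vs_def)
  have finC: "finite (cycles_at n E e)" by (rule finite_cycles_at)
  have w0: "window k t 0 = {..<k}" using t_pos by (auto simp: window_def)
  have eV: "e \<subseteq> Vs" using e by (auto simp: Vs_def)
  have U0: "{..<k} \<subseteq> Uv v \<and> Uv v \<subseteq> {..<t}" if "v \<in> cycles_at n E e" for v
  proof -
    have "v ` {..<k} = e" using that by (simp add: cycles_at_def edge_def w0)
    then show ?thesis using eV t_pos(3) by (auto simp: Uv_def)
  qed
  have r: "1 \<le> card (new_idx E v)" "card (Uv v) < t \<Longrightarrow> t - 1 - (card (Uv v) - k) \<le> card (new_idx E v)" if v: "v \<in> cycles_at n E e" for v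
  proof -
    have finN: "finite (new_idx E v)" by (simp add: new_idx_def)
    show "1 \<le> card (new_idx E v)" using v finN by (simp add: cycles_at_def card_gt_0_iff Suc_le_eq)
    \<comment> \<open>I consists of the old cycle edges. It contains 0, since the anchor e belongs
      to E, and its windows lie in the old positions.\<close>
    define I where "I = {..<t} - new_idx E v"
    have I0: "0 \<in> I" using v e t_pos by (auto simp: I_def new_idx_def cycles_at_def)
    have sub: "(\<Union>i\<in>I. window k t i) \<subseteq> Uv v"
    proof
      fix x assume "x \<in> (\<Union>i\<in>I. window k t i)"
      then obtain i where i: "i \<in> I" "x \<in> window k t i" by auto
      then have "edge v i \<in> E" by (auto simp: I_def new_idx_def)
      moreover have "v x \<in> edge v i" using i by (auto simp: edge_def)
      ultimately show "x \<in> Uv v" using window_subset[OF t_pos(1), of k i] i by (auto simp: Uv_def Vs_def)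
    qed
    have "I \<subseteq> {..<t}" "I \<noteq> {}" using I0 by (auto simp: I_def)
    then have "min t (card I + k - 1) \<le> card (\<Union>i\<in>I. window k t i)"
      using t_pos(4) by (rule card_Union_window)
    also have "\<dots> \<le> card (Uv v)" using sub by (intro card_mono) (auto simp: Uv_def)
    finally have 1: "min t (card I + k - 1) \<le> card (Uv v)" .
    have "card I = t - card (new_idx E v)"
      unfolding I_def using finN by (subst card_Diff_subset) (auto simp: new_idx_def)
    moreover have "card (new_idx E v) \<le> t" using card_mono[of "{..<t}" "new_idx E v"] by (auto simp: new_idx_def)
    ultimately show "t - 1 - (card (Uv v) - k) \<le> card (new_idx E v)" if "card (Uv v) < t"
      using 1 that t_pos(4) by (simp add: min_def split: if_splits)
  qed
  have count: "real (card {v\<in>cycles_at n E e. Uv v = U}) \<le> real k ^ k * M ^ (card U - k) * real n ^ (t - card U)"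
    if U: "{..<k} \<subseteq> U" "U \<subseteq> {..<t}" for U
  proof -
    have finU: "finite U" using U finite_subset by blast
    let ?f = "\<lambda>i. if i < k then e else if i \<in> U then Vs else {..<n}"
    have fine: "finite e" using E e by blast
    have "{v\<in>cycles_at n E e. Uv v = U} \<subseteq> PiE {..<t} ?f"
    proof
      fix v assume v: "v \<in> {v\<in>cycles_at n E e. Uv v = U}"
      then have im: "v ` {..<k} = e" by (simp add: cycles_at_def edge_def w0)
      show "v \<in> PiE {..<t} ?f"
      proof (rule PiE_I)
        fix i assume i: "i \<in> {..<t}"
        show "v i \<in> ?f i" using v im i by (auto simp: cycles_at_def Uv_def PiE_iff)
      qed (use v in \<open>auto simp: cycles_at_def PiE_iff extensional_def\<close>)
    qed
    moreover have "finite (PiE {..<t} ?f)" using fine finV by (intro finite_PiE) auto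
    ultimately have "card {v\<in>cycles_at n E e. Uv v = U} \<le> card (PiE {..<t} ?f)" by (intro card_mono)
    also have "\<dots> = (\<Prod>i<t. card (?f i))" by (simp add: card_PiE)
    also have "\<dots> = (\<Prod>i\<in>{..<k}. card (?f i)) * ((\<Prod>i\<in>U - {..<k}. card (?f i)) * (\<Prod>i\<in>{..<t} - U. card (?f i)))"
    proof -
      have "(\<Prod>i<t. card (?f i)) = (\<Prod>i\<in>{..<t} - U. card (?f i)) * (\<Prod>i\<in>U. card (?f i))"
        using U(2) by (rule prod.subset_diff) simp
      also have "(\<Prod>i\<in>U. card (?f i)) = (\<Prod>i\<in>U - {..<k}. card (?f i)) * (\<Prod>i\<in>{..<k}. card (?f i))"
        using U(1) finU by (rule prod.subset_diff)
      finally show ?thesis by (simp only: mult_ac)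
    qed
    also have "(\<Prod>i\<in>{..<k}. card (?f i)) = k ^ k" using e by simp
    also have "(\<Prod>i\<in>U - {..<k}. card (?f i)) = card Vs ^ (card U - k)"
    proof -
      have "(\<Prod>i\<in>U - {..<k}. card (?f i)) = (\<Prod>i\<in>U - {..<k}. card Vs)" by (rule prod.cong) auto
      then show ?thesis using U finU by (simp add: card_Diff_subset)
    qed
    also have "(\<Prod>i\<in>{..<t} - U. card (?f i)) = n ^ (t - card U)"
    proof -
      have "(\<Prod>i\<in>{..<t} - U. card (?f i)) = (\<Prod>i\<in>{..<t} - U. n)" using U by (intro prod.cong) auto
      then show ?thesis using U finU by (simp add: card_Diff_subset)
    qed
    finally have "real (card {v\<in>cycles_at n E e. Uv v = U}) \<le> real (k ^ k * (card Vs ^ (card U - k) * n ^ (t - card U)))"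
      by (rule of_nat_mono)
    also have "\<dots> = real k ^ k * real (card Vs) ^ (card U - k) * real n ^ (t - card U)" by (simp add: mult.assoc)
    also have "\<dots> \<le> real k ^ k * M ^ (card U - k) * real n ^ (t - card U)"
      using M by (intro mult_right_mono mult_left_mono power_mono) (auto simp: Vs_def)
    finally show ?thesis .
  qed
  have "(\<Sum>v\<in>cycles_at n E e. q ^ card (new_idx E v))
     = (\<Sum>U\<in>{U. {..<k} \<subseteq> U \<and> U \<subseteq> {..<t}}. \<Sum>v\<in>{v\<in>cycles_at n E e. Uv v = U}. q ^ card (new_idx E v))"
    using finC U0 by (intro sum.group[symmetric]) auto
  also have "\<dots> \<le> (\<Sum>U\<in>{U. {..<k} \<subseteq> U \<and> U \<subseteq> {..<t}}. real k ^ k * (A + M ^ t * B))"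
  proof (rule sum_mono)
    fix U assume U: "U \<in> {U. {..<k} \<subseteq> U \<and> U \<subseteq> {..<t}}"
    then have finU: "finite U" using finite_subset by blast
    have cU: "k \<le> card U" "card U \<le> t"
      using U finU card_mono[of U "{..<k}"] card_mono[of "{..<t}" U] by auto
    \<comment> \<open>If all vertices are old the window bound says nothing, and only the one new
      edge demanded in \<open>cycles_at\<close> is available.\<close>
    define r0 where "r0 = (if card U < t then t - 1 - (card U - k) else 1)"
    have "(\<Sum>v\<in>{v\<in>cycles_at n E e. Uv v = U}. q ^ card (new_idx E v)) \<le> (\<Sum>v\<in>{v\<in>cycles_at n E e. Uv v = U}. q ^ r0)"
      using r q by (intro sum_mono power_decreasing) (auto simp: r0_def)
    also have "\<dots> = real (card {v\<in>cycles_at n E e. Uv v = U}) * q ^ r0" by simp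
    also have "\<dots> \<le> (real k ^ k * M ^ (card U - k) * real n ^ (t - card U)) * q ^ r0"
      using count U q by (intro mult_right_mono) auto
    also have "\<dots> = real k ^ k * (M ^ (card U - k) * (real n ^ (t - card U) * q ^ r0))" by (simp add: mult.assoc)
    also have "\<dots> \<le> real k ^ k * (A + M ^ t * B)"
    proof (rule mult_left_mono)
      consider "card U = k" | "k < card U" "card U < t" | "card U = t" "k < t" using cU by linarith
      then show "M ^ (card U - k) * (real n ^ (t - card U) * q ^ r0) \<le> A + M ^ t * B"
      proof cases
        case 1
        have "k < t" using k4 tk by linarith
        then have "r0 = t - 1" using 1 by (simp add: r0_def)
        then have "M ^ (card U - k) * (real n ^ (t - card U) * q ^ r0) \<le> A" using A 1 by simp
        moreover have "0 \<le> M ^ t * B" using M AB by simp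
        ultimately show ?thesis by linarith
      next
        case 2
        have "q ^ r0 \<le> q ^ (t - 1 - (card U - k))" using 2 by (simp add: r0_def)
        then have "real n ^ (t - card U) * q ^ r0 \<le> B" using B(1)[OF 2] by (meson mult_left_mono of_nat_0_le_iff order_trans zero_le_power)
        then have "M ^ (card U - k) * (real n ^ (t - card U) * q ^ r0) \<le> M ^ t * B"
          using M AB q cU by (intro mult_mono power_increasing) auto
        then show ?thesis using AB by linarith
      next
        case 3
        have "q ^ r0 \<le> q ^ 1" using 3 by (simp add: r0_def)
        then have "real n ^ (t - card U) * q ^ r0 \<le> B" using B(2) 3 by simp
        then have "M ^ (card U - k) * (real n ^ (t - card U) * q ^ r0) \<le> M ^ t * B"
          using M AB q cU by (intro mult_mono power_increasing) auto
        then show ?thesis using AB by linarith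
      qed
    qed simp
    finally show "(\<Sum>v\<in>{v\<in>cycles_at n E e. Uv v = U}. q ^ card (new_idx E v)) \<le> real k ^ k * (A + M ^ t * B)" .
  qed
  also have "\<dots> = real (card {U. {..<k} \<subseteq> U \<and> U \<subseteq> {..<t}}) * (real k ^ k * (A + M ^ t * B))" by simp
  also have "\<dots> \<le> 2 ^ t * (real k ^ k * (A + M ^ t * B))"
  proof (rule mult_right_mono)
    have "card {U. {..<k} \<subseteq> U \<and> U \<subseteq> {..<t}} \<le> card (Pow {..<t})" by (intro card_mono) auto
    then have "card {U. {..<k} \<subseteq> U \<and> U \<subseteq> {..<t}} \<le> 2 ^ t" by (simp add: card_Pow)
    then have "real (card {U. {..<k} \<subseteq> U \<and> U \<subseteq> {..<t}}) \<le> real (2 ^ t)" by (rule of_nat_mono)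
    then show "real (card {U. {..<k} \<subseteq> U \<and> U \<subseteq> {..<t}}) \<le> 2 ^ t" by (simp only: of_nat_power of_nat_numeral)
  qed (use AB M in auto)
  finally show ?thesis by (simp add: mult.assoc)
qed

text \<open>A new apex has n choices and creates two new edges; an old apex has only as many choices
  as E has vertices, and then one new edge is enough.\<close>

lemma sum_tri_succ:
  fixes p :: real
  assumes fin: "finite E" and E: "\<And>f. f \<in> E \<Longrightarrow> finite f \<and> card f = k" and p: "0 \<le> p" "p \<le> 1"
  shows "(\<Sum>X\<in>tri_succ n E. p ^ card X)
    \<le> p ^ card E * (real (card E) * real k ^ 2 * (real n * p^2 + real (card (\<Union>E)) * p))"
proof -
  let ?J = "{(g, z, a, b). g \<in> E \<and> z \<in> {..<n} \<and> a \<in> g \<and> b \<in> g \<and> z \<notin> g \<and> a \<noteq> b \<and> \<not> {insert z g - {a}, insert z g - {b}} \<subseteq> E}"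
  let ?I = "SIGMA g:E. {..<n} \<times> g \<times> g"
  define Vs where "Vs = \<Union>E"
  define w where "w = (\<lambda>z. if z \<in> Vs then p else p^2)"
  have finI: "finite ?I" using fin E by auto
  have sub: "?J \<subseteq> ?I" by auto
  have finJ: "finite ?J" using sub finI by (rule finite_subset)
  have "(\<Sum>X\<in>tri_succ n E. p ^ card X) \<le> (\<Sum>(g, z, a, b)\<in>?J. p ^ card (E \<union> {g, insert z g - {a}, insert z g - {b}}))"
    unfolding tri_succ_def using sum_image_le[OF finJ, of "\<lambda>X. p ^ card X" "\<lambda>(g, z, a, b). E \<union> {g, insert z g - {a}, insert z g - {b}}"] p
    by (simp add: case_prod_unfold)
  also have "\<dots> \<le> (\<Sum>(g, z, a, b)\<in>?J. p ^ card E * w z)"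
  proof (rule sum_mono)
    fix x assume x: "x \<in> ?J"
    obtain g z a b where gz: "x = (g, z, a, b)" by (metis prod_cases4)
    have J: "g \<in> E" "a \<in> g" "b \<in> g" "z \<notin> g" "a \<noteq> b" "\<not> {insert z g - {a}, insert z g - {b}} \<subseteq> E" using x gz by auto
    let ?T = "{insert z g - {a}, insert z g - {b}}"
    have eq: "E \<union> {g, insert z g - {a}, insert z g - {b}} = E \<union> (?T - E)" using J(1) by auto
    have c: "card (E \<union> (?T - E)) = card E + card (?T - E)" using fin by (intro card_Un_disjoint) auto
    have "p ^ card (?T - E) \<le> w z"
    proof (cases "z \<in> Vs")
      case True
      have "1 \<le> card (?T - E)" using J(6) by (simp add: Suc_le_eq card_gt_0_iff)
      then have "p ^ card (?T - E) \<le> p ^ 1" using p by (intro power_decreasing) auto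
      then show ?thesis using True by (simp add: w_def)
    next
      case False
      have "insert z g - {x} \<notin> E" if "x \<in> g" for x
      proof
        assume "insert z g - {x} \<in> E"
        moreover have "z \<in> insert z g - {x}" using that J(4) by auto
        ultimately show False using False unfolding Vs_def by blast
      qed
      then have "insert z g - {a} \<notin> E" "insert z g - {b} \<notin> E" using J(2,3) by blast+
      then have "?T - E = ?T" by (simp add: insert_Diff_if)
      moreover have "insert z g - {a} \<noteq> insert z g - {b}" using J by auto
      ultimately have "card (?T - E) = 2" by simp
      then show ?thesis using False by (simp add: w_def)
    qed
    then show "(case x of (g, z, a, b) \<Rightarrow> p ^ card (E \<union> {g, insert z g - {a}, insert z g - {b}})) \<le> (case x of (g, z, a, b) \<Rightarrow> p ^ card E * w z)"
      using p unfolding gz prod.case eq c power_add by (intro mult_left_mono) auto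
  qed
  also have "\<dots> \<le> (\<Sum>(g, z, a, b)\<in>?I. p ^ card E * w z)"
    using sub finI p by (intro sum_mono2) (auto simp: w_def)
  also have "\<dots> = (\<Sum>g\<in>E. \<Sum>(z, a, b)\<in>{..<n} \<times> g \<times> g. p ^ card E * w z)"
    using fin E by (subst sum.Sigma) (auto simp: case_prod_unfold)
  also have "\<dots> = (\<Sum>g\<in>E. (\<Sum>z<n. p ^ card E * w z) * (real k * real k))"
  proof (rule sum.cong)
    fix g assume g: "g \<in> E"
    have "(\<Sum>(z, a, b)\<in>{..<n} \<times> g \<times> g. p ^ card E * w z) = (\<Sum>z<n. \<Sum>ab\<in>g \<times> g. p ^ card E * w z)"
      by (subst sum.cartesian_product) (auto intro: sum.cong)
    also have "\<dots> = (\<Sum>z<n. p ^ card E * w z * (real k * real k))"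
      using E[OF g] by (simp add: card_cartesian_product mult_ac)
    also have "\<dots> = (\<Sum>z<n. p ^ card E * w z) * (real k * real k)" by (rule sum_distrib_right[symmetric])
    finally show "(\<Sum>(z, a, b)\<in>{..<n} \<times> g \<times> g. p ^ card E * w z) = (\<Sum>z<n. p ^ card E * w z) * (real k * real k)" .
  qed simp
  also have "\<dots> = real (card E) * real k ^ 2 * p ^ card E * (\<Sum>z<n. w z)"
  proof -
    have "(\<Sum>z<n. p ^ card E * w z) = p ^ card E * (\<Sum>z<n. w z)" by (simp add: sum_distrib_left)
    then show ?thesis by (simp only: sum_constant power2_eq_square mult_ac)
  qed
  finally have 1: "(\<Sum>X\<in>tri_succ n E. p ^ card X) \<le> real (card E) * real k ^ 2 * p ^ card E * (\<Sum>z<n. w z)" .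
  have 2: "(\<Sum>z<n. w z) \<le> real n * p^2 + real (card Vs) * p"
  proof -
    have "(\<Sum>z<n. w z) \<le> (\<Sum>z<n. p^2 + (if z \<in> Vs then p else 0))" using p by (intro sum_mono) (auto simp: w_def)
    also have "\<dots> = real n * p^2 + real (card ({..<n} \<inter> Vs)) * p" by (simp add: sum.distrib sum.If_cases)
    also have "\<dots> \<le> real n * p^2 + real (card Vs) * p"
      using fin E p by (intro add_left_mono mult_right_mono of_nat_mono card_mono) (auto simp: Vs_def)
    finally show ?thesis .
  qed
  have "real (card E) * real k ^ 2 * p ^ card E * (\<Sum>z<n. w z) \<le> real (card E) * real k ^ 2 * p ^ card E * (real n * p^2 + real (card Vs) * p)"
    using 2 p by (intro mult_left_mono) auto
  then show ?thesis using 1 unfolding Vs_def by (simp only: mult_ac)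
qed

end

section \<open>Sparse hypergraphs are colourable\<close>

lemma card_nsets_le:
  assumes "finite U" shows "card ([U]\<^bsup>k\<^esup>) \<le> card U ^ k"
proof -
  have "[U]\<^bsup>k\<^esup> = {A. A \<subseteq> U \<and> card A = k}" using assms finite_subset by (auto simp: nsets_def)
  then have "card ([U]\<^bsup>k\<^esup>) = card U choose k" using assms by (simp add: n_subsets)
  then show ?thesis by (cases "k \<le> card U") (simp_all add: binomial_le_pow binomial_eq_0)
qed

context kt
begin

definition low :: "nat set set \<Rightarrow> bool" where
  "low E \<longleftrightarrow> (\<exists>y\<in>\<Union>E. card {e\<in>E. y \<in> e} \<le> degree_bound k)"

text \<open>The vertex of small degree is chosen as a function of E alone. The exploration therefore
  branches over the new edge sets only and not over the vertex.\<close>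

definition low_edges :: "nat set set \<Rightarrow> nat set set" where
  "low_edges E = {e\<in>E. (SOME y. y \<in> \<Union>E \<and> card {e\<in>E. y \<in> e} \<le> degree_bound k) \<in> e}"

definition succs :: "nat \<Rightarrow> nat set set \<Rightarrow> nat set set set" where
  "succs n E = (tri_succ n E \<union> (\<Union>e\<in>low_edges E. cyc_succ n E e)) \<inter> Pow ([{..<n}]\<^bsup>k\<^esup>)"

lemma low_edgesE:
  assumes "low E"
  obtains y where "low_edges E = {e\<in>E. y \<in> e}" "y \<in> \<Union>E" "card (low_edges E) \<le> degree_bound k"
proof -
  define y where "y = (SOME y. y \<in> \<Union>E \<and> card {e\<in>E. y \<in> e} \<le> degree_bound k)"
  have "\<exists>y. y \<in> \<Union>E \<and> card {e\<in>E. y \<in> e} \<le> degree_bound k" using assms unfolding low_def by blast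
  then have "y \<in> \<Union>E \<and> card {e\<in>E. y \<in> e} \<le> degree_bound k" unfolding y_def by (rule someI_ex)
  moreover have "low_edges E = {e\<in>E. y \<in> e}" by (simp add: low_edges_def y_def)
  ultimately show thesis using that[of y] by simp
qed

lemma edge_rotate: "edge (\<lambda>j. v ((s + j) mod t)) i = edge v ((s + i) mod t)"
  unfolding edge_def window_def image_image by (simp add: mod_simps add.assoc)

lemma cyc_rotate:
  assumes "inj_on v {..<t}" "s < t"
  shows "inj_on (\<lambda>j. v ((s + j) mod t)) {..<t}" "cyc k t (\<lambda>j. v ((s + j) mod t)) = cyc k t v"
proof -
  have inj: "inj_on (\<lambda>j. (s + j) mod t) {..<t}" using inj_on_shift[of s t 0] by (simp add: atLeast0LessThan)
  have im: "(\<lambda>j. (s + j) mod t) ` {..<t} = {..<t}"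
  proof (rule card_seteq)
    show "(\<lambda>j. (s + j) mod t) ` {..<t} \<subseteq> {..<t}" using t_pos by auto
    show "card {..<t} \<le> card ((\<lambda>j. (s + j) mod t) ` {..<t})" using inj by (simp add: card_image)
  qed simp
  show "inj_on (\<lambda>j. v ((s + j) mod t)) {..<t}"
    using comp_inj_on[OF inj, of v] assms(1) im by (simp add: o_def)
  have "cyc k t (\<lambda>j. v ((s + j) mod t)) = (\<lambda>i. edge v ((s + i) mod t)) ` {..<t}"
    by (simp add: cyc_eq edge_rotate)
  also have "\<dots> = edge v ` (\<lambda>j. (s + j) mod t) ` {..<t}" by (simp add: image_image)
  finally show "cyc k t (\<lambda>j. v ((s + j) mod t)) = cyc k t v" by (simp add: im cyc_eq)
qed

text \<open>In a class of least size every edge is there because of some triangle that only this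
  edge meets. These private triangles drive both statements: they hang on the cycle edges in the
  exploration and on the fingerprint edges in the container argument.\<close>

lemma minimal_colouring:
  assumes "colourable k t G" "finite G"
  obtains B where "B \<subseteq> G" "\<And>T. is_tri k T \<Longrightarrow> T \<subseteq> G \<Longrightarrow> T \<inter> B \<noteq> {}" "\<And>C. is_cyc k t C \<Longrightarrow> \<not> C \<subseteq> B"
    "\<And>f. f \<in> B \<Longrightarrow> \<exists>T. is_tri k T \<and> T \<subseteq> G \<and> T \<inter> B = {f}"
proof -
  define Q where "Q = (\<lambda>B. B \<subseteq> G \<and> (\<forall>T. is_tri k T \<and> T \<subseteq> G \<longrightarrow> T \<inter> B \<noteq> {}) \<and> (\<forall>C. is_cyc k t C \<longrightarrow> \<not> C \<subseteq> B))"
  have "\<exists>B. Q B" using assms(1) unfolding colourable_def Q_def by blast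
  then obtain B where B: "Q B" "\<And>B'. Q B' \<Longrightarrow> card B \<le> card B'" using ex_has_least_nat[of Q _ card] by blast
  have QB: "B \<subseteq> G" "\<And>T. is_tri k T \<Longrightarrow> T \<subseteq> G \<Longrightarrow> T \<inter> B \<noteq> {}" "\<And>C. is_cyc k t C \<Longrightarrow> \<not> C \<subseteq> B"
    using B(1) unfolding Q_def by blast+
  show thesis
  proof (rule that[OF QB])
    fix f assume f: "f \<in> B"
    have "card (B - {f}) < card B" using f finite_subset[OF QB(1) assms(2)] by (intro psubset_card_mono) auto
    then have "\<not> Q (B - {f})" using B(2)[of "B - {f}"] by linarith
    moreover have "B - {f} \<subseteq> G" "\<And>C. is_cyc k t C \<Longrightarrow> \<not> C \<subseteq> B - {f}" using QB by blast+
    ultimately obtain T where T: "is_tri k T" "T \<subseteq> G" "T \<inter> (B - {f}) = {}" unfolding Q_def by blast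
    then have "T \<inter> B = {f}" using QB(2)[OF T(1,2)] by blast
    then show "\<exists>T. is_tri k T \<and> T \<subseteq> G \<and> T \<inter> B = {f}" using T by blast
  qed
qed

text \<open>If no triangle of G straddles E, the edges L at the chosen vertex can be deleted, the
  rest coloured by minimality, and L coloured locally. As G is not colourable, the class B of this
  colouring must contain a cycle; the local colouring excludes a cycle inside E, and the cycle edges
  outside E carry their private triangles.\<close>

lemma succ_exists:
  assumes G: "G \<subseteq> [{..<n}]\<^bsup>k\<^esup>" and nc: "\<not> colourable k t G"
    and min: "\<And>G'. G' \<subset> G \<Longrightarrow> colourable k t G'" and E: "E \<subseteq> G" "low E"
  shows "\<exists>E'\<in>succs n E. E' \<subseteq> G"
proof -
  have finG: "finite G" using G finite_imp_finite_nsets finite_subset by blast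
  have Gk: "finite e" "card e = k" "e \<subseteq> {..<n}" if "e \<in> G" for e using that G by (auto simp: nsets_def)
  obtain y where y: "low_edges E = {e\<in>E. y \<in> e}" "y \<in> \<Union>E" "card (low_edges E) \<le> degree_bound k"
    by (rule low_edgesE[OF E(2)])
  define L where "L = low_edges E"
  have LE: "L \<subseteq> E" "L \<noteq> {}" using y by (auto simp: L_def)
  show ?thesis
  proof (cases "\<exists>T. is_tri k T \<and> T \<subseteq> G \<and> T \<inter> E \<noteq> {} \<and> \<not> T \<subseteq> E")
    case True
    then obtain T g where T: "is_tri k T" "T \<subseteq> G" "g \<in> T" "g \<in> E" "\<not> T \<subseteq> E" by blast
    obtain z a b where zab: "finite g" "card g = k" "z \<notin> g" "a \<in> g" "b \<in> g" "a \<noteq> b"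
      "T = {g, insert z g - {a}, insert z g - {b}}" by (rule is_triE[OF T(1,3)])
    have "insert z g - {a} \<in> G" using zab(7) T(2) by blast
    then have zn: "z \<in> {..<n}" using Gk(3) zab(3,4) by blast
    have "\<not> {insert z g - {a}, insert z g - {b}} \<subseteq> E" using T zab(7) by auto
    then have "E \<union> T \<in> tri_succ n E"
      unfolding tri_succ_def using zab zn T(4) by (intro image_eqI[of _ _ "(g, z, a, b)"]) auto
    moreover have "E \<union> T \<subseteq> G" using E T by blast
    ultimately show ?thesis using G unfolding succs_def by blast
  next
    case full: False
    have finL: "finite L" using LE E finG by (meson finite_subset)
    have cL: "card L \<le> degree_bound k" using y by (simp add: L_def)
    have Lk: "finite e \<and> card e = k" if "e \<in> L" for e using that LE E Gk by blast
    obtain R where R: "R \<subseteq> L" "\<And>e e'. e \<in> R \<Longrightarrow> e' \<in> R \<Longrightarrow> e \<noteq> e' \<Longrightarrow> card (e \<inter> e') \<noteq> k - 1"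
      "\<And>F. (\<And>m. m < k \<Longrightarrow> F m \<in> L - R) \<Longrightarrow>
         (\<And>m m'. m \<le> m' \<Longrightarrow> m' < k \<Longrightarrow> card (F m \<inter> F m') = k - (m' - m)) \<Longrightarrow> False"
    proof (rule local_colouring[OF k4 finL cL Lk])
      fix R assume R: "R \<subseteq> L" "\<And>e e'. e \<in> R \<Longrightarrow> e' \<in> R \<Longrightarrow> e \<noteq> e' \<Longrightarrow> card (e \<inter> e') \<noteq> k - 1"
        "\<And>F. (\<And>m. m < k \<Longrightarrow> F m \<in> L - R) \<Longrightarrow>
         (\<And>m m'. m \<le> m' \<Longrightarrow> m' < k \<Longrightarrow> card (F m \<inter> F m') = k - (m' - m)) \<Longrightarrow> False"
      show thesis by (rule that, fact R(1), fact R(2), fact R(3))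
    qed
    have "G - L \<subset> G" using LE E by blast
    then have col0: "colourable k t (G - L)" by (rule min)
    have fin0: "finite (G - L)" using finG by simp
    obtain B0 where B0: "B0 \<subseteq> G - L" "\<And>T. is_tri k T \<Longrightarrow> T \<subseteq> G - L \<Longrightarrow> T \<inter> B0 \<noteq> {}"
      "\<And>C. is_cyc k t C \<Longrightarrow> \<not> C \<subseteq> B0" "\<And>f. f \<in> B0 \<Longrightarrow> \<exists>T. is_tri k T \<and> T \<subseteq> G - L \<and> T \<inter> B0 = {f}"
    proof (rule minimal_colouring[OF col0 fin0])
      fix B0 assume H: "B0 \<subseteq> G - L" "\<And>T. is_tri k T \<Longrightarrow> T \<subseteq> G - L \<Longrightarrow> T \<inter> B0 \<noteq> {}"
      "\<And>C. is_cyc k t C \<Longrightarrow> \<not> C \<subseteq> B0" "\<And>f. f \<in> B0 \<Longrightarrow> \<exists>T. is_tri k T \<and> T \<subseteq> G - L \<and> T \<inter> B0 = {f}"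
      show thesis by (rule that, fact H(1), fact H(2), fact H(3), fact H(4))
    qed
    \<comment> \<open>Triangles that meet L lie inside E and have two edges in L at distance 1, not
      both in R; so the only way for B to fail is a cycle.\<close>
    define B where "B = B0 \<union> (L - R)"
    have BG: "B \<subseteq> G" using B0 LE E by (auto simp: B_def)
    have hit: "T \<inter> B \<noteq> {}" if T: "is_tri k T" "T \<subseteq> G" for T
    proof (cases "T \<inter> L = {}")
      case True
      then have "T \<subseteq> G - L" using T by blast
      then show ?thesis using B0(2)[OF T(1)] by (auto simp: B_def)
    next
      case False
      then obtain g where g: "g \<in> T" "g \<in> L" by blast
      then have yg: "y \<in> g" "g \<in> E" using y by (auto simp: L_def)
      have TE: "T \<subseteq> E" using full T g yg by blast
      obtain g1 g2 where g12: "g1 \<in> T" "g2 \<in> T" "g1 \<noteq> g2" "y \<in> g1" "y \<in> g2" "card (g1 \<inter> g2) = k - 1"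
        using is_tri_two_at_vertex[OF T(1) yg(1) g(1)] by blast
      then have "g1 \<in> L" "g2 \<in> L" using TE y by (auto simp: L_def)
      moreover have "\<not> (g1 \<in> R \<and> g2 \<in> R)" using R(2)[of g1 g2] g12 by blast
      ultimately show ?thesis using g12 by (auto simp: B_def)
    qed
    obtain C where C: "is_cyc k t C" "C \<subseteq> B"
      using nc hit BG unfolding colourable_def by blast
    have "C \<inter> (L - R) \<noteq> {}" using B0(3)[OF C(1)] C(2) by (auto simp: B_def)
    then obtain e where e: "e \<in> C" "e \<in> L" by blast
    have ye: "y \<in> e" "e \<in> E" using e y by (auto simp: L_def)
    obtain v0 where v0: "inj_on v0 {..<t}" "C = cyc k t v0" using C(1) unfolding is_cyc_def by blast
    obtain s where s: "s < t" "e = edge v0 s" using e v0 by (auto simp: cyc_eq)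
    define v1 where "v1 = (\<lambda>j. v0 ((s + j) mod t))"
    have v1: "inj_on v1 {..<t}" "cyc k t v1 = C" unfolding v1_def using cyc_rotate[OF v0(1) s(1)] v0(2) by auto
    have e1: "edge v1 0 = e" unfolding v1_def edge_rotate using s by simp
    define v where "v = restrict v1 {..<t}"
    have edge_v: "edge v i = edge v1 i" for i
      unfolding edge_def v_def using window_subset[OF t_pos(1)] by (intro image_cong) auto
    have v: "inj_on v {..<t}" "cyc k t v = C" "edge v 0 = e"
      using v1 e1 by (auto simp: v_def inj_on_def cyc_eq edge_v[unfolded v_def])
    have Cn: "\<Union>C \<subseteq> {..<n}" using C(2) BG Gk(3) by blast
    have vn: "v \<in> PiE {..<t} (\<lambda>_. {..<n})"
    proof -
      have "v ` {..<t} \<subseteq> {..<n}" using Union_cyc[OF t_pos(4), of t v] v(2) Cn by simp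
      then show ?thesis by (auto simp: PiE_iff v_def)
    qed
    \<comment> \<open>A cycle inside E would have its k edges at y in L - R, an isometric path that
      R was chosen to prevent.\<close>
    have notE: "\<not> C \<subseteq> E"
    proof
      assume CE: "C \<subseteq> E"
      obtain F where F: "\<And>m. m < k \<Longrightarrow> F m \<in> C" "\<And>m. m < k \<Longrightarrow> y \<in> F m"
        "\<And>m m'. m \<le> m' \<Longrightarrow> m' < k \<Longrightarrow> card (F m \<inter> F m') = k - (m' - m)"
        using cyc_edges_at_vertex[OF v0(1) tk t_pos(4), of e y] e(1) ye(1) v0(2) by metis
      have "F m \<in> L - R" if "m < k" for m
      proof -
        have "F m \<in> L" using F(1,2)[OF that] CE y by (auto simp: L_def)
        moreover have "F m \<in> B" using F(1)[OF that] C(2) by blast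
        ultimately show ?thesis using B0(1) by (auto simp: B_def)
      qed
      then show False using R(3)[of F] F(3) by blast
    qed
    let ?N = "new_idx E v"
    have N: "?N \<noteq> {}" using notE v(2) by (auto simp: new_idx_def cyc_eq)
    have ex: "\<exists>z \<alpha> \<beta>. z < n \<and> \<alpha> < k \<and> \<beta> < k \<and> z \<notin> edge v i \<and> \<alpha> \<noteq> \<beta> \<and> apexes v i z \<alpha> \<beta> \<inter> (cyc k t v \<union> E) = {}
        \<and> apexes v i z \<alpha> \<beta> \<subseteq> G" if i: "i \<in> ?N" for i
    proof -
      \<comment> \<open>A new cycle edge is outside L, hence in B0, and its private triangle avoids
        E because no triangle straddles E. The triangle lies in G - L and meets B0 in f only, so its
        other edges avoid the cycle.\<close>
      define f where "f = edge v i"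
      have f: "f \<in> C" "f \<notin> E" using i v(2) by (auto simp: new_idx_def cyc_eq f_def)
      then have "f \<in> B0" using C(2) LE by (auto simp: B_def)
      then obtain T where T: "is_tri k T" "T \<subseteq> G - L" "T \<inter> B0 = {f}" using B0(4) by blast
      then have fT: "f \<in> T" by blast
      obtain z a b where zab: "finite f" "card f = k" "z \<notin> f" "a \<in> f" "b \<in> f" "a \<noteq> b"
        "T = {f, insert z f - {a}, insert z f - {b}}" by (rule is_triE[OF T(1) fT])
      obtain \<alpha> where \<alpha>: "\<alpha> < k" "a = v ((i + \<alpha>) mod t)" using zab(4) by (auto simp: f_def edge_def window_def)
      obtain \<beta> where \<beta>: "\<beta> < k" "b = v ((i + \<beta>) mod t)" using zab(5) by (auto simp: f_def edge_def window_def)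
      have ap: "apexes v i z \<alpha> \<beta> = {insert z f - {a}, insert z f - {b}}" by (simp add: apexes_def f_def \<alpha> \<beta>)
      have zg: "z \<in> g" if "g \<in> apexes v i z \<alpha> \<beta>" for g using that zab(3-5) unfolding ap by blast
      have TG: "T \<subseteq> G" using T(2) by blast
      have apT: "apexes v i z \<alpha> \<beta> \<subseteq> T" unfolding ap zab(7) by blast
      have "apexes v i z \<alpha> \<beta> \<inter> C = {}"
      proof (rule ccontr)
        assume "apexes v i z \<alpha> \<beta> \<inter> C \<noteq> {}"
        then obtain g where g: "g \<in> apexes v i z \<alpha> \<beta>" "g \<in> C" by blast
        then have "g \<in> B" "g \<notin> L" using C(2) apT T(2) by blast+
        then have "g \<in> T \<inter> B0" using g apT by (auto simp: B_def)
        then have "g = f" using T(3) by blast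
        then show False using zg[OF g(1)] zab(3) by blast
      qed
      moreover have "T \<inter> E = {}" using full T(1) TG fT f(2) by blast
      ultimately have disj: "apexes v i z \<alpha> \<beta> \<inter> (cyc k t v \<union> E) = {}" using apT v(2) by blast
      have zn: "z < n"
      proof -
        have "insert z f - {a} \<in> G" using TG zab(7) by blast
        then show ?thesis using Gk(3) zab(3,4) by blast
      qed
      have ne: "\<alpha> \<noteq> \<beta>" using \<alpha> \<beta> zab(6) by blast
      have apG: "apexes v i z \<alpha> \<beta> \<subseteq> G" using apT TG by blast
      show ?thesis using zn \<alpha>(1) \<beta>(1) zab(3)[unfolded f_def] ne disj apG
        by (intro exI[of _ z] exI[of _ \<alpha>] exI[of _ \<beta>] conjI)
    qed
    then obtain z0 \<alpha>0 \<beta>0 where z0: "\<And>i. i \<in> ?N \<Longrightarrow> z0 i < n \<and> \<alpha>0 i < k \<and> \<beta>0 i < k \<and> z0 i \<notin> edge v i \<and> \<alpha>0 i \<noteq> \<beta>0 i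
        \<and> apexes v i (z0 i) (\<alpha>0 i) (\<beta>0 i) \<inter> (cyc k t v \<union> E) = {} \<and> apexes v i (z0 i) (\<alpha>0 i) (\<beta>0 i) \<subseteq> G"
      by metis
    define z \<alpha> \<beta> where "z = restrict z0 ?N" and "\<alpha> = restrict \<alpha>0 ?N" and "\<beta> = restrict \<beta>0 ?N"
    have zN: "z i = z0 i" "\<alpha> i = \<alpha>0 i" "\<beta> i = \<beta>0 i" if "i \<in> ?N" for i using that by (auto simp: z_def \<alpha>_def \<beta>_def)
    have ch: "(z, \<alpha>, \<beta>) \<in> choices n ?N" using z0 by (auto simp: choices_def z_def \<alpha>_def \<beta>_def)
    have ok: "ok_ext E v z \<alpha> \<beta>" unfolding ok_ext_def using z0 zN by simp
    have vc: "v \<in> cycles_at n E e" using vn v N by (simp add: cycles_at_def)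
    have "ext E v z \<alpha> \<beta> \<in> cyc_succ n E e"
      unfolding cyc_succ_def using vc ch ok by (intro image_eqI[of _ _ "(v, z, \<alpha>, \<beta>)"]) auto
    moreover have extG: "ext E v z \<alpha> \<beta> \<subseteq> G"
    proof -
      have "apexes v i (z i) (\<alpha> i) (\<beta> i) \<subseteq> G" if "i \<in> ?N" for i using z0[OF that] zN[OF that] by simp
      then show ?thesis unfolding ext_def using E(1) v(2) C(2) BG by blast
    qed
    ultimately show ?thesis using e(2) G unfolding succs_def L_def by blast
  qed
qed

section \<open>Exploration of minimal obstructions\<close>

primrec reach :: "nat \<Rightarrow> nat \<Rightarrow> nat set set set" where
  "reach n 0 = (\<lambda>e. {e}) ` [{..<n}]\<^bsup>k\<^esup>"
| "reach n (Suc j) = (\<Union>E\<in>reach n j. succs n E)"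

lemma finite_succs: "finite (succs n E)"
  unfolding succs_def by (simp add: finite_imp_finite_nsets)

text \<open>A cycle step adds at most t cycle edges and two edges for each of at most t triangles,
  so at most 3 * t edges; a triangle step adds fewer.\<close>

lemma reach_props:
  assumes "E \<in> reach n j" shows "E \<subseteq> [{..<n}]\<^bsup>k\<^esup>" "E \<noteq> {}" "card E \<le> 3 * t * Suc j"
proof -
  have "E \<subseteq> [{..<n}]\<^bsup>k\<^esup> \<and> E \<noteq> {} \<and> card E \<le> 3 * t * Suc j" using assms
  proof (induction j arbitrary: E)
    case 0
    then show ?case using t_pos by auto
  next
    case (Suc j)
    then obtain E0 where E0: "E0 \<in> reach n j" "E \<in> succs n E0" by auto
    then have IH: "E0 \<subseteq> [{..<n}]\<^bsup>k\<^esup>" "E0 \<noteq> {}" "card E0 \<le> 3 * t * Suc j" using Suc.IH by auto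
    have sub: "E \<subseteq> [{..<n}]\<^bsup>k\<^esup>" using E0 by (auto simp: succs_def)
    have "E0 \<subseteq> E \<and> card E \<le> card E0 + 3 * t"
    proof (cases "E \<in> tri_succ n E0")
      case True
      then obtain g z a b where "E = E0 \<union> {g, insert z g - {a}, insert z g - {b}}" by (auto simp: tri_succ_def)
      moreover have "card {g, insert z g - {a}, insert z g - {b}} \<le> 3" by (simp add: card_insert_if)
      ultimately show ?thesis using card_Un_le[of E0 "{g, insert z g - {a}, insert z g - {b}}"] t_pos by auto
    next
      case False
      then obtain e v z \<alpha> \<beta> where E: "E = ext E0 v z \<alpha> \<beta>" using E0(2) by (auto simp: succs_def cyc_succ_def)
      have N: "new_idx E0 v \<subseteq> {..<t}" by (auto simp: new_idx_def)
      have cN: "card (new_idx E0 v) \<le> t" using card_mono[OF _ N] by simp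
      have "card (\<Union>i\<in>new_idx E0 v. apexes v i (z i) (\<alpha> i) (\<beta> i)) \<le> (\<Sum>i\<in>new_idx E0 v. card (apexes v i (z i) (\<alpha> i) (\<beta> i)))"
        using N finite_subset by (intro card_UN_le) auto
      also have "\<dots> \<le> (\<Sum>i\<in>new_idx E0 v. 2)" by (intro sum_mono) (simp add: apexes_def card_insert_if)
      also have "\<dots> \<le> 2 * t" using cN by simp
      finally have 1: "card (\<Union>i\<in>new_idx E0 v. apexes v i (z i) (\<alpha> i) (\<beta> i)) \<le> 2 * t" .
      have 2: "card (cyc k t v) \<le> t" unfolding cyc_eq using card_image_le[of "{..<t}" "edge v"] by simp
      have "card E \<le> card (E0 \<union> cyc k t v) + card (\<Union>i\<in>new_idx E0 v. apexes v i (z i) (\<alpha> i) (\<beta> i))"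
        unfolding E ext_def by (rule card_Un_le)
      moreover have "card (E0 \<union> cyc k t v) \<le> card E0 + card (cyc k t v)" by (rule card_Un_le)
      ultimately have "card E \<le> card E0 + 3 * t" using 1 2 by linarith
      then show ?thesis unfolding E ext_def by blast
    qed
    then show ?case using IH sub by auto
  qed
  then show "E \<subseteq> [{..<n}]\<^bsup>k\<^esup>" "E \<noteq> {}" "card E \<le> 3 * t * Suc j" by auto
qed

lemma finite_reach: "finite (reach n j)"
  by (induction j) (auto simp: finite_succs finite_imp_finite_nsets)

text \<open>M bounds the number of edges and of vertices of E at once, since every edge has k
  vertices. The first summand comes from the triangle steps and the second from the cycle steps,
  taken at each of the few edges at the chosen vertex.\<close>

lemma sum_succs:
  fixes p \<eta> :: real
  assumes E: "E \<subseteq> [{..<n}]\<^bsup>k\<^esup>" "E \<noteq> {}" and b: "real k * real (card E) \<le> M" "1 \<le> M" and p: "0 < p" "p \<le> 1" and n: "1 \<le> n"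
    and np: "1 \<le> real n * p" "1 \<le> real n^2 * p^3" "1 \<le> real n^3 * p^4"
    and q: "real n * p^3 \<le> 1"
    and A: "real n ^ (t - k) * (real n * p^3) ^ (t - 1) \<le> A"
    and B: "\<And>u. k < u \<Longrightarrow> u < t \<Longrightarrow> real n ^ (t - u) * (real n * p^3) ^ (t - 1 - (u - k)) \<le> B" "real n * p^3 \<le> B"
    and low: "low E"
  shows "(\<Sum>X\<in>succs n E. p ^ card X) \<le> p ^ card E * (real k ^ 2 * (M * (real n * p^2) + M^2 * p)
     + real (degree_bound k) * (real (t + 1) * real (2 * t) ^ t * real k ^ (2 * t)) * (2 ^ t * real k ^ k) * (A + M ^ t * B))"
proof -
  define K1 where "K1 = real (t + 1) * real (2 * t) ^ t * real k ^ (2 * t)"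
  have finE: "finite E" using E finite_imp_finite_nsets finite_subset by blast
  have Ek: "finite f \<and> card f = k" if "f \<in> E" for f using that E by (auto simp: nsets_def)
  have q0: "0 \<le> real n * p^3" using p by simp
  have AB: "0 \<le> A" "0 \<le> B"
  proof -
    have "0 \<le> real n ^ (t - k) * (real n * p^3) ^ (t - 1)" using q0 by simp
    then show "0 \<le> A" using A by linarith
    show "0 \<le> B" using q0 B(2) by linarith
  qed
  have cE: "real (card E) \<le> M"
  proof -
    have "real (card E) \<le> real k * real (card E)" using t_pos(4) by (simp add: mult_le_cancel_right1)
    then show ?thesis using b by linarith
  qed
  have UE: "real (card (\<Union>E)) \<le> M"
  proof -
    have "card (\<Union>E) \<le> (\<Sum>e\<in>E. card e)" using card_UN_le[OF finE, of "\<lambda>x. x"] by simp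
    also have "\<dots> = card E * k" using Ek by simp
    finally have "real (card (\<Union>E)) \<le> real (card E * k)" by (rule of_nat_mono)
    also have "\<dots> = real k * real (card E)" by simp
    finally show ?thesis using b by linarith
  qed
  obtain y where y: "low_edges E = {e\<in>E. y \<in> e}" "y \<in> \<Union>E" "card (low_edges E) \<le> degree_bound k"
    by (rule low_edgesE[OF low])
  have finL: "finite (low_edges E)" using y finE by simp
  have fin1: "finite (tri_succ n E)"
  proof -
    have "tri_succ n E \<subseteq> (\<lambda>(g, z, a, b). E \<union> {g, insert z g - {a}, insert z g - {b}}) ` (SIGMA g:E. {..<n} \<times> g \<times> g)"
      unfolding tri_succ_def by (intro image_mono) auto
    then show ?thesis by (rule finite_subset) (use finE Ek in auto)
  qed
  have fin2: "finite (cyc_succ n E e)" for e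
  proof -
    have "cyc_succ n E e \<subseteq> (\<lambda>(v, z, \<alpha>, \<beta>). ext E v z \<alpha> \<beta>) ` (SIGMA v:cycles_at n E e. choices n (new_idx E v))"
      unfolding cyc_succ_def by (intro image_mono) auto
    moreover have "finite (SIGMA v:cycles_at n E e. choices n (new_idx E v))"
      using finite_cycles_at finite_choices by (auto simp: new_idx_def)
    ultimately show ?thesis by (meson finite_imageI finite_subset)
  qed
  have "(\<Sum>X\<in>succs n E. p ^ card X) \<le> (\<Sum>X\<in>tri_succ n E \<union> (\<Union>e\<in>low_edges E. cyc_succ n E e). p ^ card X)"
    unfolding succs_def using fin1 fin2 finL p by (intro sum_mono2) auto
  also have "\<dots> \<le> (\<Sum>X\<in>tri_succ n E. p ^ card X) + (\<Sum>X\<in>(\<Union>e\<in>low_edges E. cyc_succ n E e). p ^ card X)"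
  proof -
    let ?B = "\<Union>e\<in>low_edges E. cyc_succ n E e"
    have "finite ?B" using fin2 finL by auto
    then have "sum (\<lambda>X. p ^ card X) (tri_succ n E \<union> ?B) + sum (\<lambda>X. p ^ card X) (tri_succ n E \<inter> ?B)
        = sum (\<lambda>X. p ^ card X) (tri_succ n E) + sum (\<lambda>X. p ^ card X) ?B" by (rule sum.union_inter[OF fin1])
    moreover have "0 \<le> sum (\<lambda>X. p ^ card X) (tri_succ n E \<inter> ?B)" using p by (intro sum_nonneg) simp
    ultimately show ?thesis by linarith
  qed
  also have "(\<Sum>X\<in>(\<Union>e\<in>low_edges E. cyc_succ n E e). p ^ card X) \<le> (\<Sum>e\<in>low_edges E. \<Sum>X\<in>cyc_succ n E e. p ^ card X)"
  proof -
    have "(\<Union>e\<in>low_edges E. cyc_succ n E e) = snd ` (SIGMA e:low_edges E. cyc_succ n E e)" by force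
    then have "(\<Sum>X\<in>(\<Union>e\<in>low_edges E. cyc_succ n E e). p ^ card X) \<le> (\<Sum>x\<in>(SIGMA e:low_edges E. cyc_succ n E e). p ^ card (snd x))"
      using sum_image_le[of "SIGMA e:low_edges E. cyc_succ n E e" "\<lambda>X. p ^ card X" snd] fin2 finL p by (simp add: o_def)
    also have "\<dots> = (\<Sum>e\<in>low_edges E. \<Sum>X\<in>cyc_succ n E e. p ^ card X)"
      using fin2 finL by (subst sum.Sigma) (auto simp: case_prod_unfold)
    finally show ?thesis .
  qed
  also have "(\<Sum>e\<in>low_edges E. \<Sum>X\<in>cyc_succ n E e. p ^ card X)
      \<le> (\<Sum>e\<in>low_edges E. p ^ card E * K1 * (2 ^ t * real k ^ k * (A + M ^ t * B)))"
  proof (rule sum_mono)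
    fix e assume e: "e \<in> low_edges E"
    then have eE: "e \<in> E" "card e = k" using y Ek by auto
    have "(\<Sum>X\<in>cyc_succ n E e. p ^ card X) \<le> p ^ card E * K1 * (\<Sum>v\<in>cycles_at n E e. (real n * p^3) ^ card (new_idx E v))"
      unfolding K1_def by (rule sum_cyc_succ[OF finE n p np])
    also have "\<dots> \<le> p ^ card E * K1 * (2 ^ t * real k ^ k * (A + M ^ t * B))"
      using sum_cycles_at[OF finE _ eE q0 q UE b(2) n A B AB] Ek p by (intro mult_left_mono) (auto simp: K1_def)
    finally show "(\<Sum>X\<in>cyc_succ n E e. p ^ card X) \<le> p ^ card E * K1 * (2 ^ t * real k ^ k * (A + M ^ t * B))" .
  qed
  also have "\<dots> \<le> real (degree_bound k) * (p ^ card E * K1 * (2 ^ t * real k ^ k * (A + M ^ t * B)))"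
    using y(3) p AB b by (simp, intro mult_right_mono) (auto simp: K1_def)
  also have "(\<Sum>X\<in>tri_succ n E. p ^ card X) \<le> p ^ card E * (real k ^ 2 * (M * (real n * p^2) + M^2 * p))"
  proof -
    have "(\<Sum>X\<in>tri_succ n E. p ^ card X) \<le> p ^ card E * (real (card E) * real k ^ 2 * (real n * p^2 + real (card (\<Union>E)) * p))"
      using finE Ek p by (intro sum_tri_succ) auto
    also have "\<dots> \<le> p ^ card E * (M * real k ^ 2 * (real n * p^2 + M * p))"
      using cE UE p b by (intro mult_left_mono mult_mono add_left_mono mult_right_mono) auto
    also have "\<dots> = p ^ card E * (real k ^ 2 * (M * (real n * p^2) + M^2 * p))" by (simp add: algebra_simps power2_eq_square)
    finally show ?thesis .
  qed
  finally show ?thesis by (simp add: K1_def algebra_simps)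
qed

lemma not_low_dense:
  assumes "E \<subseteq> [{..<n}]\<^bsup>k\<^esup>" "\<not> low E"
  shows "(degree_bound k + 1) * card (\<Union>E) \<le> k * card E"
proof -
  have finE: "finite E" using assms finite_imp_finite_nsets finite_subset by blast
  have Ek: "E \<subseteq> [\<Union>E]\<^bsup>k\<^esup>" using assms by (auto simp: nsets_def)
  have finU: "finite (\<Union>E)" using finE assms by (auto simp: nsets_def)
  have "(degree_bound k + 1) * card (\<Union>E) = (\<Sum>y\<in>\<Union>E. degree_bound k + 1)" by simp
  also have "\<dots> \<le> (\<Sum>y\<in>\<Union>E. card {e\<in>E. y \<in> e})"
    using assms(2) unfolding low_def by (intro sum_mono) (auto simp: not_le Suc_le_eq)
  also have "\<dots> = k * card E" by (rule sum_degree_points[OF finU Ek])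
  finally show ?thesis .
qed

text \<open>A least non-colourable subset either survives J exploration steps or contains a
  reachable set without a vertex of small degree. Survival is bounded by the total weight of the
  reached sets, which starts from at most n ^ k and shrinks by \<rho> in each step. Sets reached
  before step J have at most 3 * t * J edges, hence at most b vertices, and the dense ones among
  them are handled by a first moment over their number v of vertices.\<close>

lemma prob_not_colourable:
  fixes p \<rho> :: real
  assumes p: "0 \<le> p" "p \<le> p0" "p0 \<le> 1" "0 < p0"
    and step: "\<And>E. E \<subseteq> [{..<n}]\<^bsup>k\<^esup> \<Longrightarrow> E \<noteq> {} \<Longrightarrow> card E \<le> 3 * t * J \<Longrightarrow> low E \<Longrightarrow> (\<Sum>X\<in>succs n E. p0 ^ card X) \<le> \<rho> * p0 ^ card E"
    and rho: "0 \<le> \<rho>" and b: "b = 3 * t * k * J"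
  shows "rPr p ([{..<n}]\<^bsup>k\<^esup>) (\<lambda>X. \<not> colourable k t X)
     \<le> \<rho> ^ J * real n ^ k + (\<Sum>v=1..b. real n ^ v * (real b ^ k * p0) ^ (nat \<lceil>real (degree_bound k + 1) * real v / real k\<rceil>))"
proof -
  let ?\<Omega> = "[{..<n}]\<^bsup>k\<^esup>"
  define d where "d = degree_bound k + 1"
  define mv where "mv = (\<lambda>v::nat. nat \<lceil>real d * real v / real k\<rceil>)"
  have fin\<Omega>: "finite ?\<Omega>" by (simp add: finite_imp_finite_nsets)
  have p1: "p \<le> 1" using p by linarith
  \<comment> \<open>Only sets with a vertex of small degree are extended, because these are the ones
    whose successors \<open>step\<close> controls.\<close>
  define R where "R = rec_nat (reach n 0) (\<lambda>j S. \<Union>E\<in>{E\<in>S. low E}. succs n E)"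
  have R0: "R 0 = reach n 0" and RS: "R (Suc j) = (\<Union>E\<in>{E\<in>R j. low E}. succs n E)" for j by (simp_all add: R_def)
  have Rsub: "R j \<subseteq> reach n j" for j
  proof (induction j)
    case (Suc j)
    then show ?case unfolding RS by auto
  qed (simp only: R0)
  have finR: "finite (R j)" for j using Rsub finite_reach finite_subset by blast
  have W: "(\<Sum>E\<in>R j. p0 ^ card E) \<le> \<rho> ^ j * real n ^ k" if "j \<le> J" for j using that
  proof (induction j)
    case 0
    have "(\<Sum>E\<in>R 0. p0 ^ card E) \<le> (\<Sum>E\<in>reach n 0. 1)" unfolding R0 using p by (intro sum_mono power_le_one) auto
    also have "\<dots> \<le> real (card ?\<Omega>)" using card_image_le[OF fin\<Omega>, of "\<lambda>e. {e}"] by simp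
    also have "\<dots> \<le> real (n ^ k)"
      using card_nsets_le[of "{..<n}" k] by (intro of_nat_mono) simp
    finally show ?case by simp
  next
    case (Suc j)
    have "R (Suc j) = snd ` (SIGMA E:{E\<in>R j. low E}. succs n E)" unfolding RS by force
    then have "(\<Sum>X\<in>R (Suc j). p0 ^ card X) \<le> (\<Sum>x\<in>(SIGMA E:{E\<in>R j. low E}. succs n E). p0 ^ card (snd x))"
      using sum_image_le[of "SIGMA E:{E\<in>R j. low E}. succs n E" "\<lambda>X. p0 ^ card X" snd] finR finite_succs p by (simp add: o_def)
    also have "\<dots> = (\<Sum>E\<in>{E\<in>R j. low E}. \<Sum>X\<in>succs n E. p0 ^ card X)"
      using finR finite_succs by (subst sum.Sigma) (auto simp: case_prod_unfold)
    also have "\<dots> \<le> (\<Sum>E\<in>{E\<in>R j. low E}. \<rho> * p0 ^ card E)"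
    proof (rule sum_mono)
      fix E assume E: "E \<in> {E\<in>R j. low E}"
      then have Er: "E \<in> reach n j" using Rsub by blast
      have "3 * t * Suc j \<le> 3 * t * J" using Suc.prems by (intro mult_le_mono2) simp
      then show "(\<Sum>X\<in>succs n E. p0 ^ card X) \<le> \<rho> * p0 ^ card E"
        using reach_props[OF Er] E by (intro step) auto
    qed
    also have "\<dots> \<le> (\<Sum>E\<in>R j. \<rho> * p0 ^ card E)" using finR p rho by (intro sum_mono2) auto
    also have "\<dots> = \<rho> * (\<Sum>E\<in>R j. p0 ^ card E)" by (simp add: sum_distrib_left)
    also have "\<dots> \<le> \<rho> * (\<rho> ^ j * real n ^ k)" using Suc rho by (intro mult_left_mono) auto
    finally show ?case by simp
  qed
  have chainR: "(\<exists>E\<in>R j. E \<subseteq> X) \<or> (\<exists>i<j. \<exists>E\<in>reach n i. E \<subseteq> X \<and> \<not> low E)"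
    if X: "\<not> colourable k t X" "X \<subseteq> ?\<Omega>" for X j
  proof -
    have finX: "finite X" using X(2) fin\<Omega> finite_subset by blast
    obtain G where G: "G \<subseteq> X \<and> \<not> colourable k t G" "\<And>G'. G' \<subseteq> X \<and> \<not> colourable k t G' \<Longrightarrow> card G \<le> card G'"
      using ex_has_least_nat[of "\<lambda>G. G \<subseteq> X \<and> \<not> colourable k t G" X card] X(1) by blast
    have min: "colourable k t G'" if G': "G' \<subset> G" for G'
    proof (rule ccontr)
      assume "\<not> colourable k t G'"
      then have "card G \<le> card G'" using G that by blast
      moreover have "card G' < card G" using G' finite_subset[OF _ finX] G by (intro psubset_card_mono) auto
      ultimately show False by simp
    qed
    have GX: "G \<subseteq> ?\<Omega>" using G X(2) by blast
    have "(\<exists>E\<in>R j. E \<subseteq> G) \<or> (\<exists>i<j. \<exists>E\<in>reach n i. E \<subseteq> G \<and> \<not> low E)"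
    proof (induction j)
      case 0
      have "G \<noteq> {}"
      proof
        assume "G = {}"
        have T0: "\<not> T \<subseteq> {}" if "is_tri k T" for T :: "nat set set" using that by (auto simp: is_tri_def)
        have C0: "\<not> C \<subseteq> {}" if C: "is_cyc k t C" for C :: "nat set set"
        proof -
          obtain v where "C = cyc k t v" using C unfolding is_cyc_def by blast
          then have "v ` window k t 0 \<in> C" using t_pos(1) by (auto simp: cyc_def)
          then show ?thesis by blast
        qed
        have "colourable k t ({} :: nat set set)" unfolding colourable_def
        proof (rule exI[of _ "{}"], intro conjI allI impI)
          fix T :: "nat set set" assume "is_tri k T \<and> T \<subseteq> {}"
          then show "T \<inter> {} \<noteq> {}" using T0 by metis
        next
          fix C :: "nat set set" assume "is_cyc k t C"
          then show "\<not> C \<subseteq> {}" by (rule C0)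
        qed (rule subset_refl)
        then show False using G \<open>G = {}\<close> by blast
      qed
      then obtain e where "e \<in> G" by blast
      then have "{e} \<in> R 0" "{e} \<subseteq> G" using GX by (auto simp: R0)
      then show ?case by blast
    next
      case (Suc j)
      then consider E where "E \<in> R j" "E \<subseteq> G" | i E where "i < j" "E \<in> reach n i" "E \<subseteq> G" "\<not> low E" by blast
      then show ?case
      proof cases
        case 1
        show ?thesis
        proof (cases "low E")
          case True
          then obtain E' where "E' \<in> succs n E" "E' \<subseteq> G" using succ_exists[OF GX _ min 1(2)] G by blast
          then show ?thesis using 1 True unfolding RS by blast
        next
          case False
          then show ?thesis using 1 Rsub by blast
        qed
      next
        case 2
        then show ?thesis by (meson less_SucI)
      qed
    qed
    then show ?thesis using G(1) by blast
  qed
  \<comment> \<open>From a dense set only its vertex set and a subset of exactly \<open>mv v\<close>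
    edges are kept. This makes the family easy to count: at most n ^ v vertex sets and at most
    \<open>(b ^ k) ^ mv v\<close> edge sets in each.\<close>
  define \<F> where "\<F> = (\<lambda>v. {A. \<exists>U. U \<subseteq> {..<n} \<and> card U = v \<and> A \<subseteq> [U]\<^bsup>k\<^esup> \<and> card A = mv v})"
  have F\<Omega>: "A \<subseteq> ?\<Omega>" if "A \<in> \<F> v" for A v using that by (fastforce simp: \<F>_def nsets_def)
  have finF: "finite (\<F> v)" for v by (rule finite_subset[of _ "Pow ?\<Omega>"]) (use F\<Omega> fin\<Omega> in auto)
  have dense: "\<exists>v\<in>{1..b}. \<exists>A\<in>\<F> v. A \<subseteq> X" if E: "E \<in> reach n i" "i < J" "E \<subseteq> X" "\<not> low E" for E i X
  proof -
    note rp = reach_props[OF E(1)]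
    have finE: "finite E" using rp fin\<Omega> finite_subset by blast
    define v where "v = card (\<Union>E)"
    have finU: "finite (\<Union>E)" using finE rp(1) by (auto simp: nsets_def)
    have "v \<ge> 1"
    proof -
      obtain e where "e \<in> E" using rp(2) by blast
      then have "card e = k" "e \<subseteq> \<Union>E" using rp(1) by (auto simp: nsets_def)
      then have "k \<le> v" unfolding v_def using finU card_mono by metis
      then show ?thesis using t_pos by linarith
    qed
    moreover have "v \<le> b"
    proof -
      have "v \<le> (\<Sum>e\<in>E. card e)" unfolding v_def using card_UN_le[OF finE, of "\<lambda>x. x"] by simp
      also have "\<dots> = (\<Sum>e\<in>E. k)" using rp(1) by (intro sum.cong) (auto simp: nsets_def)
      also have "\<dots> = card E * k" by simp
      also have "\<dots> \<le> (3 * t * Suc i) * k" using rp(3) by (rule mult_le_mono1)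
      also have "\<dots> \<le> (3 * t * J) * k" using E(2) by (intro mult_le_mono1 mult_le_mono2) simp
      finally show ?thesis by (simp add: b mult_ac)
    qed
    moreover have mvE: "mv v \<le> card E"
    proof -
      have "d * v \<le> k * card E" using not_low_dense[OF rp(1) E(4)] by (simp add: v_def d_def)
      then have "real (d * v) \<le> real (k * card E)" by (rule of_nat_mono)
      then have "real d * real v / real k \<le> real (card E)" using t_pos by (simp add: divide_le_eq mult_ac)
      then show ?thesis unfolding mv_def by (simp add: nat_le_iff ceiling_le_iff)
    qed
    obtain A where A: "A \<subseteq> E" "card A = mv v" using obtain_subset_with_card_n[OF mvE] by metis
    moreover have "A \<in> \<F> v"
    proof -
      have "\<Union>E \<subseteq> {..<n}" "A \<subseteq> [\<Union>E]\<^bsup>k\<^esup>" using rp(1) A by (auto simp: nsets_def)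
      then show ?thesis using A unfolding \<F>_def v_def by blast
    qed
    ultimately show ?thesis using E(3) by (meson atLeastAtMost_iff order_trans)
  qed
  have Fcount: "(\<Sum>A\<in>\<F> v. p ^ card A) \<le> real n ^ v * (real b ^ k * p0) ^ mv v" if v: "v \<in> {1..b}" for v
  proof -
    have "\<F> v \<subseteq> (\<Union>U\<in>{U. U \<subseteq> {..<n} \<and> card U = v}. {A. A \<subseteq> [U]\<^bsup>k\<^esup> \<and> card A = mv v})" by (auto simp: \<F>_def)
    then have "card (\<F> v) \<le> card (\<Union>U\<in>{U. U \<subseteq> {..<n} \<and> card U = v}. {A. A \<subseteq> [U]\<^bsup>k\<^esup> \<and> card A = mv v})"
    proof (rule card_mono[rotated])
      have "(\<Union>U\<in>{U. U \<subseteq> {..<n} \<and> card U = v}. {A. A \<subseteq> [U]\<^bsup>k\<^esup> \<and> card A = mv v}) \<subseteq> Pow ?\<Omega>"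
      proof
        fix A assume "A \<in> (\<Union>U\<in>{U. U \<subseteq> {..<n} \<and> card U = v}. {A. A \<subseteq> [U]\<^bsup>k\<^esup> \<and> card A = mv v})"
        then obtain U where "U \<subseteq> {..<n}" "A \<subseteq> [U]\<^bsup>k\<^esup>" by blast
        then show "A \<in> Pow ?\<Omega>" using nsets_mono[of U "{..<n}" k] by blast
      qed
      then show "finite (\<Union>U\<in>{U. U \<subseteq> {..<n} \<and> card U = v}. {A. A \<subseteq> [U]\<^bsup>k\<^esup> \<and> card A = mv v})"
        using fin\<Omega> by (meson finite_Pow_iff finite_subset)
    qed
    also have "\<dots> \<le> (\<Sum>U\<in>{U. U \<subseteq> {..<n} \<and> card U = v}. card {A. A \<subseteq> [U]\<^bsup>k\<^esup> \<and> card A = mv v})"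
      by (rule card_UN_le) simp
    also have "\<dots> \<le> (\<Sum>U\<in>{U. U \<subseteq> {..<n} \<and> card U = v}. (b ^ k) ^ mv v)"
    proof (rule sum_mono)
      fix U assume U: "U \<in> {U. U \<subseteq> {..<n} \<and> card U = v}"
      then have finU: "finite U" using finite_subset by blast
      have "card ([U]\<^bsup>k\<^esup>) \<le> v ^ k" using card_nsets_le[OF finU, of k] U by simp
      also have "\<dots> \<le> b ^ k" using v by (intro power_mono) auto
      finally have c: "card ([U]\<^bsup>k\<^esup>) \<le> b ^ k" .
      have "card {A. A \<subseteq> [U]\<^bsup>k\<^esup> \<and> card A = mv v} = card ([U]\<^bsup>k\<^esup>) choose mv v"
        using finite_imp_finite_nsets[OF finU] by (rule n_subsets)
      also have "\<dots> \<le> card ([U]\<^bsup>k\<^esup>) ^ mv v" by (cases "mv v \<le> card ([U]\<^bsup>k\<^esup>)") (simp_all add: binomial_le_pow binomial_eq_0)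
      also have "\<dots> \<le> (b ^ k) ^ mv v" using c by (rule power_mono) simp
      finally show "card {A. A \<subseteq> [U]\<^bsup>k\<^esup> \<and> card A = mv v} \<le> (b ^ k) ^ mv v" .
    qed
    also have "\<dots> = (n choose v) * (b ^ k) ^ mv v" by (simp add: n_subsets)
    also have "\<dots> \<le> n ^ v * (b ^ k) ^ mv v"
      by (rule mult_right_mono) (cases "v \<le> n", simp_all add: binomial_le_pow binomial_eq_0)
    finally have "real (card (\<F> v)) \<le> real (n ^ v * (b ^ k) ^ mv v)" by (rule of_nat_mono)
    then have cF: "real (card (\<F> v)) \<le> real n ^ v * (real b ^ k) ^ mv v" by simp
    have "(\<Sum>A\<in>\<F> v. p ^ card A) = (\<Sum>A\<in>\<F> v. p ^ mv v)" by (rule sum.cong) (auto simp: \<F>_def)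
    also have "\<dots> = real (card (\<F> v)) * p ^ mv v" by simp
    also have "\<dots> \<le> (real n ^ v * (real b ^ k) ^ mv v) * p0 ^ mv v" using cF p by (intro mult_mono power_mono) auto
    also have "\<dots> = real n ^ v * (real b ^ k * p0) ^ mv v" by (simp add: power_mult_distrib)
    finally show ?thesis .
  qed
  have "rPr p ?\<Omega> (\<lambda>X. \<not> colourable k t X)
     \<le> rPr p ?\<Omega> (\<lambda>X. (\<exists>E\<in>R J. E \<subseteq> X) \<or> (\<exists>v\<in>{1..b}. \<exists>A\<in>\<F> v. A \<subseteq> X))"
  proof (rule rPr_mono[OF p(1) p1])
    fix X assume "X \<subseteq> ?\<Omega>" "\<not> colourable k t X"
    then show "(\<exists>E\<in>R J. E \<subseteq> X) \<or> (\<exists>v\<in>{1..b}. \<exists>A\<in>\<F> v. A \<subseteq> X)"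
      using chainR[of X J] dense by blast
  qed
  also have "\<dots> \<le> rPr p ?\<Omega> (\<lambda>X. \<exists>E\<in>R J. E \<subseteq> X) + rPr p ?\<Omega> (\<lambda>X. \<exists>v\<in>{1..b}. \<exists>A\<in>\<F> v. A \<subseteq> X)"
    by (rule rPr_Un[OF p(1) p1])
  also have "rPr p ?\<Omega> (\<lambda>X. \<exists>E\<in>R J. E \<subseteq> X) \<le> (\<Sum>E\<in>R J. p ^ card E)"
    using reach_props(1) Rsub by (intro rPr_first_moment[OF fin\<Omega> p(1) p1 finR]) blast
  also have "\<dots> \<le> (\<Sum>E\<in>R J. p0 ^ card E)" using p by (intro sum_mono power_mono) auto
  also have "\<dots> \<le> \<rho> ^ J * real n ^ k" by (rule W) simp
  also have "rPr p ?\<Omega> (\<lambda>X. \<exists>v\<in>{1..b}. \<exists>A\<in>\<F> v. A \<subseteq> X) \<le> (\<Sum>v=1..b. rPr p ?\<Omega> (\<lambda>X. \<exists>A\<in>\<F> v. A \<subseteq> X))"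
    by (rule rPr_Union[OF p(1) p1]) simp
  also have "\<dots> \<le> (\<Sum>v=1..b. real n ^ v * (real b ^ k * p0) ^ mv v)"
  proof (rule sum_mono)
    fix v assume v: "v \<in> {1..b}"
    have "rPr p ?\<Omega> (\<lambda>X. \<exists>A\<in>\<F> v. A \<subseteq> X) \<le> (\<Sum>A\<in>\<F> v. p ^ card A)"
      by (rule rPr_first_moment[OF fin\<Omega> p(1) p1 finF F\<Omega>])
    then show "rPr p ?\<Omega> (\<lambda>X. \<exists>A\<in>\<F> v. A \<subseteq> X) \<le> real n ^ v * (real b ^ k * p0) ^ mv v" using Fcount[OF v] by linarith
  qed
  finally show ?thesis by (simp add: mv_def d_def)
qed

end

section \<open>The 0-statement\<close>

lemma eventually_powr_neg_le:
  fixes s K \<epsilon> :: real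
  assumes "0 < s" "0 < \<epsilon>"
  shows "\<forall>\<^sub>F n :: nat in sequentially. K * real n powr (- s) \<le> \<epsilon>"
proof -
  have "(\<lambda>n::nat. K * real n powr (- s)) \<longlonglongrightarrow> K * 0"
    by (intro tendsto_mult tendsto_const tendsto_neg_powr filterlim_real_sequentially) (use assms in simp)
  then have "\<forall>\<^sub>F n in sequentially. K * real n powr (- s) < \<epsilon>"
    using assms(2) by (intro order_tendstoD(2)) auto
  then show ?thesis by (rule eventually_mono) simp
qed

lemma eventually_powr_ge:
  fixes s c :: real
  assumes "0 < s" "0 < c"
  shows "\<forall>\<^sub>F n :: nat in sequentially. 1 \<le> c * real n powr s"
  using eventually_powr_neg_le[OF assms, of 1] eventually_gt_at_top[of 0]
proof eventually_elim
  case (elim n)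
  then have "1 / real n powr s \<le> c" by (simp add: powr_minus_divide)
  then show ?case using elim by (simp add: field_simps)
qed

lemma eventually_log_le_powr:
  fixes \<delta> K1 K2 :: real
  assumes "0 < \<delta>"
  shows "\<forall>\<^sub>F n :: nat in sequentially. K1 * ln (real n) + K2 \<le> real n powr \<delta>"
proof -
  have "((\<lambda>n::nat. (K1 * ln (real n) + K2) / real n powr \<delta>) \<longlongrightarrow> 0) sequentially"
    using assms by real_asymp
  then have "\<forall>\<^sub>F n::nat in sequentially. (K1 * ln (real n) + K2) / real n powr \<delta> < 1"
    by (rule order_tendstoD) simp
  then show ?thesis using eventually_gt_at_top[of 0]
    by eventually_elim (simp add: divide_less_eq)
qed

context kt
begin

text \<open>The explored sets have logarithmic size, so their sizes are bounded by n ^ \<delta>. At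
  the threshold the main cycle term is bounded by the constant \<open>c^3\<close>, and every other
  term is a negative power of n; c is chosen to push the sum below 1 / e.\<close>

lemma zero_statement:
  fixes x a :: real
  assumes x: "x = (real t - real k) / (real t - 1)" "1/2 < x" and a: "a = (1 + x) / 3"
    and dense: "real k < real (degree_bound k + 1) * a"
  shows "\<exists>c>0. \<forall>p :: nat \<Rightarrow> real. (\<forall>n. 0 \<le> p n \<and> p n \<le> 1) \<longrightarrow>
     (\<forall>\<^sub>F n in sequentially. p n \<le> c * real n powr (- a)) \<longrightarrow>
     (\<lambda>n. rPr (p n) ([{..<n}]\<^bsup>k\<^esup>) (\<lambda>X. \<not> colourable k t X)) \<longlonglongrightarrow> 0"
proof -
  have tr: "real k \<ge> 4" "real t \<ge> 2 * real k" using k4 tk by linarith+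
  have xt: "x * (real t - 1) = real t - real k" using x tr by simp
  have "real t - real k < real t - 1" "0 < real t - 1" using tr by auto
  then have x1: "x < 1" unfolding x(1) by (subst divide_less_eq_1_pos) auto
  define d where "d = degree_bound k + 1"
  \<comment> \<open>The exponent gained by the cycle terms other than the main one: 1 - x for every
    additional old vertex, and x if all vertices are old. The number g below is the excess in the
    hypothesis \<open>dense\<close>.\<close>
  define \<eta> where "\<eta> = min x (1 - x)"
  define g where "g = a * real d / real k - 1"
  have pos: "0 < a" "a < 2/3" "1 < 2 * a" using x(2) x1 unfolding a by simp_all
  have \<eta>0: "0 < \<eta>" using x(2) x1 by (simp add: \<eta>_def)
  have g0: "0 < g" using dense tr by (simp add: g_def d_def mult_ac)
  \<comment> \<open>The four bounds leave negative exponents for, in this order: triangle steps with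
    a new apex; triangle steps with an old apex, and the factor n ^ (\<delta> k) in the dense sets;
    the cycle terms other than the main one; the final first moment.\<close>
  define \<delta> where "\<delta> = min (min ((2*a-1)/2) (a/(2*real k))) (min (\<eta>/(2*real t)) (g/(real d+2)))"
  have \<delta>0: "0 < \<delta>" using pos \<eta>0 g0 tr by (simp add: \<delta>_def)
  have \<delta>: "\<delta> \<le> (2*a-1)/2" "\<delta> \<le> a/(2*real k)" "\<delta> \<le> \<eta>/(2*real t)" "\<delta> \<le> g/(real d+2)"
    unfolding \<delta>_def by (rule order_trans[OF min.cobounded1 min.cobounded1] order_trans[OF min.cobounded1 min.cobounded2]
      order_trans[OF min.cobounded2 min.cobounded1] order_trans[OF min.cobounded2 min.cobounded2])+
  have \<delta>1: "\<delta> + 1 - 2 * a < 0" using \<delta>(1) pos(3) by (simp add: field_simps)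
  have \<delta>k: "\<delta> * real k \<le> a / 2"
    using mult_right_mono[OF \<delta>(2), of "real k"] tr by (simp add: field_simps)
  have "\<delta> * 4 \<le> \<delta> * real k" using tr \<delta>0 by (intro mult_left_mono) auto
  then have \<delta>2: "2 * \<delta> - a < 0" using \<delta>k pos(1) by linarith
  have "\<delta> * real t \<le> \<eta> / 2"
    using mult_right_mono[OF \<delta>(3), of "real t"] tr by (simp add: field_simps)
  then have \<delta>3: "\<delta> * real t - \<eta> < 0" using \<eta>0 by linarith
  define \<gamma> where "\<gamma> = (a - \<delta> * real k) * real d / real k - 1"
  have \<gamma>: "\<gamma> = g - \<delta> * real d" using tr by (simp add: \<gamma>_def g_def field_simps)
  have "\<delta> * (real d + 2) \<le> g" using \<delta>(4) by (simp add: pos_le_divide_eq)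
  then have \<delta>4: "\<delta> - \<gamma> < 0" unfolding \<gamma> using \<delta>0 by (simp add: algebra_simps)
  then have \<gamma>0: "0 < \<gamma>" using \<delta>0 by linarith
  define K where "K = real (degree_bound k) * (real (t + 1) * real (2 * t) ^ t * real k ^ (2 * t)) * (2 ^ t * real k ^ k)"
  have K0: "0 \<le> K" by (simp add: K_def)
  \<comment> \<open>Gives \<open>K * c^3 \<le> 1/6\<close>; together with three error terms of 1/18
    each the step weight is at most 1/3, which is below 1 / e.\<close>
  define c where "c = 1 / (6 * K + 6)"
  have c: "0 < c" "c \<le> 1" using K0 by (auto simp: c_def)
  have "K * c \<le> 1/6" unfolding c_def using K0 by (simp add: field_simps)
  moreover have "c^3 \<le> c" using c power_decreasing[of 1 3 c] by simp
  ultimately have Kc: "K * c^3 \<le> 1/6" using mult_left_mono[of "c^3" c K] K0 by linarith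
  \<comment> \<open>Chosen so that exp (- J n) times the at most n ^ k starting edges is at most 1 /
    n.\<close>
  define J where "J = (\<lambda>n::nat. nat \<lceil>(real k + 1) * ln (real n)\<rceil>)"
  define b where "b = (\<lambda>n. 3 * t * k * J n)"
  have bd: "rPr q ([{..<n}]\<^bsup>k\<^esup>) (\<lambda>X. \<not> colourable k t X) \<le> real n powr (- 1) + real n powr (\<delta> - \<gamma>)"
    if n: "1 \<le> n" and q: "0 \<le> q" "q \<le> c * real n powr (- a)"
      and e1: "1 \<le> c * real n powr (1 - a)" and e2: "1 \<le> c^3 * real n powr (2 - 3 * a)" and e3: "1 \<le> c^4 * real n powr (3 - 4 * a)"
      and e4: "3 * real t * real k * (real k + 1) * ln (real n) + 3 * real t * real k \<le> real n powr \<delta>"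
      and e5: "real k^2 * real n powr (- (2 * a - 1 - \<delta>)) \<le> 1/18" and e6: "real k^2 * real n powr (- (a - 2 * \<delta>)) \<le> 1/18"
      and e7: "K * real n powr (- (\<eta> - \<delta> * real t)) \<le> 1/18"
    for n q
  proof -
    define N where "N = real n"
    have N: "1 \<le> N" "0 < N" using n by (auto simp: N_def)
    define p0 where "p0 = c * N powr (- a)"
    have Neg: "N powr (- s) \<le> 1" if "0 \<le> s" for s using powr_mono[of "- s" 0 N] N that by simp
    have "N powr (- a) \<le> 1" using pos by (intro Neg) simp
    then have p0: "0 < p0" "p0 \<le> 1" "p0 \<le> N powr (- a)" using c N by (auto simp: p0_def mult_le_one mult_left_le_one_le)
    have Npow: "N ^ m = N powr real m" for m using N by (simp add: powr_realpow)
    have pw: "(N powr s) ^ m = N powr (s * real m)" for s m using N by (simp add: powr_realpow[symmetric] powr_powr)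
    have p0m: "p0 ^ m = c ^ m * N powr (- (a * real m))" for m by (simp add: p0_def power_mult_distrib pw)
    have np3: "N * p0^3 = c^3 * N powr (- x)"
    proof -
      have "N * p0^3 = c^3 * (N powr 1 * N powr (- (a * 3)))" using N by (simp add: p0m)
      also have "\<dots> = c^3 * N powr (1 + - (a * 3))" by (simp only: powr_add)
      also have "1 + - (a * 3) = - x" using a by simp
      finally show ?thesis .
    qed
    have c31: "c^3 \<le> 1" "0 < c^3" using c by (auto simp: power_le_one)
    have np3': "N * p0^3 \<le> N powr (- x)" unfolding np3 using c31 by (simp add: mult_left_le_one_le)
    have f1: "1 \<le> N * p0"
    proof -
      have "N * p0 = c * (N powr 1 * N powr (- a))" using N by (simp add: p0_def)
      also have "\<dots> = c * N powr (1 - a)" unfolding powr_add[symmetric] by simp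
      finally show ?thesis using e1 by (simp add: N_def)
    qed
    have f2: "1 \<le> N^2 * p0^3"
    proof -
      have "N^2 * p0^3 = c^3 * (N powr 2 * N powr (- (a * 3)))" by (simp add: p0m Npow)
      also have "\<dots> = c^3 * N powr (2 - 3 * a)" by (simp add: powr_add[symmetric] mult_ac)
      finally show ?thesis using e2 by (simp add: N_def)
    qed
    have f3: "1 \<le> N^3 * p0^4"
    proof -
      have "N^3 * p0^4 = c^4 * (N powr 3 * N powr (- (a * 4)))" by (simp add: p0m Npow)
      also have "\<dots> = c^4 * N powr (3 - 4 * a)" by (simp add: powr_add[symmetric] mult_ac)
      finally show ?thesis using e3 by (simp add: N_def)
    qed
    have f4: "N * p0^3 \<le> 1" using np3' Neg[of x] x by linarith
    have fA: "N ^ (t - k) * (N * p0^3) ^ (t - 1) \<le> c^3"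
    proof -
      have "N ^ (t - k) * (N * p0^3) ^ (t - 1) = (c^3)^(t-1) * (N powr (real t - real k) * N powr (- x * (real t - 1)))"
        unfolding np3 Npow power_mult_distrib pw using t_pos by (simp add: of_nat_diff)
      also have "\<dots> = (c^3)^(t-1)" using N xt by (simp add: powr_add[symmetric])
      also have "\<dots> \<le> (c^3)^1" using c31 t_pos by (intro power_decreasing) auto
      finally show ?thesis by simp
    qed
    have fB: "N ^ (t - u) * (N * p0^3) ^ (t - 1 - (u - k)) \<le> N powr (- \<eta>)" if u: "k < u" "u < t" for u
    proof -
      have "N ^ (t - u) * (N * p0^3) ^ (t - 1 - (u - k)) \<le> N ^ (t - u) * (N powr (- x)) ^ (t - 1 - (u - k))"
        using np3' N p0 by (intro mult_left_mono power_mono) auto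
      also have "\<dots> = N powr (real t - real u) * N powr (- x * (real t - 1 - (real u - real k)))"
      proof -
        have "t - 1 - (u - k) = t + k - 1 - u" using u by arith
        moreover have "real (t + k - 1 - u) = real t - 1 - (real u - real k)" using u by (simp add: of_nat_diff)
        ultimately have e: "real (t - 1 - (u - k)) = real t - 1 - (real u - real k)" by simp
        show ?thesis unfolding Npow pw e using u by (simp add: of_nat_diff)
      qed
      also have "\<dots> = N powr (real t - real u + - x * (real t - 1 - (real u - real k)))" by (rule powr_add[symmetric])
      also have "\<dots> \<le> N powr (- \<eta>)"
      proof (rule powr_mono[OF _ N(1)])
        have "real t - real u + - x * (real t - 1 - (real u - real k)) = - ((1 - x) * (real u - real k))"
          using xt by (simp add: algebra_simps)
        also have "\<dots> \<le> - (1 - x)"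
        proof -
          have "(1 - x) * 1 \<le> (1 - x) * (real u - real k)" using x1 u by (intro mult_left_mono) auto
          then show ?thesis by simp
        qed
        also have "\<dots> \<le> - \<eta>" by (simp add: \<eta>_def)
        finally show "real t - real u + - x * (real t - 1 - (real u - real k)) \<le> - \<eta>" .
      qed
      finally show ?thesis .
    qed
    have fB2: "N * p0^3 \<le> N powr (- \<eta>)"
    proof -
      have "N powr (- x) \<le> N powr (- \<eta>)" using N by (intro powr_mono) (auto simp: \<eta>_def)
      then show ?thesis using np3' by linarith
    qed
    define M where "M = N powr \<delta>"
    have M1: "1 \<le> M" using N \<delta>0 by (simp add: M_def ge_one_powr_ge_zero)
    have lnN: "0 \<le> ln N" using N by simp
    have bM: "real (b n) \<le> M"
    proof -
      have "real (J n) \<le> (real k + 1) * ln N + 1"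
      proof -
        have "0 \<le> (real k + 1) * ln N" using lnN by simp
        then show ?thesis unfolding J_def N_def[symmetric] by linarith
      qed
      then have "3 * real t * real k * real (J n) \<le> 3 * real t * real k * ((real k + 1) * ln N + 1)" by (intro mult_left_mono) auto
      then show ?thesis using e4 by (simp add: b_def M_def N_def algebra_simps)
    qed
    have "rPr q ([{..<n}]\<^bsup>k\<^esup>) (\<lambda>X. \<not> colourable k t X)
      \<le> exp (- 1) ^ J n * real n ^ k + (\<Sum>v=1..b n. real n ^ v * (real (b n) ^ k * p0) ^ (nat \<lceil>real (degree_bound k + 1) * real v / real k\<rceil>))"
    proof (rule prob_not_colourable)
      show "0 \<le> q" "q \<le> p0" using q by (auto simp: p0_def N_def)
      show "p0 \<le> 1" "0 < p0" by (fact p0)+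
      show "b n = 3 * t * k * J n" by (simp add: b_def)
      fix E assume E: "E \<subseteq> [{..<n}]\<^bsup>k\<^esup>" "E \<noteq> {}" "card E \<le> 3 * t * J n" "low E"
      have "k * card E \<le> k * (3 * t * J n)" using E(3) by (rule mult_le_mono2)
      also have "\<dots> = b n" by (simp add: b_def)
      finally have "real (k * card E) \<le> real (b n)" by (rule of_nat_mono)
      then have EM: "real k * real (card E) \<le> M" using bM by simp
      have "(\<Sum>X\<in>succs n E. p0 ^ card X) \<le> p0 ^ card E * (real k ^ 2 * (M * (real n * p0^2) + M^2 * p0)
         + real (degree_bound k) * (real (t + 1) * real (2 * t) ^ t * real k ^ (2 * t)) * (2 ^ t * real k ^ k) * (c^3 + M ^ t * N powr (- \<eta>)))"
        using f1 f2 f3 f4 fA fB fB2 M1 EM p0 n E unfolding N_def by (intro sum_succs) auto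
      also have "\<dots> \<le> p0 ^ card E * exp (- 1)"
      proof (rule mult_left_mono)
        have "M * (N * p0^2) \<le> N powr \<delta> * (N powr 1 * N powr (- a * 2))"
          using p0 N power_mono[of p0 "N powr (- a)" 2] by (auto simp: M_def pw intro!: mult_left_mono)
        also have "\<dots> = N powr (- (2 * a - 1 - \<delta>))" unfolding powr_add[symmetric] by (simp add: algebra_simps)
        finally have s1: "real k^2 * (M * (N * p0^2)) \<le> 1/18"
          using e5 mult_left_mono[of _ _ "real k^2"] unfolding N_def by (meson order_trans zero_le_power2)
        have "M^2 * p0 \<le> N powr (\<delta> * 2) * N powr (- a)"
          using p0 by (auto simp: M_def pw intro!: mult_left_mono)
        also have "\<dots> = N powr (- (a - 2 * \<delta>))" by (simp add: powr_add[symmetric] algebra_simps)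
        finally have s2: "real k^2 * (M^2 * p0) \<le> 1/18"
          using e6 mult_left_mono[of _ _ "real k^2"] unfolding N_def by (meson order_trans zero_le_power2)
        have "M ^ t * N powr (- \<eta>) = N powr (\<delta> * real t) * N powr (- \<eta>)" by (simp add: M_def pw)
        also have "\<dots> = N powr (- (\<eta> - \<delta> * real t))" by (simp add: powr_add[symmetric] algebra_simps)
        finally have s3: "K * (M ^ t * N powr (- \<eta>)) \<le> 1/18" using e7 by (simp add: N_def)
        have "real k ^ 2 * (M * (N * p0^2) + M^2 * p0) + K * (c^3 + M ^ t * N powr (- \<eta>)) \<le> 1/3"
          unfolding distrib_left using s1 s2 s3 Kc by linarith
        also have "1/3 \<le> exp (- 1 :: real)" using exp_le by (simp add: exp_minus field_simps)
        finally show "real k ^ 2 * (M * (real n * p0^2) + M^2 * p0)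
         + real (degree_bound k) * (real (t + 1) * real (2 * t) ^ t * real k ^ (2 * t)) * (2 ^ t * real k ^ k) * (c^3 + M ^ t * N powr (- \<eta>)) \<le> exp (- 1)"
          by (simp add: K_def N_def)
      qed (use p0 in simp)
      finally show "(\<Sum>X\<in>succs n E. p0 ^ card X) \<le> exp (- 1) * p0 ^ card E" by (simp add: mult.commute)
    qed simp
    also have "exp (- 1) ^ J n * real n ^ k \<le> N powr (- 1)"
    proof -
      have "(real k + 1) * ln N \<le> real (J n)" unfolding J_def N_def by linarith
      then have "exp (- real (J n)) \<le> exp (- ((real k + 1) * ln N))" by simp
      also have "\<dots> = N powr (- (real k + 1))" unfolding powr_def using N by (simp add: algebra_simps)
      finally have "exp (- 1) ^ J n \<le> N powr (- (real k + 1))" by (simp add: exp_of_nat_mult[symmetric])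
      then have "exp (- 1) ^ J n * N ^ k \<le> N powr (- (real k + 1)) * N powr real k" unfolding Npow by (intro mult_right_mono) auto
      also have "\<dots> = N powr (- 1)" by (simp add: powr_add[symmetric])
      finally show ?thesis by (simp add: N_def)
    qed
    also have "(\<Sum>v=1..b n. real n ^ v * (real (b n) ^ k * p0) ^ (nat \<lceil>real (degree_bound k + 1) * real v / real k\<rceil>))
        \<le> (\<Sum>v=1..b n. N powr (- \<gamma>))"
    proof (rule sum_mono)
      fix v assume v: "v \<in> {1..b n}"
      define mv where "mv = nat \<lceil>real d * real v / real k\<rceil>"
      have mv: "real d * real v / real k \<le> real mv" unfolding mv_def by linarith
      have "real (b n) ^ k * p0 \<le> M ^ k * N powr (- a)" using bM p0 by (intro mult_mono power_mono) auto
      also have "\<dots> = N powr (\<delta> * real k) * N powr (- a)" by (simp add: M_def pw)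
      also have "\<dots> = N powr (- (a - \<delta> * real k))" by (simp add: powr_add[symmetric] algebra_simps)
      finally have y: "real (b n) ^ k * p0 \<le> N powr (- (a - \<delta> * real k))" .
      have ak: "0 \<le> a - \<delta> * real k" using \<delta>k pos by linarith
      have "real n ^ v * (real (b n) ^ k * p0) ^ mv \<le> N powr real v * (N powr (- (a - \<delta> * real k))) ^ mv"
        unfolding N_def[symmetric] Npow using y p0 by (intro mult_left_mono power_mono) auto
      also have "\<dots> = N powr (real v + - (a - \<delta> * real k) * real mv)" unfolding pw by (rule powr_add[symmetric])
      also have "\<dots> \<le> N powr (- \<gamma>)"
      proof (rule powr_mono[OF _ N(1)])
        have "(a - \<delta> * real k) * (real d * real v / real k) \<le> (a - \<delta> * real k) * real mv" using mv ak by (rule mult_left_mono)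
        moreover have "(a - \<delta> * real k) * (real d * real v / real k) = real v * (\<gamma> + 1)" by (simp add: \<gamma>_def)
        moreover have "1 * \<gamma> \<le> real v * \<gamma>" using v \<gamma>0 by (intro mult_right_mono) auto
        ultimately show "real v + - (a - \<delta> * real k) * real mv \<le> - \<gamma>" by (simp add: algebra_simps)
      qed
      finally show "real n ^ v * (real (b n) ^ k * p0) ^ (nat \<lceil>real (degree_bound k + 1) * real v / real k\<rceil>) \<le> N powr (- \<gamma>)"
        by (simp add: mv_def d_def)
    qed
    also have "\<dots> = real (b n) * N powr (- \<gamma>)" by simp
    also have "\<dots> \<le> M * N powr (- \<gamma>)" using bM by (intro mult_right_mono) auto
    also have "\<dots> = N powr (\<delta> - \<gamma>)" by (simp add: M_def powr_add[symmetric])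
    finally show ?thesis by (simp add: N_def)
  qed
  show ?thesis
  proof (rule exI[of _ c], intro conjI allI impI)
    show "0 < c" by (fact c)
    fix p :: "nat \<Rightarrow> real" assume p: "\<forall>n. 0 \<le> p n \<and> p n \<le> 1" and pc: "\<forall>\<^sub>F n in sequentially. p n \<le> c * real n powr (- a)"
    have "\<forall>\<^sub>F n in sequentially. rPr (p n) ([{..<n}]\<^bsup>k\<^esup>) (\<lambda>X. \<not> colourable k t X) \<le> real n powr (- 1) + real n powr (\<delta> - \<gamma>)"
    proof -
      have E: "0 < 1 - a" "0 < 2 - 3 * a" "0 < 3 - 4 * a" "0 < 2 * a - 1 - \<delta>" "0 < a - 2 * \<delta>" "0 < \<eta> - \<delta> * real t" "0 < (1/18 :: real)"
        using pos \<delta>1 \<delta>2 \<delta>3 by auto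
      have C: "0 < c^3" "0 < c^4" using c by auto
      show ?thesis using pc eventually_ge_at_top[of 1]
          eventually_powr_ge[OF E(1) c(1)] eventually_powr_ge[OF E(2) C(1)] eventually_powr_ge[OF E(3) C(2)]
          eventually_log_le_powr[OF \<delta>0, of "3 * real t * real k * (real k + 1)" "3 * real t * real k"]
          eventually_powr_neg_le[OF E(4) E(7), of "real k^2"] eventually_powr_neg_le[OF E(5) E(7), of "real k^2"]
          eventually_powr_neg_le[OF E(6) E(7), of K]
      proof eventually_elim
        case (elim n)
        show ?case using p by (intro bd elim) auto
      qed
    qed
    note c1 = this
    have c2: "(\<lambda>n. real n powr (- 1) + real n powr (\<delta> - \<gamma>)) \<longlonglongrightarrow> 0 + 0"
      using \<delta>4 by (intro tendsto_add tendsto_neg_powr filterlim_real_sequentially) auto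
    have c3: "\<forall>\<^sub>F n in sequentially. 0 \<le> rPr (p n) ([{..<n}]\<^bsup>k\<^esup>) (\<lambda>X. \<not> colourable k t X)"
      using p by (intro always_eventually allI rPr_nonneg) auto
    show "(\<lambda>n. rPr (p n) ([{..<n}]\<^bsup>k\<^esup>) (\<lambda>X. \<not> colourable k t X)) \<longlonglongrightarrow> 0"
      using tendsto_sandwich[OF c3 c1 tendsto_const] c2 by simp
  qed
qed

end

section \<open>The 1-statement\<close>

text \<open>An exponential moment bound: \<open>\<mu> powr (real (card S) - s)\<close> is at least 1
  on the range of summation. With y = p^3 and s of the order of y * card W both factors are
  exponentials of order s, with constants that \<mu> controls; a bound by the number of subsets
  would lose a logarithm.\<close>

lemma sum_small_subsets:
  fixes y \<mu> s :: real
  assumes W: "finite W" and y: "0 \<le> y" and l: "0 < \<mu>" "\<mu> \<le> 1"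
  shows "(\<Sum>S\<in>{S. S \<subseteq> W \<and> real (card S) \<le> s}. y ^ card S) \<le> \<mu> powr (- s) * exp (\<mu> * y * real (card W))"
proof -
  have pw: "(\<Sum>S\<in>Pow W. z ^ card S) = (1 + z) ^ card W" for z :: real
    using prod_add[OF W, of "\<lambda>_. z" "\<lambda>_. 1 :: real"] by (simp add: add.commute)
  have "(\<Sum>S\<in>{S. S \<subseteq> W \<and> real (card S) \<le> s}. y ^ card S)
      \<le> (\<Sum>S\<in>{S. S \<subseteq> W \<and> real (card S) \<le> s}. \<mu> powr (- s) * (\<mu> * y) ^ card S)"
  proof (rule sum_mono)
    fix S assume S: "S \<in> {S. S \<subseteq> W \<and> real (card S) \<le> s}"
    have "\<mu> powr 0 \<le> \<mu> powr (- s + real (card S))" using S l by (intro powr_mono') auto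
    then have "1 \<le> \<mu> powr (- s) * \<mu> ^ card S" using l unfolding powr_add by (simp add: powr_realpow)
    then have "1 * y ^ card S \<le> (\<mu> powr (- s) * \<mu> ^ card S) * y ^ card S" using y by (intro mult_right_mono) auto
    then show "y ^ card S \<le> \<mu> powr (- s) * (\<mu> * y) ^ card S" by (simp add: power_mult_distrib mult_ac)
  qed
  also have "\<dots> \<le> (\<Sum>S\<in>Pow W. \<mu> powr (- s) * (\<mu> * y) ^ card S)"
    using W y l by (intro sum_mono2) auto
  also have "\<dots> = \<mu> powr (- s) * (1 + \<mu> * y) ^ card W" by (simp add: sum_distrib_left[symmetric] pw)
  also have "\<dots> \<le> \<mu> powr (- s) * exp (\<mu> * y) ^ card W"
    using y l exp_ge_add_one_self[of "\<mu> * y"] by (intro mult_left_mono power_mono) auto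
  also have "\<dots> = \<mu> powr (- s) * exp (\<mu> * y * real (card W))" by (simp add: exp_of_nat2_mult)
  finally show ?thesis .
qed

text \<open>The choice \<mu> = 1 / m in the previous bound. The logarithm hidden in
  \<open>m powr s\<close> is harmless where s is smaller than the available exponent by a power of
  n.\<close>

lemma card_small_subsets:
  fixes m s :: real
  assumes W: "finite W" "real (card W) \<le> m" and m: "1 \<le> m"
  shows "real (card {S. S \<subseteq> W \<and> real (card S) \<le> s}) \<le> m powr s * exp 1"
proof -
  have "real (card {S. S \<subseteq> W \<and> real (card S) \<le> s}) = (\<Sum>S\<in>{S. S \<subseteq> W \<and> real (card S) \<le> s}. 1 ^ card S)" by simp
  also have "\<dots> \<le> (1 / m) powr (- s) * exp (1 / m * 1 * real (card W))"
    using W m by (intro sum_small_subsets) auto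
  also have "\<dots> \<le> m powr s * exp 1"
  proof (rule mult_mono)
    show "(1 / m) powr (- s) \<le> m powr s" using m by (simp add: powr_divide powr_minus field_simps)
    show "exp (1 / m * 1 * real (card W)) \<le> exp 1" using W m by (simp add: divide_le_eq)
  qed auto
  finally show ?thesis .
qed

section \<open>Janson's inequality for edges inside (k+1)-sets\<close>

lemma nsets_Int_le:
  assumes "finite Q" "finite Q'" "card Q = Suc k" "card Q' = Suc k" "Q \<noteq> Q'"
  shows "[Q]\<^bsup>k\<^esup> \<inter> [Q']\<^bsup>k\<^esup> \<subseteq> {Q \<inter> Q'}"
proof
  fix e assume "e \<in> [Q]\<^bsup>k\<^esup> \<inter> [Q']\<^bsup>k\<^esup>"
  then have e: "e \<subseteq> Q \<inter> Q'" "card e = k" by (auto simp: nsets_def)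
  have "Q \<inter> Q' \<noteq> Q" using assms card_subset_eq[of Q' Q] by auto
  then have "card (Q \<inter> Q') < Suc k" using assms psubset_card_mono[of Q "Q \<inter> Q'"] by auto
  then have "e = Q \<inter> Q'" using e assms by (intro card_seteq) auto
  then show "e \<in> {Q \<inter> Q'}" by simp
qed

lemma card_nsets_Suc: "card Q = Suc k \<Longrightarrow> card ([Q]\<^bsup>k\<^esup>) = Suc k"
  by (simp add: card_nsets)

lemma card_neighbour_cliques:
  assumes V: "finite V" and Q: "Q \<in> [V]\<^bsup>Suc k\<^esup>"
  shows "card {Q'\<in>[V]\<^bsup>Suc k\<^esup>. Q' \<noteq> Q \<and> [Q']\<^bsup>k\<^esup> \<inter> [Q]\<^bsup>k\<^esup> \<noteq> {}} \<le> Suc k * card V"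
proof -
  have finQ: "finite Q" "card Q = Suc k" using Q by (auto simp: nsets_def)
  have fin: "finite ([Q]\<^bsup>k\<^esup> \<times> V)" using finQ V by (simp add: finite_imp_finite_nsets)
  have "{Q'\<in>[V]\<^bsup>Suc k\<^esup>. Q' \<noteq> Q \<and> [Q']\<^bsup>k\<^esup> \<inter> [Q]\<^bsup>k\<^esup> \<noteq> {}} \<subseteq> (\<lambda>(e, v). insert v e) ` ([Q]\<^bsup>k\<^esup> \<times> V)"
  proof
    fix Q' assume "Q' \<in> {Q'\<in>[V]\<^bsup>Suc k\<^esup>. Q' \<noteq> Q \<and> [Q']\<^bsup>k\<^esup> \<inter> [Q]\<^bsup>k\<^esup> \<noteq> {}}"
    then obtain e where Q': "Q' \<subseteq> V" "finite Q'" "card Q' = Suc k" and e: "e \<subseteq> Q'" "card e = k" "e \<in> [Q]\<^bsup>k\<^esup>" by (auto simp: nsets_def)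
    have "card (Q' - e) = 1" using Q' e by (simp add: card_Diff_subset finite_subset)
    then obtain v where "Q' - e = {v}" by (auto simp: card_1_singleton_iff)
    then have "Q' = insert v e" "v \<in> V" using e Q' by auto
    then show "Q' \<in> (\<lambda>(e, v). insert v e) ` ([Q]\<^bsup>k\<^esup> \<times> V)" using e(3) by force
  qed
  then have "card {Q'\<in>[V]\<^bsup>Suc k\<^esup>. Q' \<noteq> Q \<and> [Q']\<^bsup>k\<^esup> \<inter> [Q]\<^bsup>k\<^esup> \<noteq> {}} \<le> card ([Q]\<^bsup>k\<^esup> \<times> V)"
    by (rule surj_card_le[OF fin])
  also have "\<dots> = Suc k * card V" using card_nsets_Suc[OF finQ(2)] by (simp only: card_cartesian_product)
  finally show ?thesis .
qed

text \<open>Two of the chosen e-edge sets share at most one edge, and a (k+1)-set has at most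
  \<open>Suc k * card V\<close> neighbours with a common facet, so the correlation term of Janson's
  inequality is small. Used with e = 3 for triangles and with e = 5 for the first of the three
  parts.\<close>

lemma prob_no_clique_part:
  fixes p :: real
  assumes V: "finite V" and p: "0 \<le> p" "p \<le> 1" and Q: "\<Q> \<subseteq> [V]\<^bsup>Suc k\<^esup>"
    and B: "\<And>Q. Q \<in> \<Q> \<Longrightarrow> B Q \<subseteq> [Q]\<^bsup>k\<^esup> \<and> card (B Q) = e" and e: "1 \<le> e"
  shows "rPr p ([V]\<^bsup>k\<^esup>) (\<lambda>X. \<forall>Q\<in>\<Q>. \<not> B Q \<subseteq> X)
    \<le> exp (- (real (card \<Q>) * p ^ e * (1 - real (Suc k) * real (card V) * p ^ (e - 1))))"
proof -
  have finQ: "finite \<Q>" using Q V finite_imp_finite_nsets finite_subset by metis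
  then obtain xs where xs: "set xs = \<Q>" "distinct xs" using finite_distinct_list by metis
  have Qf: "finite Q" "card Q = Suc k" "Q \<subseteq> V" if "Q \<in> \<Q>" for Q using Q that by (auto simp: nsets_def)
  have BV: "B Q \<subseteq> [V]\<^bsup>k\<^esup>" if "Q \<in> \<Q>" for Q using B[OF that] nsets_mono[OF Qf(3)[OF that], of k] by blast
  have finB: "finite (B Q)" if "Q \<in> \<Q>" for Q
    using B[OF that] finite_imp_finite_nsets[OF Qf(1)[OF that]] finite_subset by metis
  have "rPr p ([V]\<^bsup>k\<^esup>) (\<lambda>X. \<forall>Q\<in>\<Q>. \<not> B Q \<subseteq> X) \<le> exp (- (\<Sum>i\<in>\<Q>. p ^ card (B i))
        + (\<Sum>i\<in>\<Q>. \<Sum>j\<in>{j\<in>\<Q>. j \<noteq> i \<and> B j \<inter> B i \<noteq> {}}. p ^ card (B i \<union> B j)))"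
    using rPr_janson[OF finite_imp_finite_nsets[OF V, of k] p xs(2), of B] BV unfolding xs(1) by blast
  also have "\<dots> \<le> exp (- (real (card \<Q>) * p ^ e) + (\<Sum>i\<in>\<Q>. real (Suc k * card V) * (p ^ e * p ^ (e - 1))))"
  proof -
    have "(\<Sum>i\<in>\<Q>. p ^ card (B i)) = real (card \<Q>) * p ^ e" using B by simp
    moreover have "(\<Sum>i\<in>\<Q>. \<Sum>j\<in>{j\<in>\<Q>. j \<noteq> i \<and> B j \<inter> B i \<noteq> {}}. p ^ card (B i \<union> B j))
       \<le> (\<Sum>i\<in>\<Q>. real (Suc k * card V) * (p ^ e * p ^ (e - 1)))"
    proof (rule sum_mono)
      fix i assume i: "i \<in> \<Q>"
      let ?N = "{j\<in>\<Q>. j \<noteq> i \<and> B j \<inter> B i \<noteq> {}}"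
      have "(\<Sum>j\<in>?N. p ^ card (B i \<union> B j)) = (\<Sum>j\<in>?N. p ^ e * p ^ (e - 1))"
      proof (rule sum.cong[OF refl])
        fix j assume j: "j \<in> ?N"
        then have jQ: "j \<in> \<Q>" "j \<noteq> i" "B j \<inter> B i \<noteq> {}" by auto
        have "B j \<inter> B i \<subseteq> {j \<inter> i}"
          using nsets_Int_le[OF Qf(1)[OF jQ(1)] Qf(1)[OF i] Qf(2)[OF jQ(1)] Qf(2)[OF i] jQ(2)] B[OF jQ(1)] B[OF i] by blast
        then have "B j \<inter> B i = {j \<inter> i}" using jQ(3) by blast
        then have "card (B i \<inter> B j) = 1" by (simp add: Int_commute)
        then have "card (B i \<union> B j) = e + (e - 1)"
          using card_Un_Int[OF finB[OF i] finB[OF jQ(1)]] B[OF i] B[OF jQ(1)] e by simp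
        then show "p ^ card (B i \<union> B j) = p ^ e * p ^ (e - 1)" by (simp add: power_add)
      qed
      also have "\<dots> = real (card ?N) * (p ^ e * p ^ (e - 1))" by simp
      also have "\<dots> \<le> real (Suc k * card V) * (p ^ e * p ^ (e - 1))"
      proof (rule mult_right_mono)
        have iV: "i \<in> [V]\<^bsup>Suc k\<^esup>" using i Q by blast
        have "?N \<subseteq> {Q'\<in>[V]\<^bsup>Suc k\<^esup>. Q' \<noteq> i \<and> [Q']\<^bsup>k\<^esup> \<inter> [i]\<^bsup>k\<^esup> \<noteq> {}}" using B i Q by blast
        then have "card ?N \<le> card {Q'\<in>[V]\<^bsup>Suc k\<^esup>. Q' \<noteq> i \<and> [Q']\<^bsup>k\<^esup> \<inter> [i]\<^bsup>k\<^esup> \<noteq> {}}"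
          using finite_imp_finite_nsets[OF V, of "Suc k"] by (intro card_mono) auto
        also have "\<dots> \<le> Suc k * card V" by (rule card_neighbour_cliques[OF V iV])
        finally show "real (card ?N) \<le> real (Suc k * card V)" by (rule of_nat_mono)
      qed (use p in simp)
      finally show "(\<Sum>j\<in>?N. p ^ card (B i \<union> B j)) \<le> real (Suc k * card V) * (p ^ e * p ^ (e - 1))" .
    qed
    ultimately show ?thesis by simp
  qed
  also have "\<dots> = exp (- (real (card \<Q>) * p ^ e * (1 - real (Suc k) * real (card V) * p ^ (e - 1))))"
  proof -
    have "(\<Sum>i\<in>\<Q>. real (Suc k * card V) * (p ^ e * p ^ (e - 1))) = real (card \<Q>) * (real (Suc k) * real (card V) * (p ^ e * p ^ (e - 1)))"
      by (simp only: sum_constant of_nat_mult mult.assoc)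
    then show ?thesis by (simp only: right_diff_distrib mult_ac) simp
  qed
  finally show ?thesis .
qed

lemma is_tri_three_faces:
  assumes "card Q = Suc k" "T \<subseteq> [Q]\<^bsup>k\<^esup>" "card T = 3"
  shows "is_tri k T"
proof -
  have finQ: "finite Q" using assms(1) card_ge_0_finite by force
  have ex: "\<exists>a\<in>Q. g = Q - {a}" if g: "g \<in> T" for g
  proof -
    have g': "g \<subseteq> Q" "card g = k" using g assms(2) by (auto simp: nsets_def)
    then have "card (Q - g) = 1" using assms(1) finQ by (simp add: card_Diff_subset finite_subset)
    then obtain a where "Q - g = {a}" by (auto simp: card_1_singleton_iff)
    then have "a \<in> Q" "g = Q - {a}" using g' by auto
    then show ?thesis by blast
  qed
  obtain g1 g2 g3 where T: "T = {g1, g2, g3}" "g1 \<noteq> g2" "g1 \<noteq> g3" "g2 \<noteq> g3" using assms(3) by (auto simp: card_3_iff)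
  obtain a where a: "a \<in> Q" "g1 = Q - {a}" using ex[of g1] T by auto
  obtain b where b: "b \<in> Q" "g2 = Q - {b}" using ex[of g2] T by auto
  obtain c where c: "c \<in> Q" "g3 = Q - {c}" using ex[of g3] T by auto
  have "a \<noteq> b" "a \<noteq> c" "b \<noteq> c" using T a b c by auto
  moreover have "T = {Q - {a}, Q - {b}, Q - {c}}" using T(1) a(2) b(2) c(2) by simp
  ultimately show ?thesis unfolding is_tri_def using finQ assms(1) a(1) b(1) c(1)
    by (intro exI[of _ Q] exI[of _ a] exI[of _ b] exI[of _ c] conjI)
qed

lemma is_tri_subset_faces:
  assumes "is_tri k T" "1 \<le> k" shows "finite (\<Union>T)" "card (\<Union>T) = Suc k" "T \<subseteq> [\<Union>T]\<^bsup>k\<^esup>"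
proof -
  obtain Q a b c where Q: "finite Q" "card Q = Suc k" "a \<in> Q" "b \<in> Q" "c \<in> Q"
    "a \<noteq> b" "a \<noteq> c" "b \<noteq> c" "T = {Q - {a}, Q - {b}, Q - {c}}" using assms unfolding is_tri_def by blast
  have U: "\<Union>T = Q" using Q by auto
  show "finite (\<Union>T)" "card (\<Union>T) = Suc k" "T \<subseteq> [\<Union>T]\<^bsup>k\<^esup>" unfolding U using Q by (auto simp: nsets_def)
qed

lemma partn_lst_transfer:
  assumes P: "partn_lst {..<R} s k" and W: "finite W" "card W = R" and f: "f \<in> [W]\<^bsup>k\<^esup> \<rightarrow> {..<length s}"
  shows "\<exists>i<length s. \<exists>U\<in>[W]\<^bsup>(s ! i)\<^esup>. f ` [U]\<^bsup>k\<^esup> \<subseteq> {i}"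
proof -
  obtain g where g: "bij_betw g {..<R} W" using ex_bij_betw_nat_finite[OF W(1)] W(2) by (auto simp: atLeast0LessThan)
  have inj: "inj_on g {..<R}" and img: "g ` {..<R} = W" using g by (auto simp: bij_betw_def)
  have gi: "g ` e \<in> [W]\<^bsup>j\<^esup>" if "e \<in> [{..<R}]\<^bsup>j\<^esup>" for e j
  proof -
    have "e \<subseteq> {..<R}" "finite e" "card e = j" using that by (auto simp: nsets_def)
    moreover have "card (g ` e) = card e" using inj_on_subset[OF inj] calculation by (intro card_image) auto
    ultimately show ?thesis using img by (auto simp: nsets_def)
  qed
  have "(\<lambda>e. f (g ` e)) \<in> [{..<R}]\<^bsup>k\<^esup> \<rightarrow> {..<length s}" using f gi by blast
  then obtain i H where i: "i < length s" and H: "H \<in> [{..<R}]\<^bsup>(s ! i)\<^esup>" and mono: "(\<lambda>e. f (g ` e)) ` [H]\<^bsup>k\<^esup> \<subseteq> {i}"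
    using partn_lstE[OF P, of "\<lambda>e. f (g ` e)" "length s"] by (metis (no_types, lifting))
  have "f e = i" if e: "e \<in> [g ` H]\<^bsup>k\<^esup>" for e
  proof -
    have e': "e \<subseteq> g ` H" "card e = k" "finite e" using e by (auto simp: nsets_def)
    then obtain h where h: "h \<subseteq> H" "e = g ` h" by (auto simp: subset_image_iff)
    have HR: "H \<subseteq> {..<R}" using H by (auto simp: nsets_def)
    have hin: "inj_on g h" using h HR inj inj_on_subset by blast
    then have "card h = k" "finite h" using e' h by (auto simp: card_image finite_image_iff)
    then have "h \<in> [H]\<^bsup>k\<^esup>" using h by (auto simp: nsets_def)
    then show ?thesis using mono h(2) by blast
  qed
  then show ?thesis using i gi[OF H] by blast
qed

text \<open>Supersaturation by averaging: every R-set contains a monochromatic set of one of the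
  prescribed sizes, and a set of size \<open>s ! i\<close> lies in at most
  \<open>card V ^ (R - s ! i)\<close> of the R-sets.\<close>

lemma ramsey_density:
  fixes s :: "nat list"
  shows "\<exists>\<gamma>>0. \<exists>R. \<forall>(V :: 'a set) f. finite V \<longrightarrow> R \<le> card V \<longrightarrow> f \<in> [V]\<^bsup>k\<^esup> \<rightarrow> {..<length s} \<longrightarrow>
    (\<exists>i<length s. \<gamma> * real (card V) ^ (s ! i) \<le> real (card {U\<in>[V]\<^bsup>(s ! i)\<^esup>. f ` [U]\<^bsup>k\<^esup> \<subseteq> {i}}))"
proof -
  obtain R0 :: nat where R0: "partn_lst {..<R0} s k" using ramsey_full by blast
  define R where "R = R0 + sum_list s + 1"
  have P: "partn_lst {..<R} s k" by (rule partn_lst_greater_resource[OF R0]) (simp add: R_def)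
  have sR: "s ! i \<le> R" if "i < length s" for i using that elem_le_sum_list[OF that] by (simp add: R_def)
  have R1: "1 \<le> R" by (simp add: R_def)
  define l where "l = length s"
  \<comment> \<open>The factor l + 1 in place of l makes the final comparison with the binomial
    coefficient strict.\<close>
  define \<gamma> where "\<gamma> = 1 / ((real l + 1) * real R ^ R)"
  have \<gamma>0: "0 < \<gamma>" using R1 by (simp add: \<gamma>_def)
  have "\<exists>i<length s. \<gamma> * real (card V) ^ (s ! i) \<le> real (card {U\<in>[V]\<^bsup>(s ! i)\<^esup>. f ` [U]\<^bsup>k\<^esup> \<subseteq> {i}})"
    if V: "finite V" "R \<le> card V" and f: "f \<in> [V]\<^bsup>k\<^esup> \<rightarrow> {..<length s}" for V :: "'a set" and f
  proof (rule ccontr)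
    assume con: "\<not> ?thesis"
    define m where "m = card V"
    define \<U> where "\<U> = (\<lambda>i. {U\<in>[V]\<^bsup>(s ! i)\<^esup>. f ` [U]\<^bsup>k\<^esup> \<subseteq> {i}})"
    have less: "real (card (\<U> i)) \<le> \<gamma> * real m ^ (s ! i)" if "i < l" for i
      using con that unfolding l_def m_def \<U>_def by (meson linear)
    have finU: "finite (\<U> i)" for i unfolding \<U>_def using V by (simp add: finite_imp_finite_nsets)
    have finW: "finite ([V]\<^bsup>R\<^esup>)" using V by (simp add: finite_imp_finite_nsets)
    have sub: "[V]\<^bsup>R\<^esup> \<subseteq> (\<Union>i<l. \<Union>U\<in>\<U> i. {W\<in>[V]\<^bsup>R\<^esup>. U \<subseteq> W})"
    proof
      fix W assume W: "W \<in> [V]\<^bsup>R\<^esup>"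
      then have W': "W \<subseteq> V" "finite W" "card W = R" by (auto simp: nsets_def)
      have "f \<in> [W]\<^bsup>k\<^esup> \<rightarrow> {..<length s}" using f nsets_mono[OF W'(1), of k] by blast
      then obtain i U where "i < length s" "U \<in> [W]\<^bsup>(s ! i)\<^esup>" "f ` [U]\<^bsup>k\<^esup> \<subseteq> {i}"
        using partn_lst_transfer[OF P W'(2,3)] by blast
      moreover from this have "U \<subseteq> W" by (auto simp: nsets_def)
      moreover from calculation have "U \<in> \<U> i" unfolding \<U>_def using nsets_mono[OF W'(1), of "s ! i"] by blast
      ultimately show "W \<in> (\<Union>i<l. \<Union>U\<in>\<U> i. {W\<in>[V]\<^bsup>R\<^esup>. U \<subseteq> W})" using W unfolding l_def by blast
    qed
    have ext: "card {W\<in>[V]\<^bsup>R\<^esup>. U \<subseteq> W} \<le> m ^ (R - s ! i)" if U: "U \<in> \<U> i" for U i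
    proof -
      have U': "finite U" "card U = s ! i" using U by (auto simp: \<U>_def nsets_def)
      have "card {W\<in>[V]\<^bsup>R\<^esup>. U \<subseteq> W} \<le> card ([V]\<^bsup>(R - s ! i)\<^esup>)"
      proof (rule card_inj_on_le[of "\<lambda>W. W - U"])
        show "inj_on (\<lambda>W. W - U) {W\<in>[V]\<^bsup>R\<^esup>. U \<subseteq> W}" by (rule inj_onI) blast
        show "(\<lambda>W. W - U) ` {W\<in>[V]\<^bsup>R\<^esup>. U \<subseteq> W} \<subseteq> [V]\<^bsup>(R - s ! i)\<^esup>"
          using U' by (auto simp: nsets_def card_Diff_subset)
        show "finite ([V]\<^bsup>(R - s ! i)\<^esup>)" using V by (simp add: finite_imp_finite_nsets)
      qed
      also have "\<dots> \<le> m ^ (R - s ! i)" unfolding m_def by (rule card_nsets_le[OF V(1)])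
      finally show ?thesis .
    qed
    have "card ([V]\<^bsup>R\<^esup>) \<le> card (\<Union>i<l. \<Union>U\<in>\<U> i. {W\<in>[V]\<^bsup>R\<^esup>. U \<subseteq> W})"
      using finU finW by (intro card_mono[OF _ sub]) auto
    also have "\<dots> \<le> (\<Sum>i<l. card (\<Union>U\<in>\<U> i. {W\<in>[V]\<^bsup>R\<^esup>. U \<subseteq> W}))" by (rule card_UN_le) simp
    also have "\<dots> \<le> (\<Sum>i<l. card (\<U> i) * m ^ (R - s ! i))"
    proof (rule sum_mono)
      fix i
      have "card (\<Union>U\<in>\<U> i. {W\<in>[V]\<^bsup>R\<^esup>. U \<subseteq> W}) \<le> (\<Sum>U\<in>\<U> i. card {W\<in>[V]\<^bsup>R\<^esup>. U \<subseteq> W})" by (rule card_UN_le[OF finU])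
      also have "\<dots> \<le> (\<Sum>U\<in>\<U> i. m ^ (R - s ! i))" using ext by (rule sum_mono)
      finally show "card (\<Union>U\<in>\<U> i. {W\<in>[V]\<^bsup>R\<^esup>. U \<subseteq> W}) \<le> card (\<U> i) * m ^ (R - s ! i)" by simp
    qed
    finally have "real (m choose R) \<le> real (\<Sum>i<l. card (\<U> i) * m ^ (R - s ! i))" unfolding m_def by (metis card_nsets of_nat_mono)
    also have "\<dots> = (\<Sum>i<l. real (card (\<U> i)) * real m ^ (R - s ! i))" by simp
    also have "\<dots> \<le> (\<Sum>i<l. \<gamma> * real m ^ R)"
    proof (rule sum_mono)
      fix i assume i: "i \<in> {..<l}"
      have "real (card (\<U> i)) * real m ^ (R - s ! i) \<le> (\<gamma> * real m ^ (s ! i)) * real m ^ (R - s ! i)"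
        using less i by (intro mult_right_mono) auto
      also have "\<dots> = \<gamma> * real m ^ R" using sR i by (simp add: l_def power_add[symmetric])
      finally show "real (card (\<U> i)) * real m ^ (R - s ! i) \<le> \<gamma> * real m ^ R" .
    qed
    also have "\<dots> = real l / (real l + 1) * (real m ^ R / real R ^ R)" by (simp add: \<gamma>_def)
    also have "\<dots> < 1 * (real m ^ R / real R ^ R)"
      using R1 V(2) by (intro mult_strict_right_mono) (auto simp: m_def)
    also have "\<dots> = (real m / real R) ^ R" by (simp add: power_divide)
    also have "\<dots> \<le> real (m choose R)" using binomial_ge_n_over_k_pow_k[of R m, where 'a = real] V(2) by (simp add: m_def)
    finally show False by simp
  qed
  then show ?thesis using \<gamma>0 by blast
qed

section \<open>Containers for tight cycles and the estimates for the three parts\<close>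

context kt
begin

text \<open>Each t-set carries a spanning tight cycle, and the t-set is recovered as its union.
  Ramsey's theorem speaks of cliques while the containers speak of cycles; this joins the
  two.\<close>

lemma card_cliques_le_cycles:
  assumes V: "finite (V :: nat set)"
  shows "card {U\<in>[V]\<^bsup>t\<^esup>. [U]\<^bsup>k\<^esup> \<inter> X = {}} \<le> card {C. is_cyc k t C \<and> C \<subseteq> [V]\<^bsup>k\<^esup> \<and> C \<inter> X = {}}"
proof -
  have "\<exists>C. is_cyc k t C \<and> C \<subseteq> [U]\<^bsup>k\<^esup> \<and> \<Union>C = U" if U: "U \<in> [V]\<^bsup>t\<^esup>" for U
  proof -
    have U': "finite U" "card U = t" using U by (auto simp: nsets_def)
    obtain v where v: "bij_betw v {..<t} U" using ex_bij_betw_nat_finite[OF U'(1)] U'(2) by (auto simp: atLeast0LessThan)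
    then have inj: "inj_on v {..<t}" and img: "v ` {..<t} = U" by (auto simp: bij_betw_def)
    have un: "\<Union>(cyc k t v) = U" unfolding Union_cyc[OF t_pos(4)] by (fact img)
    have "cyc k t v \<subseteq> [U]\<^bsup>k\<^esup>"
    proof
      fix e assume e: "e \<in> cyc k t v"
      then obtain i where "e = v ` window k t i" by (auto simp: cyc_def)
      then have "card e = k" "finite e" using card_image_window[OF inj t_pos(3,1)] by auto
      then show "e \<in> [U]\<^bsup>k\<^esup>" using e un by (auto simp: nsets_def)
    qed
    then show ?thesis using inj un unfolding is_cyc_def by metis
  qed
  then obtain c where c: "\<And>U. U \<in> [V]\<^bsup>t\<^esup> \<Longrightarrow> is_cyc k t (c U) \<and> c U \<subseteq> [U]\<^bsup>k\<^esup> \<and> \<Union>(c U) = U" by metis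
  show ?thesis
  proof (rule card_inj_on_le[of c])
    show "inj_on c {U\<in>[V]\<^bsup>t\<^esup>. [U]\<^bsup>k\<^esup> \<inter> X = {}}" by (rule inj_onI) (metis (mono_tags) c mem_Collect_eq)
    show "c ` {U\<in>[V]\<^bsup>t\<^esup>. [U]\<^bsup>k\<^esup> \<inter> X = {}} \<subseteq> {C. is_cyc k t C \<and> C \<subseteq> [V]\<^bsup>k\<^esup> \<and> C \<inter> X = {}}"
    proof
      fix C assume "C \<in> c ` {U\<in>[V]\<^bsup>t\<^esup>. [U]\<^bsup>k\<^esup> \<inter> X = {}}"
      then obtain U where U: "U \<in> [V]\<^bsup>t\<^esup>" "[U]\<^bsup>k\<^esup> \<inter> X = {}" "C = c U" by blast
      have "[U]\<^bsup>k\<^esup> \<subseteq> [V]\<^bsup>k\<^esup>" using U(1) by (intro nsets_mono) (auto simp: nsets_def)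
      then show "C \<in> {C. is_cyc k t C \<and> C \<subseteq> [V]\<^bsup>k\<^esup> \<and> C \<inter> X = {}}" using c[OF U(1)] U(2,3) by blast
    qed
    have "{C. is_cyc k t C \<and> C \<subseteq> [V]\<^bsup>k\<^esup> \<and> C \<inter> X = {}} \<subseteq> Pow ([V]\<^bsup>k\<^esup>)" by blast
    then show "finite {C. is_cyc k t C \<and> C \<subseteq> [V]\<^bsup>k\<^esup> \<and> C \<inter> X = {}}"
      using V by (meson finite_Pow_iff finite_imp_finite_nsets finite_subset)
  qed
qed

lemma cyc_restrict: "cyc k t (restrict v {..<t}) = cyc k t v"
proof -
  have "restrict v {..<t} ` window k t i = v ` window k t i" for i
    using window_subset[OF t_pos(1), of k i] by (intro image_cong) auto
  then show ?thesis by (simp add: cyc_def)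
qed

text \<open>A cycle that contains j given edges has at least \<open>min t (j + k - 1)\<close> of its
  vertices in their union, by \<open>card_Union_window\<close>; only the remaining vertices are free
  in V.\<close>

lemma codegree_cycles:
  assumes V: "finite (V :: nat set)" "V \<noteq> {}" and S: "S \<noteq> {}" "finite S" "card S \<le> t"
  shows "real (codegree {C. is_cyc k t C \<and> C \<subseteq> [V]\<^bsup>k\<^esup>} S)
     \<le> 2 ^ t * real (t * k) ^ t * real (card V) ^ (t - min t (card S + k - 1))"
proof -
  define U where "U = \<Union>S"
  define w where "w = min t (card S + k - 1)"
  define m where "m = card V"
  have m1: "1 \<le> m" using V by (simp add: m_def Suc_le_eq card_gt_0_iff)
  define \<V> where "\<V> = (\<Union>A\<in>{A. A \<subseteq> {..<t} \<and> w \<le> card A}. PiE {..<t} (\<lambda>i. if i \<in> A then U else V))"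
  have tk1: "1 \<le> t * k" using t_pos by (simp add: Suc_le_eq)
  show ?thesis
  proof (cases "\<forall>e\<in>S. finite e \<and> card e = k")
    case False
    then obtain e where e: "e \<in> S" "\<not> (finite e \<and> card e = k)" by blast
    have "{C\<in>{C. is_cyc k t C \<and> C \<subseteq> [V]\<^bsup>k\<^esup>}. S \<subseteq> C} = {}" using e by (auto simp: nsets_def)
    then show ?thesis unfolding codegree_def by (simp only: card.empty) simp
  next
    case True
    have finU: "finite U" using S True by (auto simp: U_def)
    have cU: "card U \<le> t * k"
    proof -
      have "card U \<le> (\<Sum>e\<in>S. card e)" unfolding U_def using card_UN_le[OF S(2), of "\<lambda>x. x"] by simp
      also have "\<dots> = card S * k" using True by simp
      finally show ?thesis using mult_le_mono1[OF S(3), of k] by linarith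
    qed
    have sub: "{C\<in>{C. is_cyc k t C \<and> C \<subseteq> [V]\<^bsup>k\<^esup>}. S \<subseteq> C} \<subseteq> cyc k t ` \<V>"
    proof
      fix C assume "C \<in> {C\<in>{C. is_cyc k t C \<and> C \<subseteq> [V]\<^bsup>k\<^esup>}. S \<subseteq> C}"
      then obtain v where v: "inj_on v {..<t}" "C = cyc k t v" and C: "C \<subseteq> [V]\<^bsup>k\<^esup>" "S \<subseteq> C" unfolding is_cyc_def by blast
      have "\<Union>C \<subseteq> V" using C(1) by (auto simp: nsets_def)
      then have vV: "v ` {..<t} \<subseteq> V" unfolding v(2) Union_cyc[OF t_pos(4)] .
      define I where "I = {i. i < t \<and> v ` window k t i \<in> S}"
      define A where "A = (\<Union>i\<in>I. window k t i)"
      have Aw: "A \<subseteq> {..<t}" unfolding A_def using window_subset[OF t_pos(1)] by blast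
      have SI: "S = (\<lambda>i. v ` window k t i) ` I" using C(2) v(2) by (auto simp: I_def cyc_def)
      have finI: "finite I" by (simp add: I_def)
      have "card S \<le> card I" unfolding SI by (rule card_image_le[OF finI])
      moreover have "min t (card I + k - 1) \<le> card A"
      proof -
        have "I \<noteq> {}" using SI S(1) by (metis image_empty)
        moreover have "I \<subseteq> {..<t}" by (auto simp: I_def)
        ultimately show ?thesis unfolding A_def by (intro card_Union_window t_pos(4))
      qed
      ultimately have wA: "w \<le> card A" unfolding w_def by linarith
      have AU: "v ` A \<subseteq> U" unfolding A_def U_def SI by blast
      have "restrict v {..<t} \<in> PiE {..<t} (\<lambda>i. if i \<in> A then U else V)" unfolding restrict_PiE_iff using AU vV by auto
      then have "restrict v {..<t} \<in> \<V>" unfolding \<V>_def using Aw wA by blast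
      then show "C \<in> cyc k t ` \<V>" using cyc_restrict[of v] v(2) by (metis imageI)
    qed
    have fin1: "finite {A. A \<subseteq> {..<t} \<and> w \<le> card A}" by simp
    have finV: "finite \<V>" unfolding \<V>_def using V(1) finU by (intro finite_UN_I fin1 finite_PiE) auto
    have "card {C\<in>{C. is_cyc k t C \<and> C \<subseteq> [V]\<^bsup>k\<^esup>}. S \<subseteq> C} \<le> card \<V>" by (rule surj_card_le[OF finV sub])
    also have "\<dots> \<le> (\<Sum>A\<in>{A. A \<subseteq> {..<t} \<and> w \<le> card A}. card (PiE {..<t} (\<lambda>i. if i \<in> A then U else V)))"
      unfolding \<V>_def by (rule card_UN_le[OF fin1])
    also have "\<dots> \<le> (\<Sum>A\<in>{A. A \<subseteq> {..<t} \<and> w \<le> card A}. (t * k) ^ t * m ^ (t - w))"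
    proof (rule sum_mono)
      fix A assume A: "A \<in> {A. A \<subseteq> {..<t} \<and> w \<le> card A}"
      then have finA: "finite A" using finite_subset by blast
      have cA: "card A \<le> t" using A card_mono[of "{..<t}" A] by simp
      have "card (PiE {..<t} (\<lambda>i. if i \<in> A then U else V)) = (\<Prod>i<t. if i \<in> A then card U else card V)"
        by (simp add: card_PiE if_distrib)
      also have "\<dots> = card U ^ card A * m ^ (t - card A)"
      proof -
        have "{..<t} \<inter> A = A" "card ({..<t} \<inter> - A) = t - card A" using A finA by (auto simp: Diff_eq[symmetric] card_Diff_subset)
        then show ?thesis by (simp add: prod.If_cases m_def)
      qed
      also have "\<dots> \<le> (t * k) ^ card A * m ^ (t - w)"
        using cU A m1 by (intro mult_mono power_mono power_increasing) auto
      also have "\<dots> \<le> (t * k) ^ t * m ^ (t - w)" by (intro mult_le_mono1 power_increasing[OF cA tk1])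
      finally show "card (PiE {..<t} (\<lambda>i. if i \<in> A then U else V)) \<le> (t * k) ^ t * m ^ (t - w)" .
    qed
    also have "\<dots> = card {A. A \<subseteq> {..<t} \<and> w \<le> card A} * ((t * k) ^ t * m ^ (t - w))" by simp
    also have "\<dots> \<le> 2 ^ t * ((t * k) ^ t * m ^ (t - w))"
    proof (rule mult_le_mono1)
      have "card {A. A \<subseteq> {..<t} \<and> w \<le> card A} \<le> card (Pow {..<t})" by (intro card_mono) auto
      then show "card {A. A \<subseteq> {..<t} \<and> w \<le> card A} \<le> 2 ^ t" by (simp add: card_Pow)
    qed
    finally have "real (codegree {C. is_cyc k t C \<and> C \<subseteq> [V]\<^bsup>k\<^esup>} S) \<le> real (2 ^ t * ((t * k) ^ t * m ^ (t - w)))"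
      unfolding codegree_def by (rule of_nat_mono)
    then show ?thesis by (simp add: m_def w_def mult_ac)
  qed
qed

text \<open>The hypergraph to which the container theorem is applied has the k-subsets of V as
  vertices and the tight cycles as edges. For it x is the exponent with
  \<open>D * q ^ (t - 1) = 1\<close>, so the fingerprints have order
  \<open>card V powr (real k - x)\<close>.\<close>

lemma cycle_containers:
  fixes x \<beta> :: real
  assumes x: "x = (real t - real k) / (real t - 1)" and \<beta>: "0 < \<beta>"
  shows "\<exists>L>0. \<forall>V :: nat set. finite V \<longrightarrow> V \<noteq> {} \<longrightarrow>
    cert (\<lambda>I. I \<subseteq> [V]\<^bsup>k\<^esup> \<and> (\<forall>C. is_cyc k t C \<longrightarrow> \<not> C \<subseteq> I)) (L * real (card V) powr (real k - x))
      (\<lambda>X. X \<subseteq> [V]\<^bsup>k\<^esup> \<and> real (card {C. is_cyc k t C \<and> C \<subseteq> [V]\<^bsup>k\<^esup> \<and> C \<inter> X = {}}) < \<beta> * real (card V) ^ t)"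
proof -
  define K where "K = 2 ^ t * real (t * k) ^ t"
  have K0: "0 < K" using t_pos by (simp add: K_def)
  have tr: "real k \<ge> 4" "real t \<ge> 2 * real k" using k4 tk by linarith+
  have xt: "x * (real t - 1) = real t - real k" using x tr by simp
  have x01: "0 \<le> x" "x \<le> 1" using tr by (auto simp: x)
  have t1: "t \<ge> 1" using t_pos by linarith
  obtain L where L: "L > 0" "\<forall>(\<Omega> :: nat set set) \<H> q D N. finite \<Omega> \<longrightarrow> \<H> \<subseteq> [\<Omega>]\<^bsup>t\<^esup> \<longrightarrow> real (card \<Omega>) \<le> N \<longrightarrow> 0 < q
      \<longrightarrow> q \<le> 1 \<longrightarrow> 0 < D \<longrightarrow> D * q ^ (t - 1) = 1 \<longrightarrow> 1 \<le> q * N \<longrightarrow> capped K D q t \<H> \<longrightarrow>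
      cert (\<lambda>I. I \<subseteq> \<Omega> \<and> avoids \<H> I) (L * (q * N))
        (\<lambda>X. X \<subseteq> \<Omega> \<and> real (card {e\<in>\<H>. e \<inter> X = {}}) < \<beta> * D * N)"
    using containers[OF t1 K0 \<beta>, where 'a = "nat set"] by (elim exE conjE)
  show ?thesis
  proof (intro exI[of _ L] conjI allI impI)
    show "0 < L" by (fact L(1))
    fix V :: "nat set" assume V: "finite V" "V \<noteq> {}"
    define m where "m = real (card V)"
    have m: "1 \<le> m" using V by (simp add: m_def Suc_le_eq card_gt_0_iff)
    define \<H> where "\<H> = {C. is_cyc k t C \<and> C \<subseteq> [V]\<^bsup>k\<^esup>}"
    define q where "q = m powr (- x)"
    define D where "D = m powr (real t - real k)"
    define N where "N = m powr real k"
    have Nk: "N = m ^ k" using m by (simp add: N_def powr_realpow)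
    have qp: "q ^ j = m powr (- x * real j)" for j using m by (simp add: q_def powr_realpow[symmetric] powr_powr)
    have fin: "finite ([V]\<^bsup>k\<^esup>)" using V by (simp add: finite_imp_finite_nsets)
    have "cert (\<lambda>I. I \<subseteq> [V]\<^bsup>k\<^esup> \<and> avoids \<H> I) (L * (q * N)) (\<lambda>X. X \<subseteq> [V]\<^bsup>k\<^esup> \<and> real (card {e\<in>\<H>. e \<inter> X = {}}) < \<beta> * D * N)"
    proof (rule L(2)[rule_format, OF fin])
      show "\<H> \<subseteq> [[V]\<^bsup>k\<^esup>]\<^bsup>t\<^esup>"
      proof
        fix C assume "C \<in> \<H>"
        then obtain v where "inj_on v {..<t}" "C = cyc k t v" "C \<subseteq> [V]\<^bsup>k\<^esup>" unfolding \<H>_def is_cyc_def by blast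
        then show "C \<in> [[V]\<^bsup>k\<^esup>]\<^bsup>t\<^esup>" using card_cyc[OF _ tk t_pos(4)] finite_subset[OF _ fin] by (auto simp: nsets_def)
      qed
      show "real (card ([V]\<^bsup>k\<^esup>)) \<le> N" unfolding Nk m_def using of_nat_mono[OF card_nsets_le[OF V(1), of k], where 'a = real] by simp
      show "0 < q" "0 < D" using m by (auto simp: q_def D_def)
      show "q \<le> 1" using powr_mono[of "- x" 0 m] m x01 by (simp add: q_def)
      have "real (t - 1) = real t - 1" using t1 by (simp add: of_nat_diff)
      then show "D * q ^ (t - 1) = 1" unfolding qp D_def powr_add[symmetric] using xt m by simp
      have "m powr 0 \<le> m powr (- x + real k)" using m x01 tr by (intro powr_mono) auto
      then show "1 \<le> q * N" using m unfolding q_def N_def powr_add by simp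
      show "capped K D q t \<H>"
        unfolding capped_def
      proof (intro allI impI)
        fix S :: "nat set set" assume S: "S \<noteq> {}" "finite S" "card S \<le> t"
        define j where "j = card S"
        have j: "1 \<le> j" "j \<le> t" using S by (auto simp: j_def Suc_le_eq card_gt_0_iff)
        have jr: "real (j - 1) = real j - 1" using j by (simp add: of_nat_diff)
        have "real j - 1 \<le> real t - 1" "0 \<le> real j - 1" using j by auto
        note j' = this
        \<comment> \<open>The two regimes of the codegree bound: while j + k - 1 is below t each
          edge beyond the first fixes a vertex and x \<le> 1 suffices; afterwards the value at j = t
          is enough.\<close>
        have xj: "x * (real j - 1) \<le> x * (real t - 1)" "x * (real j - 1) \<le> 1 * (real j - 1)"
          by (rule mult_left_mono[OF j'(1) x01(1)], rule mult_right_mono[OF x01(2) j'(2)])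
        have "real (codegree \<H> S) \<le> K * m ^ (t - min t (j + k - 1))"
          using codegree_cycles[OF V S] by (simp add: \<H>_def K_def m_def j_def)
        also have "\<dots> \<le> K * (D * q ^ (j - 1))"
        proof (rule mult_left_mono)
          have "m ^ (t - min t (j + k - 1)) = m powr real (t - min t (j + k - 1))" using m by (intro powr_realpow[symmetric]) simp
          also have "\<dots> \<le> m powr (real t - real k + - x * (real j - 1))"
          proof (rule powr_mono[OF _ m])
            show "real (t - min t (j + k - 1)) \<le> real t - real k + - x * (real j - 1)"
            proof (cases "t \<le> j + k - 1")
              case True
              then show ?thesis using xj(1) xt by simp
            next
              case False
              then have "real (t - min t (j + k - 1)) = real t - real k - (real j - 1)" using j by (simp add: of_nat_diff min_def)
              then show ?thesis using xj(2) by simp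
            qed
          qed
          finally show "m ^ (t - min t (j + k - 1)) \<le> D * q ^ (j - 1)" unfolding qp jr D_def powr_add .
        qed (use K0 in simp)
        finally show "real (codegree \<H> S) \<le> K * D * q ^ (card S - 1)" by (simp add: j_def mult.assoc)
      qed
    qed
    then show "cert (\<lambda>I. I \<subseteq> [V]\<^bsup>k\<^esup> \<and> (\<forall>C. is_cyc k t C \<longrightarrow> \<not> C \<subseteq> I)) (L * real (card V) powr (real k - x))
      (\<lambda>X. X \<subseteq> [V]\<^bsup>k\<^esup> \<and> real (card {C. is_cyc k t C \<and> C \<subseteq> [V]\<^bsup>k\<^esup> \<and> C \<inter> X = {}}) < \<beta> * real (card V) ^ t)"
    proof (rule cert_weaken)
      show "I \<subseteq> [V]\<^bsup>k\<^esup> \<and> avoids \<H> I" if "I \<subseteq> [V]\<^bsup>k\<^esup> \<and> (\<forall>C. is_cyc k t C \<longrightarrow> \<not> C \<subseteq> I)" for I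
        using that unfolding avoids_def \<H>_def by blast
      show "L * (q * N) \<le> L * real (card V) powr (real k - x)" by (simp add: q_def N_def m_def powr_add[symmetric])
      have "D * N = m powr (real t - real k + real k)" unfolding D_def N_def by (rule powr_add[symmetric])
      then have DN: "\<beta> * D * N = \<beta> * real (card V) ^ t" using m by (simp add: powr_realpow m_def mult.assoc)
      have HX: "{e\<in>\<H>. e \<inter> X = {}} = {C. is_cyc k t C \<and> C \<subseteq> [V]\<^bsup>k\<^esup> \<and> C \<inter> X = {}}" for X by (auto simp: \<H>_def)
      show "X \<subseteq> [V]\<^bsup>k\<^esup> \<and> real (card {C. is_cyc k t C \<and> C \<subseteq> [V]\<^bsup>k\<^esup> \<and> C \<inter> X = {}}) < \<beta> * real (card V) ^ t"
        if "X \<subseteq> [V]\<^bsup>k\<^esup> \<and> real (card {e\<in>\<H>. e \<inter> X = {}}) < \<beta> * D * N" for X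
        using that unfolding HX DN .
    qed
  qed
qed


definition cycle_free :: "nat set set \<Rightarrow> bool" where
  "cycle_free I \<longleftrightarrow> (\<forall>C. is_cyc k t C \<longrightarrow> \<not> C \<subseteq> I)"

lemma cycle_container_fingerprints:
  fixes x \<gamma> :: real
  assumes "x = (real t - real k) / (real t - 1)" "0 < \<gamma>"
  obtains L where "L > 0" "\<And>V :: nat set. finite V \<Longrightarrow> V \<noteq> {} \<Longrightarrow>
    cert (\<lambda>I. I \<subseteq> [V]\<^bsup>k\<^esup> \<and> cycle_free I) (L * real (card V) powr (real k - x))
      (\<lambda>X. X \<subseteq> [V]\<^bsup>k\<^esup> \<and> real (card {U\<in>[V]\<^bsup>t\<^esup>. [U]\<^bsup>k\<^esup> \<inter> X = {}}) < \<gamma> * real (card V) ^ t)"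
proof -
  obtain L where L: "L > 0" "\<forall>V :: nat set. finite V \<longrightarrow> V \<noteq> {} \<longrightarrow>
    cert (\<lambda>I. I \<subseteq> [V]\<^bsup>k\<^esup> \<and> (\<forall>C. is_cyc k t C \<longrightarrow> \<not> C \<subseteq> I)) (L * real (card V) powr (real k - x))
      (\<lambda>X. X \<subseteq> [V]\<^bsup>k\<^esup> \<and> real (card {C. is_cyc k t C \<and> C \<subseteq> [V]\<^bsup>k\<^esup> \<and> C \<inter> X = {}}) < \<gamma> * real (card V) ^ t)"
    using cycle_containers[OF assms] by (elim exE conjE)
  show thesis
  proof (rule that[OF L(1)])
    fix V :: "nat set" assume V: "finite V" "V \<noteq> {}"
    show "cert (\<lambda>I. I \<subseteq> [V]\<^bsup>k\<^esup> \<and> cycle_free I) (L * real (card V) powr (real k - x))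
      (\<lambda>X. X \<subseteq> [V]\<^bsup>k\<^esup> \<and> real (card {U\<in>[V]\<^bsup>t\<^esup>. [U]\<^bsup>k\<^esup> \<inter> X = {}}) < \<gamma> * real (card V) ^ t)"
    proof (rule cert_weaken[OF L(2)[rule_format, OF V]])
      fix X assume X: "X \<subseteq> [V]\<^bsup>k\<^esup> \<and> real (card {C. is_cyc k t C \<and> C \<subseteq> [V]\<^bsup>k\<^esup> \<and> C \<inter> X = {}}) < \<gamma> * real (card V) ^ t"
      have "real (card {U\<in>[V]\<^bsup>t\<^esup>. [U]\<^bsup>k\<^esup> \<inter> X = {}}) \<le> real (card {C. is_cyc k t C \<and> C \<subseteq> [V]\<^bsup>k\<^esup> \<and> C \<inter> X = {}})"
        by (rule of_nat_mono[OF card_cliques_le_cycles[OF V(1)]])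
      then show "X \<subseteq> [V]\<^bsup>k\<^esup> \<and> real (card {U\<in>[V]\<^bsup>t\<^esup>. [U]\<^bsup>k\<^esup> \<inter> X = {}}) < \<gamma> * real (card V) ^ t" using X by linarith
    qed (simp_all add: cycle_free_def)
  qed
qed

lemma one_minus_power_le_exp:
  fixes p g :: real
  assumes "0 \<le> p" "p \<le> 1" "g \<le> real n" shows "(1 - p) ^ n \<le> exp (- (p * g))"
proof -
  have "(1 - p) ^ n \<le> exp (- p) ^ n" using assms exp_ge_add_one_self[of "- p"] by (intro power_mono) auto
  also have "\<dots> = exp (- (p * real n))" using exp_of_nat2_mult[of "- p" n] by simp
  also have "\<dots> \<le> exp (- (p * g))" using assms by (simp add: mult_left_mono)
  finally show ?thesis .
qed

text \<open>The sets excluded by the containers of I and of J have a common part, of positive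
  density by Ramsey, which the random set I \<union> J has to miss. The number of fingerprint pairs
  is too small to matter: the exponent k - x of the fingerprints is below the exponent of n^k p, and
  this absorbs the logarithm.\<close>

lemma prob_two_cycle_free:
  fixes x :: real
  assumes x: "x = (real t - real k) / (real t - 1)"
  shows "\<exists>\<gamma>>0. \<exists>L>0. \<exists>R. \<forall>(V :: nat set) p. finite V \<longrightarrow> V \<noteq> {} \<longrightarrow> R \<le> card V \<longrightarrow> 0 \<le> p \<longrightarrow> p \<le> 1 \<longrightarrow>
    rPr p ([V]\<^bsup>k\<^esup>) (\<lambda>X. \<exists>I J. X = I \<union> J \<and> cycle_free I \<and> cycle_free J)
     \<le> ((real (card V) ^ k) powr (L * real (card V) powr (real k - x)) * exp 1) ^ 2 * exp (- (p * (\<gamma> * real (card V) ^ k)))"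
proof -
  obtain \<gamma> R where \<gamma>: "\<gamma> > 0" "\<forall>(V :: nat set) f. finite V \<longrightarrow> R \<le> card V \<longrightarrow> f \<in> [V]\<^bsup>k\<^esup> \<rightarrow> {..<length [t, t, k]} \<longrightarrow>
    (\<exists>i<length [t, t, k]. \<gamma> * real (card V) ^ ([t, t, k] ! i) \<le> real (card {U\<in>[V]\<^bsup>([t, t, k] ! i)\<^esup>. f ` [U]\<^bsup>k\<^esup> \<subseteq> {i}}))"
    using ramsey_density[of k "[t, t, k]", where 'a = nat] by (elim exE conjE)
  obtain L where L: "L > 0" "\<And>V :: nat set. finite V \<Longrightarrow> V \<noteq> {} \<Longrightarrow>
    cert (\<lambda>I. I \<subseteq> [V]\<^bsup>k\<^esup> \<and> cycle_free I) (L * real (card V) powr (real k - x))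
      (\<lambda>X. X \<subseteq> [V]\<^bsup>k\<^esup> \<and> real (card {U\<in>[V]\<^bsup>t\<^esup>. [U]\<^bsup>k\<^esup> \<inter> X = {}}) < \<gamma> * real (card V) ^ t)"
  proof (rule cycle_container_fingerprints[OF x \<gamma>(1)])
    fix L assume H: "L > 0" "\<And>V :: nat set. finite V \<Longrightarrow> V \<noteq> {} \<Longrightarrow>
    cert (\<lambda>I. I \<subseteq> [V]\<^bsup>k\<^esup> \<and> cycle_free I) (L * real (card V) powr (real k - x))
      (\<lambda>X. X \<subseteq> [V]\<^bsup>k\<^esup> \<and> real (card {U\<in>[V]\<^bsup>t\<^esup>. [U]\<^bsup>k\<^esup> \<inter> X = {}}) < \<gamma> * real (card V) ^ t)"
    show thesis by (rule that, fact H(1), fact H(2))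
  qed
  have "rPr p ([V]\<^bsup>k\<^esup>) (\<lambda>X. \<exists>I J. X = I \<union> J \<and> cycle_free I \<and> cycle_free J)
     \<le> ((real (card V) ^ k) powr (L * real (card V) powr (real k - x)) * exp 1) ^ 2 * exp (- (p * (\<gamma> * real (card V) ^ k)))"
    if V: "finite V" "V \<noteq> {}" "R \<le> card V" and p: "0 \<le> p" "p \<le> 1" for V :: "nat set" and p
  proof -
    define m where "m = real (card V)"
    define \<Omega> where "\<Omega> = [V]\<^bsup>k\<^esup>"
    define s where "s = L * m powr (real k - x)"
    have m1: "1 \<le> m" using V by (simp add: m_def Suc_le_eq card_gt_0_iff)
    have fin: "finite \<Omega>" using V by (simp add: \<Omega>_def finite_imp_finite_nsets)
    define G where "G = (\<lambda>X. X \<subseteq> \<Omega> \<and> real (card {U\<in>[V]\<^bsup>t\<^esup>. [U]\<^bsup>k\<^esup> \<inter> X = {}}) < \<gamma> * m ^ t)"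
    obtain \<sigma> \<xi> where cert: "\<And>I. I \<subseteq> \<Omega> \<and> cycle_free I \<Longrightarrow> certifies \<sigma> \<xi> s G I"
      using L(2)[OF V(1,2)] unfolding \<Omega>_def[symmetric] m_def[symmetric] s_def[symmetric] G_def[symmetric] by (rule certE) blast
    have dens: "\<gamma> * m ^ k \<le> real (card (X1 \<inter> X2 \<inter> \<Omega>))" if X: "G X1" "G X2" for X1 X2
    proof -
      \<comment> \<open>Colours 0 and 1 stand for k-sets in one of the two containers, where
        monochromatic t-sets are rare. The third clique size is k itself, so colour 2 merely counts
        the k-sets excluded by both.\<close>
      define f :: "nat set \<Rightarrow> nat" where "f = (\<lambda>e. if e \<notin> X1 then 0 else if e \<notin> X2 then 1 else 2)"
      have "f \<in> [V]\<^bsup>k\<^esup> \<rightarrow> {..<length [t, t, k]}" by (auto simp: f_def)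
      then obtain i where i: "i < length [t, t, k]"
        "\<gamma> * m ^ ([t, t, k] ! i) \<le> real (card {U\<in>[V]\<^bsup>([t, t, k] ! i)\<^esup>. f ` [U]\<^bsup>k\<^esup> \<subseteq> {i}})"
        using \<gamma>(2)[rule_format, OF V(1,3)] unfolding m_def by blast
      have finU: "finite {U\<in>[V]\<^bsup>t\<^esup>. P U}" for P using V by (simp add: finite_imp_finite_nsets)
      have no: "\<not> \<gamma> * m ^ t \<le> real (card {U\<in>[V]\<^bsup>t\<^esup>. f ` [U]\<^bsup>k\<^esup> \<subseteq> {j}})"
        if Y: "G Y" "\<And>e. f e = j \<Longrightarrow> e \<notin> Y" for Y j
      proof -
        have "{U\<in>[V]\<^bsup>t\<^esup>. f ` [U]\<^bsup>k\<^esup> \<subseteq> {j}} \<subseteq> {U\<in>[V]\<^bsup>t\<^esup>. [U]\<^bsup>k\<^esup> \<inter> Y = {}}" using Y(2) by blast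
        then have "card {U\<in>[V]\<^bsup>t\<^esup>. f ` [U]\<^bsup>k\<^esup> \<subseteq> {j}} \<le> card {U\<in>[V]\<^bsup>t\<^esup>. [U]\<^bsup>k\<^esup> \<inter> Y = {}}" by (rule card_mono[OF finU])
        then have "real (card {U\<in>[V]\<^bsup>t\<^esup>. f ` [U]\<^bsup>k\<^esup> \<subseteq> {j}}) \<le> real (card {U\<in>[V]\<^bsup>t\<^esup>. [U]\<^bsup>k\<^esup> \<inter> Y = {}})" by (rule of_nat_mono)
        then show ?thesis using Y(1) unfolding G_def by linarith
      qed
      have n0: "\<not> \<gamma> * m ^ t \<le> real (card {U\<in>[V]\<^bsup>t\<^esup>. f ` [U]\<^bsup>k\<^esup> \<subseteq> {0}})"
        by (rule no[OF X(1)]) (simp add: f_def split: if_splits)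
      have n1: "\<not> \<gamma> * m ^ t \<le> real (card {U\<in>[V]\<^bsup>t\<^esup>. f ` [U]\<^bsup>k\<^esup> \<subseteq> {1}})"
        by (rule no[OF X(2)]) (simp add: f_def split: if_splits)
      have "i \<noteq> 0" using i(2) n0 by (cases "i = 0") auto
      moreover have "i \<noteq> 1" using i(2) n1 by (cases "i = 1") auto
      ultimately have "i = 2" using i(1) by simp
      then have "\<gamma> * m ^ k \<le> real (card {U\<in>[V]\<^bsup>k\<^esup>. f ` [U]\<^bsup>k\<^esup> \<subseteq> {2}})" using i(2) by simp
      also have "\<dots> \<le> real (card (X1 \<inter> X2 \<inter> \<Omega>))"
      proof (intro of_nat_mono card_mono)
        show "finite (X1 \<inter> X2 \<inter> \<Omega>)" using fin by simp
        show "{U\<in>[V]\<^bsup>k\<^esup>. f ` [U]\<^bsup>k\<^esup> \<subseteq> {2}} \<subseteq> X1 \<inter> X2 \<inter> \<Omega>"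
        proof
          fix U assume U: "U \<in> {U\<in>[V]\<^bsup>k\<^esup>. f ` [U]\<^bsup>k\<^esup> \<subseteq> {2}}"
          then have "U \<in> [U]\<^bsup>k\<^esup>" by (auto simp: nsets_def)
          then have "f U = 2" using U by blast
          then show "U \<in> X1 \<inter> X2 \<inter> \<Omega>" using U by (auto simp: f_def \<Omega>_def split: if_splits)
        qed
      qed
      finally show ?thesis .
    qed
    define \<S> where "\<S> = {S. S \<subseteq> \<Omega> \<and> real (card S) \<le> s}"
    define \<P> where "\<P> = {P\<in>\<S> \<times> \<S>. \<gamma> * m ^ k \<le> real (card (\<xi> (fst P) \<inter> \<xi> (snd P) \<inter> \<Omega>))}"
    have finS: "finite \<S>" unfolding \<S>_def using fin by simp
    have finP: "finite \<P>" unfolding \<P>_def using finS by simp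
    have cS: "real (card \<S>) \<le> (m ^ k) powr s * exp 1"
      unfolding \<S>_def
    proof (rule card_small_subsets[OF fin])
      show "real (card \<Omega>) \<le> m ^ k" unfolding \<Omega>_def m_def using of_nat_mono[OF card_nsets_le[OF V(1), of k], where 'a = real] by simp
      show "1 \<le> m ^ k" using m1 by (rule one_le_power)
    qed
    have "rPr p \<Omega> (\<lambda>X. \<exists>I J. X = I \<union> J \<and> cycle_free I \<and> cycle_free J)
       \<le> rPr p \<Omega> (\<lambda>X. \<exists>P\<in>\<P>. X \<inter> (\<xi> (fst P) \<inter> \<xi> (snd P) \<inter> \<Omega>) = {})"
    proof (rule rPr_mono[OF p])
      fix X assume X: "X \<subseteq> \<Omega>" "\<exists>I J. X = I \<union> J \<and> cycle_free I \<and> cycle_free J"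
      then obtain I J where IJ: "X = I \<union> J" "cycle_free I" "cycle_free J" by blast
      have sub: "I \<subseteq> \<Omega>" "J \<subseteq> \<Omega>" using X(1) IJ(1) by auto
      have cI: "certifies \<sigma> \<xi> s G I" and cJ: "certifies \<sigma> \<xi> s G J" using cert sub IJ by auto
      note I = certifiesD[OF cI] and J = certifiesD[OF cJ]
      have eI: "\<xi> (\<sigma> I) = \<xi> I" by (rule I(6)[OF subset_refl I(1)])
      have eJ: "\<xi> (\<sigma> J) = \<xi> J" by (rule J(6)[OF subset_refl J(1)])
      have S1: "\<sigma> I \<in> \<S>" unfolding \<S>_def using I(1,3) sub(1) by blast
      have S2: "\<sigma> J \<in> \<S>" unfolding \<S>_def using J(1,3) sub(2) by blast
      have "(\<sigma> I, \<sigma> J) \<in> \<P>" unfolding \<P>_def using S1 S2 dens[OF I(4) J(4)] by (simp add: eI eJ)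
      moreover have "X \<inter> (\<xi> (fst (\<sigma> I, \<sigma> J)) \<inter> \<xi> (snd (\<sigma> I, \<sigma> J)) \<inter> \<Omega>) = {}"
        unfolding fst_conv snd_conv eI eJ using I(5) J(5) IJ(1) by blast
      ultimately show "\<exists>P\<in>\<P>. X \<inter> (\<xi> (fst P) \<inter> \<xi> (snd P) \<inter> \<Omega>) = {}" by (rule bexI[rotated])
    qed
    also have "\<dots> \<le> (\<Sum>P\<in>\<P>. rPr p \<Omega> (\<lambda>X. X \<inter> (\<xi> (fst P) \<inter> \<xi> (snd P) \<inter> \<Omega>) = {}))" by (rule rPr_Union[OF p finP])
    also have "\<dots> \<le> (\<Sum>P\<in>\<P>. exp (- (p * (\<gamma> * m ^ k))))"
    proof (rule sum_mono)
      fix P assume P: "P \<in> \<P>"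
      have "rPr p \<Omega> (\<lambda>X. X \<inter> (\<xi> (fst P) \<inter> \<xi> (snd P) \<inter> \<Omega>) = {}) = (1 - p) ^ card (\<xi> (fst P) \<inter> \<xi> (snd P) \<inter> \<Omega>)"
        by (rule rPr_disjoint[OF fin]) blast
      also have "\<dots> \<le> exp (- (p * (\<gamma> * m ^ k)))" using P unfolding \<P>_def by (intro one_minus_power_le_exp[OF p]) blast
      finally show "rPr p \<Omega> (\<lambda>X. X \<inter> (\<xi> (fst P) \<inter> \<xi> (snd P) \<inter> \<Omega>) = {}) \<le> exp (- (p * (\<gamma> * m ^ k)))" .
    qed
    also have "\<dots> = real (card \<P>) * exp (- (p * (\<gamma> * m ^ k)))" by simp
    also have "\<dots> \<le> ((m ^ k) powr s * exp 1) ^ 2 * exp (- (p * (\<gamma> * m ^ k)))"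
    proof (rule mult_right_mono)
      have "card \<P> \<le> card (\<S> \<times> \<S>)" unfolding \<P>_def using finS by (intro card_mono) auto
      then have "real (card \<P>) \<le> real (card \<S>) ^ 2" by (metis card_cartesian_product of_nat_mono of_nat_mult power2_eq_square)
      also have "\<dots> \<le> ((m ^ k) powr s * exp 1) ^ 2" by (rule power_mono[OF cS]) simp
      finally show "real (card \<P>) \<le> ((m ^ k) powr s * exp 1) ^ 2" .
    qed simp
    finally show ?thesis by (simp only: \<Omega>_def m_def s_def)
  qed
  then show ?thesis using \<gamma>(1) L(1) by blast
qed

lemma card_triangles:
  assumes V: "finite (V :: nat set)"
  shows "card {T. is_tri k T \<and> T \<subseteq> [V]\<^bsup>k\<^esup>} \<le> card V ^ Suc k * Suc k ^ 3"
proof -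
  define \<Q> where "\<Q> = [V]\<^bsup>Suc k\<^esup>"
  have finQ: "finite \<Q>" "\<And>Q. Q \<in> \<Q> \<Longrightarrow> finite Q \<and> card Q = Suc k" using V by (auto simp: \<Q>_def finite_imp_finite_nsets nsets_def)
  have "{T. is_tri k T \<and> T \<subseteq> [V]\<^bsup>k\<^esup>} \<subseteq> (\<Union>Q\<in>\<Q>. [[Q]\<^bsup>k\<^esup>]\<^bsup>3\<^esup>)"
  proof
    fix T assume T: "T \<in> {T. is_tri k T \<and> T \<subseteq> [V]\<^bsup>k\<^esup>}"
    then have "\<Union>T \<in> \<Q>" "T \<in> [[\<Union>T]\<^bsup>k\<^esup>]\<^bsup>3\<^esup>"
      using is_tri_subset_faces[of k T] is_tri_card[of k T] t_pos(4) unfolding \<Q>_def by (auto simp: nsets_def)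
    then show "T \<in> (\<Union>Q\<in>\<Q>. [[Q]\<^bsup>k\<^esup>]\<^bsup>3\<^esup>)" by blast
  qed
  then have "card {T. is_tri k T \<and> T \<subseteq> [V]\<^bsup>k\<^esup>} \<le> card (\<Union>Q\<in>\<Q>. [[Q]\<^bsup>k\<^esup>]\<^bsup>3\<^esup>)"
    using finQ by (intro card_mono) (auto simp: finite_imp_finite_nsets)
  also have "\<dots> \<le> (\<Sum>Q\<in>\<Q>. card ([[Q]\<^bsup>k\<^esup>]\<^bsup>3\<^esup>))" by (rule card_UN_le[OF finQ(1)])
  also have "\<dots> \<le> (\<Sum>Q\<in>\<Q>. Suc k ^ 3)"
  proof (rule sum_mono)
    fix Q assume Q: "Q \<in> \<Q>"
    show "card ([[Q]\<^bsup>k\<^esup>]\<^bsup>3\<^esup>) \<le> Suc k ^ 3"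
      using card_nsets_le[of "[Q]\<^bsup>k\<^esup>" 3] finQ(2)[OF Q] card_nsets_Suc[of Q k] by (simp add: finite_imp_finite_nsets)
  qed
  also have "\<dots> = card \<Q> * Suc k ^ 3" by simp
  also have "\<dots> \<le> card V ^ Suc k * Suc k ^ 3" unfolding \<Q>_def by (intro mult_le_mono1 card_nsets_le[OF V])
  finally show ?thesis .
qed

definition overlapping :: "nat set \<Rightarrow> (nat set set \<times> nat set set) set" where
  "overlapping V = {(T, T'). is_tri k T \<and> is_tri k T' \<and> T \<subseteq> [V]\<^bsup>k\<^esup> \<and> T' \<subseteq> [V]\<^bsup>k\<^esup> \<and> T \<noteq> T' \<and> T \<inter> T' \<noteq> {}}"

lemma finite_overlapping: "finite V \<Longrightarrow> finite (overlapping V)"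
  by (rule finite_subset[of _ "Pow ([V]\<^bsup>k\<^esup>) \<times> Pow ([V]\<^bsup>k\<^esup>)"]) (auto simp: overlapping_def finite_imp_finite_nsets)

text \<open>Different triangles on the same k + 1 vertices have at least four edges together; on
  different vertex sets they share exactly one facet, so there are five edges on k + 2 vertices. The
  seventh power collects the choices of two triples of facets and of the shared facet.\<close>

lemma sum_overlapping:
  fixes p :: real
  assumes V: "finite V" and p: "0 \<le> p" "p \<le> 1"
  shows "(\<Sum>P\<in>overlapping V. p ^ card (fst P \<union> snd P))
     \<le> real (Suc k) ^ 7 * (real (card V) ^ (k + 1) * p ^ 4 + real (card V) ^ (k + 2) * p ^ 5)"
proof -
  define \<Q> where "\<Q> = [V]\<^bsup>Suc k\<^esup>"
  define F where "F = (\<lambda>Q :: nat set. [[Q]\<^bsup>k\<^esup>]\<^bsup>3\<^esup>)"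
  define Nb where "Nb = (\<lambda>Q. {Q'\<in>\<Q>. Q' \<noteq> Q \<and> [Q']\<^bsup>k\<^esup> \<inter> [Q]\<^bsup>k\<^esup> \<noteq> {}})"
  have finQ: "finite \<Q>" "\<And>Q. Q \<in> \<Q> \<Longrightarrow> finite Q \<and> card Q = Suc k" using V by (auto simp: \<Q>_def finite_imp_finite_nsets nsets_def)
  have finF: "finite (F Q)" "card (F Q) \<le> Suc k ^ 3" if "Q \<in> \<Q>" for Q
    using card_nsets_le[of "[Q]\<^bsup>k\<^esup>" 3] finQ(2)[OF that] card_nsets_Suc[of Q k] by (simp_all add: F_def finite_imp_finite_nsets)
  have TF: "\<Union>T \<in> \<Q> \<and> T \<in> F (\<Union>T) \<and> finite T \<and> card T = 3" if "is_tri k T" "T \<subseteq> [V]\<^bsup>k\<^esup>" for T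
    using that is_tri_subset_faces[of k T] is_tri_card[of k T] t_pos(4) unfolding \<Q>_def F_def by (auto simp: nsets_def)
  have cQ: "card \<Q> \<le> card V ^ (k + 1)" unfolding \<Q>_def using card_nsets_le[OF V, of "Suc k"] by simp
  define O1 where "O1 = {P\<in>overlapping V. \<Union>(fst P) = \<Union>(snd P)}"
  define O2 where "O2 = {P\<in>overlapping V. \<Union>(fst P) \<noteq> \<Union>(snd P)}"
  have fin: "finite O1" "finite O2" using finite_overlapping[OF V] by (auto simp: O1_def O2_def)
  have 1: "card O1 \<le> card V ^ (k + 1) * Suc k ^ 7"
  proof -
    have "O1 \<subseteq> (\<Union>Q\<in>\<Q>. F Q \<times> F Q)"
    proof
      fix P assume "P \<in> O1"
      then obtain T T' where P: "P = (T, T')" "(T, T') \<in> overlapping V" "\<Union>T = \<Union>T'" unfolding O1_def by (metis (mono_tags, lifting) mem_Collect_eq prod.collapse)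
      then have "is_tri k T" "T \<subseteq> [V]\<^bsup>k\<^esup>" "is_tri k T'" "T' \<subseteq> [V]\<^bsup>k\<^esup>" by (auto simp: overlapping_def)
      then have "\<Union>T \<in> \<Q>" "T \<in> F (\<Union>T)" "T' \<in> F (\<Union>T)" using TF[of T] TF[of T'] P(3) by auto
      then show "P \<in> (\<Union>Q\<in>\<Q>. F Q \<times> F Q)" using P(1) by blast
    qed
    then have "card O1 \<le> card (\<Union>Q\<in>\<Q>. F Q \<times> F Q)" using finQ(1) finF(1) by (intro card_mono) auto
    also have "\<dots> \<le> (\<Sum>Q\<in>\<Q>. card (F Q \<times> F Q))" by (rule card_UN_le[OF finQ(1)])
    also have "\<dots> \<le> (\<Sum>Q\<in>\<Q>. Suc k ^ 3 * Suc k ^ 3)"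
    proof (rule sum_mono)
      fix Q assume Q: "Q \<in> \<Q>"
      show "card (F Q \<times> F Q) \<le> Suc k ^ 3 * Suc k ^ 3"
        unfolding card_cartesian_product by (intro mult_le_mono finF(2)[OF Q])
    qed
    also have "\<dots> = card \<Q> * Suc k ^ 6" by (simp only: power_add[symmetric] sum_constant) simp
    also have "\<dots> \<le> card V ^ (k + 1) * Suc k ^ 7" by (intro mult_le_mono cQ power_increasing) auto
    finally show ?thesis .
  qed
  have 2: "card O2 \<le> card V ^ (k + 2) * Suc k ^ 7"
  proof -
    have "O2 \<subseteq> (\<Union>Q\<in>\<Q>. \<Union>Q'\<in>Nb Q. F Q \<times> F Q')"
    proof
      fix P assume "P \<in> O2"
      then obtain T T' where P: "P = (T, T')" "(T, T') \<in> overlapping V" "\<Union>T \<noteq> \<Union>T'" unfolding O2_def by (metis (mono_tags, lifting) mem_Collect_eq prod.collapse)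
      then have T: "is_tri k T" "T \<subseteq> [V]\<^bsup>k\<^esup>" "is_tri k T'" "T' \<subseteq> [V]\<^bsup>k\<^esup>" "T \<inter> T' \<noteq> {}" by (auto simp: overlapping_def)
      note a = TF[OF T(1,2)] and b = TF[OF T(3,4)]
      have "T \<subseteq> [\<Union>T]\<^bsup>k\<^esup>" "T' \<subseteq> [\<Union>T']\<^bsup>k\<^esup>" using is_tri_subset_faces(3)[OF _ t_pos(4)] T(1,3) by auto
      then have "[\<Union>T']\<^bsup>k\<^esup> \<inter> [\<Union>T]\<^bsup>k\<^esup> \<noteq> {}" using T(5) by blast
      then have "\<Union>T' \<in> Nb (\<Union>T)" unfolding Nb_def using b P(3) by simp
      then show "P \<in> (\<Union>Q\<in>\<Q>. \<Union>Q'\<in>Nb Q. F Q \<times> F Q')" using P(1) a b by blast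
    qed
    moreover have finNb: "finite (Nb Q)" for Q using finQ(1) by (simp add: Nb_def)
    moreover have "finite (\<Union>Q\<in>\<Q>. \<Union>Q'\<in>Nb Q. F Q \<times> F Q')"
      using finQ(1) finNb finF(1) by (intro finite_UN_I finite_cartesian_product) (auto simp: Nb_def)
    ultimately have "card O2 \<le> card (\<Union>Q\<in>\<Q>. \<Union>Q'\<in>Nb Q. F Q \<times> F Q')" by (intro card_mono)
    also have "\<dots> \<le> (\<Sum>Q\<in>\<Q>. card (\<Union>Q'\<in>Nb Q. F Q \<times> F Q'))" by (rule card_UN_le[OF finQ(1)])
    also have "\<dots> \<le> (\<Sum>Q\<in>\<Q>. (Suc k * card V) * (Suc k ^ 3 * Suc k ^ 3))"
    proof (rule sum_mono)
      fix Q assume Q: "Q \<in> \<Q>"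
      have "card (\<Union>Q'\<in>Nb Q. F Q \<times> F Q') \<le> (\<Sum>Q'\<in>Nb Q. card (F Q \<times> F Q'))" by (rule card_UN_le[OF finNb])
      also have "\<dots> \<le> (\<Sum>Q'\<in>Nb Q. Suc k ^ 3 * Suc k ^ 3)"
      proof (rule sum_mono)
        fix Q' assume "Q' \<in> Nb Q"
        then have Q': "Q' \<in> \<Q>" by (simp add: Nb_def)
        show "card (F Q \<times> F Q') \<le> Suc k ^ 3 * Suc k ^ 3"
          unfolding card_cartesian_product by (intro mult_le_mono finF(2)[OF Q] finF(2)[OF Q'])
      qed
      also have "\<dots> = card (Nb Q) * (Suc k ^ 3 * Suc k ^ 3)" by simp
      also have "\<dots> \<le> (Suc k * card V) * (Suc k ^ 3 * Suc k ^ 3)"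
        unfolding Nb_def \<Q>_def using Q by (intro mult_le_mono1 card_neighbour_cliques[OF V]) (simp add: \<Q>_def)
      finally show "card (\<Union>Q'\<in>Nb Q. F Q \<times> F Q') \<le> (Suc k * card V) * (Suc k ^ 3 * Suc k ^ 3)" .
    qed
    also have "\<dots> = card \<Q> * (card V * Suc k ^ 7)"
    proof -
      have "y * z * (y ^ 3 * y ^ 3) = z * y ^ 7" for y z :: nat by (simp add: eval_nat_numeral)
      then show ?thesis by (simp only: sum_constant) simp
    qed
    also have "\<dots> \<le> card V ^ (k + 1) * (card V * Suc k ^ 7)" by (rule mult_le_mono1[OF cQ])
    also have "\<dots> = card V ^ (k + 2) * Suc k ^ 7" by simp
    finally show ?thesis .
  qed
  have "overlapping V = O1 \<union> O2" "O1 \<inter> O2 = {}" by (auto simp: O1_def O2_def)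
  then have "(\<Sum>P\<in>overlapping V. p ^ card (fst P \<union> snd P)) = (\<Sum>P\<in>O1. p ^ card (fst P \<union> snd P)) + (\<Sum>P\<in>O2. p ^ card (fst P \<union> snd P))"
    using fin by (simp add: sum.union_disjoint)
  also have "\<dots> \<le> (\<Sum>P\<in>O1. p ^ 4) + (\<Sum>P\<in>O2. p ^ 5)"
  proof (rule add_mono; rule sum_mono)
    fix P assume P: "P \<in> O1"
    obtain T T' where P': "P = (T, T')" by (metis prod.collapse)
    then have T: "is_tri k T" "is_tri k T'" "T \<noteq> T'" using P by (auto simp: O1_def overlapping_def)
    have c: "finite T" "finite T'" "card T = 3" "card T' = 3" using is_tri_card T by auto
    have "T \<subset> T \<union> T'" using T(3) c card_subset_eq[of T T'] by auto
    then have "3 < card (T \<union> T')" using c psubset_card_mono[of "T \<union> T'" T] by simp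
    then show "p ^ card (fst P \<union> snd P) \<le> p ^ 4" unfolding P' using p by (intro power_decreasing) auto
  next
    fix P assume P: "P \<in> O2"
    obtain T T' where P': "P = (T, T')" by (metis prod.collapse)
    then have T: "is_tri k T" "is_tri k T'" "\<Union>T \<noteq> \<Union>T'" using P by (auto simp: O2_def overlapping_def)
    have c: "finite T" "finite T'" "card T = 3" "card T' = 3" using is_tri_card[OF T(1)] is_tri_card[OF T(2)] by simp_all
    note f = is_tri_subset_faces[OF T(1) t_pos(4)] and f' = is_tri_subset_faces[OF T(2) t_pos(4)]
    have "T \<inter> T' \<subseteq> {\<Union>T \<inter> \<Union>T'}" using nsets_Int_le[OF f(1) f'(1) f(2) f'(2) T(3)] f(3) f'(3) by blast
    then have "card (T \<inter> T') \<le> 1" using card_mono[of "{\<Union>T \<inter> \<Union>T'}" "T \<inter> T'"] by simp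
    then have "5 \<le> card (T \<union> T')" using card_Un_Int[OF c(1,2)] c by linarith
    then show "p ^ card (fst P \<union> snd P) \<le> p ^ 5" unfolding P' using p by (intro power_decreasing) auto
  qed
  also have "\<dots> = real (card O1) * p ^ 4 + real (card O2) * p ^ 5" by simp
  also have "\<dots> \<le> real (card V ^ (k + 1) * Suc k ^ 7) * p ^ 4 + real (card V ^ (k + 2) * Suc k ^ 7) * p ^ 5"
    using of_nat_mono[OF 1, where 'a = real] of_nat_mono[OF 2, where 'a = real] p by (intro add_mono mult_right_mono) simp_all
  also have "\<dots> = real (Suc k) ^ 7 * (real (card V) ^ (k + 1) * p ^ 4 + real (card V) ^ (k + 2) * p ^ 5)"
    by (simp only: of_nat_mult of_nat_power distrib_left mult_ac)
  finally show ?thesis .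
qed

text \<open>A (k+1)-set has k + 1 facets, at least five because k is at least 4, and five are enough
  for three of one colour. One fixed choice of five facets per (k+1)-set is fed into Janson's
  inequality.\<close>

lemma prob_few_faces:
  fixes p :: real
  assumes V: "finite (V :: nat set)" and p: "0 \<le> p" "p \<le> 1"
  shows "rPr p ([V]\<^bsup>k\<^esup>) (\<lambda>X. \<forall>Q\<in>[V]\<^bsup>Suc k\<^esup>. card (X \<inter> [Q]\<^bsup>k\<^esup>) < 5)
    \<le> exp (- (real (card V choose Suc k) * p ^ 5 * (1 - real (Suc k) * real (card V) * p ^ 4)))"
proof -
  have "\<exists>B. B \<subseteq> [Q]\<^bsup>k\<^esup> \<and> card B = 5" if "Q \<in> [V]\<^bsup>Suc k\<^esup>" for Q
  proof -
    have "5 \<le> card ([Q]\<^bsup>k\<^esup>)" using that k4 card_nsets_Suc[of Q k] by (auto simp: nsets_def)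
    then show ?thesis by (metis obtain_subset_with_card_n)
  qed
  then obtain B where B: "\<And>Q. Q \<in> [V]\<^bsup>Suc k\<^esup> \<Longrightarrow> B Q \<subseteq> [Q]\<^bsup>k\<^esup> \<and> card (B Q) = 5" by metis
  have "rPr p ([V]\<^bsup>k\<^esup>) (\<lambda>X. \<forall>Q\<in>[V]\<^bsup>Suc k\<^esup>. card (X \<inter> [Q]\<^bsup>k\<^esup>) < 5) \<le> rPr p ([V]\<^bsup>k\<^esup>) (\<lambda>X. \<forall>Q\<in>[V]\<^bsup>Suc k\<^esup>. \<not> B Q \<subseteq> X)"
  proof (rule rPr_mono[OF p], intro ballI notI)
    fix X Q assume X: "\<forall>Q\<in>[V]\<^bsup>Suc k\<^esup>. card (X \<inter> [Q]\<^bsup>k\<^esup>) < 5" "Q \<in> [V]\<^bsup>Suc k\<^esup>" "B Q \<subseteq> X"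
    have "finite ([Q]\<^bsup>k\<^esup>)" using X(2) by (auto simp: nsets_def intro: finite_imp_finite_nsets[unfolded nsets_def])
    then have "card (B Q) \<le> card (X \<inter> [Q]\<^bsup>k\<^esup>)" using B[OF X(2)] X(3) by (intro card_mono) auto
    then show False using X(1,2) B[OF X(2)] by fastforce
  qed
  also have "\<dots> \<le> exp (- (real (card ([V]\<^bsup>Suc k\<^esup>)) * p ^ 5 * (1 - real (Suc k) * real (card V) * p ^ (5 - 1))))"
    by (rule prob_no_clique_part[OF V p subset_refl B]) simp_all
  finally show ?thesis by (simp add: card_nsets)
qed


text \<open>Let B be a minimal cycle-free class that meets all triangles of X, S its fingerprint and
  T f the private triangle of f in S. Fingerprint edges whose private triangle meets another one
  number at most M, unless many overlapping pairs are present, and they are counted crudely; the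
  others have disjoint triangles, whose presence costs p^3 each. All triangles inside the excluded
  set \<open>\<xi> B\<close> must be absent from X, and by Ramsey that set contains all facets of a
  positive proportion of the (k+1)-sets.\<close>

lemma prob_colourable:
  fixes x :: real
  assumes x: "x = (real t - real k) / (real t - 1)"
  shows "\<exists>\<gamma>>0. \<exists>L>0. \<exists>R. \<forall>(V :: nat set) p M \<mu>. finite V \<longrightarrow> V \<noteq> {} \<longrightarrow> R \<le> card V \<longrightarrow> 0 \<le> p \<longrightarrow> p \<le> 1 \<longrightarrow>
    0 < M \<longrightarrow> 0 < \<mu> \<longrightarrow> \<mu> \<le> 1 \<longrightarrow> real (Suc k) * real (card V) * p ^ 2 \<le> 1 / 2 \<longrightarrow>
    rPr p ([V]\<^bsup>k\<^esup>) (colourable k t)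
     \<le> real (Suc k) ^ 7 * (real (card V) ^ (k + 1) * p ^ 4 + real (card V) ^ (k + 2) * p ^ 5) / M
      + ((real (card V) ^ k) powr M * exp 1)
        * (\<mu> powr (- (L * real (card V) powr (real k - x))) * exp (\<mu> * p ^ 3 * (3 * real (Suc k) ^ 3 * real (card V) ^ (k + 1))))
        * exp (- (\<gamma> * real (card V) ^ (k + 1) * p ^ 3 / 2))"
proof -
  obtain \<gamma> R where \<gamma>: "\<gamma> > 0" "\<forall>(V :: nat set) f. finite V \<longrightarrow> R \<le> card V \<longrightarrow> f \<in> [V]\<^bsup>k\<^esup> \<rightarrow> {..<length [t, Suc k]} \<longrightarrow>
    (\<exists>i<length [t, Suc k]. \<gamma> * real (card V) ^ ([t, Suc k] ! i) \<le> real (card {U\<in>[V]\<^bsup>([t, Suc k] ! i)\<^esup>. f ` [U]\<^bsup>k\<^esup> \<subseteq> {i}}))"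
    using ramsey_density[of k "[t, Suc k]", where 'a = nat] by (elim exE conjE)
  obtain L where L: "L > 0" "\<And>V :: nat set. finite V \<Longrightarrow> V \<noteq> {} \<Longrightarrow>
    cert (\<lambda>I. I \<subseteq> [V]\<^bsup>k\<^esup> \<and> cycle_free I) (L * real (card V) powr (real k - x))
      (\<lambda>X. X \<subseteq> [V]\<^bsup>k\<^esup> \<and> real (card {U\<in>[V]\<^bsup>t\<^esup>. [U]\<^bsup>k\<^esup> \<inter> X = {}}) < \<gamma> * real (card V) ^ t)"
  proof (rule cycle_container_fingerprints[OF x \<gamma>(1)])
    fix L assume H: "L > 0" "\<And>V :: nat set. finite V \<Longrightarrow> V \<noteq> {} \<Longrightarrow>
    cert (\<lambda>I. I \<subseteq> [V]\<^bsup>k\<^esup> \<and> cycle_free I) (L * real (card V) powr (real k - x))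
      (\<lambda>X. X \<subseteq> [V]\<^bsup>k\<^esup> \<and> real (card {U\<in>[V]\<^bsup>t\<^esup>. [U]\<^bsup>k\<^esup> \<inter> X = {}}) < \<gamma> * real (card V) ^ t)"
    show thesis by (rule that, fact H(1), fact H(2))
  qed
  have "rPr p ([V]\<^bsup>k\<^esup>) (colourable k t)
     \<le> real (Suc k) ^ 7 * (real (card V) ^ (k + 1) * p ^ 4 + real (card V) ^ (k + 2) * p ^ 5) / M
      + ((real (card V) ^ k) powr M * exp 1)
        * (\<mu> powr (- (L * real (card V) powr (real k - x))) * exp (\<mu> * p ^ 3 * (3 * real (Suc k) ^ 3 * real (card V) ^ (k + 1))))
        * exp (- (\<gamma> * real (card V) ^ (k + 1) * p ^ 3 / 2))"
    if V: "finite V" "V \<noteq> {}" "R \<le> card V" and p: "0 \<le> p" "p \<le> 1" and M: "0 < M" and \<mu>: "0 < \<mu>" "\<mu> \<le> 1"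
      and mp: "real (Suc k) * real (card V) * p ^ 2 \<le> 1 / 2" for V :: "nat set" and p M \<mu>
  proof -
    define m where "m = real (card V)"
    define \<Omega> where "\<Omega> = [V]\<^bsup>k\<^esup>"
    define s where "s = L * m powr (real k - x)"
    have m1: "1 \<le> m" using V by (simp add: m_def Suc_le_eq card_gt_0_iff)
    have fin: "finite \<Omega>" using V by (simp add: \<Omega>_def finite_imp_finite_nsets)
    define G where "G = (\<lambda>X. X \<subseteq> \<Omega> \<and> real (card {U\<in>[V]\<^bsup>t\<^esup>. [U]\<^bsup>k\<^esup> \<inter> X = {}}) < \<gamma> * m ^ t)"
    obtain \<sigma> \<xi> where cert: "\<And>I. I \<subseteq> \<Omega> \<and> cycle_free I \<Longrightarrow> certifies \<sigma> \<xi> s G I"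
      using L(2)[OF V(1,2)] unfolding \<Omega>_def[symmetric] m_def[symmetric] s_def[symmetric] G_def[symmetric] by (rule certE) blast
    define \<Q> where "\<Q> = (\<lambda>X. {Q\<in>[V]\<^bsup>Suc k\<^esup>. [Q]\<^bsup>k\<^esup> \<subseteq> X})"
    have finU: "finite {U\<in>[V]\<^bsup>j\<^esup>. P U}" for P j using V by (simp add: finite_imp_finite_nsets)
    have dens: "\<gamma> * m ^ (k + 1) \<le> real (card (\<Q> Y))" if Y: "G Y" for Y
    proof -
      define f :: "nat set \<Rightarrow> nat" where "f = (\<lambda>e. if e \<notin> Y then 0 else 1)"
      have "f \<in> [V]\<^bsup>k\<^esup> \<rightarrow> {..<length [t, Suc k]}" by (auto simp: f_def)
      then obtain i where i: "i < length [t, Suc k]"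
        "\<gamma> * m ^ ([t, Suc k] ! i) \<le> real (card {U\<in>[V]\<^bsup>([t, Suc k] ! i)\<^esup>. f ` [U]\<^bsup>k\<^esup> \<subseteq> {i}})"
        using \<gamma>(2)[rule_format, OF V(1,3)] unfolding m_def by blast
      have n0: "\<not> \<gamma> * m ^ t \<le> real (card {U\<in>[V]\<^bsup>t\<^esup>. f ` [U]\<^bsup>k\<^esup> \<subseteq> {0}})"
      proof -
        have "e \<notin> Y" if "f e = 0" for e using that by (simp add: f_def split: if_splits)
        then have "{U\<in>[V]\<^bsup>t\<^esup>. f ` [U]\<^bsup>k\<^esup> \<subseteq> {0}} \<subseteq> {U\<in>[V]\<^bsup>t\<^esup>. [U]\<^bsup>k\<^esup> \<inter> Y = {}}" by blast
        then have "card {U\<in>[V]\<^bsup>t\<^esup>. f ` [U]\<^bsup>k\<^esup> \<subseteq> {0}} \<le> card {U\<in>[V]\<^bsup>t\<^esup>. [U]\<^bsup>k\<^esup> \<inter> Y = {}}" by (rule card_mono[OF finU])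
        then have "real (card {U\<in>[V]\<^bsup>t\<^esup>. f ` [U]\<^bsup>k\<^esup> \<subseteq> {0}}) \<le> real (card {U\<in>[V]\<^bsup>t\<^esup>. [U]\<^bsup>k\<^esup> \<inter> Y = {}})" by (rule of_nat_mono)
        then show ?thesis using Y unfolding G_def by linarith
      qed
      have "i \<noteq> 0" using i(2) n0 by (cases "i = 0") auto
      then have "i = 1" using i(1) by simp
      then have "\<gamma> * m ^ (k + 1) \<le> real (card {U\<in>[V]\<^bsup>Suc k\<^esup>. f ` [U]\<^bsup>k\<^esup> \<subseteq> {1}})" using i(2) by simp
      also have "\<dots> \<le> real (card (\<Q> Y))"
      proof (intro of_nat_mono card_mono)
        show "finite (\<Q> Y)" unfolding \<Q>_def by (rule finU)
        have "e \<in> Y" if "f e = 1" for e using that by (simp add: f_def split: if_splits)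
        then show "{U\<in>[V]\<^bsup>Suc k\<^esup>. f ` [U]\<^bsup>k\<^esup> \<subseteq> {1}} \<subseteq> \<Q> Y" unfolding \<Q>_def by blast
      qed
      finally show ?thesis .
    qed
    have "\<exists>B. B \<subseteq> [Q]\<^bsup>k\<^esup> \<and> card B = 3 \<and> is_tri k B" if Q: "Q \<in> [V]\<^bsup>Suc k\<^esup>" for Q
    proof -
      have cQ: "card Q = Suc k" using Q by (auto simp: nsets_def)
      have "3 \<le> card ([Q]\<^bsup>k\<^esup>)" using k4 card_nsets_Suc[OF cQ] by simp
      then obtain B where "B \<subseteq> [Q]\<^bsup>k\<^esup>" "card B = 3" by (metis obtain_subset_with_card_n)
      then show ?thesis using is_tri_three_faces[OF cQ] by blast
    qed
    then obtain \<tau> where \<tau>: "\<And>Q. Q \<in> [V]\<^bsup>Suc k\<^esup> \<Longrightarrow> \<tau> Q \<subseteq> [Q]\<^bsup>k\<^esup> \<and> card (\<tau> Q) = 3 \<and> is_tri k (\<tau> Q)" by metis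
    define \<T> where "\<T> = {T. is_tri k T \<and> T \<subseteq> \<Omega>}"
    \<comment> \<open>Pairs of an edge and a triangle through it: the fingerprint is summed together
      with its triangles, so that \<open>sum_small_subsets\<close> applies with weight p^3 per
      pair.\<close>
    define \<D> where "\<D> = {P. snd P \<in> \<T> \<and> fst P \<in> snd P}"
    have "\<T> \<subseteq> Pow \<Omega>" by (auto simp: \<T>_def)
    then have finT: "finite \<T>" using fin finite_subset by blast
    have Pi_eq: "\<D> = (\<lambda>(T, f). (f, T)) ` (SIGMA T:\<T>. T)" by (force simp: \<D>_def)
    have finPi: "finite \<D>" unfolding Pi_eq using finT is_tri_card(1) by (intro finite_imageI finite_SigmaI) (auto simp: \<T>_def)
    have cPi: "real (card \<D>) \<le> 3 * real (Suc k) ^ 3 * m ^ (k + 1)"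
    proof -
      have "card \<D> \<le> card (SIGMA T:\<T>. T)" unfolding Pi_eq using finT is_tri_card(1)
        by (intro card_image_le finite_SigmaI) (auto simp: \<T>_def)
      also have "\<dots> = (\<Sum>T\<in>\<T>. card T)" using finT is_tri_card(1) by (intro card_SigmaI) (auto simp: \<T>_def)
      also have "\<dots> = (\<Sum>T\<in>\<T>. 3)" using is_tri_card(2) by (intro sum.cong) (auto simp: \<T>_def)
      also have "\<dots> = card \<T> * 3" by simp
      also have "\<dots> \<le> (card V ^ Suc k * Suc k ^ 3) * 3" unfolding \<T>_def \<Omega>_def by (intro mult_le_mono1 card_triangles[OF V(1)])
      finally have "real (card \<D>) \<le> real ((card V ^ Suc k * Suc k ^ 3) * 3)" by (rule of_nat_mono)
      also have "\<dots> = 3 * real (Suc k) ^ 3 * m ^ (k + 1)" unfolding m_def by (simp only: of_nat_mult of_nat_power Suc_eq_plus1 of_nat_numeral mult_ac)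
      finally show ?thesis .
    qed
    define \<B> where "\<B> = {B. B \<subseteq> \<Omega> \<and> real (card B) \<le> M}"
    define \<P> where "\<P> = {P. P \<subseteq> \<D> \<and> real (card P) \<le> s}"
    have finB: "finite \<B>" and finP: "finite \<P>" using fin finPi by (auto simp: \<B>_def \<P>_def)
    define Z where "Z = (\<lambda>X. real (card {P\<in>overlapping V. fst P \<union> snd P \<subseteq> X}))"
    \<comment> \<open>B is the crudely counted part of the fingerprint and P the part with disjoint
      triangles; the container is recomputed from B and the first components of P. The disjointness
      is recorded as a statement about cardinalities.\<close>
    define bad where "bad = (\<lambda>B P X. card (\<Union>(snd ` P)) = 3 * card P \<and> \<Union>(snd ` P) \<subseteq> \<Omega> \<and> G (\<xi> (B \<union> fst ` P))
       \<and> \<Union>(snd ` P) \<subseteq> X \<and> (\<forall>Q\<in>\<Q> (\<xi> (B \<union> fst ` P)). \<not> \<tau> Q \<subseteq> X))"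
    have fino: "finite (overlapping V)" by (rule finite_overlapping[OF V(1)])
    have key: "M \<le> Z X \<or> (\<exists>B\<in>\<B>. \<exists>P\<in>\<P>. bad B P X)" if X: "X \<subseteq> \<Omega>" "colourable k t X" for X
    proof (cases "M \<le> Z X")
      case ZM: False
      have finX: "finite X" using X(1) fin finite_subset by blast
      obtain B where B: "B \<subseteq> X" "\<And>T. is_tri k T \<Longrightarrow> T \<subseteq> X \<Longrightarrow> T \<inter> B \<noteq> {}" "\<And>C. is_cyc k t C \<Longrightarrow> \<not> C \<subseteq> B"
        "\<And>f. f \<in> B \<Longrightarrow> \<exists>T. is_tri k T \<and> T \<subseteq> X \<and> T \<inter> B = {f}"
      proof (rule minimal_colouring[OF X(2) finX])
        fix B assume H: "B \<subseteq> X" "\<And>T. is_tri k T \<Longrightarrow> T \<subseteq> X \<Longrightarrow> T \<inter> B \<noteq> {}" "\<And>C. is_cyc k t C \<Longrightarrow> \<not> C \<subseteq> B"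
          "\<And>f. f \<in> B \<Longrightarrow> \<exists>T. is_tri k T \<and> T \<subseteq> X \<and> T \<inter> B = {f}"
        show thesis by (rule that, fact H(1), fact H(2), fact H(3), fact H(4))
      qed
      have cfB: "cycle_free B" unfolding cycle_free_def using B(3) by blast
      have B\<Omega>: "B \<subseteq> \<Omega>" using B(1) X(1) by blast
      have cB: "certifies \<sigma> \<xi> s G B" by (rule cert) (simp add: B\<Omega> cfB)
      note c = certifiesD[OF cB]
      obtain T where T: "\<And>f. f \<in> B \<Longrightarrow> is_tri k (T f) \<and> T f \<subseteq> X \<and> T f \<inter> B = {f}" using B(4) by metis
      define S where "S = \<sigma> B"
      have S: "S \<subseteq> B" "finite S" "real (card S) \<le> s" using c(1,2,3) by (auto simp: S_def)
      define Bad where "Bad = {f\<in>S. \<exists>f'\<in>S. f' \<noteq> f \<and> T f \<inter> T f' \<noteq> {}}"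
      define Good where "Good = S - Bad"
      have T\<Omega>: "T f \<subseteq> \<Omega>" "is_tri k (T f)" "T f \<subseteq> X" "f \<in> T f" if f: "f \<in> S" for f
      proof -
        have fB: "f \<in> B" using f S(1) by blast
        show "T f \<subseteq> \<Omega>" "is_tri k (T f)" "T f \<subseteq> X" "f \<in> T f" using T[OF fB] X(1) by blast+
      qed
      \<comment> \<open>A private triangle determines its edge as its only element in B.\<close>
      have Tinj: "f = f'" if "f \<in> S" "f' \<in> S" "T f = T f'" for f f'
      proof -
        have fB: "f \<in> B" "f' \<in> B" using that S(1) by blast+
        have "{f} = T f \<inter> B" using T[OF fB(1)] by blast
        also have "\<dots> = T f' \<inter> B" by (simp only: that(3))
        also have "\<dots> = {f'}" using T[OF fB(2)] by blast
        finally show ?thesis by (rule singleton_inject)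
      qed
      have BadM: "real (card Bad) \<le> M"
      proof -
        have "\<forall>f\<in>Bad. \<exists>f'. f' \<in> S \<and> f' \<noteq> f \<and> T f \<inter> T f' \<noteq> {}" unfolding Bad_def by blast
        then obtain h where h: "\<And>f. f \<in> Bad \<Longrightarrow> h f \<in> S \<and> h f \<noteq> f \<and> T f \<inter> T (h f) \<noteq> {}" using bchoice by metis
        have BS: "Bad \<subseteq> S" by (auto simp: Bad_def)
        have "card Bad \<le> card {P\<in>overlapping V. fst P \<union> snd P \<subseteq> X}"
        proof (rule card_inj_on_le[of "\<lambda>f. (T f, T (h f))"])
          show "inj_on (\<lambda>f. (T f, T (h f))) Bad" using Tinj BS by (intro inj_onI) blast
          show "(\<lambda>f. (T f, T (h f))) ` Bad \<subseteq> {P\<in>overlapping V. fst P \<union> snd P \<subseteq> X}"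
          proof
            fix P assume "P \<in> (\<lambda>f. (T f, T (h f))) ` Bad"
            then obtain f where f: "f \<in> Bad" "P = (T f, T (h f))" by blast
            have fS: "f \<in> S" "h f \<in> S" using f(1) BS h by auto
            have "T f \<noteq> T (h f)" using Tinj[OF fS] h[OF f(1)] by metis
            then show "P \<in> {P\<in>overlapping V. fst P \<union> snd P \<subseteq> X}"
              unfolding f(2) overlapping_def using T\<Omega>[OF fS(1)] T\<Omega>[OF fS(2)] h[OF f(1)] by (simp add: \<Omega>_def)
          qed
          show "finite {P\<in>overlapping V. fst P \<union> snd P \<subseteq> X}" using fino by simp
        qed
        then have "real (card Bad) \<le> Z X" unfolding Z_def by (rule of_nat_mono)
        then show ?thesis using ZM by linarith
      qed
      define P where "P = (\<lambda>f. (f, T f)) ` Good"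
      have GS: "Good \<subseteq> S" by (auto simp: Good_def)
      have finG: "finite Good" using GS S(2) finite_subset by blast
      have cP: "card P = card Good" unfolding P_def by (rule card_image) (auto intro: inj_onI)
      have fP: "fst ` P = Good" "snd ` P = T ` Good" by (auto simp: P_def image_image)
      have "card Good \<le> card S" by (rule card_mono[OF S(2) GS])
      then have "real (card P) \<le> s" using S(3) cP by linarith
      moreover have "P \<subseteq> \<D>"
      proof
        fix z assume "z \<in> P"
        then obtain f where f: "f \<in> S" "z = (f, T f)" using GS unfolding P_def by blast
        show "z \<in> \<D>" unfolding f(2) \<D>_def \<T>_def using T\<Omega>[OF f(1)] by simp
      qed
      ultimately have "P \<in> \<P>" unfolding \<P>_def by simp
      moreover have "Bad \<in> \<B>" unfolding \<B>_def using BadM S(1) B\<Omega> by (auto simp: Bad_def)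
      moreover have "bad Bad P X"
      proof -
        have "card (\<Union>(T ` Good)) = (\<Sum>f\<in>Good. card (T f))"
        proof (rule card_UN_disjoint[OF finG])
          show "\<forall>f\<in>Good. finite (T f)" using T\<Omega>(2) GS is_tri_card(1) by blast
          show "\<forall>i\<in>Good. \<forall>j\<in>Good. i \<noteq> j \<longrightarrow> T i \<inter> T j = {}" using GS unfolding Good_def Bad_def by blast
        qed
        also have "\<dots> = (\<Sum>f\<in>Good. 3)" using T\<Omega>(2) GS is_tri_card(2) by (intro sum.cong) blast+
        finally have c3: "card (\<Union>(T ` Good)) = 3 * card P" by (simp add: cP)
        have un: "Bad \<union> Good = \<sigma> B" unfolding Good_def S_def[symmetric] by (auto simp: Bad_def)
        have xi: "\<xi> (Bad \<union> Good) = \<xi> B" unfolding un by (rule c(6)[OF subset_refl c(1)])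
        have no: "\<not> \<tau> Q \<subseteq> X" if Q: "Q \<in> \<Q> (\<xi> B)" for Q
        proof
          assume "\<tau> Q \<subseteq> X"
          moreover have "\<tau> Q \<subseteq> \<xi> B" "is_tri k (\<tau> Q)" using \<tau>[of Q] Q unfolding \<Q>_def by auto
          ultimately show False using B(2) c(5) by blast
        qed
        have subX: "\<Union>(T ` Good) \<subseteq> X" "\<Union>(T ` Good) \<subseteq> \<Omega>" using T\<Omega>(1,3) GS by blast+
        show ?thesis unfolding bad_def fP xi using c3 subX c(4) no by simp
      qed
      ultimately show ?thesis by blast
    qed blast
    have E: "rPr p \<Omega> (\<lambda>X. M \<le> Z X) \<le> real (Suc k) ^ 7 * (m ^ (k + 1) * p ^ 4 + m ^ (k + 2) * p ^ 5) / M"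
    proof -
      have Zs: "Z X = (\<Sum>P\<in>overlapping V. of_bool (fst P \<union> snd P \<subseteq> X))" for X
        unfolding Z_def using fino by (simp add: of_bool_def sum.If_cases Int_def)
      have "rPr p \<Omega> (\<lambda>X. M \<le> Z X) \<le> rEx p \<Omega> Z / M" by (rule rEx_markov[OF p M]) (simp add: Z_def)
      also have "rEx p \<Omega> Z = (\<Sum>P\<in>overlapping V. rPr p \<Omega> (\<lambda>X. fst P \<union> snd P \<subseteq> X))"
        unfolding Zs rPr_def by (rule rEx_sum)
      also have "\<dots> = (\<Sum>P\<in>overlapping V. p ^ card (fst P \<union> snd P))"
        by (intro sum.cong refl rPr_superset[OF fin]) (auto simp: overlapping_def \<Omega>_def)
      also have "\<dots> / M \<le> real (Suc k) ^ 7 * (m ^ (k + 1) * p ^ 4 + m ^ (k + 2) * p ^ 5) / M"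
        unfolding m_def using sum_overlapping[OF V(1) p] M by (intro divide_right_mono) auto
      finally show ?thesis .
    qed
    define J where "J = exp (- (\<gamma> * m ^ (k + 1) * p ^ 3 / 2))"
    have one: "rPr p \<Omega> (bad B P) \<le> (p ^ 3) ^ card P * J" for B P
    proof (cases "card (\<Union>(snd ` P)) = 3 * card P \<and> \<Union>(snd ` P) \<subseteq> \<Omega> \<and> G (\<xi> (B \<union> fst ` P))")
      case False
      then have "\<not> bad B P X" for X unfolding bad_def by blast
      then have "rPr p \<Omega> (bad B P) = 0" by (simp add: rPr_def rEx_def)
      then show ?thesis using p by (simp add: J_def)
    next
      case True
      let ?Q = "\<Q> (\<xi> (B \<union> fst ` P))"
      have Qs: "?Q \<subseteq> [V]\<^bsup>Suc k\<^esup>" by (auto simp: \<Q>_def)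
      have "rPr p \<Omega> (bad B P) \<le> rPr p \<Omega> (\<lambda>X. \<Union>(snd ` P) \<subseteq> X \<and> (\<forall>Q\<in>?Q. \<not> \<tau> Q \<subseteq> X))"
        by (rule rPr_mono[OF p]) (simp add: bad_def)
      \<comment> \<open>Harris: the presence of the triangles of P is increasing and the absence of
        all \<open>\<tau> Q\<close> is decreasing, so the two bounds multiply.\<close>
      also have "\<dots> \<le> rPr p \<Omega> (\<lambda>X. \<Union>(snd ` P) \<subseteq> X) * rPr p \<Omega> (\<lambda>X. \<forall>Q\<in>?Q. \<not> \<tau> Q \<subseteq> X)"
        by (rule rPr_harris[OF fin p]) blast+
      also have "rPr p \<Omega> (\<lambda>X. \<Union>(snd ` P) \<subseteq> X) = (p ^ 3) ^ card P"
        using rPr_superset[OF fin, of "\<Union>(snd ` P)" p] True by (simp add: power_mult)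
      also have "(p ^ 3) ^ card P * rPr p \<Omega> (\<lambda>X. \<forall>Q\<in>?Q. \<not> \<tau> Q \<subseteq> X) \<le> (p ^ 3) ^ card P * J"
      proof (rule mult_left_mono)
        have "rPr p \<Omega> (\<lambda>X. \<forall>Q\<in>?Q. \<not> \<tau> Q \<subseteq> X)
           \<le> exp (- (real (card ?Q) * p ^ 3 * (1 - real (Suc k) * real (card V) * p ^ (3 - 1))))"
          unfolding \<Omega>_def by (rule prob_no_clique_part[OF V(1) p Qs]) (use \<tau> Qs in blast, simp)
        also have "\<dots> \<le> J"
        proof -
          have "(\<gamma> * m ^ (k + 1)) * p ^ 3 * (1 / 2) \<le> real (card ?Q) * p ^ 3 * (1 - real (Suc k) * real (card V) * p ^ (3 - 1))"
            using dens True mp p \<gamma>(1) m1 by (intro mult_mono mult_right_mono) auto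
          then show ?thesis unfolding J_def by simp
        qed
        finally show "rPr p \<Omega> (\<lambda>X. \<forall>Q\<in>?Q. \<not> \<tau> Q \<subseteq> X) \<le> J" .
      qed (use p in simp)
      finally show ?thesis .
    qed
    have "rPr p \<Omega> (colourable k t) \<le> rPr p \<Omega> (\<lambda>X. M \<le> Z X \<or> (\<exists>B\<in>\<B>. \<exists>P\<in>\<P>. bad B P X))"
      by (rule rPr_mono[OF p key])
    also have "\<dots> \<le> rPr p \<Omega> (\<lambda>X. M \<le> Z X) + rPr p \<Omega> (\<lambda>X. \<exists>B\<in>\<B>. \<exists>P\<in>\<P>. bad B P X)" by (rule rPr_Un[OF p])
    also have "rPr p \<Omega> (\<lambda>X. \<exists>B\<in>\<B>. \<exists>P\<in>\<P>. bad B P X) \<le> (\<Sum>B\<in>\<B>. rPr p \<Omega> (\<lambda>X. \<exists>P\<in>\<P>. bad B P X))"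
      by (rule rPr_Union[OF p finB])
    also have "\<dots> \<le> (\<Sum>B\<in>\<B>. (\<mu> powr (- s) * exp (\<mu> * p ^ 3 * (3 * real (Suc k) ^ 3 * m ^ (k + 1)))) * J)"
    proof (rule sum_mono)
      fix B
      have "rPr p \<Omega> (\<lambda>X. \<exists>P\<in>\<P>. bad B P X) \<le> (\<Sum>P\<in>\<P>. rPr p \<Omega> (bad B P))" by (rule rPr_Union[OF p finP])
      also have "\<dots> \<le> (\<Sum>P\<in>\<P>. (p ^ 3) ^ card P * J)" by (rule sum_mono[OF one])
      also have "\<dots> = (\<Sum>P\<in>\<P>. (p ^ 3) ^ card P) * J" by (simp only: sum_distrib_right)
      also have "\<dots> \<le> (\<mu> powr (- s) * exp (\<mu> * p ^ 3 * real (card \<D>))) * J"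
        unfolding \<P>_def using p by (intro mult_right_mono sum_small_subsets[OF finPi _ \<mu>]) (auto simp: J_def)
      also have "\<dots> \<le> (\<mu> powr (- s) * exp (\<mu> * p ^ 3 * (3 * real (Suc k) ^ 3 * m ^ (k + 1)))) * J"
        using cPi p \<mu> by (intro mult_right_mono mult_left_mono) (auto simp: J_def intro!: mult_left_mono)
      finally show "rPr p \<Omega> (\<lambda>X. \<exists>P\<in>\<P>. bad B P X) \<le> (\<mu> powr (- s) * exp (\<mu> * p ^ 3 * (3 * real (Suc k) ^ 3 * m ^ (k + 1)))) * J" .
    qed
    also have "\<dots> = real (card \<B>) * ((\<mu> powr (- s) * exp (\<mu> * p ^ 3 * (3 * real (Suc k) ^ 3 * m ^ (k + 1)))) * J)" by simp
    also have "\<dots> \<le> ((m ^ k) powr M * exp 1) * ((\<mu> powr (- s) * exp (\<mu> * p ^ 3 * (3 * real (Suc k) ^ 3 * m ^ (k + 1)))) * J)"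
    proof (rule mult_right_mono)
      show "real (card \<B>) \<le> (m ^ k) powr M * exp 1" unfolding \<B>_def
      proof (rule card_small_subsets[OF fin])
        show "real (card \<Omega>) \<le> m ^ k" unfolding \<Omega>_def m_def using of_nat_mono[OF card_nsets_le[OF V(1), of k], where 'a = real] by simp
        show "1 \<le> m ^ k" using m1 by (rule one_le_power)
      qed
    qed (simp add: J_def)
    also note E
    finally show ?thesis unfolding J_def s_def m_def \<Omega>_def by (simp only: mult.assoc)
  qed
  then show ?thesis using \<gamma>(1) L(1) by blast
qed


section \<open>Choice of the constants in the 1-statement\<close>

lemma one_statement_parts:
  fixes x a :: real
  assumes x: "x = (real t - real k) / (real t - 1)" "1/2 < x" and a: "a = (1 + x) / 3"
  shows "\<exists>C>0. \<forall>\<epsilon>>0. \<forall>\<^sub>F m :: nat in sequentially. C * real m powr (- a) \<le> 1 \<and>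
     (\<forall>V :: nat set. finite V \<longrightarrow> card V = m \<longrightarrow>
       rPr (C * real m powr (- a)) ([V]\<^bsup>k\<^esup>) (\<lambda>X. \<forall>Q\<in>[V]\<^bsup>Suc k\<^esup>. card (X \<inter> [Q]\<^bsup>k\<^esup>) < 5) \<le> \<epsilon> \<and>
       rPr (C * real m powr (- a)) ([V]\<^bsup>k\<^esup>) (colourable k t) \<le> \<epsilon> \<and>
       rPr (C * real m powr (- a)) ([V]\<^bsup>k\<^esup>) (\<lambda>X. \<exists>I J. X = I \<union> J \<and> cycle_free I \<and> cycle_free J) \<le> \<epsilon>)"
proof -
  have tr: "real k \<ge> 4" "real t \<ge> 2 * real k" using k4 tk by linarith+
  have "real t - real k < real t - 1" "0 < real t - 1" using tr by auto
  then have x1: "x < 1" unfolding x(1) by (subst divide_less_eq_1_pos) auto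
  have a_bounds: "1 / 2 < a" "a < 2 / 3" "0 < x - a" using x(2) x1 unfolding a by (simp_all add: field_simps)
  obtain \<gamma> L R where A: "\<gamma> > 0" "L > 0" "\<forall>(V :: nat set) p M \<mu>. finite V \<longrightarrow> V \<noteq> {} \<longrightarrow> R \<le> card V \<longrightarrow> 0 \<le> p \<longrightarrow> p \<le> 1 \<longrightarrow>
    0 < M \<longrightarrow> 0 < \<mu> \<longrightarrow> \<mu> \<le> 1 \<longrightarrow> real (Suc k) * real (card V) * p ^ 2 \<le> 1 / 2 \<longrightarrow>
    rPr p ([V]\<^bsup>k\<^esup>) (colourable k t)
     \<le> real (Suc k) ^ 7 * (real (card V) ^ (k + 1) * p ^ 4 + real (card V) ^ (k + 2) * p ^ 5) / M
      + ((real (card V) ^ k) powr M * exp 1)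
        * (\<mu> powr (- (L * real (card V) powr (real k - x))) * exp (\<mu> * p ^ 3 * (3 * real (Suc k) ^ 3 * real (card V) ^ (k + 1))))
        * exp (- (\<gamma> * real (card V) ^ (k + 1) * p ^ 3 / 2))"
    using prob_colourable[OF x(1)] by (elim exE conjE)
  obtain \<gamma>' L' R' where C: "\<gamma>' > 0" "L' > 0" "\<forall>(V :: nat set) p. finite V \<longrightarrow> V \<noteq> {} \<longrightarrow> R' \<le> card V \<longrightarrow> 0 \<le> p \<longrightarrow> p \<le> 1 \<longrightarrow>
    rPr p ([V]\<^bsup>k\<^esup>) (\<lambda>X. \<exists>I J. X = I \<union> J \<and> cycle_free I \<and> cycle_free J)
     \<le> ((real (card V) ^ k) powr (L' * real (card V) powr (real k - x)) * exp 1) ^ 2 * exp (- (p * (\<gamma>' * real (card V) ^ k)))"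
    using prob_two_cycle_free[OF x(1)] by (elim exE conjE)
  define \<kappa> where "\<kappa> = 3 * real (Suc k) ^ 3"
  have \<kappa>0: "0 < \<kappa>" by (simp add: \<kappa>_def)
  \<comment> \<open>Small enough that the exponential moment of the fingerprint pairs uses at most
    half of the Janson exponent, whose constant is \<gamma> / 2.\<close>
  define \<mu> where "\<mu> = min 1 (\<gamma> / (4 * \<kappa>))"
  have \<mu>: "0 < \<mu>" "\<mu> \<le> 1" using A(1) \<kappa>0 by (auto simp: \<mu>_def)
  have "\<mu> * \<kappa> \<le> (\<gamma> / (4 * \<kappa>)) * \<kappa>" using \<kappa>0 by (intro mult_right_mono) (auto simp: \<mu>_def)
  then have \<mu>\<kappa>: "\<mu> * \<kappa> \<le> \<gamma> / 4" using \<kappa>0 by simp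
  define l where "l = - ln \<mu>"
  have l0: "0 \<le> l" using \<mu> by (simp add: l_def)
  \<comment> \<open>The other half, \<open>\<gamma> * c ^ 3 / 4\<close>, must beat the cost L * l of
    the fingerprints and leave 2: one unit for the crudely counted part and one for the convergence
    to 0.\<close>
  define c where "c = max 1 (4 * (L * l + 2) / \<gamma>)"
  have c1: "1 \<le> c" by (simp add: c_def)
  have "4 * (L * l + 2) / \<gamma> \<le> c" by (simp add: c_def)
  then have "4 * (L * l + 2) \<le> \<gamma> * c" using A(1) by (simp add: pos_divide_le_eq mult.commute)
  moreover
  have "c \<le> c ^ 3" using c1 power_increasing[of 1 3 c] by simp
  then have "\<gamma> * c \<le> \<gamma> * c ^ 3" using A(1) by (intro mult_left_mono) auto
  ultimately have "4 * (L * l + 2) \<le> \<gamma> * c ^ 3" by (rule order_trans)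
  then have c3: "L * l + 2 \<le> \<gamma> * c ^ 3 / 4" by simp
  \<comment> \<open>With M = n ^ (k - x - e) the expected number of overlapping pairs is below M by
    a factor of order n ^ e. The pairs on k + 2 vertices allow exactly this e, which is positive
    because x > 1/2; and M times a logarithm is still below n ^ (k - x).\<close>
  define e where "e = (2 * x - 1) / 6"
  have e0: "0 < e" "e \<le> 1 / 6" using x(2) x1 by (auto simp: e_def)
  define K1 where "K1 = real (Suc k) ^ 7 * (c ^ 4 + c ^ 5)"
  define K3 where "K3 = 1 / (2 * real (Suc k) ^ Suc k)"
  have K3: "0 < K3" by (simp add: K3_def)
  have main: "c * real m powr (- a) \<le> 1 \<and>
     (\<forall>V :: nat set. finite V \<longrightarrow> card V = m \<longrightarrow>
       rPr (c * real m powr (- a)) ([V]\<^bsup>k\<^esup>) (\<lambda>X. \<forall>Q\<in>[V]\<^bsup>Suc k\<^esup>. card (X \<inter> [Q]\<^bsup>k\<^esup>) < 5) \<le> \<epsilon> \<and>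
       rPr (c * real m powr (- a)) ([V]\<^bsup>k\<^esup>) (colourable k t) \<le> \<epsilon> \<and>
       rPr (c * real m powr (- a)) ([V]\<^bsup>k\<^esup>) (\<lambda>X. \<exists>I J. X = I \<union> J \<and> cycle_free I \<and> cycle_free J) \<le> \<epsilon>)"
    if m: "1 \<le> m" "R \<le> m" "R' \<le> m" "Suc k \<le> m" and e1: "c * real m powr (- a) \<le> 1"
      and e2: "real (Suc k) * c ^ 2 * real m powr (- (2 * a - 1)) \<le> 1 / 2"
      and e3: "real k * ln (real m) + 0 \<le> real m powr e"
      and e4: "(2 * L' * real k / (\<gamma>' * c)) * ln (real m) + 1 / (\<gamma>' * c) \<le> real m powr (x - a)"
      and e5: "K1 * real m powr (- e) \<le> \<epsilon> / 2" and e6: "exp (2 - real m) \<le> \<epsilon> / 2" and e7: "exp (- (K3 * real m)) \<le> \<epsilon>"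
    for m \<epsilon>
  proof (intro conjI allI impI)
    show "c * real m powr (- a) \<le> 1" by (fact e1)
    fix V :: "nat set" assume V: "finite V" "card V = m"
    define N where "N = real m"
    define p where "p = c * N powr (- a)"
    have N: "1 \<le> N" "0 < N" using m by (auto simp: N_def)
    have Vne: "V \<noteq> {}" using V m by auto
    have p: "0 \<le> p" "p \<le> 1" using c1 e1 by (auto simp: p_def N_def)
    have Npow: "N ^ j = N powr real j" for j using N by (simp add: powr_realpow)
    have pw: "(N powr r) ^ j = N powr (r * real j)" for r j using N by (simp add: powr_realpow[symmetric] powr_powr)
    have Np: "N powr r * p ^ j = c ^ j * N powr (r - a * real j)" for r j
    proof -
      have "N powr r * p ^ j = c ^ j * (N powr r * N powr (- a * real j))" by (simp add: p_def power_mult_distrib pw)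
      also have "\<dots> = c ^ j * N powr (r + - a * real j)" by (simp only: powr_add)
      finally show ?thesis by simp
    qed
    define Y where "Y = N powr (real k - x)"
    have YN: "N \<le> Y"
    proof -
      have "N powr 1 \<le> N powr (real k - x)" using tr x1 N by (intro powr_mono) auto
      then show ?thesis using N by (simp add: Y_def)
    qed
    have Y0: "0 < Y" using YN N by linarith
    have mp2: "real (Suc k) * N * p ^ 2 \<le> 1 / 2"
    proof -
      have "N * p ^ 2 = c ^ 2 * N powr (- (2 * a - 1))" using Np[of 1 2] N by (simp add: algebra_simps)
      then have "real (Suc k) * N * p ^ 2 = real (Suc k) * c ^ 2 * N powr (- (2 * a - 1))" by (simp only: mult.assoc)
      then show ?thesis using e2 by (simp only: N_def)
    qed
    have p3: "N ^ (k + 1) * p ^ 3 = c ^ 3 * Y"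
    proof -
      have "N ^ (k + 1) * p ^ 3 = c ^ 3 * N powr (real (k + 1) - a * real 3)" by (simp only: Npow Np)
      also have "real (k + 1) - a * real 3 = real k - x" using a by simp
      finally show ?thesis by (simp only: Y_def)
    qed
    show "rPr (c * real m powr (- a)) ([V]\<^bsup>k\<^esup>) (\<lambda>X. \<forall>Q\<in>[V]\<^bsup>Suc k\<^esup>. card (X \<inter> [Q]\<^bsup>k\<^esup>) < 5) \<le> \<epsilon>"
    proof -
      have "rPr p ([V]\<^bsup>k\<^esup>) (\<lambda>X. \<forall>Q\<in>[V]\<^bsup>Suc k\<^esup>. card (X \<inter> [Q]\<^bsup>k\<^esup>) < 5)
        \<le> exp (- (real (m choose Suc k) * p ^ 5 * (1 - real (Suc k) * N * p ^ 4)))"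
        using prob_few_faces[OF V(1) p] by (simp only: V(2) N_def)
      also have "\<dots> \<le> exp (- (K3 * N))"
      proof -
        have "p ^ 4 \<le> p ^ 2" using p by (intro power_decreasing) auto
        then have "real (Suc k) * N * p ^ 4 \<le> real (Suc k) * N * p ^ 2" using N by (intro mult_left_mono) auto
        then have h: "1 / 2 \<le> 1 - real (Suc k) * N * p ^ 4" using mp2 by linarith
        have "(N / real (Suc k)) ^ Suc k \<le> real (m choose Suc k)"
          using binomial_ge_n_over_k_pow_k[of "Suc k" m, where 'a = real] m(4) unfolding N_def by blast
        then have "(N / real (Suc k)) ^ Suc k * p ^ 5 * (1 / 2) \<le> real (m choose Suc k) * p ^ 5 * (1 - real (Suc k) * N * p ^ 4)"
          using h p N by (intro mult_mono mult_right_mono) auto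
        moreover have "K3 * N \<le> (N / real (Suc k)) ^ Suc k * p ^ 5 * (1 / 2)"
        proof -
          have "N powr 1 \<le> N powr (real (Suc k) - a * real 5)" using N tr a_bounds by (intro powr_mono) auto
          then have "1 * N \<le> c ^ 5 * N powr (real (Suc k) - a * real 5)" using N c1 one_le_power[OF c1, of 5] by (intro mult_mono) auto
          also have "\<dots> = N ^ Suc k * p ^ 5" by (simp only: Npow Np)
          finally have "K3 * N \<le> K3 * (N ^ Suc k * p ^ 5)" using K3 by (intro mult_left_mono) auto
          also have "\<dots> = (N / real (Suc k)) ^ Suc k * p ^ 5 * (1 / 2)" unfolding K3_def power_divide by simp
          finally show ?thesis .
        qed
        ultimately show ?thesis by simp
      qed
      also have "\<dots> \<le> \<epsilon>" using e7 by (simp only: N_def)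
      finally show ?thesis by (simp only: p_def N_def)
    qed
    show "rPr (c * real m powr (- a)) ([V]\<^bsup>k\<^esup>) (colourable k t) \<le> \<epsilon>"
    proof -
      define M where "M = N powr (real k - x - e)"
      have M0: "0 < M" using N by (simp add: M_def)
      have MY: "M * N powr e = Y" unfolding M_def Y_def powr_add[symmetric] by simp
      have "rPr p ([V]\<^bsup>k\<^esup>) (colourable k t)
        \<le> real (Suc k) ^ 7 * (N ^ (k + 1) * p ^ 4 + N ^ (k + 2) * p ^ 5) / M
          + ((N ^ k) powr M * exp 1) * (\<mu> powr (- (L * Y)) * exp (\<mu> * p ^ 3 * (3 * real (Suc k) ^ 3 * N ^ (k + 1))))
           * exp (- (\<gamma> * N ^ (k + 1) * p ^ 3 / 2))"
        using A(3)[rule_format, OF V(1) Vne _ p M0 \<mu>] V(2) m(2) mp2 unfolding N_def Y_def by blast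
      also have "real (Suc k) ^ 7 * (N ^ (k + 1) * p ^ 4 + N ^ (k + 2) * p ^ 5) / M \<le> K1 * N powr (- e)"
      proof -
        have q4: "N ^ (k + 1) * p ^ 4 \<le> c ^ 4 * (M * N powr (- e))"
        proof -
          have "N ^ (k + 1) * p ^ 4 = c ^ 4 * N powr (real (k + 1) - a * real 4)" by (simp only: Npow Np)
          also have "\<dots> \<le> c ^ 4 * N powr (real k - x - e + - e)"
            using N c1 e0 a x1 x(2) by (intro mult_left_mono powr_mono) (auto simp: e_def field_simps)
          finally show ?thesis by (simp only: M_def powr_add)
        qed
        have q5: "N ^ (k + 2) * p ^ 5 \<le> c ^ 5 * (M * N powr (- e))"
        proof -
          have "N ^ (k + 2) * p ^ 5 = c ^ 5 * N powr (real (k + 2) - a * real 5)" by (simp only: Npow Np)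
          also have "\<dots> \<le> c ^ 5 * N powr (real k - x - e + - e)"
            using N c1 e0 a x1 x(2) by (intro mult_left_mono powr_mono) (auto simp: e_def field_simps)
          finally show ?thesis by (simp only: M_def powr_add)
        qed
        have "real (Suc k) ^ 7 * (N ^ (k + 1) * p ^ 4 + N ^ (k + 2) * p ^ 5) \<le> real (Suc k) ^ 7 * (c ^ 4 * (M * N powr (- e)) + c ^ 5 * (M * N powr (- e)))"
          using q4 q5 by (intro mult_left_mono add_mono) auto
        also have "\<dots> = K1 * N powr (- e) * M" by (simp only: K1_def distrib_left distrib_right mult_ac)
        finally show ?thesis using M0 by (simp only: pos_divide_le_eq)
      qed
      also have "((N ^ k) powr M * exp 1) * (\<mu> powr (- (L * Y)) * exp (\<mu> * p ^ 3 * (3 * real (Suc k) ^ 3 * N ^ (k + 1))))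
           * exp (- (\<gamma> * N ^ (k + 1) * p ^ 3 / 2)) \<le> exp (2 - N)"
      proof -
        have l1: "(N ^ k) powr M = exp (M * (real k * ln N))" using N by (simp add: powr_def ln_realpow)
        have l2: "\<mu> powr (- (L * Y)) = exp (L * l * Y)" using \<mu> by (simp add: powr_def l_def mult_ac)
        have l3: "\<mu> * p ^ 3 * (3 * real (Suc k) ^ 3 * N ^ (k + 1)) = \<mu> * \<kappa> * (c ^ 3 * Y)"
          unfolding p3[symmetric] \<kappa>_def by (simp only: mult_ac)
        have l4: "\<gamma> * N ^ (k + 1) * p ^ 3 / 2 = \<gamma> / 2 * (c ^ 3 * Y)" unfolding p3[symmetric] by simp
        have "M * (real k * ln N) \<le> M * N powr e" using e3 M0 by (intro mult_left_mono) (auto simp: N_def)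
        then have b1: "M * (real k * ln N) \<le> Y" by (simp only: MY)
        have b2: "\<mu> * \<kappa> * (c ^ 3 * Y) \<le> \<gamma> / 4 * (c ^ 3 * Y)" using \<mu>\<kappa> c1 Y0 by (intro mult_right_mono) auto
        have b3: "(L * l + 2) * Y \<le> (\<gamma> * c ^ 3 / 4) * Y" using c3 Y0 by (intro mult_right_mono) auto
        have "M * (real k * ln N) + 1 + (L * l * Y + \<mu> * \<kappa> * (c ^ 3 * Y)) + - (\<gamma> / 2 * (c ^ 3 * Y)) \<le> 2 - N"
          using b1 b2 b3 YN by (simp add: algebra_simps)
        then show ?thesis unfolding l1 l2 l3 l4 exp_add[symmetric] by simp
      qed
      also have "K1 * N powr (- e) + exp (2 - N) \<le> \<epsilon> / 2 + \<epsilon> / 2" using e5 e6 unfolding N_def by (rule add_mono)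
      finally show ?thesis by (simp add: p_def N_def)
    qed
    show "rPr (c * real m powr (- a)) ([V]\<^bsup>k\<^esup>) (\<lambda>X. \<exists>I J. X = I \<union> J \<and> cycle_free I \<and> cycle_free J) \<le> \<epsilon>"
    proof -
      have "rPr p ([V]\<^bsup>k\<^esup>) (\<lambda>X. \<exists>I J. X = I \<union> J \<and> cycle_free I \<and> cycle_free J)
         \<le> ((N ^ k) powr (L' * Y) * exp 1) ^ 2 * exp (- (p * (\<gamma>' * N ^ k)))"
        using C(3)[rule_format, OF V(1) Vne _ p] V(2) m(3) unfolding N_def Y_def by blast
      also have "\<dots> \<le> exp (2 - N)"
      proof -
        have l1: "(N ^ k) powr (L' * Y) = exp (L' * Y * (real k * ln N))" using N by (simp add: powr_def ln_realpow)
        have sq: "(exp u * exp v) ^ 2 = exp (2 * u + 2 * v)" for u v :: real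
          by (simp add: exp_add[symmetric] power2_eq_square)
        have l2: "p * (\<gamma>' * N ^ k) = \<gamma>' * c * (Y * N powr (x - a))"
        proof -
          have "N ^ k * p ^ 1 = c ^ 1 * N powr (real k - a * real 1)" by (simp only: Npow Np)
          moreover have "Y * N powr (x - a) = N powr (real k - a)" unfolding Y_def powr_add[symmetric] by simp
          ultimately show ?thesis by (simp add: mult_ac)
        qed
        have "\<gamma>' * c * ((2 * L' * real k / (\<gamma>' * c)) * ln N + 1 / (\<gamma>' * c)) \<le> \<gamma>' * c * N powr (x - a)"
          using e4 C(1) c1 unfolding N_def by (intro mult_left_mono) auto
        then have "2 * L' * real k * ln N + 1 \<le> \<gamma>' * c * N powr (x - a)" using C(1) c1 by (simp add: distrib_left)
        then have "(2 * L' * real k * ln N + 1) * Y \<le> (\<gamma>' * c * N powr (x - a)) * Y" using Y0 by (intro mult_right_mono) auto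
        then have "2 * (L' * Y * (real k * ln N)) + 2 * 1 + - (\<gamma>' * c * (Y * N powr (x - a))) \<le> 2 - N" using YN by (simp add: algebra_simps)
        then show ?thesis unfolding l1 l2 sq unfolding exp_add[symmetric] by simp
      qed
      also have "\<dots> \<le> \<epsilon>"
      proof -
        have "0 < \<epsilon> / 2" using e6 exp_gt_zero[of "2 - real m"] by linarith
        then show ?thesis using e6 unfolding N_def by linarith
      qed
      finally show ?thesis by (simp only: p_def N_def)
    qed
  qed
  show ?thesis
  proof (rule exI[of _ c], intro conjI allI impI)
    show "0 < c" using c1 by linarith
    fix \<epsilon> :: real assume \<epsilon>: "0 < \<epsilon>"
    have pos: "0 < a" "0 < 2 * a - 1" "(0::real) < 1" "(0::real) < 1/2" "0 < \<epsilon> / 2" using a_bounds \<epsilon> by auto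
    have "(\<lambda>m::nat. exp (2 - real m)) \<longlonglongrightarrow> 0" by real_asymp
    then have "\<forall>\<^sub>F m::nat in sequentially. exp (2 - real m) < \<epsilon> / 2" using pos(5) by (rule order_tendstoD)
    then have f6: "\<forall>\<^sub>F m::nat in sequentially. exp (2 - real m) \<le> \<epsilon> / 2" by (rule eventually_mono) simp
    have "(\<lambda>m::nat. exp (- (K3 * real m))) \<longlonglongrightarrow> 0" using K3 by real_asymp
    then have "\<forall>\<^sub>F m::nat in sequentially. exp (- (K3 * real m)) < \<epsilon>" using \<epsilon> by (rule order_tendstoD)
    then have f7: "\<forall>\<^sub>F m::nat in sequentially. exp (- (K3 * real m)) \<le> \<epsilon>" by (rule eventually_mono) simp
    show "\<forall>\<^sub>F m :: nat in sequentially. c * real m powr (- a) \<le> 1 \<and>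
     (\<forall>V :: nat set. finite V \<longrightarrow> card V = m \<longrightarrow>
       rPr (c * real m powr (- a)) ([V]\<^bsup>k\<^esup>) (\<lambda>X. \<forall>Q\<in>[V]\<^bsup>Suc k\<^esup>. card (X \<inter> [Q]\<^bsup>k\<^esup>) < 5) \<le> \<epsilon> \<and>
       rPr (c * real m powr (- a)) ([V]\<^bsup>k\<^esup>) (colourable k t) \<le> \<epsilon> \<and>
       rPr (c * real m powr (- a)) ([V]\<^bsup>k\<^esup>) (\<lambda>X. \<exists>I J. X = I \<union> J \<and> cycle_free I \<and> cycle_free J) \<le> \<epsilon>)"
      using eventually_ge_at_top[of 1] eventually_ge_at_top[of R] eventually_ge_at_top[of R'] eventually_ge_at_top[of "Suc k"]
        eventually_powr_neg_le[OF pos(1) pos(3), of c] eventually_powr_neg_le[OF pos(2) pos(4), of "real (Suc k) * c ^ 2"]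
        eventually_log_le_powr[OF e0(1), of "real k" 0]
        eventually_log_le_powr[OF a_bounds(3), of "2 * L' * real k / (\<gamma>' * c)" "1 / (\<gamma>' * c)"]
        eventually_powr_neg_le[OF e0(1) pos(5), of K1] f6 f7
    proof eventually_elim
      case (elim m)
      show ?case by (rule main) (fact elim)+
    qed
  qed
qed

section \<open>Assembling a monochromatic copy from the three parts\<close>

lemma combine_copies:
  fixes col :: "nat set \<Rightarrow> bool"
  assumes T: "is_tri k T" "T \<subseteq> X" "\<And>e. e \<in> T \<Longrightarrow> col e = d" "\<Union>T \<subseteq> A"
    and C: "is_cyc k t C" "C \<subseteq> X" "\<And>e. e \<in> C \<Longrightarrow> col e = d" "\<Union>C \<subseteq> B"
    and AB: "A \<inter> B = {}" "A \<subseteq> V" "B \<subseteq> V"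
  shows "\<exists>f. embedding f (disjoint_union (graph_plus k (Kn_graph 3)) (tight_cycle k t)) (V, X) \<and>
     (\<exists>c. \<forall>e\<in>edges (disjoint_union (graph_plus k (Kn_graph 3)) (tight_cycle k t)). col (f ` e) = c)"
proof -
  have k2: "2 \<le> k" using k4 by linarith
  have TV: "\<Union>T \<subseteq> V" using T(4) AB(2) by blast
  obtain f where f: "embedding f (graph_plus k (Kn_graph 3)) (V, X)"
    "(\<lambda>e. f ` e) ` edges (graph_plus k (Kn_graph 3)) = T" "f ` verts (graph_plus k (Kn_graph 3)) \<subseteq> \<Union>T"
    using embedding_of_is_tri[OF T(1,2) TV k2] by metis
  obtain v where v: "inj_on v {..<t}" "C = cyc k t v" using C(1) unfolding is_cyc_def by blast
  have vC: "v ` {..<t} = \<Union>C" unfolding v(2) Union_cyc[OF t_pos(4)] ..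
  have g: "embedding v (tight_cycle k t) (V, X)"
  proof (rule embedding_cyc[OF v(1)])
    show "cyc k t v \<subseteq> X" using C(2) v(2) by simp
    show "v ` {..<t} \<subseteq> V" unfolding vC using C(4) AB(3) by blast
  qed
  have vt: "verts (tight_cycle k t) = {..<t}" by (simp add: tight_cycle_def)
  have disj: "f ` verts (graph_plus k (Kn_graph 3)) \<inter> v ` verts (tight_cycle k t) = {}"
    unfolding vt vC using f(3) T(4) C(4) AB(1) by blast
  have emb: "embedding (case_sum f v) (disjoint_union (graph_plus k (Kn_graph 3)) (tight_cycle k t)) (V, X)"
    by (rule embedding_disjoint_union[OF f(1) g disj])
  have "col (case_sum f v ` e) = d" if e: "e \<in> edges (disjoint_union (graph_plus k (Kn_graph 3)) (tight_cycle k t))" for e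
  proof -
    consider e' where "e = Inl ` e'" "e' \<in> edges (graph_plus k (Kn_graph 3))" | e' where "e = Inr ` e'" "e' \<in> edges (tight_cycle k t)"
      using e unfolding disjoint_union_def by auto
    then show ?thesis
    proof cases
      case 1
      then have "case_sum f v ` e = f ` e'" by (simp add: image_image)
      moreover have "f ` e' \<in> T" using 1(2) f(2) by blast
      ultimately show ?thesis using T(3) by simp
    next
      case 2
      then have "case_sum f v ` e = v ` e'" by (simp add: image_image)
      moreover have "v ` e' \<in> C" using 2(2) edges_tight_cycle_image[of v k t] v(2) by blast
      ultimately show ?thesis using C(3) by simp
    qed
  qed
  then show ?thesis using emb by (intro exI[of _ "case_sum f v"] conjI exI[of _ d] ballI)
qed

text \<open>The first part has a triangle of some colour d. In the second part either colour d
  contains a cycle, which completes a copy, or the lack of a split yields a triangle of the other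
  colour. Then both colours have a triangle, and a monochromatic cycle in the third part finds one
  of its own colour in another part.\<close>

lemma arrow_of_parts:
  assumes V: "V1 \<subseteq> V" "V2 \<subseteq> V" "V3 \<subseteq> V" "V1 \<inter> V2 = {}" "V1 \<inter> V3 = {}" "V2 \<inter> V3 = {}"
    and b: "\<exists>Q\<in>[V1]\<^bsup>Suc k\<^esup>. 5 \<le> card (X \<inter> [V1]\<^bsup>k\<^esup> \<inter> [Q]\<^bsup>k\<^esup>)"
    and a: "\<not> colourable k t (X \<inter> [V2]\<^bsup>k\<^esup>)"
    and c: "\<not> (\<exists>I J. X \<inter> [V3]\<^bsup>k\<^esup> = I \<union> J \<and> cycle_free I \<and> cycle_free J)"
  shows "ramsey_arrow (V, X) (disjoint_union (graph_plus k (Kn_graph 3)) (tight_cycle k t))"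
  unfolding ramsey_arrow_def
proof (intro allI)
  fix col :: "nat set \<Rightarrow> bool"
  let ?goal = "\<exists>f. embedding f (disjoint_union (graph_plus k (Kn_graph 3)) (tight_cycle k t)) (V, X) \<and>
     (\<exists>c. \<forall>e\<in>edges (disjoint_union (graph_plus k (Kn_graph 3)) (tight_cycle k t)). col (f ` e) = c)"
  have Un: "\<Union>T \<subseteq> W" if "T \<subseteq> X \<inter> [W]\<^bsup>k\<^esup>" for T and W :: "nat set" using that by (auto simp: nsets_def)
  obtain Q where Q: "Q \<in> [V1]\<^bsup>Suc k\<^esup>" "5 \<le> card (X \<inter> [V1]\<^bsup>k\<^esup> \<inter> [Q]\<^bsup>k\<^esup>)" using b by blast
  have cQ: "card Q = Suc k" "finite Q" using Q(1) by (auto simp: nsets_def)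
  define F where "F = (\<lambda>d. {e\<in>X \<inter> [V1]\<^bsup>k\<^esup> \<inter> [Q]\<^bsup>k\<^esup>. col e = d})"
  have finF: "finite (F d)" for d unfolding F_def using finite_imp_finite_nsets[OF cQ(2), of k] by simp
  have FF: "X \<inter> [V1]\<^bsup>k\<^esup> \<inter> [Q]\<^bsup>k\<^esup> = F True \<union> F False" unfolding F_def by blast
  have "5 \<le> card (F True) + card (F False)" using Q(2) card_Un_le[of "F True" "F False"] unfolding FF by linarith
  then have "3 \<le> card (F True) \<or> 3 \<le> card (F False)" by linarith
  then obtain d where "3 \<le> card (F d)" by blast
  then obtain T1 where T1: "T1 \<subseteq> F d" "card T1 = 3" by (metis obtain_subset_with_card_n)
  have tri1: "is_tri k T1" using T1 by (intro is_tri_three_faces[OF cQ(1)]) (auto simp: F_def)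
  have T1': "T1 \<subseteq> X \<inter> [V1]\<^bsup>k\<^esup>" "\<And>e. e \<in> T1 \<Longrightarrow> col e = d" using T1(1) by (auto simp: F_def)
  define E2 where "E2 = {e\<in>X \<inter> [V2]\<^bsup>k\<^esup>. col e = d}"
  have "\<not> (E2 \<subseteq> X \<inter> [V2]\<^bsup>k\<^esup> \<and> (\<forall>T. is_tri k T \<and> T \<subseteq> X \<inter> [V2]\<^bsup>k\<^esup> \<longrightarrow> T \<inter> E2 \<noteq> {}) \<and> (\<forall>C. is_cyc k t C \<longrightarrow> \<not> C \<subseteq> E2))"
    using a unfolding colourable_def by blast
  then consider C where "is_cyc k t C" "C \<subseteq> E2" | T where "is_tri k T" "T \<subseteq> X \<inter> [V2]\<^bsup>k\<^esup>" "T \<inter> E2 = {}"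
    unfolding E2_def by blast
  then show ?goal
  proof cases
    case 1
    have C: "C \<subseteq> X \<inter> [V2]\<^bsup>k\<^esup>" "\<And>e. e \<in> C \<Longrightarrow> col e = d" using 1(2) by (auto simp: E2_def)
    show ?thesis
      by (rule combine_copies[OF tri1 _ T1'(2) Un[OF T1'(1)] 1(1) _ C(2) Un[OF C(1)] V(4,1,2)]) (use T1'(1) C(1) in auto)
  next
    case 2
    have T2: "col e = (\<not> d)" if "e \<in> T" for e using that 2(2,3) by (auto simp: E2_def)
    define E3 where "E3 = (\<lambda>d. {e\<in>X \<inter> [V3]\<^bsup>k\<^esup>. col e = d})"
    have "X \<inter> [V3]\<^bsup>k\<^esup> = E3 d \<union> E3 (\<not> d)" unfolding E3_def by blast
    then have "\<not> (cycle_free (E3 d) \<and> cycle_free (E3 (\<not> d)))" using c by blast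
    then consider C where "is_cyc k t C" "C \<subseteq> E3 d" | C where "is_cyc k t C" "C \<subseteq> E3 (\<not> d)"
      unfolding cycle_free_def by blast
    then show ?thesis
    proof cases
      case c1: 1
      have C: "C \<subseteq> X \<inter> [V3]\<^bsup>k\<^esup>" "\<And>e. e \<in> C \<Longrightarrow> col e = d" using c1(2) by (auto simp: E3_def)
      show ?thesis
        by (rule combine_copies[OF tri1 _ T1'(2) Un[OF T1'(1)] c1(1) _ C(2) Un[OF C(1)] V(5,1,3)]) (use T1'(1) C(1) in auto)
    next
      case c2: 2
      have C: "C \<subseteq> X \<inter> [V3]\<^bsup>k\<^esup>" "\<And>e. e \<in> C \<Longrightarrow> col e = (\<not> d)" using c2(2) by (auto simp: E3_def)
      show ?thesis
        by (rule combine_copies[OF 2(1) _ T2 Un[OF 2(2)] c2(1) _ C(2) Un[OF C(1)] V(6,2,3)]) (use 2(2) C(1) in auto)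
    qed
  qed
qed


text \<open>The bad events of the three parts are decreasing and depend only on the edges inside W,
  so an estimate at the density p0 on W carries over to every larger density on all n
  vertices.\<close>

lemma prob_part_le:
  fixes p0 q \<epsilon> :: real and n :: nat
  assumes W: "W \<subseteq> {..<n}" and p: "0 \<le> p0" "p0 \<le> q" "q \<le> 1"
    and up: "\<And>X Y. X \<subseteq> Y \<Longrightarrow> \<not> A X \<Longrightarrow> \<not> A Y" and le: "rPr p0 ([W]\<^bsup>k\<^esup>) A \<le> \<epsilon>"
  shows "rPr q ([{..<n}]\<^bsup>k\<^esup>) (\<lambda>X. A (X \<inter> [W]\<^bsup>k\<^esup>)) \<le> \<epsilon>"
proof -
  have finW: "finite W" using W finite_subset by blast
  have fin: "finite ([W]\<^bsup>k\<^esup>)" "finite ([{..<n}]\<^bsup>k\<^esup>)" using finW by (simp_all add: finite_imp_finite_nsets)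
  have "rPr q ([{..<n}]\<^bsup>k\<^esup>) (\<lambda>X. A (X \<inter> [W]\<^bsup>k\<^esup>)) = rPr q ([W]\<^bsup>k\<^esup>) A"
    by (rule rPr_restrict[OF fin(2) nsets_mono[OF W]])
  also have "\<dots> = 1 - rPr q ([W]\<^bsup>k\<^esup>) (\<lambda>X. \<not> A X)" using rPr_not[OF fin(1), of q A] by simp
  also have "\<dots> \<le> 1 - rPr p0 ([W]\<^bsup>k\<^esup>) (\<lambda>X. \<not> A X)" using rPr_mono_p[OF fin(1) p up] by simp
  also have "\<dots> = rPr p0 ([W]\<^bsup>k\<^esup>) A" using rPr_not[OF fin(1), of p0 A] by simp
  finally show ?thesis using le by linarith
qed

lemma one_statement:
  fixes x a :: real
  assumes x: "x = (real t - real k) / (real t - 1)" "1/2 < x" and a: "a = (1 + x) / 3"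
  shows "\<exists>C>0. \<forall>p :: nat \<Rightarrow> real. (\<forall>n. 0 \<le> p n \<and> p n \<le> 1) \<longrightarrow>
     (\<forall>\<^sub>F n in sequentially. p n \<ge> C * real n powr (- a)) \<longrightarrow>
     (\<lambda>n. rPr (p n) ([{..<n}]\<^bsup>k\<^esup>) (\<lambda>X. ramsey_arrow ({..<n}, X) (disjoint_union (graph_plus k (Kn_graph 3)) (tight_cycle k t)))) \<longlonglongrightarrow> 1"
proof -
  let ?F = "disjoint_union (graph_plus k (Kn_graph 3)) (tight_cycle k t)"
  let ?A1 = "\<lambda>V X. \<forall>Q\<in>[V]\<^bsup>Suc k\<^esup>. card (X \<inter> [Q]\<^bsup>k\<^esup>) < 5"
  let ?A3 = "\<lambda>X. \<exists>I J. X = I \<union> J \<and> cycle_free I \<and> cycle_free J"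
  have a0: "0 < a" using a x(2) by simp
  obtain c where c: "c > 0" "\<forall>\<epsilon>>0. \<forall>\<^sub>F m :: nat in sequentially. c * real m powr (- a) \<le> 1 \<and>
     (\<forall>V :: nat set. finite V \<longrightarrow> card V = m \<longrightarrow>
       rPr (c * real m powr (- a)) ([V]\<^bsup>k\<^esup>) (?A1 V) \<le> \<epsilon> \<and>
       rPr (c * real m powr (- a)) ([V]\<^bsup>k\<^esup>) (colourable k t) \<le> \<epsilon> \<and>
       rPr (c * real m powr (- a)) ([V]\<^bsup>k\<^esup>) ?A3 \<le> \<epsilon>)"
    using one_statement_parts[OF x a] by (elim exE conjE)
  have up1: "\<not> ?A1 V Y" if XY: "X \<subseteq> Y" and nX: "\<not> ?A1 V X" for X Y :: "nat set set" and V :: "nat set"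
  proof -
    obtain Q where Q: "Q \<in> [V]\<^bsup>Suc k\<^esup>" "\<not> card (X \<inter> [Q]\<^bsup>k\<^esup>) < 5" using nX by blast
    have "finite Q" using Q(1) by (auto simp: nsets_def)
    then have "card (X \<inter> [Q]\<^bsup>k\<^esup>) \<le> card (Y \<inter> [Q]\<^bsup>k\<^esup>)" using XY by (intro card_mono) (auto simp: finite_imp_finite_nsets)
    then show ?thesis using Q by (meson leD leI order_trans)
  qed
  have up2: "\<not> colourable k t Y" if "X \<subseteq> Y" "\<not> colourable k t X" for X Y :: "nat set set"
  proof
    assume "colourable k t Y"
    then obtain B where B: "B \<subseteq> Y" "\<And>T. is_tri k T \<and> T \<subseteq> Y \<Longrightarrow> T \<inter> B \<noteq> {}" "\<And>C. is_cyc k t C \<Longrightarrow> \<not> C \<subseteq> B" unfolding colourable_def by blast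
    have "colourable k t X" unfolding colourable_def
    proof (rule exI[of _ "B \<inter> X"], intro conjI allI impI)
      fix T :: "nat set set" assume T: "is_tri k T \<and> T \<subseteq> X"
      then have "T \<inter> B \<noteq> {}" using B(2)[of T] that(1) by blast
      then show "T \<inter> (B \<inter> X) \<noteq> {}" using T by blast
    next
      fix C :: "nat set set" assume "is_cyc k t C"
      then show "\<not> C \<subseteq> B \<inter> X" using B(3)[of C] by blast
    qed blast
    then show False using that(2) by blast
  qed
  have up3: "\<not> ?A3 Y" if "X \<subseteq> Y" "\<not> ?A3 X" for X Y
  proof
    assume "?A3 Y"
    then obtain I J where IJ: "Y = I \<union> J" "cycle_free I" "cycle_free J" by blast
    have "X = (I \<inter> X) \<union> (J \<inter> X)" "cycle_free (I \<inter> X)" "cycle_free (J \<inter> X)"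
      using IJ that(1) unfolding cycle_free_def by blast+
    then show False using that(2) by blast
  qed
  show ?thesis
  proof (rule exI[of _ "c * 4 powr a"], intro conjI allI impI)
    show "0 < c * 4 powr a" using c(1) by simp
    fix p :: "nat \<Rightarrow> real" assume p: "\<forall>n. 0 \<le> p n \<and> p n \<le> 1" and pC: "\<forall>\<^sub>F n in sequentially. p n \<ge> c * 4 powr a * real n powr (- a)"
    show "(\<lambda>n. rPr (p n) ([{..<n}]\<^bsup>k\<^esup>) (\<lambda>X. ramsey_arrow ({..<n}, X) ?F)) \<longlonglongrightarrow> 1"
    proof (rule tendstoI)
      fix \<epsilon> :: real assume \<epsilon>: "0 < \<epsilon>"
      then have e4: "0 < \<epsilon> / 4" by simp
      obtain m0 where m0: "\<And>m. m \<ge> m0 \<Longrightarrow> c * real m powr (- a) \<le> 1 \<and>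
         (\<forall>V :: nat set. finite V \<longrightarrow> card V = m \<longrightarrow>
           rPr (c * real m powr (- a)) ([V]\<^bsup>k\<^esup>) (?A1 V) \<le> \<epsilon> / 4 \<and>
           rPr (c * real m powr (- a)) ([V]\<^bsup>k\<^esup>) (colourable k t) \<le> \<epsilon> / 4 \<and>
           rPr (c * real m powr (- a)) ([V]\<^bsup>k\<^esup>) ?A3 \<le> \<epsilon> / 4)"
        using c(2)[rule_format, OF e4] unfolding eventually_sequentially by (elim exE) blast
      show "\<forall>\<^sub>F n in sequentially. dist (rPr (p n) ([{..<n}]\<^bsup>k\<^esup>) (\<lambda>X. ramsey_arrow ({..<n}, X) ?F)) 1 < \<epsilon>"
        using pC eventually_ge_at_top[of "3 * m0 + 12"]
      proof eventually_elim
        case (elim n)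
        \<comment> \<open>Each part gets n div 3 vertices, at least n / 4 of them, and the factor
          \<open>4 powr a\<close> in the constant pays for the smaller vertex set.\<close>
        define m where "m = n div 3"
        have m: "m0 \<le> m" "n \<le> 4 * m" "3 * m \<le> n" "1 \<le> m" using elim(2) by (auto simp: m_def)
        define p0 where "p0 = c * real m powr (- a)"
        note P = m0[OF m(1), folded p0_def]
        have p01: "0 \<le> p0" "p n \<le> 1" "0 \<le> p n" using c(1) p by (auto simp: p0_def)
        have p0p: "p0 \<le> p n"
        proof -
          have "real m powr (- a) \<le> (real n / 4) powr (- a)" using a0 m elim(2) by (intro powr_mono2') auto
          also have "\<dots> = 4 powr a * real n powr (- a)" by (simp add: powr_divide powr_minus field_simps)
          finally have "p0 \<le> c * (4 powr a * real n powr (- a))" unfolding p0_def using c(1) by (intro mult_left_mono) auto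
          then show ?thesis using elim(1) by (simp add: mult.assoc)
        qed
        define W where "W = (\<lambda>j. {j * m..<(j + 1) * m})"
        have W: "W j \<subseteq> {..<n}" "finite (W j)" "card (W j) = m" if "j < 3" for j
        proof -
          have "(j + 1) * m \<le> 3 * m" using that by (intro mult_le_mono1) simp
          then have "(j + 1) * m \<le> n" using m(3) by (rule order_trans)
          then show "W j \<subseteq> {..<n}" unfolding W_def by (meson atLeastLessThan_iff lessThan_iff less_le_trans subsetI)
        qed (auto simp: W_def)
        have Wd: "W 0 \<inter> W 1 = {}" "W 0 \<inter> W 2 = {}" "W 1 \<inter> W 2 = {}" by (auto simp: W_def)
        let ?\<Omega> = "[{..<n}]\<^bsup>k\<^esup>"
        have fin: "finite ?\<Omega>" by (simp add: finite_imp_finite_nsets)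
        have q1: "rPr (p n) ?\<Omega> (\<lambda>X. ?A1 (W 0) (X \<inter> [W 0]\<^bsup>k\<^esup>)) \<le> \<epsilon> / 4"
        proof (rule prob_part_le[OF _ p01(1) p0p p01(2)])
          show "W 0 \<subseteq> {..<n}" by (rule W) simp
          show "rPr p0 ([W 0]\<^bsup>k\<^esup>) (?A1 (W 0)) \<le> \<epsilon> / 4" using P W[of 0] by simp
        qed (rule up1)
        have q2: "rPr (p n) ?\<Omega> (\<lambda>X. colourable k t (X \<inter> [W 1]\<^bsup>k\<^esup>)) \<le> \<epsilon> / 4"
        proof (rule prob_part_le[OF _ p01(1) p0p p01(2)])
          show "W 1 \<subseteq> {..<n}" by (rule W) simp
          show "rPr p0 ([W 1]\<^bsup>k\<^esup>) (colourable k t) \<le> \<epsilon> / 4" using P W[of 1] by simp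
        qed (rule up2)
        have q3: "rPr (p n) ?\<Omega> (\<lambda>X. ?A3 (X \<inter> [W 2]\<^bsup>k\<^esup>)) \<le> \<epsilon> / 4"
        proof (rule prob_part_le[OF _ p01(1) p0p p01(2)])
          show "W 2 \<subseteq> {..<n}" by (rule W) simp
          show "rPr p0 ([W 2]\<^bsup>k\<^esup>) ?A3 \<le> \<epsilon> / 4" using P W[of 2] by simp
        qed (rule up3)
        have "rPr (p n) ?\<Omega> (\<lambda>X. \<not> ramsey_arrow ({..<n}, X) ?F)
          \<le> rPr (p n) ?\<Omega> (\<lambda>X. ?A1 (W 0) (X \<inter> [W 0]\<^bsup>k\<^esup>) \<or> (colourable k t (X \<inter> [W 1]\<^bsup>k\<^esup>) \<or> ?A3 (X \<inter> [W 2]\<^bsup>k\<^esup>)))"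
        proof (rule rPr_mono[OF p01(3,2)], rule ccontr)
          fix X assume na: "\<not> ramsey_arrow ({..<n}, X) ?F"
            and H: "\<not> (?A1 (W 0) (X \<inter> [W 0]\<^bsup>k\<^esup>) \<or> (colourable k t (X \<inter> [W 1]\<^bsup>k\<^esup>) \<or> ?A3 (X \<inter> [W 2]\<^bsup>k\<^esup>)))"
          have h1: "\<exists>Q\<in>[W 0]\<^bsup>Suc k\<^esup>. 5 \<le> card (X \<inter> [W 0]\<^bsup>k\<^esup> \<inter> [Q]\<^bsup>k\<^esup>)" using H by (meson not_le)
          have h2: "\<not> colourable k t (X \<inter> [W 1]\<^bsup>k\<^esup>)" and h3: "\<not> ?A3 (X \<inter> [W 2]\<^bsup>k\<^esup>)" using H by blast+
          have "ramsey_arrow ({..<n}, X) ?F"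
            by (rule arrow_of_parts[OF W(1)[of 0] W(1)[of 1] W(1)[of 2] Wd h1 h2 h3]) simp_all
          then show False using na by blast
        qed
        also have "\<dots> \<le> rPr (p n) ?\<Omega> (\<lambda>X. ?A1 (W 0) (X \<inter> [W 0]\<^bsup>k\<^esup>)) + rPr (p n) ?\<Omega> (\<lambda>X. colourable k t (X \<inter> [W 1]\<^bsup>k\<^esup>) \<or> ?A3 (X \<inter> [W 2]\<^bsup>k\<^esup>))"
          by (rule rPr_Un[OF p01(3,2)])
        also have "\<dots> \<le> rPr (p n) ?\<Omega> (\<lambda>X. ?A1 (W 0) (X \<inter> [W 0]\<^bsup>k\<^esup>)) + (rPr (p n) ?\<Omega> (\<lambda>X. colourable k t (X \<inter> [W 1]\<^bsup>k\<^esup>)) + rPr (p n) ?\<Omega> (\<lambda>X. ?A3 (X \<inter> [W 2]\<^bsup>k\<^esup>)))"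
          by (rule add_left_mono[OF rPr_Un[OF p01(3,2)]])
        finally have "rPr (p n) ?\<Omega> (\<lambda>X. \<not> ramsey_arrow ({..<n}, X) ?F) < \<epsilon>" using q1 q2 q3 \<epsilon> by linarith
        moreover have "rPr (p n) ?\<Omega> (\<lambda>X. ramsey_arrow ({..<n}, X) ?F) \<le> 1" by (rule rPr_le_1[OF fin p01(3,2)])
        ultimately show ?case unfolding rPr_not[OF fin] dist_real_def by simp
      qed
    qed
  qed
qed

end

section \<open>Densities\<close>

lemma finite_subhypergraph_image:
  assumes "finite (verts G)" "finite (edges G)"
  shows "finite {f H |H. subhypergraph H G \<and> P H}"
proof (rule finite_subset)
  show "{f H |H. subhypergraph H G \<and> P H} \<subseteq> f ` (Pow (verts G) \<times> Pow (edges G))"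
    by (force simp: subhypergraph_def)
qed (use assms in simp)

text \<open>On fewer than t vertices, e edges need at least e + k - 1 of them, and the density is at
  most 1. On all t vertices the full edge set is best and gives a value of at least 1.\<close>

lemma max_density_tight_cycle:
  assumes kt: "2 \<le> k" "2 * k \<le> t"
  shows "max_density k (tight_cycle k t) = (real t - 1) / (real t - real k)"
proof -
  let ?G = "tight_cycle k t"
  have t0: "0 < t" and kt': "k < t" using kt by linarith+
  have k1: "1 \<le> k" using kt by linarith
  have E: "edges ?G = window k t ` {..<t}" by (simp add: tight_cycle_def window_def)
  have V: "verts ?G = {..<t}" by (simp add: tight_cycle_def)
  have inj: "inj_on (window k t) {..<t}" by (rule inj_on_window[OF kt(2) k1])
  have cE: "card (edges ?G) = t" unfolding E by (simp add: card_image[OF inj])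
  have pos: "0 < real t - real k" using kt' by simp
  have ge1: "1 \<le> (real t - 1) / (real t - real k)" using pos k1 by (simp add: le_divide_eq)
  show ?thesis unfolding max_density_def
  proof (rule Max_eqI)
    show "finite {edge_density k H |H. subhypergraph H ?G}"
      using finite_subhypergraph_image[of ?G "edge_density k" "\<lambda>_. True"] by (simp add: E V)
    have "subhypergraph ?G ?G" unfolding subhypergraph_def E V using window_subset[OF t0] by auto
    moreover have "edge_density k ?G = (real t - 1) / (real t - real k)"
      unfolding edge_density_def cE using V t0 kt by simp
    ultimately show "(real t - 1) / (real t - real k) \<in> {edge_density k H |H. subhypergraph H ?G}" by (metis (mono_tags, lifting) mem_Collect_eq)
    fix y assume "y \<in> {edge_density k H |H. subhypergraph H ?G}"
    then obtain H where H: "subhypergraph H ?G" "y = edge_density k H" by blast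
    have HV: "verts H \<subseteq> {..<t}" "edges H \<subseteq> window k t ` {..<t}" "\<And>e. e \<in> edges H \<Longrightarrow> e \<subseteq> verts H"
      using H(1) unfolding subhypergraph_def E V by blast+
    have finV: "finite (verts H)" using HV(1) finite_subset by blast
    have vt: "card (verts H) \<le> t" using card_mono[OF _ HV(1)] by simp
    define e where "e = card (edges H)"
    have et: "e \<le> t" unfolding e_def using card_mono[OF _ HV(2)] card_image_le[of "{..<t}" "window k t"] by simp
    consider "e = 0" | "e = 1" "card (verts H) = k" | "e = 1" "card (verts H) \<noteq> k" | "2 \<le> e" by linarith
    then show "y \<le> (real t - 1) / (real t - real k)"
    proof cases
      case 1
      then have "y = 0" using H(2) by (simp add: edge_density_def e_def)
      then show ?thesis using ge1 by linarith
    next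
      case 2
      then have "y = 1 / real k" using H(2) by (simp add: edge_density_def e_def)
      moreover have "1 / real k \<le> 1" using k1 by simp
      ultimately show ?thesis using ge1 by linarith
    next
      \<comment> \<open>An edge with additional isolated vertices has numerator 0.\<close>
      case 3
      then have "y = 0" using H(2) by (simp add: edge_density_def e_def)
      then show ?thesis using ge1 by linarith
    next
      case 4
      define I where "I = {i\<in>{..<t}. window k t i \<in> edges H}"
      have I: "I \<subseteq> {..<t}" "edges H = window k t ` I" using HV(2) by (auto simp: I_def)
      have cI: "card I = e" unfolding e_def I(2) by (rule card_image[OF inj_on_subset[OF inj I(1)], symmetric])
      have "I \<noteq> {}" using cI 4 by auto
      then have "min t (card I + k - 1) \<le> card (\<Union>i\<in>I. window k t i)" using I(1) k1 by (intro card_Union_window)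
      also have "\<dots> \<le> card (verts H)" using HV(3) I(2) by (intro card_mono[OF finV]) blast
      finally have v: "min t (e + k - 1) \<le> card (verts H)" by (simp only: cI)
      have y: "y = (real e - 1) / (real (card (verts H)) - real k)" using H(2) 4 by (simp add: edge_density_def e_def)
      show ?thesis
      proof (cases "t \<le> e + k - 1")
        case True
        then have "card (verts H) = t" using v vt by simp
        then have "y = (real e - 1) / (real t - real k)" using y by simp
        also have "\<dots> \<le> (real t - 1) / (real t - real k)" using et pos by (intro divide_right_mono) auto
        finally show ?thesis .
      next
        case False
        then have "e + k - 1 \<le> card (verts H)" using v by simp
        then have "real e - 1 \<le> real (card (verts H)) - real k" "0 < real e - 1" using 4 by linarith+
        then have "y \<le> 1" unfolding y by (simp add: divide_le_eq)
        then show ?thesis using ge1 by linarith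
      qed
    qed
  qed
qed

text \<open>Two edges already cover all k + 1 vertices, so the whole triangle is best among the
  subhypergraphs with at least two edges. A single edge gives at most 1 / x, which is no larger than
  3 / (1 + x) because x > 1/2.\<close>

lemma asym_density_K3_plus:
  fixes x :: real
  assumes k: "2 \<le> k" and x: "1 / 2 < x" and d: "1 / max_density k F = x"
  shows "asym_density k (graph_plus k (Kn_graph 3)) F = 3 / (1 + x)"
proof -
  let ?G = "graph_plus k (Kn_graph 3)" and ?W = "{..<3::nat} <+> {..<k - 2}"
  let ?f = "\<lambda>H :: (nat + nat) hypergraph. real (card (edges H)) / (real (card (verts H)) - real k + 1 / max_density k F)"
  have V: "verts ?G = ?W" by (rule verts_K3_plus)
  have E: "edges ?G = (\<lambda>i. ?W - {Inl i}) ` {..<3}" by (rule edges_K3_plus)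
  have finW: "finite ?W" by simp
  have cW: "card ?W = k + 1" using k by (simp add: card_Plus)
  have inj: "inj_on (\<lambda>i. ?W - {Inl i}) {..<3}" by (rule inj_onI) auto
  have cE: "card (edges ?G) = 3" unfolding E by (simp add: card_image[OF inj])
  have finE: "finite (edges ?G)" unfolding E by simp
  show ?thesis unfolding asym_density_def
  proof (rule Max_eqI)
    show "finite {?f H |H. subhypergraph H ?G \<and> 1 \<le> card (edges H)}"
      using finite_subhypergraph_image[of ?G ?f "\<lambda>H. 1 \<le> card (edges H)"] finE V by simp
    have "subhypergraph ?G ?G" unfolding subhypergraph_def V E by auto
    moreover have "?f ?G = 3 / (1 + x)" unfolding cE V cW d by simp
    ultimately show "3 / (1 + x) \<in> {?f H |H. subhypergraph H ?G \<and> 1 \<le> card (edges H)}"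
      using cE by (intro CollectI exI[of _ ?G]) simp
    fix y assume "y \<in> {?f H |H. subhypergraph H ?G \<and> 1 \<le> card (edges H)}"
    then obtain H where H: "subhypergraph H ?G" "1 \<le> card (edges H)" "y = ?f H" by blast
    have HV: "verts H \<subseteq> ?W" "edges H \<subseteq> edges ?G" "\<And>e. e \<in> edges H \<Longrightarrow> e \<subseteq> verts H"
      using H(1) unfolding subhypergraph_def V by blast+
    have finH: "finite (verts H)" using HV(1) finW finite_subset by blast
    have e3: "card (edges H) \<le> 3" using card_mono[OF finE HV(2)] cE by simp
    have y: "y = real (card (edges H)) / (real (card (verts H)) - real k + x)" using H(3) d by simp
    show "y \<le> 3 / (1 + x)"
    proof (cases "card (edges H) = 1")
      case True
      then obtain g where g: "edges H = {g}" by (auto simp: card_1_singleton_iff)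
      then obtain i where i: "i < 3" "g = ?W - {Inl i}" using HV(2) unfolding E by auto
      have "Inl i \<in> ?W" using i(1) by auto
      then have "card g = k" unfolding i(2) by (simp only: card_Diff_singleton cW diff_add_inverse2)
      moreover have "card g \<le> card (verts H)" using HV(3) g by (intro card_mono[OF finH]) auto
      ultimately have "y \<le> 1 / x" unfolding y True using x by (simp add: frac_le)
      also have "\<dots> \<le> 3 / (1 + x)" using x by (simp add: field_simps)
      finally show ?thesis .
    next
      case False
      then have "2 \<le> card (edges H)" using H(2) by linarith
      then obtain g1 g2 where g: "g1 \<in> edges H" "g2 \<in> edges H" "g1 \<noteq> g2"
      proof -
        obtain S where S: "S \<subseteq> edges H" "card S = 2" using \<open>2 \<le> card (edges H)\<close> by (metis obtain_subset_with_card_n)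
        then obtain g1 g2 where "S = {g1, g2}" "g1 \<noteq> g2" by (auto simp: card_2_iff)
        then show thesis using S(1) that by blast
      qed
      obtain i j where "g1 = ?W - {Inl i}" "g2 = ?W - {Inl j}" using g(1,2) HV(2) unfolding E by blast
      then have "?W \<subseteq> g1 \<union> g2" using g(3) by auto
      also have "\<dots> \<subseteq> verts H" using HV(3) g by blast
      finally have "verts H = ?W" using HV(1) by blast
      then have "y = real (card (edges H)) / (1 + x)" unfolding y using cW by simp
      also have "\<dots> \<le> 3 / (1 + x)" using e3 x by (intro divide_right_mono) auto
      finally show ?thesis .
    qed
  qed
qed

text \<open>For k = 4 and k = 5 the values 8 and 14 are the least t that satisfy the last
  inequality: t = 7 and t = 13 give equality. For k \<ge> 6 one gets x = k / (k + 1), and the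
  inequality follows from 6 k^2 + 6 k < 6 k^2 + 7 k + 2.\<close>

lemma cycle_length_props:
  assumes k: "4 \<le> k" and t: "t = cycle_length k" and x: "x = (real t - real k) / (real t - 1)" and a: "a = (1 + x) / 3"
  shows "2 * k \<le> t" "1 / 2 < x" "real k < real (degree_bound k + 1) * a"
proof -
  consider "k = 4" | "k = 5" | "6 \<le> k" using k by linarith
  then have "2 * k \<le> t \<and> 1 / 2 < x \<and> real k < real (degree_bound k + 1) * a"
  proof cases
    case 1
    then show ?thesis by (simp add: t cycle_length_def x a degree_bound_def)
  next
    case 2
    then show ?thesis by (simp add: t cycle_length_def x a degree_bound_def)
  next
    case 3
    have t2: "t = k * k" using 3 by (simp add: t cycle_length_def power2_eq_square)
    have r: "6 \<le> real k" using 3 by simp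
    have xk: "x = real k / (real k + 1)"
    proof -
      have "x = (real k * (real k - 1)) / ((real k + 1) * (real k - 1))" unfolding x t2 by (simp add: algebra_simps)
      then show ?thesis using r by simp
    qed
    have ak: "a = (2 * real k + 1) / (3 * (real k + 1))" unfolding a xk using r by (simp add: field_simps)
    have "real k \<le> 2 * real ((k + 1) div 2)" by linarith
    then have "3 * real k / 2 + 1 \<le> real (degree_bound k + 1)" using 3 by (simp add: degree_bound_def)
    then have "(3 * real k / 2 + 1) * a \<le> real (degree_bound k + 1) * a" using r by (intro mult_right_mono) (auto simp: ak)
    moreover have "real k < (3 * real k / 2 + 1) * a" unfolding ak using r by (simp add: field_simps)
    moreover have "2 * k \<le> t" unfolding t2 using 3 by (intro mult_le_mono1) simp
    moreover have "1 / 2 < x" unfolding xk using r by (simp add: field_simps)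
    ultimately show ?thesis by linarith
  qed
  then show "2 * k \<le> t" "1 / 2 < x" "real k < real (degree_bound k + 1) * a" by blast+
qed

theorem theorem2p1:
  fixes k :: nat and \<theta> :: real
  assumes "k \<ge> 4"
    and "\<theta> = asym_density k (graph_plus k (Kn_graph 3)) (tight_cycle k (cycle_length k))"
  shows "\<exists>c > 0. \<exists>C > 0. \<forall>p :: nat \<Rightarrow> real. (\<forall>n. 0 \<le> p n \<and> p n \<le> 1) \<longrightarrow>
    ((\<forall>\<^sub>F n in sequentially. p n \<le> c * real n powr (- 1 / \<theta>)) \<longrightarrow>
      (\<lambda>n. measure_pmf.prob (random_hypergraph k n (p n))
         {G. ramsey_arrow G (disjoint_union (graph_plus k (Kn_graph 3))
                                            (tight_cycle k (cycle_length k)))})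
        \<longlonglongrightarrow> 0) \<and>
    ((\<forall>\<^sub>F n in sequentially. p n \<ge> C * real n powr (- 1 / \<theta>)) \<longrightarrow>
      (\<lambda>n. measure_pmf.prob (random_hypergraph k n (p n))
         {G. ramsey_arrow G (disjoint_union (graph_plus k (Kn_graph 3))
                                            (tight_cycle k (cycle_length k)))})
        \<longlonglongrightarrow> 1)"
proof -
  define t where "t = cycle_length k"
  define x where "x = (real t - real k) / (real t - 1)"
  define a where "a = (1 + x) / 3"
  note props = cycle_length_props[OF assms(1) t_def x_def a_def]
  interpret kt k t by unfold_locales (use assms(1) props(1) in auto)
  have k2: "2 \<le> k" using assms(1) by linarith
  have "1 / max_density k (tight_cycle k t) = x" unfolding max_density_tight_cycle[OF k2 props(1)] x_def by simp
  then have th: "\<theta> = 3 / (1 + x)" unfolding assms(2) t_def[symmetric] by (rule asym_density_K3_plus[OF k2 props(2)])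
  have \<theta>: "- 1 / \<theta> = - a" unfolding th a_def using props(2) by (simp add: field_simps)
  let ?F = "disjoint_union (graph_plus k (Kn_graph 3)) (tight_cycle k t)"
  obtain c where c: "c > 0" "\<forall>p :: nat \<Rightarrow> real. (\<forall>n. 0 \<le> p n \<and> p n \<le> 1) \<longrightarrow>
     (\<forall>\<^sub>F n in sequentially. p n \<le> c * real n powr (- a)) \<longrightarrow>
     (\<lambda>n. rPr (p n) ([{..<n}]\<^bsup>k\<^esup>) (\<lambda>X. \<not> colourable k t X)) \<longlonglongrightarrow> 0"
    using zero_statement[OF x_def props(2) a_def props(3)] by (elim exE conjE)
  obtain C where C: "C > 0" "\<forall>p :: nat \<Rightarrow> real. (\<forall>n. 0 \<le> p n \<and> p n \<le> 1) \<longrightarrow>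
     (\<forall>\<^sub>F n in sequentially. p n \<ge> C * real n powr (- a)) \<longrightarrow>
     (\<lambda>n. rPr (p n) ([{..<n}]\<^bsup>k\<^esup>) (\<lambda>X. ramsey_arrow ({..<n}, X) ?F)) \<longlonglongrightarrow> 1"
    using one_statement[OF x_def props(2) a_def] by (elim exE conjE)
  show ?thesis unfolding \<theta> t_def[symmetric]
  proof (rule exI[of _ c], intro conjI c(1), rule exI[of _ C], intro conjI C(1) allI impI)
    fix p :: "nat \<Rightarrow> real" assume p: "\<forall>n. 0 \<le> p n \<and> p n \<le> 1"
    have pr: "measure_pmf.prob (random_hypergraph k n (p n)) {G. ramsey_arrow G ?F}
        = rPr (p n) ([{..<n}]\<^bsup>k\<^esup>) (\<lambda>X. ramsey_arrow ({..<n}, X) ?F)" for n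
      using p by (intro prob_random_hypergraph) auto
    {
      assume "\<forall>\<^sub>F n in sequentially. p n \<le> c * real n powr (- a)"
      then have l: "(\<lambda>n. rPr (p n) ([{..<n}]\<^bsup>k\<^esup>) (\<lambda>X. \<not> colourable k t X)) \<longlonglongrightarrow> 0" using c(2) p by blast
      have le: "rPr (p n) ([{..<n}]\<^bsup>k\<^esup>) (\<lambda>X. ramsey_arrow ({..<n}, X) ?F) \<le> rPr (p n) ([{..<n}]\<^bsup>k\<^esup>) (\<lambda>X. \<not> colourable k t X)" for n
      proof (rule rPr_mono)
        fix X :: "nat set set" assume "ramsey_arrow ({..<n}, X) ?F"
        then show "\<not> colourable k t X" using colourable_imp_not_arrow[OF _ k2] by blast
      qed (use p in auto)
      have nn: "0 \<le> rPr (p n) ([{..<n}]\<^bsup>k\<^esup>) (\<lambda>X. ramsey_arrow ({..<n}, X) ?F)" for n using p by (intro rPr_nonneg) auto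
      show "(\<lambda>n. measure_pmf.prob (random_hypergraph k n (p n)) {G. ramsey_arrow G ?F}) \<longlonglongrightarrow> 0"
        unfolding pr by (rule tendsto_sandwich[OF always_eventually always_eventually tendsto_const l]) (use nn le in auto)
    }
    {
      assume "\<forall>\<^sub>F n in sequentially. C * real n powr (- a) \<le> p n"
      then show "(\<lambda>n. measure_pmf.prob (random_hypergraph k n (p n)) {G. ramsey_arrow G ?F}) \<longlonglongrightarrow> 1"
        unfolding pr using C(2) p by blast
    }
  qed
qed

end
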